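(* Let $(S^{(n)})_{n=0}^\infty$ be an Appell sequence on $\Phi'$, with generating function $$\sum_{n=0}^\infty\frac{1}{n!}\langle S^{(n)}(\omega),\xi^{\otimes n}\rangle=\frac{\exp[\langle\omega,\xi\rangle]}{\rho(\xi)},\qquad \rho(\xi)=\sum_{n=0}^\infty\langle\rho^{(n)},\xi^{\otimes n}\rangle,$$ where $\rho^{(n)}\in\Phi'^{\odot n}$ and $\rho^{(0)}=1$, and let $\theta^{(n)}\in\Phi'^{\odot n}$, $n\in\mathbb N_0$, be given by $\frac1{\rho(\xi)}=\sum_{n=0}^\infty\langle\theta^{(n)},\xi^{\otimes n}\rangle$. Let $\beta\in(1,\infty)$. Assume that there exist $\tau\in T$ and a constant $C\ge1$ such that $$\|\theta^{(n)}\|_{-\tau}\le C^{n}(n!)^{\frac1\beta-1},\qquad \|\rho^{(n)}\|_{-\tau}\le C^{n}(n!)^{\frac1\beta-1},\qquad n\in\mathbb N.$$ Then, for each $\alpha\in[0,\beta]$, the corresponding Sheffer operator $\mathfrak S:\mathcal P(\Phi')\to\mathcal P(\Phi')$ extends by continuity to a linear self-homeomorphism of $\mathcal E^{\alpha}_{\mathrm{min}}(\Phi')$.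
   Context: **Spaces.** $\mathbb N_0=\{0,1,2,\dots\}$. $\mathcal L(E,F)$ is the space of continuous linear operators from $E$ to $F$. Let $T$ be an arbitrary index set and $(\mathcal H_{\tau,\mathbb R})_{\tau\in T}$ a family of real separable Hilbert spaces such that: for any $\tau_1,\tau_2\in T$ there is $\tau_3\in T$ with $\mathcal H_{\tau_3,\mathbb R}\subset\mathcal H_{\tau_1,\mathbb R}$ and $\mathcal H_{\tau_3,\mathbb R}\subset\mathcal H_{\tau_2,\mathbb R}$, both embeddings continuous; for each $\tau_1\in T$ there is $\tau_2\in T$ with $\mathcal H_{\tau_2,\mathbb R}\subset\mathcal H_{\tau_1,\mathbb R}$ and Hilbert–Schmidt embedding; $\bigcap_{\tau\in T}\mathcal H_{\tau,\mathbb R}$ is dense in each $\mathcal H_{\tau,\mathbb R}$; and there is $\tau_0\in T$ such that every $\mathcal H_{\tau,\mathbb R}$ is continuously embedded into $\mathcal H_{0,\mathbb R}:=\mathcal H_{\tau_0,\mathbb R}$ (the center space). Let $\mathcal H_\tau$, $\mathcal H_0$ be the complexifications, and $\Phi=\bigcap_{\tau\in T}\mathcal H_\tau$ with the projective limit topology (a complex nuclear space). $\mathcal H_{-\tau}$ is the dual of $\mathcal H_\tau$ with respect to the center space $\mathcal H_0$, and $\Phi'=\bigcup_{\tau\in T}\mathcal H_{-\tau}$, the dual of $\Phi$, carries the locally convex inductive limit topology. The bilinear dual pairing $\langle\omega,\xi\rangle$ is the continuous extension of $(\omega,\overline\xi)_{\mathcal H_0}$. With $\odot$ the (Hilbert-space)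 symmetric tensor product, $\Phi^{\odot n}=\operatorname{proj\,lim}_{\tau}\mathcal H_\tau^{\odot n}$ and $\Phi'^{\odot n}=\operatorname{ind\,lim}_{\tau}\mathcal H_{-\tau}^{\odot n}$ (the dual of $\Phi^{\odot n}$) for $n\ge1$, and all these are $\mathbb C$ for $n=0$. The norms of $\mathcal H_{\tau}^{\odot n}$ and $\mathcal H_{-\tau}^{\odot n}$ are denoted $\|\cdot\|_\tau$ and $\|\cdot\|_{-\tau}$. $\omega^{\otimes 0}:=1$. **Entire functions.** A function on a locally convex space is entire if it is continuous and holomorphic along every complex line. For $\alpha>0$, $\tau\in T$, $l\in\mathbb N_0$, $\mathcal E^\alpha_l(\mathcal H_{-\tau})$ is the space of entire $f:\mathcal H_{-\tau}\to\mathbb C$ with norm $\mathbf n_{\tau,l,\alpha}(f)=\sup_{\omega\in\mathcal H_{-\tau}}|f(\omega)|\exp(-2^{-l}\|\omega\|_{-\tau}^\alpha)<\infty$. $\mathcal E^\alpha_{\mathrm{min}}(\Phi')$ is the set of functions $f:\Phi'\to\mathbb C$ whose restriction to $\mathcal H_{-\tau}$ belongs to $\mathcal E^\alpha_l(\mathcal H_{-\tau})$ for all $\tau\in T$, $l\in\mathbb N_0$, with the projective limit topology given by all the norms $\mathbf n_{\tau,l,\alpha}$. Further, $\mathcal E^0_{\mathrm{min}}(\Phi'):=\operatorname{proj\,lim}_{\alpha>0}\mathcal E^\alpha_{\mathrm{min}}(\Phi')$ (intersection over $\alpha>0$ with projective limit topology). **Polynomials and Appell sequences.** $\mathcal P(\Phi')$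 is the space of polynomials $p(\omega)=\sum_{k=0}^n\langle\omega^{\otimes k},\varphi^{(k)}\rangle$, $\varphi^{(k)}\in\Phi^{\odot k}$, $n\in\mathbb N_0$. A sequence of monic polynomials on $\Phi'$ is a sequence of maps $S^{(n)}:\Phi'\to\Phi'^{\odot n}$, $n\in\mathbb N_0$, of the form $S^{(n)}(\omega)=\sum_{k=0}^nU_{n,k}\omega^{\otimes k}$ with $U_{n,k}\in\mathcal L(\Phi'^{\odot k},\Phi'^{\odot n})$ and $U_{n,n}=\mathbf 1$ (identity). An Appell sequence on $\Phi'$ is a sequence of monic polynomials on $\Phi'$ with generating function of the form displayed in the claim. All identities between generating functions are identities of formal power series: for all fixed $\omega\in\Phi'$, $\xi\in\Phi$ they hold as identities of formal power series in $z\in\mathbb C$ after replacing $\xi$ by $z\xi$. The corresponding Sheffer operator is the linear bijection $\mathfrak S:\mathcal P(\Phi')\to\mathcal P(\Phi')$ given by $\mathfrak S\langle\omega^{\otimes n},\varphi^{(n)}\rangle=\langle S^{(n)}(\omega),\varphi^{(n)}\rangle$, $\varphi^{(n)}\in\Phi^{\odot n}$, $n\in\mathbb N_0$. *)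

theory Defs
  imports "HOL-Analysis.Analysis" "HOL-Computational_Algebra.Formal_Power_Series"
begin

section \<open>Conventions for spaces of functions\<close>

text \<open>
  All dual spaces, tensor powers and spaces of entire functions below are realized as sets of
  complex-valued functions on an ambient type. A function with domain \<open>D\<close> is represented by a
  total function that vanishes outside \<open>D\<close>, so that equality of the represented objects is
  equality in HOL and the vector space operations are the pointwise ones.
\<close>

definition fcomb :: "complex \<Rightarrow> ('x \<Rightarrow> complex) \<Rightarrow> complex \<Rightarrow> ('x \<Rightarrow> complex) \<Rightarrow> 'x \<Rightarrow> complex" where
  "fcomb a f b g = (\<lambda>x. a * f x + b * g x)"

definition flinear_on ::
  "('x \<Rightarrow> complex) set \<Rightarrow> (('x \<Rightarrow> complex) \<Rightarrow> 'y \<Rightarrow> complex) \<Rightarrow> bool" where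
  "flinear_on V A \<longleftrightarrow>
     (\<forall>a b. \<forall>f\<in>V. \<forall>g\<in>V. A (fcomb a f b g) = fcomb a (A f) b (A g))"

definition seminorm_on :: "('x \<Rightarrow> complex) set \<Rightarrow> (('x \<Rightarrow> complex) \<Rightarrow> real) \<Rightarrow> bool" where
  "seminorm_on V q \<longleftrightarrow>
     (\<forall>f\<in>V. 0 \<le> q f) \<and>
     (\<forall>f\<in>V. \<forall>g\<in>V. q (fcomb 1 f 1 g) \<le> q f + q g) \<and>
     (\<forall>c. \<forall>f\<in>V. q (\<lambda>x. c * f x) = cmod c * q f)"

text \<open>The locally convex topology on \<open>V\<close> given by a nonempty family \<open>Q\<close> of seminorms.\<close>

definition seminorm_topology ::
  "('x \<Rightarrow> complex) set \<Rightarrow> (('x \<Rightarrow> complex) \<Rightarrow> real) set \<Rightarrow> ('x \<Rightarrow> complex) topology" where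
  "seminorm_topology V Q =
     topology_generated_by {{g \<in> V. q (fcomb 1 g (-1) f) < e} | f q e. f \<in> V \<and> q \<in> Q \<and> 0 < e}"

lemma topspace_seminorm_topology:
  assumes "Q \<noteq> {}" and "\<And>q. q \<in> Q \<Longrightarrow> q (\<lambda>x. 0) = 0"
  shows "topspace (seminorm_topology V Q) = V"
proof -
  obtain q where q: "q \<in> Q"
    using assms by blast
  have "x \<in> topspace (seminorm_topology V Q)" if x: "x \<in> V" for x
  proof -
    have "fcomb 1 x (-1) x = (\<lambda>y. 0)"
      by (auto simp: fcomb_def)
    then have "x \<in> {g \<in> V. q (fcomb 1 g (-1) x) < 1}"
      using x assms(2)[OF q] by simp
    moreover have "{g \<in> V. q (fcomb 1 g (-1) x) < 1}
        \<in> {{g \<in> V. q (fcomb 1 g (-1) f) < e} | f q e. f \<in> V \<and> q \<in> Q \<and> 0 < e}"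
      using q x zero_less_one by blast
    ultimately show ?thesis
      unfolding seminorm_topology_def topology_generated_by_topspace by blast
  qed
  then show ?thesis
    unfolding seminorm_topology_def topology_generated_by_topspace by auto
qed

text \<open>
  The dual of a complex vector space \<open>V\<close> with norm \<open>N\<close>, where \<open>lc a x b y\<close> is the linear
  combination \<open>a x + b y\<close> in \<open>V\<close>.
\<close>

definition dual_of ::
  "'x set \<Rightarrow> (complex \<Rightarrow> 'x \<Rightarrow> complex \<Rightarrow> 'x \<Rightarrow> 'x) \<Rightarrow> ('x \<Rightarrow> real) \<Rightarrow> ('x \<Rightarrow> complex) set" where
  "dual_of V lc N =
     {F. (\<forall>x. x \<notin> V \<longrightarrow> F x = 0) \<and>
         (\<forall>a b. \<forall>x\<in>V. \<forall>y\<in>V. F (lc a x b y) = a * F x + b * F y) \<and>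
         (\<exists>K. \<forall>x\<in>V. cmod (F x) \<le> K * N x)}"

definition dual_norm :: "'x set \<Rightarrow> ('x \<Rightarrow> real) \<Rightarrow> ('x \<Rightarrow> complex) \<Rightarrow> real" where
  "dual_norm V N F = (SUP x\<in>{x\<in>V. N x \<le> 1}. cmod (F x))"


section \<open>Families of real Hilbert spaces\<close>

text \<open>
  The spaces \<open>\<H>\<^sub>\<tau>\<^sub>,\<^sub>\<real>\<close> are linear subspaces of one common real vector space, each with an inner
  product of its own; this is what gives meaning to inclusions and intersections.
\<close>

record ('t, 'v) hilbert_family =
  indices :: "'t set"
  hspace :: "'t \<Rightarrow> 'v set"
  hinner :: "'t \<Rightarrow> 'v \<Rightarrow> 'v \<Rightarrow> real"
  center :: "'t"

definition hnorm :: "('t, 'v) hilbert_family \<Rightarrow> 't \<Rightarrow> 'v \<Rightarrow> real" where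
  "hnorm R \<tau> x = sqrt (hinner R \<tau> x x)"

text \<open>The locale \<open>Metric_space\<close> asks for nonnegativity and symmetry also outside the carrier.\<close>

definition hdist :: "('t, 'v::real_vector) hilbert_family \<Rightarrow> 't \<Rightarrow> 'v \<Rightarrow> 'v \<Rightarrow> real" where
  "hdist R \<tau> x y = (if x \<in> hspace R \<tau> \<and> y \<in> hspace R \<tau> then hnorm R \<tau> (x - y) else 0)"

definition htopology :: "('t, 'v::real_vector) hilbert_family \<Rightarrow> 't \<Rightarrow> 'v topology" where
  "htopology R \<tau> = Metric_space.mtopology (hspace R \<tau>) (hdist R \<tau>)"

definition real_separable_hilbert :: "('t, 'v::real_vector) hilbert_family \<Rightarrow> 't \<Rightarrow> bool" where
  "real_separable_hilbert R \<tau> \<longleftrightarrow>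
     subspace (hspace R \<tau>) \<and>
     (\<forall>x\<in>hspace R \<tau>. \<forall>y\<in>hspace R \<tau>. hinner R \<tau> x y = hinner R \<tau> y x) \<and>
     (\<forall>x\<in>hspace R \<tau>. \<forall>y\<in>hspace R \<tau>. \<forall>z\<in>hspace R \<tau>.
        hinner R \<tau> (x + y) z = hinner R \<tau> x z + hinner R \<tau> y z) \<and>
     (\<forall>c. \<forall>x\<in>hspace R \<tau>. \<forall>y\<in>hspace R \<tau>. hinner R \<tau> (c *\<^sub>R x) y = c * hinner R \<tau> x y) \<and>
     (\<forall>x\<in>hspace R \<tau>. 0 \<le> hinner R \<tau> x x) \<and>
     (\<forall>x\<in>hspace R \<tau>. hinner R \<tau> x x = 0 \<longrightarrow> x = 0) \<and>
     Metric_space.mcomplete (hspace R \<tau>) (hdist R \<tau>) \<and>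
     separable_space (htopology R \<tau>)"

definition continuously_embedded :: "('t, 'v) hilbert_family \<Rightarrow> 't \<Rightarrow> 't \<Rightarrow> bool" where
  "continuously_embedded R \<tau> \<sigma> \<longleftrightarrow>
     hspace R \<tau> \<subseteq> hspace R \<sigma> \<and> (\<exists>K. \<forall>x\<in>hspace R \<tau>. hnorm R \<sigma> x \<le> K * hnorm R \<tau> x)"

definition orthonormal_basis ::
  "('t, 'v::real_vector) hilbert_family \<Rightarrow> 't \<Rightarrow> 'v set \<Rightarrow> bool" where
  "orthonormal_basis R \<tau> B \<longleftrightarrow>
     B \<subseteq> hspace R \<tau> \<and>
     (\<forall>e\<in>B. \<forall>f\<in>B. hinner R \<tau> e f = (if e = f then 1 else 0)) \<and>
     htopology R \<tau> closure_of span B = hspace R \<tau>"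

definition hilbert_schmidt_embedded ::
  "('t, 'v::real_vector) hilbert_family \<Rightarrow> 't \<Rightarrow> 't \<Rightarrow> bool" where
  "hilbert_schmidt_embedded R \<tau> \<sigma> \<longleftrightarrow>
     continuously_embedded R \<tau> \<sigma> \<and>
     (\<exists>B. orthonormal_basis R \<tau> B \<and> (\<lambda>e. (hnorm R \<sigma> e)\<^sup>2) summable_on B)"

definition nuclear_hilbert_family :: "('t, 'v::real_vector) hilbert_family \<Rightarrow> bool" where
  "nuclear_hilbert_family R \<longleftrightarrow>
     (\<forall>\<tau>\<in>indices R. real_separable_hilbert R \<tau>) \<and>
     (\<forall>\<tau>1\<in>indices R. \<forall>\<tau>2\<in>indices R. \<exists>\<tau>3\<in>indices R.
        continuously_embedded R \<tau>3 \<tau>1 \<and> continuously_embedded R \<tau>3 \<tau>2) \<and>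
     (\<forall>\<tau>1\<in>indices R. \<exists>\<tau>2\<in>indices R. hilbert_schmidt_embedded R \<tau>2 \<tau>1) \<and>
     (\<forall>\<tau>\<in>indices R. htopology R \<tau> closure_of (\<Inter>\<sigma>\<in>indices R. hspace R \<sigma>) = hspace R \<tau>) \<and>
     center R \<in> indices R \<and>
     (\<forall>\<tau>\<in>indices R. continuously_embedded R \<tau> (center R))"


section \<open>Complexification and the dual space\<close>

text \<open>The pair \<open>(x, y)\<close> stands for \<open>x + i y\<close>.\<close>

type_synonym 'v cplx = "'v \<times> 'v"

definition cscale :: "complex \<Rightarrow> 'v::real_vector cplx \<Rightarrow> 'v cplx" where
  "cscale c z = (Re c *\<^sub>R fst z - Im c *\<^sub>R snd z, Re c *\<^sub>R snd z + Im c *\<^sub>R fst z)"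

definition ccomb :: "complex \<Rightarrow> 'v::real_vector cplx \<Rightarrow> complex \<Rightarrow> 'v cplx \<Rightarrow> 'v cplx" where
  "ccomb a x b y = cscale a x + cscale b y"

definition cspace :: "('t, 'v) hilbert_family \<Rightarrow> 't \<Rightarrow> 'v cplx set" where
  "cspace R \<tau> = hspace R \<tau> \<times> hspace R \<tau>"

text \<open>Linear in the first argument and antilinear in the second one.\<close>

definition cinner :: "('t, 'v) hilbert_family \<Rightarrow> 't \<Rightarrow> 'v cplx \<Rightarrow> 'v cplx \<Rightarrow> complex" where
  "cinner R \<tau> z w =
     Complex (hinner R \<tau> (fst z) (fst w) + hinner R \<tau> (snd z) (snd w))
             (hinner R \<tau> (snd z) (fst w) - hinner R \<tau> (fst z) (snd w))"

definition cnorm :: "('t, 'v) hilbert_family \<Rightarrow> 't \<Rightarrow> 'v cplx \<Rightarrow> real" where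
  "cnorm R \<tau> z = sqrt (Re (cinner R \<tau> z z))"

definition Phi :: "('t, 'v) hilbert_family \<Rightarrow> 'v cplx set" where
  "Phi R = (\<Inter>\<tau>\<in>indices R. cspace R \<tau>)"

text \<open>
  \<open>\<H>\<^sub>-\<^sub>\<tau>\<close> is the dual of \<open>\<H>\<^sub>\<tau>\<close> through the bilinear pairing that extends
  \<open>\<langle>\<omega>, \<xi>\<rangle> = (\<omega>, \<xi>-conjugate)\<^sub>0\<close>: its elements are the functionals \<open>\<xi> \<mapsto> \<langle>\<omega>, \<xi>\<rangle>\<close>. Since \<open>\<Phi>\<close> is dense in
  \<open>\<H>\<^sub>\<tau>\<close>, a continuous functional on \<open>\<H>\<^sub>\<tau>\<close> is recorded by its restriction to \<open>\<Phi>\<close>. In this way all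
  \<open>\<H>\<^sub>-\<^sub>\<tau>\<close> live in one function space, their union \<open>\<Phi>'\<close> makes sense, and the pairing
  \<open>\<langle>\<omega>, \<xi>\<rangle>\<close> is the application \<open>\<omega> \<xi>\<close>.
\<close>

type_synonym 'v dual = "'v cplx \<Rightarrow> complex"

definition neg_space :: "('t, 'v::real_vector) hilbert_family \<Rightarrow> 't \<Rightarrow> 'v dual set" where
  "neg_space R \<tau> = dual_of (Phi R) ccomb (cnorm R \<tau>)"

definition neg_norm :: "('t, 'v) hilbert_family \<Rightarrow> 't \<Rightarrow> 'v dual \<Rightarrow> real" where
  "neg_norm R \<tau> = dual_norm (Phi R) (cnorm R \<tau>)"

definition Phi_dual :: "('t, 'v::real_vector) hilbert_family \<Rightarrow> 'v dual set" where
  "Phi_dual R = (\<Union>\<tau>\<in>indices R. neg_space R \<tau>)"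


section \<open>Symmetric tensor powers\<close>

text \<open>
  The Hilbert space tensor power \<open>\<H>\<^sub>\<tau>\<^sup>\<otimes>\<^sup>n\<close> is realized as the space of Hilbert--Schmidt
  \<open>n\<close>-linear functionals on the dual \<open>\<H>\<^sub>-\<^sub>\<tau>\<close>, with the Hilbert--Schmidt norm; the elementary tensor
  \<open>\<xi>\<^sub>1 \<otimes> \<dots> \<otimes> \<xi>\<^sub>n\<close> is \<open>(\<omega>\<^sub>1, \<dots>, \<omega>\<^sub>n) \<mapsto> \<langle>\<omega>\<^sub>1, \<xi>\<^sub>1\<rangle> \<cdots> \<langle>\<omega>\<^sub>n, \<xi>\<^sub>n\<rangle>\<close>, and the symmetric power consists of
  the symmetric functionals. Argument tuples are lists.
\<close>

type_synonym 'v tensor = "'v dual list \<Rightarrow> complex"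

definition symmetric_multilinear :: "'v dual set \<Rightarrow> nat \<Rightarrow> 'v tensor \<Rightarrow> bool" where
  "symmetric_multilinear D n \<phi> \<longleftrightarrow>
     (\<forall>ws. \<not> (length ws = n \<and> set ws \<subseteq> D) \<longrightarrow> \<phi> ws = 0) \<and>
     (\<forall>ws vs. mset ws = mset vs \<longrightarrow> \<phi> ws = \<phi> vs) \<and>
     (\<forall>ws a b. \<forall>\<omega>\<in>D. \<forall>\<eta>\<in>D. \<forall>i<n. length ws = n \<and> set ws \<subseteq> D \<longrightarrow>
        \<phi> (ws[i := fcomb a \<omega> b \<eta>]) = a * \<phi> (ws[i := \<omega>]) + b * \<phi> (ws[i := \<eta>]))"

text \<open>
  The Riesz isomorphism \<open>e \<mapsto> (\<cdot>, e)\<^sub>\<tau>\<close> maps orthonormal systems of \<open>\<H>\<^sub>\<tau>\<close> to those of \<open>\<H>\<^sub>-\<^sub>\<tau>\<close>.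
\<close>

definition riesz :: "('t, 'v) hilbert_family \<Rightarrow> 't \<Rightarrow> 'v cplx \<Rightarrow> 'v dual" where
  "riesz R \<tau> e = (\<lambda>\<xi>. if \<xi> \<in> Phi R then cinner R \<tau> \<xi> e else 0)"

definition corthonormal :: "('t, 'v) hilbert_family \<Rightarrow> 't \<Rightarrow> 'v cplx set \<Rightarrow> bool" where
  "corthonormal R \<tau> E \<longleftrightarrow>
     E \<subseteq> cspace R \<tau> \<and> (\<forall>e\<in>E. \<forall>f\<in>E. cinner R \<tau> e f = (if e = f then 1 else 0))"

text \<open>
  The square of the Hilbert--Schmidt norm is the sum of \<open>\<bar>\<phi>(e\<^sub>1, \<dots>, e\<^sub>n)\<bar>\<^sup>2\<close> over all \<open>n\<close>-tuples from an
  orthonormal basis. To avoid choosing a basis it is written as the supremum of these sums over all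
  finite orthonormal systems, which is the same number (possibly infinite).
\<close>

definition hs_sums :: "('t, 'v) hilbert_family \<Rightarrow> 't \<Rightarrow> nat \<Rightarrow> 'v tensor \<Rightarrow> real set" where
  "hs_sums R \<tau> n \<phi> =
     {\<Sum>es\<in>{es. length es = n \<and> set es \<subseteq> E}. (cmod (\<phi> (map (riesz R \<tau>) es)))\<^sup>2 | E.
        finite E \<and> corthonormal R \<tau> E}"

definition sym_power :: "('t, 'v::real_vector) hilbert_family \<Rightarrow> 't \<Rightarrow> nat \<Rightarrow> 'v tensor set" where
  "sym_power R \<tau> n =
     {\<phi>. symmetric_multilinear (neg_space R \<tau>) n \<phi> \<and> bdd_above (hs_sums R \<tau> n \<phi>)}"

definition sym_norm :: "('t, 'v) hilbert_family \<Rightarrow> 't \<Rightarrow> nat \<Rightarrow> 'v tensor \<Rightarrow> real" where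
  "sym_norm R \<tau> n \<phi> = sqrt (Sup (hs_sums R \<tau> n \<phi>))"

text \<open>
  \<open>\<Phi>\<^sup>\<odot>\<^sup>n\<close> is the intersection of the \<open>\<H>\<^sub>\<tau>\<^sup>\<odot>\<^sup>n\<close>. For \<open>\<H>\<^sub>\<sigma> \<subseteq> \<H>\<^sub>\<tau>\<close> the inclusion
  \<open>\<H>\<^sub>\<sigma>\<^sup>\<odot>\<^sup>n \<subseteq> \<H>\<^sub>\<tau>\<^sup>\<odot>\<^sup>n\<close> is restriction of functionals from \<open>\<H>\<^sub>-\<^sub>\<sigma>\<close> to \<open>\<H>\<^sub>-\<^sub>\<tau>\<close>, so an element of the
  intersection is one functional on \<open>\<Phi>'\<close> all of whose restrictions are of the required kind.
\<close>

definition restrict_tensor :: "'v dual set \<Rightarrow> 'v tensor \<Rightarrow> 'v tensor" where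
  "restrict_tensor D \<phi> = (\<lambda>ws. if set ws \<subseteq> D then \<phi> ws else 0)"

definition Phi_sym :: "('t, 'v::real_vector) hilbert_family \<Rightarrow> nat \<Rightarrow> 'v tensor set" where
  "Phi_sym R n =
     {\<phi>. (\<forall>ws. \<not> (length ws = n \<and> set ws \<subseteq> Phi_dual R) \<longrightarrow> \<phi> ws = 0) \<and>
         (\<forall>\<tau>\<in>indices R. restrict_tensor (neg_space R \<tau>) \<phi> \<in> sym_power R \<tau> n)}"

definition tensor_pow ::
  "('t, 'v::real_vector) hilbert_family \<Rightarrow> nat \<Rightarrow> 'v cplx \<Rightarrow> 'v tensor" where
  "tensor_pow R n \<xi> =
     (\<lambda>ws. if length ws = n \<and> set ws \<subseteq> Phi_dual R then prod_list (map (\<lambda>\<omega>. \<omega> \<xi>) ws) else 0)"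

text \<open>
  \<open>\<H>\<^sub>-\<^sub>\<tau>\<^sup>\<odot>\<^sup>n\<close> is the dual of \<open>\<H>\<^sub>\<tau>\<^sup>\<odot>\<^sup>n\<close>, its elements being recorded by their restrictions to the dense
  subspace \<open>\<Phi>\<^sup>\<odot>\<^sup>n\<close>. The pairing \<open>\<langle>F, \<phi>\<rangle>\<close> is again the application \<open>F \<phi>\<close>. For \<open>n = 0\<close> the space
  \<open>\<Phi>\<^sup>\<odot>\<^sup>0\<close> is identified with the complex numbers by \<open>\<phi> \<mapsto> \<phi> []\<close>.
\<close>

type_synonym 'v dual_tensor = "'v tensor \<Rightarrow> complex"

definition neg_sym :: "('t, 'v::real_vector) hilbert_family \<Rightarrow> 't \<Rightarrow> nat \<Rightarrow> 'v dual_tensor set" where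
  "neg_sym R \<tau> n = dual_of (Phi_sym R n) fcomb (sym_norm R \<tau> n)"

definition neg_sym_norm ::
  "('t, 'v::real_vector) hilbert_family \<Rightarrow> 't \<Rightarrow> nat \<Rightarrow> 'v dual_tensor \<Rightarrow> real" where
  "neg_sym_norm R \<tau> n = dual_norm (Phi_sym R n) (sym_norm R \<tau> n)"

definition Phi_dual_sym :: "('t, 'v::real_vector) hilbert_family \<Rightarrow> nat \<Rightarrow> 'v dual_tensor set" where
  "Phi_dual_sym R n = (\<Union>\<tau>\<in>indices R. neg_sym R \<tau> n)"

text \<open>
  The locally convex inductive limit topology, the finest locally convex topology for which all
  inclusions of the \<open>\<H>\<^sub>-\<^sub>\<tau>\<^sup>\<odot>\<^sup>n\<close> are continuous: it is given by all seminorms whose restriction to each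
  \<open>\<H>\<^sub>-\<^sub>\<tau>\<^sup>\<odot>\<^sup>n\<close> is continuous.
\<close>

definition ind_lim_topology ::
  "('t, 'v::real_vector) hilbert_family \<Rightarrow> nat \<Rightarrow> 'v dual_tensor topology" where
  "ind_lim_topology R n =
     seminorm_topology (Phi_dual_sym R n)
       {q. seminorm_on (Phi_dual_sym R n) q \<and>
           (\<forall>\<tau>\<in>indices R. \<exists>K. \<forall>F\<in>neg_sym R \<tau> n. q F \<le> K * neg_sym_norm R \<tau> n F)}"

text \<open>The element \<open>\<omega>\<^sup>\<otimes>\<^sup>n\<close>; for \<open>n = 0\<close> it is the number 1, that is, \<open>\<phi> \<mapsto> \<phi> []\<close>.\<close>

definition dual_pow ::
  "('t, 'v::real_vector) hilbert_family \<Rightarrow> nat \<Rightarrow> 'v dual \<Rightarrow> 'v dual_tensor" where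
  "dual_pow R n \<omega> = (\<lambda>\<phi>. if \<phi> \<in> Phi_sym R n then \<phi> (replicate n \<omega>) else 0)"

definition dual_one :: "('t, 'v::real_vector) hilbert_family \<Rightarrow> 'v dual_tensor" where
  "dual_one R = (\<lambda>\<phi>. if \<phi> \<in> Phi_sym R 0 then \<phi> [] else 0)"


section \<open>Entire functions\<close>

definition entire_on_neg ::
  "('t, 'v::real_vector) hilbert_family \<Rightarrow> 't \<Rightarrow> ('v dual \<Rightarrow> complex) \<Rightarrow> bool" where
  "entire_on_neg R \<tau> f \<longleftrightarrow>
     continuous_map (seminorm_topology (neg_space R \<tau>) {neg_norm R \<tau>}) euclidean f \<and>
     (\<forall>\<omega>\<in>neg_space R \<tau>. \<forall>\<eta>\<in>neg_space R \<tau>. (\<lambda>z. f (fcomb 1 \<omega> z \<eta>)) holomorphic_on UNIV)"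

definition growth_quotient ::
  "('t, 'v) hilbert_family \<Rightarrow> 't \<Rightarrow> nat \<Rightarrow> real \<Rightarrow> ('v dual \<Rightarrow> complex) \<Rightarrow> 'v dual \<Rightarrow> real" where
  "growth_quotient R \<tau> l \<alpha> f \<omega> = cmod (f \<omega>) * exp (- ((1/2) ^ l * neg_norm R \<tau> \<omega> powr \<alpha>))"

definition growth_norm ::
  "('t, 'v::real_vector) hilbert_family \<Rightarrow> 't \<Rightarrow> nat \<Rightarrow> real \<Rightarrow> ('v dual \<Rightarrow> complex) \<Rightarrow> real" where
  "growth_norm R \<tau> l \<alpha> f = (SUP \<omega>\<in>neg_space R \<tau>. growth_quotient R \<tau> l \<alpha> f \<omega>)"

text \<open>
  The case \<open>\<alpha> = 0\<close> is the projective limit over all positive exponents, so it is defined by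
  the exponents in \<open>(0, \<infinity>)\<close>.
\<close>

definition growth_exponents :: "real \<Rightarrow> real set" where
  "growth_exponents \<alpha> = (if \<alpha> = 0 then {0<..} else {\<alpha>})"

definition E_min :: "('t, 'v::real_vector) hilbert_family \<Rightarrow> real \<Rightarrow> ('v dual \<Rightarrow> complex) set" where
  "E_min R \<alpha> =
     {f. (\<forall>\<omega>. \<omega> \<notin> Phi_dual R \<longrightarrow> f \<omega> = 0) \<and>
         (\<forall>\<tau>\<in>indices R. entire_on_neg R \<tau> f) \<and>
         (\<forall>a\<in>growth_exponents \<alpha>. \<forall>\<tau>\<in>indices R. \<forall>l.
            bdd_above (growth_quotient R \<tau> l a f ` neg_space R \<tau>))}"

definition E_min_topology ::
  "('t, 'v::real_vector) hilbert_family \<Rightarrow> real \<Rightarrow> ('v dual \<Rightarrow> complex) topology" where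
  "E_min_topology R \<alpha> =
     seminorm_topology (E_min R \<alpha>)
       {growth_norm R \<tau> l a | \<tau> l a. \<tau> \<in> indices R \<and> a \<in> growth_exponents \<alpha>}"

lemma topspace_E_min_topology:
  assumes "indices R \<noteq> {}"
  shows "topspace (E_min_topology R \<alpha>) = E_min R \<alpha>"
proof -
  have "(\<lambda>\<xi>. 0) \<in> neg_space R \<tau>" for \<tau>
    by (auto simp: neg_space_def dual_of_def intro!: exI[of _ 0])
  then have zero: "growth_norm R \<tau> l a (\<lambda>\<omega>. 0) = 0" for \<tau> l a
    unfolding growth_norm_def growth_quotient_def by (auto intro!: cSUP_const)
  have "1 \<in> growth_exponents \<alpha> \<or> \<alpha> \<in> growth_exponents \<alpha>"
    by (simp add: growth_exponents_def)
  then show ?thesis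
    unfolding E_min_topology_def using assms zero
    by (intro topspace_seminorm_topology) auto
qed


section \<open>Polynomials, Appell sequences and Sheffer operators\<close>

definition monomial ::
  "('t, 'v::real_vector) hilbert_family \<Rightarrow> nat \<Rightarrow> 'v tensor \<Rightarrow> 'v dual \<Rightarrow> complex" where
  "monomial R n \<phi> = (\<lambda>\<omega>. if \<omega> \<in> Phi_dual R then dual_pow R n \<omega> \<phi> else 0)"

definition polynomials :: "('t, 'v::real_vector) hilbert_family \<Rightarrow> ('v dual \<Rightarrow> complex) set" where
  "polynomials R =
     {(\<lambda>\<omega>. \<Sum>k\<le>n. monomial R k (\<phi> k) \<omega>) | n \<phi>. \<forall>k. \<phi> k \<in> Phi_sym R k}"

type_synonym 'v poly_sequence = "nat \<Rightarrow> 'v dual \<Rightarrow> 'v dual_tensor"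

definition monic_polynomial_sequence ::
  "('t, 'v::real_vector) hilbert_family \<Rightarrow> 'v poly_sequence \<Rightarrow> bool" where
  "monic_polynomial_sequence R S \<longleftrightarrow>
     (\<exists>U :: nat \<Rightarrow> nat \<Rightarrow> 'v dual_tensor \<Rightarrow> 'v dual_tensor.
        (\<forall>n. \<forall>k\<le>n. flinear_on (Phi_dual_sym R k) (U n k) \<and>
                    continuous_map (ind_lim_topology R k) (ind_lim_topology R n) (U n k)) \<and>
        (\<forall>n. \<forall>F\<in>Phi_dual_sym R n. U n n F = F) \<and>
        (\<forall>n. \<forall>\<omega>\<in>Phi_dual R. S n \<omega> = (\<lambda>\<phi>. \<Sum>k\<le>n. U n k (dual_pow R k \<omega>) \<phi>)))"

text \<open>
  The power series \<open>\<Sum>\<^sub>n \<langle>F\<^sub>n, (z \<xi>)\<^sup>\<otimes>\<^sup>n\<rangle>\<close> as a formal power series in \<open>z\<close>.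
\<close>

definition gen_series ::
  "('t, 'v::real_vector) hilbert_family \<Rightarrow> (nat \<Rightarrow> 'v dual_tensor) \<Rightarrow> 'v cplx \<Rightarrow> complex fps" where
  "gen_series R F \<xi> = Abs_fps (\<lambda>n. F n (tensor_pow R n \<xi>))"

definition appell_sequence ::
  "('t, 'v::real_vector) hilbert_family \<Rightarrow> (nat \<Rightarrow> 'v dual_tensor) \<Rightarrow> 'v poly_sequence \<Rightarrow> bool" where
  "appell_sequence R \<rho> S \<longleftrightarrow>
     monic_polynomial_sequence R S \<and>
     (\<forall>n. \<rho> n \<in> Phi_dual_sym R n) \<and> \<rho> 0 = dual_one R \<and>
     (\<forall>\<omega>\<in>Phi_dual R. \<forall>\<xi>\<in>Phi R.
        Abs_fps (\<lambda>n. 1 / fact n * S n \<omega> (tensor_pow R n \<xi>)) =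
        fps_exp (\<omega> \<xi>) / gen_series R \<rho> \<xi>)"

text \<open>
  The two conditions determine the operator on \<open>polynomials R\<close>; its values elsewhere are irrelevant.
\<close>

definition sheffer_operator ::
  "('t, 'v::real_vector) hilbert_family \<Rightarrow> 'v poly_sequence \<Rightarrow>
     ('v dual \<Rightarrow> complex) \<Rightarrow> 'v dual \<Rightarrow> complex" where
  "sheffer_operator R S =
     (SOME A. flinear_on (polynomials R) A \<and>
        (\<forall>n. \<forall>\<phi>\<in>Phi_sym R n.
           A (monomial R n \<phi>) = (\<lambda>\<omega>. if \<omega> \<in> Phi_dual R then S n \<omega> \<phi> else 0)))"

end

theory Submission
  imports Defs "HOL-Complex_Analysis.Complex_Analysis"
begin

text \<open>
  Formally \<open>\<SS>\<close> is the differential operator \<open>1/\<rho>(D)\<close>: for a coefficient sequence \<open>\<kappa>\<close> put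
  \<open>A f(\<omega>) = \<Sum>\<^sub>k \<langle>\<kappa>\<^sub>k, D\<^sup>k f(\<omega>)\<rangle>\<close>, the constant \<open>diff_op\<close> below. With \<open>\<kappa> = \<theta>\<close> this maps the power
  \<open>\<langle>\<omega>, \<xi>\<rangle>\<^sup>n\<close> to \<open>n!\<close> times the coefficient of \<open>z\<^sup>n\<close> in \<open>exp(z \<langle>\<omega>, \<xi>\<rangle>) / \<rho>(z \<xi>)\<close>, which is
  \<open>\<langle>S\<^sub>n(\<omega>), \<xi>\<^sup>\<otimes>\<^sup>n\<rangle>\<close>. With \<open>\<kappa> = \<rho>\<close> it must give the inverse operator, and the estimates assumed for
  \<open>\<rho>\<close> and \<open>\<theta>\<close> are the same. So the theorem follows once \<open>diff_op\<close> is continuous on the space of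
  entire functions for every \<open>\<kappa>\<close> as in the hypotheses, and once identities that hold on powers are
  known to hold everywhere.

  Continuity. The \<open>k\<close>-th derivative of a function \<open>f\<close> that is entire along lines and bounded on
  balls is a symmetric \<open>k\<close>-linear form on \<open>\<Phi>'\<close>, and Cauchy's estimate bounds it by \<open>(k/r)\<^sup>k\<close> times
  the supremum of \<open>\<bar>f\<bar>\<close> on a ball of radius \<open>r\<close>. By nuclearity the inclusion of \<open>\<H>\<^sub>-\<^sub>\<tau>\<close> into a
  larger dual space \<open>\<H>\<^sub>-\<^sub>\<sigma>\<close> is Hilbert--Schmidt, say with norm at most \<open>M\<close>, so a form bounded on
  \<open>\<H>\<^sub>-\<^sub>\<sigma>\<close> has a finite Hilbert--Schmidt norm on \<open>\<H>\<^sub>-\<^sub>\<tau>\<close>, at the cost of a factor \<open>M\<^sup>k\<close> (lemma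
  \<open>deriv_form_norm\<close>). With \<open>r\<close> a multiple of \<open>k powr (1/\<beta>)\<close> the bound \<open>C\<^sup>k k! powr (1/\<beta> - 1)\<close> on
  the coefficients turns \<open>(M k/r)\<^sup>k\<close> into a geometric factor, as small as desired, while \<open>f\<close> grows
  on that ball only by a factor \<open>exp(\<epsilon> r powr a)\<close> with \<open>a \<le> \<beta>\<close>, hence at most geometrically in
  \<open>k\<close>; since \<open>f\<close> is of minimal type, \<open>\<epsilon>\<close> may be chosen small (lemma \<open>summand_growth\<close>). The
  remaining constants are absorbed in the same way by passing from one growth norm to another one.

  Identities. A linear functional on \<open>\<Phi>\<^sup>\<odot>\<^sup>n\<close> that is bounded by the values of tensors on the
  diagonal over a ball of some \<open>\<H>\<^sub>-\<^sub>\<tau>\<close> is determined by its values on the tensors \<open>\<xi>\<^sup>\<otimes>\<^sup>n\<close> (lemma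
  \<open>functional_determined_by_powers\<close>): the Hilbert--Schmidt inclusion is a norm limit of operators
  of finite rank, and composed with such an operator a homogeneous polynomial becomes a
  combination of powers. Taylor polynomials converge to \<open>f\<close> in every growth norm, so continuous
  functionals on the space of entire functions that agree on powers are equal (lemma
  \<open>bounded_functionals_agree\<close>). Applied to evaluations of the composed operators this yields that
  \<open>\<rho>(D)\<close> and \<open>\<theta>(D)\<close> are inverse to each other; applied to evaluations of \<open>\<theta>(D)\<close> on monomials it
  yields that \<open>\<theta>(D)\<close> extends \<open>\<SS>\<close>. Convergence of Taylor polynomials also shows that the
  polynomials are dense.
\<close>

section \<open>Elementary estimates and sums\<close>

lemma power_self_le_exp_fact: "real n ^ n \<le> exp 1 ^ n * fact n"
proof -
  have "real n ^ n / fact n \<le> exp (real n)"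
    using sum_le_suminf[OF summable_exp[of "real n"], of "{n}"]
    by (simp add: exp_def divide_inverse mult.commute scaleR_conv_of_real)
  then have "real n ^ n \<le> exp (real n) * fact n" by (simp add: divide_le_eq)
  then show ?thesis by (simp add: exp_of_nat_mult[symmetric])
qed

lemma power_le_exp_powr:
  assumes a: "0 < a" and e: "(0::real) < e"
  obtains Q where "0 \<le> Q" "\<And>t. 0 \<le> t \<Longrightarrow> t ^ n \<le> Q * exp (e * t powr a)"
proof -
  \<comment> \<open>For \<open>t \<ge> 1\<close> the power \<open>t\<^sup>n\<close> is at most \<open>(t powr a)\<^sup>m\<close>, which is a constant times one term of
    an exponential series.\<close>
  define m where "m = nat \<lceil>real n / a\<rceil>"
  have m: "real n \<le> real m * a"
  proof -
    have "real n / a \<le> real m" unfolding m_def by (rule real_nat_ceiling_ge)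
    then show ?thesis using a by (simp add: divide_le_eq)
  qed
  have b: "t ^ n \<le> (1 + fact m / e ^ m) * exp (e * t powr a)" if t: "0 \<le> t" for t
  proof (cases "t \<le> 1")
    case True
    have "t ^ n \<le> 1" using t True by (rule power_le_one)
    also have "\<dots> \<le> (1 + fact m / e ^ m) * exp (e * t powr a)"
      using mult_mono[of 1 "1 + fact m / e ^ m" 1 "exp (e * t powr a)"] e by simp
    finally show ?thesis .
  next
    case False
    have "t ^ n = t powr real n" using False by (simp add: powr_realpow)
    also have "\<dots> \<le> t powr (real m * a)" using m False by (intro powr_mono) auto
    also have "\<dots> = (t powr a) ^ m"
      using False powr_powr[of t a "real m"] powr_realpow[of "t powr a" m] by (simp add: mult.commute)
    also have "\<dots> = (e * t powr a) ^ m / e ^ m" using e by (simp add: power_mult_distrib)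
    also have "\<dots> \<le> (fact m * exp (e * t powr a)) / e ^ m"
    proof (intro divide_right_mono)
      have "(e * t powr a) ^ m / fact m \<le> exp (e * t powr a)"
        using sum_le_suminf[OF summable_exp[of "e * t powr a"], of "{m}"] e
        by (simp add: exp_def divide_inverse mult.commute scaleR_conv_of_real)
      then show "(e * t powr a) ^ m \<le> fact m * exp (e * t powr a)" by (simp add: divide_le_eq mult.commute)
    qed (use e in simp)
    also have "\<dots> = fact m / e ^ m * exp (e * t powr a)" by simp
    also have "\<dots> \<le> (1 + fact m / e ^ m) * exp (e * t powr a)" by (intro mult_right_mono) auto
    finally show ?thesis .
  qed
  have "0 \<le> 1 + fact m / e ^ m" using e by simp
  then show ?thesis using b by (rule that)
qed

lemma powr_add_le:
  assumes "0 \<le> x" "0 \<le> y" "(0::real) < a"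
  shows "(x + y) powr a \<le> 2 powr a * (x powr a + y powr a)"
proof -
  have "(x + y) powr a \<le> (2 * max x y) powr a" using assms by (intro powr_mono2) auto
  also have "\<dots> = 2 powr a * (max x y) powr a" using assms by (simp add: powr_mult)
  also have "\<dots> \<le> 2 powr a * (x powr a + y powr a)"
    by (intro mult_left_mono) (auto simp: max_def)
  finally show ?thesis .
qed

lemma half_power_small:
  assumes "(0::real) < e"
  obtains l0 :: nat where "\<And>l. l0 \<le> l \<Longrightarrow> c * (1/2) ^ l \<le> e"
proof -
  have "(\<lambda>l. c * (1/2) ^ l) \<longlonglongrightarrow> c * 0" by (intro tendsto_intros LIMSEQ_realpow_zero) auto
  then have "(\<lambda>l. c * (1/2) ^ l) \<longlonglongrightarrow> 0" by simp
  then have "\<forall>\<^sub>F l in sequentially. c * (1/2) ^ l < e" using assms by (rule order_tendstoD)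
  then obtain l0 where "\<And>l. l0 \<le> l \<Longrightarrow> c * (1/2) ^ l < e" unfolding eventually_sequentially by blast
  then show ?thesis using that less_imp_le by blast
qed

lemma has_sum_sum_finite:
  fixes f :: "'i \<Rightarrow> 'b \<Rightarrow> real"
  assumes "finite E" "\<And>e. e \<in> E \<Longrightarrow> (f e has_sum s e) B"
  shows "((\<lambda>b. \<Sum>e\<in>E. f e b) has_sum (\<Sum>e\<in>E. s e)) B"
  using assms by (induction E rule: finite_induct) (auto intro: has_sum_add)

lemma sum_lists_prod_list:
  fixes g :: "'a \<Rightarrow> real"
  assumes "finite E"
  shows "(\<Sum>es\<in>{es. length es = n \<and> set es \<subseteq> E}. prod_list (map g es)) = (\<Sum>e\<in>E. g e) ^ n"
proof (induction n)
  case 0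
  have "{es :: 'a list. length es = 0 \<and> set es \<subseteq> E} = {[]}" by auto
  then show ?case by simp
next
  case (Suc n)
  let ?L = "\<lambda>n. {es. length es = n \<and> set es \<subseteq> E}"
  have "?L (Suc n) = (\<lambda>(e, es). e # es) ` (E \<times> ?L n)"
    by (auto simp: length_Suc_conv image_iff)
  moreover have "inj_on (\<lambda>(e, es). e # es) (E \<times> ?L n)" by (auto simp: inj_on_def)
  ultimately have "(\<Sum>es\<in>?L (Suc n). prod_list (map g es)) = (\<Sum>(e, es)\<in>E \<times> ?L n. g e * prod_list (map g es))"
    by (simp add: sum.reindex case_prod_unfold)
  also have "\<dots> = (\<Sum>e\<in>E. g e) * (\<Sum>es\<in>?L n. prod_list (map g es))"
    by (simp add: sum_product sum.cartesian_product)
  finally show ?case using Suc by simp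
qed

section \<open>Entire functions of one variable\<close>

lemma entire_deriv_bound:
  fixes g :: "complex \<Rightarrow> complex"
  assumes "g holomorphic_on UNIV" "0 < r" "\<And>z. cmod (z - w) \<le> r \<Longrightarrow> cmod (g z) \<le> M"
  shows "cmod (deriv g w) \<le> M / r"
proof -
  have "cmod ((deriv ^^ 1) g w) \<le> fact 1 * M / r ^ 1"
  proof (rule Cauchy_inequality)
    show "g holomorphic_on ball w r" using assms(1) holomorphic_on_subset by blast
    show "continuous_on (cball w r) g"
      using assms(1) holomorphic_on_imp_continuous_on holomorphic_on_subset by blast
  qed (use assms in \<open>auto simp: norm_minus_commute\<close>)
  then show ?thesis by simp
qed

lemma entire_lipschitz_bound:
  fixes g :: "complex \<Rightarrow> complex"
  assumes g: "g holomorphic_on UNIV" and r: "0 < r" and M: "\<And>z. cmod z \<le> r \<Longrightarrow> cmod (g z) \<le> M"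
    and z: "cmod z \<le> r / 2"
  shows "cmod (g z - g 0) \<le> 2 * M / r * cmod z"
proof -
  have "cmod (g z - g 0) \<le> (2 * M / r) * cmod (z - 0)"
  proof (rule field_differentiable_bound[where S = "cball 0 (r/2)" and f' = "deriv g"])
    show "(g has_field_derivative deriv g x) (at x within cball 0 (r / 2))" for x
      using g holomorphic_derivI[OF g open_UNIV UNIV_I] has_field_derivative_at_within by blast
    show "cmod (deriv g x) \<le> 2 * M / r" if x: "x \<in> cball 0 (r / 2)" for x
    proof -
      have "cmod (deriv g x) \<le> M / (r / 2)"
      proof (rule entire_deriv_bound[OF g])
        fix y assume "cmod (y - x) \<le> r / 2"
        then have "cmod y \<le> r"
          using x norm_triangle_ineq[of "y - x" x] by auto
        then show "cmod (g y) \<le> M" by (rule M)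
      qed (use r in auto)
      then show ?thesis by (simp add: mult.commute)
    qed
  qed (use z r in auto)
  then show ?thesis by simp
qed

lemma entire_taylor_bound:
  fixes g :: "complex \<Rightarrow> complex"
  assumes g: "g holomorphic_on UNIV" and M: "\<And>z. cmod z \<le> 1 \<Longrightarrow> cmod (g z) \<le> M"
    and z: "cmod z \<le> 1 / 4"
  shows "cmod (g z - g 0 - z * deriv g 0) \<le> 8 * M * (cmod z)\<^sup>2"
proof -
  define h where "h = (\<lambda>w. g w - w * deriv g 0)"
  have g': "deriv g holomorphic_on UNIV"
    using g holomorphic_deriv by blast
  have M0: "0 \<le> M" using M[of 0] norm_ge_zero[of "g 0"] by (simp del: norm_ge_zero)
  have d: "cmod (deriv g x) \<le> 2 * M" if "cmod x \<le> 1 / 2" for x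
  proof -
    have "cmod (deriv g x) \<le> M / (1 / 2)"
    proof (rule entire_deriv_bound[OF g])
      fix y assume "cmod (y - x) \<le> 1 / 2"
      then have "cmod y \<le> 1"
        using that norm_triangle_ineq[of "y - x" x] by auto
      then show "cmod (g y) \<le> M" by (rule M)
    qed auto
    then show ?thesis by simp
  qed
  have "cmod (h z - h 0) \<le> (8 * M * cmod z) * cmod (z - 0)"
  proof (rule field_differentiable_bound[where S = "cball 0 (cmod z)" and f' = "\<lambda>w. deriv g w - deriv g 0"])
    show "(h has_field_derivative deriv g x - deriv g 0) (at x within cball 0 (cmod z))" for x
      unfolding h_def
      by (rule derivative_eq_intros holomorphic_derivI[OF g open_UNIV UNIV_I] refl | simp)+
    show "cmod (deriv g x - deriv g 0) \<le> 8 * M * cmod z" if x: "x \<in> cball 0 (cmod z)" for x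
    proof -
      have "cmod (deriv g x - deriv g 0) \<le> 2 * (2 * M) / (1/2) * cmod x"
        by (rule entire_lipschitz_bound[OF g']) (use d x z in auto)
      also have "\<dots> \<le> 8 * M * cmod z" using x M0 by (simp add: mult_left_mono)
      finally show ?thesis .
    qed
  qed auto
  then show ?thesis by (simp add: h_def power2_eq_square algebra_simps)
qed

text \<open>An error bound that is quadratic in the increment survives the application of a bounded
  linear operator, so this criterion serves where derivatives and operators are to be exchanged.\<close>

lemma has_field_derivative_quadratic:
  fixes g :: "complex \<Rightarrow> complex"
  assumes "0 < d" "\<And>t. cmod t \<le> d \<Longrightarrow> cmod (g t - g 0 - t * c) \<le> K * (cmod t)\<^sup>2"
  shows "(g has_field_derivative c) (at 0)"
proof -
  have "(\<lambda>t. (g t - g 0) / t - c) \<midarrow>0\<rightarrow> 0"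
  proof (rule tendsto_0_le[where K = 1])
    show "(\<lambda>t. K * cmod t) \<midarrow>0\<rightarrow> 0"
      by (auto intro!: tendsto_eq_intros)
    show "\<forall>\<^sub>F t in at 0. norm ((g t - g 0) / t - c) \<le> norm (K * cmod t) * 1"
      unfolding eventually_at
    proof (intro exI[of _ d] conjI ballI impI)
      fix t :: complex assume t: "t \<noteq> 0 \<and> dist t 0 < d"
      have "(g t - g 0) / t - c = (g t - g 0 - t * c) / t" using t by (simp add: field_simps)
      then have "norm ((g t - g 0) / t - c) = cmod (g t - g 0 - t * c) / cmod t"
        by (simp add: norm_divide)
      also have "\<dots> \<le> K * (cmod t)\<^sup>2 / cmod t"
        using t assms(2)[of t] by (intro divide_right_mono) auto
      also have "\<dots> \<le> norm (K * cmod t) * 1" using t by (simp add: power2_eq_square)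
      finally show "norm ((g t - g 0) / t - c) \<le> norm (K * cmod t) * 1" .
    qed (use assms in auto)
  qed
  then have "(\<lambda>t. (g t - g 0) / t) \<midarrow>0\<rightarrow> c" by (simp add: LIM_zero_iff)
  then show ?thesis by (simp add: has_field_derivative_iff)
qed

section \<open>Functions that are entire along lines and bounded on balls\<close>

definition D :: "('x \<Rightarrow> complex) \<Rightarrow> (('x \<Rightarrow> complex) \<Rightarrow> complex) \<Rightarrow> ('x \<Rightarrow> complex) \<Rightarrow> complex" where
  "D w f \<omega> = deriv (\<lambda>z. f (fcomb 1 \<omega> z w)) 0"

abbreviation Ds :: "('x \<Rightarrow> complex) list \<Rightarrow> (('x \<Rightarrow> complex) \<Rightarrow> complex) \<Rightarrow> ('x \<Rightarrow> complex) \<Rightarrow> complex" where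
  "Ds ws f \<equiv> foldr D ws f"

lemma fcomb_line: "fcomb 1 (fcomb 1 \<omega> s w) t v = fcomb 1 (fcomb 1 \<omega> t v) s w"
  and fcomb_add: "fcomb 1 (fcomb 1 \<omega> s w) t w = fcomb 1 \<omega> (s + t) w"
  and fcomb_zero [simp]: "fcomb 1 \<omega> 0 w = \<omega>"
  by (auto simp: fcomb_def algebra_simps)

lemma fcomb_triangle: "fcomb 1 f (-1) h = fcomb 1 (fcomb 1 f (-1) g) 1 (fcomb 1 g (-1) h)"
  by (simp add: fcomb_def)

lemma D_translate: "D w (\<lambda>\<omega>. f (fcomb 1 \<omega> t v)) = (\<lambda>\<omega>. D w f (fcomb 1 \<omega> t v))"
  by (simp add: D_def fun_eq_iff fcomb_line)

lemma Ds_translate: "Ds ws (\<lambda>\<omega>. f (fcomb 1 \<omega> t v)) = (\<lambda>\<omega>. Ds ws f (fcomb 1 \<omega> t v))"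
  by (induction ws) (simp_all add: D_translate)

locale seminormed =
  fixes V :: "('x \<Rightarrow> complex) set" and N :: "('x \<Rightarrow> complex) \<Rightarrow> real"
  assumes V_fcomb: "v \<in> V \<Longrightarrow> w \<in> V \<Longrightarrow> fcomb a v b w \<in> V"
    and V_zero: "(\<lambda>x. 0) \<in> V"
    and N_nonneg: "v \<in> V \<Longrightarrow> 0 \<le> N v"
    and N_fcomb: "v \<in> V \<Longrightarrow> w \<in> V \<Longrightarrow> N (fcomb a v b w) \<le> cmod a * N v + cmod b * N w"
begin

text \<open>Holomorphy is required along complex lines only. Boundedness on balls makes Cauchy's
  estimates uniform in the direction; it implies that derivatives are linear in the direction and
  that the function is locally Lipschitz.\<close>

definition bounded_type :: "(('x \<Rightarrow> complex) \<Rightarrow> complex) \<Rightarrow> bool" where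
  "bounded_type f \<longleftrightarrow> (\<forall>\<omega>\<in>V. \<forall>\<eta>\<in>V. (\<lambda>z. f (fcomb 1 \<omega> z \<eta>)) holomorphic_on UNIV) \<and>
     (\<forall>r. \<exists>M. \<forall>\<omega>\<in>V. N \<omega> \<le> r \<longrightarrow> cmod (f \<omega>) \<le> M)"

lemma bounded_type_holo: "bounded_type f \<Longrightarrow> \<omega> \<in> V \<Longrightarrow> \<eta> \<in> V \<Longrightarrow> (\<lambda>z. f (fcomb 1 \<omega> z \<eta>)) holomorphic_on UNIV"
  by (simp add: bounded_type_def)

lemma bounded_type_bounded:
  assumes "bounded_type f"
  obtains M where "0 \<le> M" "\<And>\<omega>. \<omega> \<in> V \<Longrightarrow> N \<omega> \<le> r \<Longrightarrow> cmod (f \<omega>) \<le> M"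
proof -
  obtain M where M: "\<forall>\<omega>\<in>V. N \<omega> \<le> r \<longrightarrow> cmod (f \<omega>) \<le> M"
    using assms unfolding bounded_type_def by blast
  show ?thesis by (rule that[of "max 0 M"]) (use M in \<open>auto intro: order_trans\<close>)
qed

lemma N_line: "v \<in> V \<Longrightarrow> w \<in> V \<Longrightarrow> cmod t * N w \<le> r \<Longrightarrow> N (fcomb 1 v t w) \<le> N v + r"
  using N_fcomb[of v w 1 t] by simp

lemma D_deriv:
  assumes "bounded_type f" "\<omega> \<in> V" "w \<in> V"
  shows "((\<lambda>z. f (fcomb 1 \<omega> z w)) has_field_derivative D w f (fcomb 1 \<omega> t w)) (at t)"
proof -
  let ?g = "\<lambda>z. f (fcomb 1 \<omega> z w)"
  have h: "?g holomorphic_on UNIV" by (rule bounded_type_holo[OF assms])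
  have "D w f (fcomb 1 \<omega> t w) = deriv (\<lambda>z. ?g (t + z)) 0"
    by (simp add: D_def fcomb_add)
  also have "\<dots> = deriv ?g t"
  proof (rule DERIV_imp_deriv)
    have "((\<lambda>x. ?g x) has_field_derivative deriv ?g t) (at (0 + t))"
      using holomorphic_derivI[OF h open_UNIV UNIV_I] by simp
    then show "((\<lambda>z. ?g (t + z)) has_field_derivative deriv ?g t) (at 0)"
      by (subst (asm) DERIV_shift) (simp only: add.commute)
  qed
  finally show ?thesis using holomorphic_derivI[OF h open_UNIV UNIV_I] by simp
qed

text \<open>Cauchy's estimate on the disc of radius \<open>s / N w\<close> in the complex line through \<open>\<omega>\<close> in
  direction \<open>w\<close>. If \<open>N w = 0\<close>, the whole line stays in every ball around \<open>\<omega>\<close>, and letting the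
  radius grow gives \<open>0\<close> as in Liouville's theorem.\<close>

lemma D_bound:
  assumes f: "bounded_type f" and \<omega>: "\<omega> \<in> V" and w: "w \<in> V" and s: "0 < s"
    and c: "\<And>\<zeta>. \<zeta> \<in> V \<Longrightarrow> N \<zeta> \<le> s \<Longrightarrow> cmod (f (fcomb 1 \<omega> 1 \<zeta>)) \<le> c"
  shows "cmod (D w f \<omega>) \<le> N w / s * c"
proof -
  have c0: "0 \<le> c"
  proof -
    have "N (\<lambda>x. 0) \<le> s" using N_fcomb[OF V_zero V_zero, of 0 0] s by (simp add: fcomb_def)
    then have "cmod (f (fcomb 1 \<omega> 1 (\<lambda>x. 0))) \<le> c" by (rule c[OF V_zero])
    then show ?thesis using norm_ge_zero order_trans by blast
  qed
  have b: "cmod (D w f \<omega>) \<le> c / r" if r: "0 < r" "r * N w \<le> s" for r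
    unfolding D_def
  proof (rule entire_deriv_bound[OF bounded_type_holo[OF f \<omega> w] r(1)])
    fix z assume z: "cmod (z - 0) \<le> r"
    have "N (fcomb 0 w z w) \<le> cmod z * N w" using N_fcomb[OF w w, of 0 z] by simp
    also have "\<dots> \<le> s"
      using z r N_nonneg[OF w] by (smt (verit) diff_zero mult_right_mono)
    finally have "cmod (f (fcomb 1 \<omega> 1 (fcomb 0 w z w))) \<le> c" using c V_fcomb w by blast
    moreover have "fcomb 1 \<omega> 1 (fcomb 0 w z w) = fcomb 1 \<omega> z w" by (auto simp: fcomb_def)
    ultimately show "cmod (f (fcomb 1 \<omega> z w)) \<le> c" by simp
  qed
  show ?thesis
  proof (cases "N w = 0")
    case True
    have "cmod (D w f \<omega>) \<le> e" if "e > 0" for e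
    proof -
      have "cmod (D w f \<omega>) \<le> c / ((c + 1) / e)" by (rule b) (use True s that c0 in auto)
      also have "\<dots> \<le> e" using c0 that by (simp add: field_simps)
      finally show ?thesis .
    qed
    then have "cmod (D w f \<omega>) \<le> 0" by (rule field_le_epsilon[of _ 0, simplified])
    then show ?thesis using True by simp
  next
    case False
    then have Nw: "N w > 0" using N_nonneg[OF w] by simp
    show ?thesis using b[of "s / N w"] Nw s by (simp add: field_simps)
  qed
qed

text \<open>In the complex line through \<open>\<omega>\<close> and \<open>\<eta>\<close>, parametrized so that \<open>\<eta>\<close> is the point \<open>1\<close>, the disc
  of radius \<open>1/e\<close> stays within distance \<open>1\<close> of \<open>\<omega>\<close>.\<close>

lemma bounded_type_lipschitz:
  assumes f: "bounded_type f" and \<omega>: "\<omega> \<in> V" and \<eta>: "\<eta> \<in> V" and e: "0 < e" "e \<le> 1 / 2"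
    and d: "N (fcomb 1 \<eta> (-1) \<omega>) \<le> e"
    and M: "\<And>\<zeta>. \<zeta> \<in> V \<Longrightarrow> N \<zeta> \<le> N \<omega> + 1 \<Longrightarrow> cmod (f \<zeta>) \<le> M"
  shows "cmod (f \<eta> - f \<omega>) \<le> 2 * M * e"
proof -
  let ?w = "fcomb 1 \<eta> (-1) \<omega>"
  have w: "?w \<in> V" using V_fcomb \<omega> \<eta> by blast
  have "cmod (f (fcomb 1 \<omega> 1 ?w) - f (fcomb 1 \<omega> 0 ?w)) \<le> 2 * M / (1 / e) * cmod 1"
  proof (rule entire_lipschitz_bound[OF bounded_type_holo[OF f \<omega> w]])
    fix z :: complex assume "cmod z \<le> 1 / e"
    then have "cmod z * N ?w \<le> (1 / e) * e" using d e N_nonneg[OF w] by (intro mult_mono) auto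
    then show "cmod (f (fcomb 1 \<omega> z ?w)) \<le> M"
      using e N_line[OF \<omega> w, of z 1] by (intro M V_fcomb \<omega> w) simp_all
  qed (use e in \<open>auto simp: field_simps\<close>)
  moreover have "fcomb 1 \<omega> 1 ?w = \<eta>" by (auto simp: fcomb_def)
  ultimately show ?thesis by simp
qed

lemma D_difference_quotient:
  assumes f: "bounded_type f" and w: "w \<in> V" and \<omega>: "\<omega> \<in> V" and t: "cmod t \<le> 1 / 4"
    and M: "\<And>\<zeta>. \<zeta> \<in> V \<Longrightarrow> N \<zeta> \<le> N \<omega> + N w \<Longrightarrow> cmod (f \<zeta>) \<le> M"
  shows "cmod (f (fcomb 1 \<omega> t w) - f \<omega> - t * D w f \<omega>) \<le> 8 * M * (cmod t)\<^sup>2"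
proof -
  have "cmod (f (fcomb 1 \<omega> t w) - f (fcomb 1 \<omega> 0 w) - t * D w f \<omega>) \<le> 8 * M * (cmod t)\<^sup>2"
    unfolding D_def
  proof (rule entire_taylor_bound[OF bounded_type_holo[OF f \<omega> w] _ t])
    fix z :: complex assume "cmod z \<le> 1"
    then have "cmod z * N w \<le> N w" using N_nonneg[OF w] by (simp add: mult_left_le_one_le)
    then show "cmod (f (fcomb 1 \<omega> z w)) \<le> M" by (intro M V_fcomb \<omega> w N_line)
  qed
  then show ?thesis by simp
qed

lemma bounded_type_combine: "bounded_type f \<Longrightarrow> bounded_type g \<Longrightarrow> bounded_type (fcomb a f b g)"
proof (unfold bounded_type_def, intro conjI ballI allI; elim conjE)
  fix r
  assume "\<forall>r. \<exists>M. \<forall>\<omega>\<in>V. N \<omega> \<le> r \<longrightarrow> cmod (f \<omega>) \<le> M" "\<forall>r. \<exists>M. \<forall>\<omega>\<in>V. N \<omega> \<le> r \<longrightarrow> cmod (g \<omega>) \<le> M"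
  then obtain M1 M2 where M: "\<forall>\<omega>\<in>V. N \<omega> \<le> r \<longrightarrow> cmod (f \<omega>) \<le> M1" "\<forall>\<omega>\<in>V. N \<omega> \<le> r \<longrightarrow> cmod (g \<omega>) \<le> M2"
    by meson
  show "\<exists>M. \<forall>\<omega>\<in>V. N \<omega> \<le> r \<longrightarrow> cmod (fcomb a f b g \<omega>) \<le> M"
  proof (intro exI ballI impI)
    fix \<omega> assume "\<omega> \<in> V" "N \<omega> \<le> r"
    then show "cmod (fcomb a f b g \<omega>) \<le> cmod a * M1 + cmod b * M2"
      unfolding fcomb_def using M
      by (intro order_trans[OF norm_triangle_ineq] add_mono) (simp_all add: norm_mult mult_left_mono)
  qed
qed (auto simp: fcomb_def[of a f b g] intro!: holomorphic_intros)

lemma bounded_type_translate: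
  assumes f: "bounded_type f" and w: "w \<in> V"
  shows "bounded_type (\<lambda>\<omega>. f (fcomb 1 \<omega> t w))"
  unfolding bounded_type_def
proof (intro conjI ballI allI)
  fix \<omega> \<eta> assume "\<omega> \<in> V" "\<eta> \<in> V"
  then show "(\<lambda>z. f (fcomb 1 (fcomb 1 \<omega> z \<eta>) t w)) holomorphic_on UNIV"
    by (subst fcomb_line) (intro bounded_type_holo f V_fcomb w)
next
  fix r
  obtain M where "\<And>\<omega>. \<omega> \<in> V \<Longrightarrow> N \<omega> \<le> r + cmod t * N w \<Longrightarrow> cmod (f \<omega>) \<le> M"
    using bounded_type_bounded[OF f] by blast
  then show "\<exists>M. \<forall>\<omega>\<in>V. N \<omega> \<le> r \<longrightarrow> cmod (f (fcomb 1 \<omega> t w)) \<le> M"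
    using V_fcomb[OF _ w] N_line[OF _ w order_refl] by (meson add_right_mono order_trans)
qed

text \<open>The difference quotients are holomorphic along lines, and by their quadratic error bound
  they converge to the derivative uniformly on balls.\<close>

lemma bounded_type_D:
  assumes f: "bounded_type f" and w: "w \<in> V"
  shows "bounded_type (D w f)"
  unfolding bounded_type_def
proof (intro conjI ballI allI)
  fix r
  obtain M where M: "0 \<le> M" "\<And>\<omega>. \<omega> \<in> V \<Longrightarrow> N \<omega> \<le> r + 1 \<Longrightarrow> cmod (f \<omega>) \<le> M"
    using bounded_type_bounded[OF f] by blast
  have "cmod (D w f \<omega>) \<le> N w / 1 * M" if \<omega>: "\<omega> \<in> V" "N \<omega> \<le> r" for \<omega>
  proof (rule D_bound[OF f \<omega>(1) w])
    fix \<zeta> assume "\<zeta> \<in> V" "N \<zeta> \<le> 1"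
    then show "cmod (f (fcomb 1 \<omega> 1 \<zeta>)) \<le> M"
      using N_fcomb[of \<omega> \<zeta> 1 1] \<omega> by (intro M V_fcomb) simp_all
  qed simp
  then show "\<exists>M. \<forall>\<omega>\<in>V. N \<omega> \<le> r \<longrightarrow> cmod (D w f \<omega>) \<le> M" by blast
next
  fix \<omega> \<eta> assume \<omega>: "\<omega> \<in> V" and \<eta>: "\<eta> \<in> V"
  \<comment> \<open>The shift by \<open>4\<close> keeps all increments in the disc of radius \<open>1/4\<close> where the quadratic error
    bound holds.\<close>
  let ?t = "\<lambda>n. inverse (of_nat (n + 4)) :: complex"
  let ?q = "\<lambda>n z. (f (fcomb 1 (fcomb 1 \<omega> z \<eta>) (?t n) w) - f (fcomb 1 \<omega> z \<eta>)) / ?t n"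
  show "(\<lambda>z. D w f (fcomb 1 \<omega> z \<eta>)) holomorphic_on UNIV"
  proof (rule holomorphic_uniform_sequence[where f = ?q])
    show "?q n holomorphic_on UNIV" for n
      by (subst fcomb_line) (intro holomorphic_intros bounded_type_holo f V_fcomb \<omega> \<eta> w, simp)
    fix z0 :: complex
    obtain M where M: "0 \<le> M" "\<And>\<zeta>. \<zeta> \<in> V \<Longrightarrow> N \<zeta> \<le> N \<omega> + (cmod z0 + 1) * N \<eta> + N w \<Longrightarrow> cmod (f \<zeta>) \<le> M"
      using bounded_type_bounded[OF f] by blast
    have "uniform_limit (cball z0 1) ?q (\<lambda>z. D w f (fcomb 1 \<omega> z \<eta>)) sequentially"
    proof (rule uniform_limitI)
      fix e :: real assume e: "0 < e"
      have "(\<lambda>n. 8 * M * inverse (real (n + 4))) \<longlonglongrightarrow> 0"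
        by (rule tendsto_mult_right_zero[OF LIMSEQ_ignore_initial_segment[OF lim_inverse_n, of 4]])
      then have "\<forall>\<^sub>F n in sequentially. 8 * M * inverse (real (n + 4)) < e"
        using e by (rule order_tendstoD)
      then show "\<forall>\<^sub>F n in sequentially. \<forall>z\<in>cball z0 1. dist (?q n z) (D w f (fcomb 1 \<omega> z \<eta>)) < e"
      proof (rule eventually_mono, intro ballI)
        fix n z assume n: "8 * M * inverse (real (n + 4)) < e" and z: "z \<in> cball z0 1"
        let ?x = "fcomb 1 \<omega> z \<eta>"
        have x: "?x \<in> V" using V_fcomb \<omega> \<eta> by blast
        have "cmod z \<le> cmod z0 + 1"
          using z norm_triangle_ineq[of z0 "z - z0"] by (auto simp: dist_norm norm_minus_commute)
        then have Nx: "N ?x \<le> N \<omega> + (cmod z0 + 1) * N \<eta>"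
          by (intro N_line \<omega> \<eta> mult_right_mono N_nonneg)
        have t2: "cmod (?t n) = inverse (real (n + 4))"
          by (simp only: norm_inverse norm_of_nat)
        have t1: "cmod (?t n) \<le> 1/4" unfolding t2 by (simp add: field_simps)
        have t3: "?t n \<noteq> 0" using t2 by force
        note t = t1 t2 t3
        have "?q n z - D w f ?x = (f (fcomb 1 ?x (?t n) w) - f ?x - ?t n * D w f ?x) / ?t n"
          using t(3) by (simp add: diff_divide_distrib)
        then have "cmod (?q n z - D w f ?x)
            = cmod (f (fcomb 1 ?x (?t n) w) - f ?x - ?t n * D w f ?x) / cmod (?t n)"
          by (simp only: norm_divide)
        also have "\<dots> \<le> 8 * M * (cmod (?t n))\<^sup>2 / cmod (?t n)"
          by (intro divide_right_mono D_difference_quotient f w x t M) (use Nx in auto)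
        also have "\<dots> = 8 * M * cmod (?t n)"
          using t(3) by (simp add: power2_eq_square del: of_nat_add)
        finally show "dist (?q n z) (D w f ?x) < e" using n t(2) by (simp add: dist_norm)
      qed
    qed
    then show "\<exists>d>0. cball z0 d \<subseteq> UNIV \<and> uniform_limit (cball z0 d) ?q (\<lambda>z. D w f (fcomb 1 \<omega> z \<eta>)) sequentially"
      by (intro exI[of _ 1]) simp
  qed simp
qed

lemma D_fcomb:
  assumes f: "bounded_type f" and g: "bounded_type g" and w: "w \<in> V" and \<omega>: "\<omega> \<in> V"
  shows "D w (fcomb a f b g) \<omega> = fcomb a (D w f) b (D w g) \<omega>"
proof -
  have "((\<lambda>z. fcomb a f b g (fcomb 1 \<omega> z w)) has_field_derivative
      a * D w f (fcomb 1 \<omega> 0 w) + b * D w g (fcomb 1 \<omega> 0 w)) (at 0)"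
    unfolding fcomb_def[of a f b g] by (intro DERIV_add DERIV_cmult D_deriv f g w \<omega>)
  then show ?thesis unfolding D_def by (simp add: DERIV_imp_deriv fcomb_def D_def)
qed

text \<open>Homogeneity is the chain rule. For additivity one moves first in direction \<open>w\<close> and then in
  direction \<open>v\<close>: the derivative in direction \<open>v\<close> has changed by \<open>O(t)\<close> only, so the total error is
  \<open>O(t\<^sup>2)\<close>.\<close>

lemma D_direction_linear:
  assumes f: "bounded_type f" and v: "v \<in> V" and w: "w \<in> V" and \<omega>: "\<omega> \<in> V"
  shows "D (fcomb a v b w) f \<omega> = a * D v f \<omega> + b * D w f \<omega>"
proof -
  let ?c = "a * D v f \<omega> + b * D w f \<omega>"
  let ?g = "\<lambda>t. f (fcomb 1 \<omega> t (fcomb a v b w))"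
  define v' w' where "v' = fcomb a v 0 v" and "w' = fcomb b w 0 w"
  have v': "v' \<in> V" and w': "w' \<in> V" using V_fcomb v w by (auto simp: v'_def w'_def)
  have sc: "D (fcomb a u 0 u) f \<omega>' = a * D u f \<omega>'" if "u \<in> V" "\<omega>' \<in> V" for a u \<omega>'
  proof -
    have "((\<lambda>z. f (fcomb 1 \<omega>' (a * z) u)) has_field_derivative D u f (fcomb 1 \<omega>' (a * 0) u) * a) (at 0)"
      by (rule DERIV_chain'[where f = "\<lambda>z. a * z" and g = "\<lambda>z. f (fcomb 1 \<omega>' z u)"])
         (auto intro!: derivative_eq_intros, use D_deriv[OF f that(2,1), of 0] in simp)
    moreover have "fcomb 1 \<omega>' (a * z) u = fcomb 1 \<omega>' z (fcomb a u 0 u)" for z by (auto simp: fcomb_def)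
    ultimately show ?thesis unfolding D_def by (simp add: DERIV_imp_deriv D_def)
  qed
  obtain M where M: "0 \<le> M" "\<And>\<zeta>. \<zeta> \<in> V \<Longrightarrow> N \<zeta> \<le> N \<omega> + N w' + N v' \<Longrightarrow> cmod (f \<zeta>) \<le> M"
    using bounded_type_bounded[OF f] by blast
  obtain M' where M': "0 \<le> M'" "\<And>\<zeta>. \<zeta> \<in> V \<Longrightarrow> N \<zeta> \<le> N \<omega> + N w' \<Longrightarrow> cmod (D v' f \<zeta>) \<le> M'"
    using bounded_type_bounded[OF bounded_type_D[OF f v']] by blast
  note nn = N_nonneg[OF v'] N_nonneg[OF w']
  have "(?g has_field_derivative D v' f \<omega> + D w' f \<omega>) (at 0)"
  proof (rule has_field_derivative_quadratic[where d = "1/4" and K = "8 * M + 8 * M + 2 * M'"])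
    fix t :: complex assume t: "cmod t \<le> 1 / 4"
    let ?x = "fcomb 1 \<omega> t w'"
    have x: "?x \<in> V" using V_fcomb \<omega> w' by blast
    have "cmod t * N w' \<le> N w'" using t nn by (simp add: mult_left_le_one_le)
    then have Nx: "N ?x \<le> N \<omega> + N w'" by (intro N_line \<omega> w')
    have 1: "cmod (f (fcomb 1 ?x t v') - f ?x - t * D v' f ?x) \<le> 8 * M * (cmod t)\<^sup>2"
      by (rule D_difference_quotient[OF f v' x t]) (use Nx M in auto)
    have 2: "cmod (f ?x - f \<omega> - t * D w' f \<omega>) \<le> 8 * M * (cmod t)\<^sup>2"
      by (rule D_difference_quotient[OF f w' \<omega> t]) (use nn M in auto)
    have 3: "cmod (D v' f ?x - D v' f (fcomb 1 \<omega> 0 w')) \<le> 2 * M' / 1 * cmod t"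
    proof (rule entire_lipschitz_bound[OF bounded_type_holo[OF bounded_type_D[OF f v'] \<omega> w']])
      fix z :: complex assume "cmod z \<le> 1"
      then have "cmod z * N w' \<le> N w'" using nn by (simp add: mult_left_le_one_le)
      then show "cmod (D v' f (fcomb 1 \<omega> z w')) \<le> M'" by (intro M' V_fcomb \<omega> w' N_line)
    qed (use t in auto)
    have 3: "cmod (t * (D v' f ?x - D v' f \<omega>)) \<le> 2 * M' * (cmod t)\<^sup>2"
      using mult_left_mono[OF 3 norm_ge_zero[of t]] by (simp add: norm_mult power2_eq_square mult_ac)
    have "fcomb 1 ?x t v' = fcomb 1 \<omega> t (fcomb a v b w)"
      by (auto simp: fcomb_def v'_def w'_def algebra_simps)
    then have "?g t - ?g 0 - t * (D v' f \<omega> + D w' f \<omega>)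
       = (f (fcomb 1 ?x t v') - f ?x - t * D v' f ?x) + (f ?x - f \<omega> - t * D w' f \<omega>)
          + t * (D v' f ?x - D v' f \<omega>)"
      by (simp add: algebra_simps)
    then show "cmod (?g t - ?g 0 - t * (D v' f \<omega> + D w' f \<omega>)) \<le> (8 * M + 8 * M + 2 * M') * (cmod t)\<^sup>2"
      using norm_triangle_le[OF add_mono[OF norm_triangle_le[OF add_mono[OF 1 2]] 3]]
      by (simp add: algebra_simps)
  qed simp
  then have "D (fcomb a v b w) f \<omega> = D v' f \<omega> + D w' f \<omega>"
    unfolding D_def by (simp add: DERIV_imp_deriv D_def)
  then show ?thesis using sc v w \<omega> by (simp add: v'_def w'_def)
qed

text \<open>The error of a difference quotient as a function on the whole space, so that an operator can
  be applied to it.\<close>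

definition quot_error where
  "quot_error f w t = fcomb (1 / t) (fcomb 1 (\<lambda>\<omega>. f (fcomb 1 \<omega> t w)) (- 1) f) (- 1) (D w f)"

lemma quot_error_bound:
  assumes f: "bounded_type f" and w: "w \<in> V" and \<omega>: "\<omega> \<in> V" and t: "cmod t \<le> 1 / 4" "t \<noteq> 0"
    and M: "\<And>\<zeta>. \<zeta> \<in> V \<Longrightarrow> N \<zeta> \<le> N \<omega> + N w \<Longrightarrow> cmod (f \<zeta>) \<le> M"
  shows "cmod (quot_error f w t \<omega>) \<le> 8 * M * cmod t"
proof -
  have "quot_error f w t \<omega> = (f (fcomb 1 \<omega> t w) - f \<omega> - t * D w f \<omega>) / t"
    using t by (simp add: quot_error_def fcomb_def[of _ _ _ "D w f"] fcomb_def[of _ _ _ f] field_simps)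
  then have "cmod (quot_error f w t \<omega>) = cmod (f (fcomb 1 \<omega> t w) - f \<omega> - t * D w f \<omega>) / cmod t"
    by (simp add: norm_divide)
  also have "\<dots> \<le> 8 * M * (cmod t)\<^sup>2 / cmod t"
    by (intro divide_right_mono D_difference_quotient f w \<omega> t M) auto
  finally show ?thesis using t by (simp add: power2_eq_square)
qed

lemma D_cong:
  assumes "\<And>\<zeta>. \<zeta> \<in> V \<Longrightarrow> f \<zeta> = g \<zeta>" "w \<in> V" "\<omega> \<in> V"
  shows "D w f \<omega> = D w g \<omega>"
  unfolding D_def using assms V_fcomb by simp

text \<open>A linear operator that commutes with translations maps difference quotients to difference
  quotients; if its value at \<open>\<omega>\<close> is controlled by \<open>f\<close> on a ball around \<open>\<omega>\<close>, the error of the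
  difference quotient is mapped to something small. With \<open>T = D v\<close> this is the symmetry of second
  derivatives, with \<open>T\<close> a term of a differential operator it is holomorphy of that term. The class
  \<open>P\<close> stands for the functions to which \<open>T\<close> applies: functions of bounded type on \<open>V\<close> in the first
  case, on all of \<open>\<Phi>'\<close> in the second one.\<close>

lemma local_operator_has_derivative:
  assumes P: "\<And>f. P f \<Longrightarrow> bounded_type f"
    and P_fcomb: "\<And>f g a b. P f \<Longrightarrow> P g \<Longrightarrow> P (fcomb a f b g)"
    and P_translate: "\<And>f t w. P f \<Longrightarrow> w \<in> V \<Longrightarrow> P (\<lambda>\<omega>. f (fcomb 1 \<omega> t w))"
    and P_D: "\<And>f w. P f \<Longrightarrow> w \<in> V \<Longrightarrow> P (D w f)"
    and linear: "\<And>f g a b \<omega>. P f \<Longrightarrow> P g \<Longrightarrow> \<omega> \<in> V \<Longrightarrow> T (fcomb a f b g) \<omega> = a * T f \<omega> + b * T g \<omega>"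
    and translate: "\<And>f t w \<omega>. P f \<Longrightarrow> w \<in> V \<Longrightarrow> \<omega> \<in> V \<Longrightarrow> T (\<lambda>\<omega>. f (fcomb 1 \<omega> t w)) \<omega> = T f (fcomb 1 \<omega> t w)"
    and K: "0 \<le> K"
    and bound: "\<And>f \<omega> c. P f \<Longrightarrow> \<omega> \<in> V \<Longrightarrow> (\<And>\<zeta>. \<zeta> \<in> V \<Longrightarrow> N \<zeta> \<le> r \<Longrightarrow> cmod (f (fcomb 1 \<omega> 1 \<zeta>)) \<le> c)
        \<Longrightarrow> cmod (T f \<omega>) \<le> K * c"
    and f: "P f" and w: "w \<in> V" and \<omega>: "\<omega> \<in> V"
  shows "((\<lambda>t. T f (fcomb 1 \<omega> t w)) has_field_derivative T (D w f) \<omega>) (at 0)"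
proof -
  let ?g = "\<lambda>t. T f (fcomb 1 \<omega> t w)"
  obtain M where M: "0 \<le> M" "\<And>\<zeta>. \<zeta> \<in> V \<Longrightarrow> N \<zeta> \<le> N \<omega> + r + N w \<Longrightarrow> cmod (f \<zeta>) \<le> M"
    using bounded_type_bounded[OF P[OF f]] by blast
  have Pq: "P (quot_error f w t)" for t
    unfolding quot_error_def by (intro P_fcomb P_translate P_D f w)
  show ?thesis
  proof (rule has_field_derivative_quadratic[where d = "1/4" and K = "K * (8 * M)"])
    fix t :: complex assume t: "cmod t \<le> 1/4"
    show "cmod (?g t - ?g 0 - t * T (D w f) \<omega>) \<le> K * (8 * M) * (cmod t)\<^sup>2"
    proof (cases "t = 0")
      case False
      have eq: "T (quot_error f w t) \<omega> = (1 / t) * (?g t - ?g 0) - T (D w f) \<omega>"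
        unfolding quot_error_def
        by (simp add: linear P_fcomb P_translate P_D f w \<omega> translate)
      have "cmod (T (quot_error f w t) \<omega>) \<le> K * (8 * M * cmod t)"
      proof (rule bound[OF Pq \<omega>])
        fix \<zeta> assume \<zeta>: "\<zeta> \<in> V" "N \<zeta> \<le> r"
        then have "N (fcomb 1 \<omega> 1 \<zeta>) \<le> N \<omega> + r" using N_line[OF \<omega> \<zeta>(1), of 1 r] by simp
        then show "cmod (quot_error f w t (fcomb 1 \<omega> 1 \<zeta>)) \<le> 8 * M * cmod t"
          by (intro quot_error_bound P f w V_fcomb \<omega> \<zeta> t False M) auto
      qed
      then have "cmod t * cmod (T (quot_error f w t) \<omega>) \<le> cmod t * (K * (8 * M * cmod t))"
        by (intro mult_left_mono) auto
      moreover have "?g t - ?g 0 - t * T (D w f) \<omega> = t * T (quot_error f w t) \<omega>"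
        unfolding eq using False by (simp add: field_simps)
      ultimately show ?thesis by (simp add: norm_mult power2_eq_square mult_ac)
    qed simp
  qed simp
qed

lemma D_commute:
  assumes f: "bounded_type f" and v: "v \<in> V" and w: "w \<in> V" and \<omega>: "\<omega> \<in> V"
  shows "D v (D w f) \<omega> = D w (D v f) \<omega>"
proof -
  have "((\<lambda>t. D v f (fcomb 1 \<omega> t w)) has_field_derivative D v (D w f) \<omega>) (at 0)"
  proof (rule local_operator_has_derivative[where P = bounded_type and K = "N v" and r = 1])
    fix f \<omega> c assume "bounded_type f" "\<omega> \<in> V" "\<And>\<zeta>. \<zeta> \<in> V \<Longrightarrow> N \<zeta> \<le> 1 \<Longrightarrow> cmod (f (fcomb 1 \<omega> 1 \<zeta>)) \<le> c"
    then show "cmod (D v f \<omega>) \<le> N v * c" using D_bound[of f \<omega> v 1 c] v by simp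
  qed (use assms in \<open>auto simp: bounded_type_combine bounded_type_translate bounded_type_D D_fcomb D_translate N_nonneg fcomb_def[of _ "D _ _"]\<close>)
  then show ?thesis unfolding D_def[of w "D v f"] by (simp add: DERIV_imp_deriv)
qed

section \<open>Iterated derivatives\<close>

lemma bounded_type_Ds: "bounded_type f \<Longrightarrow> set ws \<subseteq> V \<Longrightarrow> bounded_type (Ds ws f)"
  by (induction ws) (auto intro: bounded_type_D)

lemma Ds_fcomb:
  assumes "bounded_type f" "bounded_type g" "set ws \<subseteq> V" "\<omega> \<in> V"
  shows "Ds ws (fcomb a f b g) \<omega> = a * Ds ws f \<omega> + b * Ds ws g \<omega>"
  using assms(3,4)
proof (induction ws arbitrary: \<omega>)
  case (Cons w ws)
  have "D w (Ds ws (fcomb a f b g)) \<omega> = D w (fcomb a (Ds ws f) b (Ds ws g)) \<omega>"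
    by (rule D_cong) (use Cons in \<open>auto simp: fcomb_def[of _ "Ds _ _"]\<close>)
  then show ?case
    using Cons.prems assms by (simp add: D_fcomb bounded_type_Ds) (simp add: fcomb_def)
qed (simp add: fcomb_def)

lemma Ds_move:
  assumes "bounded_type f" "set as \<subseteq> V" "w \<in> V" "set bs \<subseteq> V" "\<omega> \<in> V"
  shows "Ds (as @ w # bs) f \<omega> = Ds (w # as @ bs) f \<omega>"
  using assms(2,5)
proof (induction as arbitrary: \<omega>)
  case (Cons a as)
  have "D a (Ds (as @ w # bs) f) \<omega> = D a (D w (Ds (as @ bs) f)) \<omega>"
    by (rule D_cong) (use Cons in auto)
  also have "\<dots> = D w (D a (Ds (as @ bs) f)) \<omega>"
  proof -
    have "bounded_type (Ds (as @ bs) f)" using Cons.prems assms by (intro bounded_type_Ds) auto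
    then show ?thesis using Cons.prems assms by (intro D_commute) auto
  qed
  finally show ?case by simp
qed simp

lemma Ds_perm:
  assumes "bounded_type f" "mset ws = mset vs" "set ws \<subseteq> V" "\<omega> \<in> V"
  shows "Ds ws f \<omega> = Ds vs f \<omega>"
  using assms(2-4)
proof (induction ws arbitrary: vs \<omega>)
  case (Cons w ws)
  have w: "w \<in> set vs" using Cons.prems(1) by (metis list.set_intros(1) mset_eq_setD)
  then obtain as bs where vs: "vs = as @ w # bs" by (auto simp: in_set_conv_decomp)
  have V: "set vs \<subseteq> V" using Cons.prems by (metis mset_eq_setD)
  have ws: "mset ws = mset (as @ bs)" using Cons.prems(1) vs by simp
  have "D w (Ds ws f) \<omega> = D w (Ds (as @ bs) f) \<omega>"
    by (rule D_cong) (use Cons.IH[OF ws] Cons.prems in auto)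
  also have "\<dots> = Ds vs f \<omega>"
    unfolding vs using Ds_move[OF assms(1), of as w bs \<omega>] V Cons.prems vs by simp
  finally show ?case by simp
qed simp

lemma Ds_slot_linear:
  assumes f: "bounded_type f" and v: "v \<in> V" and w: "w \<in> V" and "set ws \<subseteq> V" "i < length ws" "\<omega> \<in> V"
  shows "Ds (ws[i := fcomb a v b w]) f \<omega> = a * Ds (ws[i := v]) f \<omega> + b * Ds (ws[i := w]) f \<omega>"
  using assms(4-6)
proof (induction ws arbitrary: i \<omega>)
  case (Cons u us)
  show ?case
  proof (cases i)
    case 0
    then show ?thesis using D_direction_linear[OF bounded_type_Ds[OF f] v w] Cons.prems by simp
  next
    case (Suc j)
    have b: "bounded_type (Ds (us[j := x]) f)" if "x \<in> V" for x
      using Cons.prems that set_update_subset_insert[of us j x] by (intro bounded_type_Ds f) auto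
    have "D u (Ds (us[j := fcomb a v b w]) f) \<omega>
        = D u (fcomb a (Ds (us[j := v]) f) b (Ds (us[j := w]) f)) \<omega>"
      by (rule D_cong) (use Cons Suc in \<open>auto simp: fcomb_def[of _ "Ds _ _"]\<close>)
    also have "\<dots> = fcomb a (D u (Ds (us[j := v]) f)) b (D u (Ds (us[j := w]) f)) \<omega>"
      by (rule D_fcomb) (use Cons.prems b v w in auto)
    finally show ?thesis using Suc by (simp add: fcomb_def)
  qed
qed simp

text \<open>Every derivative uses up a ball of radius \<open>s\<close>, so the values of \<open>f\<close> on a ball of radius
  \<open>n s\<close> enter. For \<open>n s\<close> equal to a given radius \<open>r\<close> this loses the factor \<open>n\<^sup>n / n!\<close> against
  Cauchy's formula for the diagonal, which is only geometric in \<open>n\<close>.\<close>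

lemma Ds_bound:
  assumes f: "bounded_type f" and s: "0 < s" and "set ws \<subseteq> V" "\<omega> \<in> V"
    and "\<And>\<zeta>. \<zeta> \<in> V \<Longrightarrow> N \<zeta> \<le> real (length ws) * s \<Longrightarrow> cmod (f (fcomb 1 \<omega> 1 \<zeta>)) \<le> c"
  shows "cmod (Ds ws f \<omega>) \<le> prod_list (map N ws) / s ^ length ws * c"
  using assms(3-5)
proof (induction ws arbitrary: \<omega>)
  case Nil
  have "N (\<lambda>x. 0) \<le> 0" using N_fcomb[OF V_zero V_zero, of 0 0] by (simp add: fcomb_def)
  then show ?case using Nil.prems(3)[OF V_zero] by (simp add: fcomb_def)
next
  case (Cons w ws)
  have "cmod (D w (Ds ws f) \<omega>) \<le> N w / s * (prod_list (map N ws) / s ^ length ws * c)"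
  proof (rule D_bound[OF bounded_type_Ds[OF f] _ _ s])
    fix \<zeta> assume \<zeta>: "\<zeta> \<in> V" "N \<zeta> \<le> s"
    show "cmod (Ds ws f (fcomb 1 \<omega> 1 \<zeta>)) \<le> prod_list (map N ws) / s ^ length ws * c"
    proof (rule Cons.IH)
      fix \<zeta>' assume \<zeta>': "\<zeta>' \<in> V" "N \<zeta>' \<le> real (length ws) * s"
      have "N (fcomb 1 \<zeta> 1 \<zeta>') \<le> real (length (w # ws)) * s"
        using N_fcomb[of \<zeta> \<zeta>' 1 1] \<zeta> \<zeta>' by (simp add: algebra_simps)
      then have "cmod (f (fcomb 1 \<omega> 1 (fcomb 1 \<zeta> 1 \<zeta>'))) \<le> c"
        by (intro Cons.prems V_fcomb \<zeta> \<zeta>')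
      then show "cmod (f (fcomb 1 (fcomb 1 \<omega> 1 \<zeta>) 1 \<zeta>')) \<le> c"
        by (simp add: fcomb_def add.assoc)
    qed (use Cons.prems \<zeta> V_fcomb in auto)
  qed (use Cons.prems in auto)
  then show ?case by simp
qed

lemma Ds_replicate:
  assumes f: "bounded_type f" and "\<omega> \<in> V" "w \<in> V"
  shows "Ds (replicate n w) f (fcomb 1 \<omega> t w) = (deriv ^^ n) (\<lambda>z. f (fcomb 1 \<omega> z w)) t"
proof (induction n arbitrary: t)
  case (Suc n)
  have "bounded_type (Ds (replicate n w) f)" by (rule bounded_type_Ds[OF f]) (use assms in auto)
  then have "D w (Ds (replicate n w) f) (fcomb 1 \<omega> t w) = deriv (\<lambda>z. Ds (replicate n w) f (fcomb 1 \<omega> z w)) t"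
    using D_deriv assms by (metis DERIV_imp_deriv)
  moreover have "(\<lambda>z. Ds (replicate n w) f (fcomb 1 \<omega> z w)) = (deriv ^^ n) (\<lambda>z. f (fcomb 1 \<omega> z w))"
    by (rule ext) (rule Suc)
  ultimately show ?case by (simp del: foldr_replicate)
qed simp

lemma Taylor_sums:
  assumes f: "bounded_type f" and \<omega>: "\<omega> \<in> V"
  shows "(\<lambda>n. Ds (replicate n \<omega>) f (\<lambda>x. 0) / fact n) sums f \<omega>"
proof -
  let ?g = "\<lambda>z. f (fcomb 1 (\<lambda>x. 0) z \<omega>)"
  have "?g holomorphic_on ball 0 2" using bounded_type_holo[OF f V_zero \<omega>] holomorphic_on_subset by blast
  then have "(\<lambda>n. (deriv ^^ n) ?g 0 / fact n * (1 - 0) ^ n) sums ?g 1"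
    by (rule holomorphic_power_series) simp
  moreover have "?g 1 = f \<omega>" by (simp add: fcomb_def)
  ultimately show ?thesis using Ds_replicate[OF f V_zero \<omega>, of _ 0] by simp
qed

text \<open>Cauchy's estimate on the circle of radius \<open>2\<close> in the line through \<open>0\<close> and \<open>\<omega>\<close>; any radius
  greater than \<open>1\<close> makes the Taylor series at \<open>\<omega>\<close> decay geometrically.\<close>

lemma Taylor_coefficient_bound:
  assumes f: "bounded_type f" and \<omega>: "\<omega> \<in> V"
    and M: "\<And>\<zeta>. \<zeta> \<in> V \<Longrightarrow> N \<zeta> \<le> 2 * N \<omega> \<Longrightarrow> cmod (f \<zeta>) \<le> M"
  shows "cmod (Ds (replicate n \<omega>) f (\<lambda>x. 0) / fact n) \<le> M / 2 ^ n"
proof -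
  let ?g = "\<lambda>z. f (fcomb 1 (\<lambda>x. 0) z \<omega>)"
  have h: "?g holomorphic_on UNIV" by (rule bounded_type_holo[OF f V_zero \<omega>])
  have N0: "N (\<lambda>x. 0) \<le> 0" using N_fcomb[OF V_zero V_zero, of 0 0] by (simp add: fcomb_def)
  have "cmod ((deriv ^^ n) ?g 0) \<le> fact n * M / 2 ^ n"
  proof (rule Cauchy_inequality)
    show "?g holomorphic_on ball 0 2" "continuous_on (cball 0 2) ?g"
      using h holomorphic_on_imp_continuous_on holomorphic_on_subset by blast+
    fix z :: complex assume "cmod (0 - z) = 2"
    then show "cmod (?g z) \<le> M"
      using N_line[OF V_zero \<omega>, of z "2 * N \<omega>"] N0 by (intro M V_fcomb V_zero \<omega>) simp_all
  qed simp
  then show ?thesis using Ds_replicate[OF f V_zero \<omega>, of n 0]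
    by (simp add: norm_divide field_simps)
qed

end

section \<open>Geometry of the complexified Hilbert spaces\<close>

locale hilbert_member =
  fixes R :: "('t, 'v::real_vector) hilbert_family" and \<tau> :: 't
  assumes hilbert: "real_separable_hilbert R \<tau>"
begin

lemma hspace_subspace: "subspace (hspace R \<tau>)"
  using hilbert by (simp add: real_separable_hilbert_def)

lemmas hspace_intros [simp, intro] =
  subspace_0[OF hspace_subspace] subspace_add[OF hspace_subspace] subspace_diff[OF hspace_subspace]
  subspace_scale[OF hspace_subspace]

lemma hinner_commute: "x \<in> hspace R \<tau> \<Longrightarrow> y \<in> hspace R \<tau> \<Longrightarrow> hinner R \<tau> x y = hinner R \<tau> y x"
  and hinner_add_left: "x \<in> hspace R \<tau> \<Longrightarrow> y \<in> hspace R \<tau> \<Longrightarrow> z \<in> hspace R \<tau> \<Longrightarrow>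
      hinner R \<tau> (x + y) z = hinner R \<tau> x z + hinner R \<tau> y z"
  and hinner_scale_left: "x \<in> hspace R \<tau> \<Longrightarrow> y \<in> hspace R \<tau> \<Longrightarrow> hinner R \<tau> (c *\<^sub>R x) y = c * hinner R \<tau> x y"
  and hinner_nonneg: "x \<in> hspace R \<tau> \<Longrightarrow> 0 \<le> hinner R \<tau> x x"
  and hinner_definite: "x \<in> hspace R \<tau> \<Longrightarrow> hinner R \<tau> x x = 0 \<Longrightarrow> x = 0"
  using hilbert by (auto simp: real_separable_hilbert_def)

lemma hinner_diff_left: "x \<in> hspace R \<tau> \<Longrightarrow> y \<in> hspace R \<tau> \<Longrightarrow> z \<in> hspace R \<tau> \<Longrightarrow>
      hinner R \<tau> (x - y) z = hinner R \<tau> x z - hinner R \<tau> y z"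
  using hinner_add_left[of "x - y" y z] by simp

lemma hinner_add_right: "x \<in> hspace R \<tau> \<Longrightarrow> y \<in> hspace R \<tau> \<Longrightarrow> z \<in> hspace R \<tau> \<Longrightarrow>
      hinner R \<tau> z (x + y) = hinner R \<tau> z x + hinner R \<tau> z y"
  and hinner_scale_right: "x \<in> hspace R \<tau> \<Longrightarrow> y \<in> hspace R \<tau> \<Longrightarrow> hinner R \<tau> y (c *\<^sub>R x) = c * hinner R \<tau> y x"
  and hinner_diff_right: "x \<in> hspace R \<tau> \<Longrightarrow> y \<in> hspace R \<tau> \<Longrightarrow> z \<in> hspace R \<tau> \<Longrightarrow>
      hinner R \<tau> z (x - y) = hinner R \<tau> z x - hinner R \<tau> z y"
  by (simp_all add: hinner_commute[of z] hinner_commute[of y "c *\<^sub>R x"] hinner_commute[of y x]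
      hinner_add_left hinner_scale_left hinner_diff_left)

lemma hinner_zero [simp]: "x \<in> hspace R \<tau> \<Longrightarrow> hinner R \<tau> 0 x = 0" "x \<in> hspace R \<tau> \<Longrightarrow> hinner R \<tau> x 0 = 0"
  using hinner_scale_left[of x x 0] hinner_scale_right[of x x 0] by simp_all

lemmas hinner_simps = hinner_add_left hinner_add_right hinner_diff_left hinner_diff_right
  hinner_scale_left hinner_scale_right

lemma cscale_in [simp, intro]: "z \<in> cspace R \<tau> \<Longrightarrow> cscale c z \<in> cspace R \<tau>"
  by (auto simp: cspace_def cscale_def)

lemma cspace_add [simp, intro]: "z \<in> cspace R \<tau> \<Longrightarrow> w \<in> cspace R \<tau> \<Longrightarrow> z + w \<in> cspace R \<tau>"
  and cspace_zero [simp, intro]: "0 \<in> cspace R \<tau>"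
  by (auto simp: cspace_def zero_prod_def)

lemma ccomb_in [simp, intro]: "z \<in> cspace R \<tau> \<Longrightarrow> w \<in> cspace R \<tau> \<Longrightarrow> ccomb a z b w \<in> cspace R \<tau>"
  by (simp add: ccomb_def)

lemma cspace_sum [intro]: "(\<And>i. i \<in> I \<Longrightarrow> f i \<in> cspace R \<tau>) \<Longrightarrow> sum f I \<in> cspace R \<tau>"
  by (induction I rule: infinite_finite_induct) auto

lemma cinner_add_left: "x \<in> cspace R \<tau> \<Longrightarrow> y \<in> cspace R \<tau> \<Longrightarrow> z \<in> cspace R \<tau> \<Longrightarrow>
      cinner R \<tau> (x + y) z = cinner R \<tau> x z + cinner R \<tau> y z"
  and cinner_scale_left: "x \<in> cspace R \<tau> \<Longrightarrow> z \<in> cspace R \<tau> \<Longrightarrow> cinner R \<tau> (cscale c x) z = c * cinner R \<tau> x z"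
  and cinner_commute: "x \<in> cspace R \<tau> \<Longrightarrow> y \<in> cspace R \<tau> \<Longrightarrow> cinner R \<tau> y x = cnj (cinner R \<tau> x y)"
  by (auto simp: cspace_def cinner_def cscale_def complex_eq_iff hinner_simps algebra_simps hinner_commute)

lemma cinner_add_right: "x \<in> cspace R \<tau> \<Longrightarrow> y \<in> cspace R \<tau> \<Longrightarrow> z \<in> cspace R \<tau> \<Longrightarrow>
      cinner R \<tau> z (x + y) = cinner R \<tau> z x + cinner R \<tau> z y"
  and cinner_scale_right: "x \<in> cspace R \<tau> \<Longrightarrow> z \<in> cspace R \<tau> \<Longrightarrow> cinner R \<tau> z (cscale c x) = cnj c * cinner R \<tau> z x"
  using cinner_commute[of "x + y" z] cinner_commute[of x z] cinner_commute[of y z] cinner_commute[of "cscale c x" z]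
  by (simp_all add: cinner_add_left cinner_scale_left)

lemma cinner_zero_left [simp]: "z \<in> cspace R \<tau> \<Longrightarrow> cinner R \<tau> 0 z = 0"
  using cinner_scale_left[of z z 0] by (simp add: cscale_def zero_prod_def)

lemma cinner_ccomb: "x \<in> cspace R \<tau> \<Longrightarrow> y \<in> cspace R \<tau> \<Longrightarrow> z \<in> cspace R \<tau> \<Longrightarrow>
      cinner R \<tau> (ccomb a x b y) z = a * cinner R \<tau> x z + b * cinner R \<tau> y z"
  by (simp add: ccomb_def cinner_add_left cinner_scale_left)

lemma cinner_sum_left: "z \<in> cspace R \<tau> \<Longrightarrow> (\<And>i. i \<in> I \<Longrightarrow> f i \<in> cspace R \<tau>) \<Longrightarrow>
      cinner R \<tau> (sum f I) z = (\<Sum>i\<in>I. cinner R \<tau> (f i) z)"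
  by (induction I rule: infinite_finite_induct) (auto simp: cinner_add_left cspace_sum)

lemma cinner_self: "x \<in> cspace R \<tau> \<Longrightarrow> cinner R \<tau> x x = of_real ((cnorm R \<tau> x)\<^sup>2)"
  by (auto simp: cspace_def cinner_def cnorm_def complex_eq_iff hinner_commute hinner_nonneg)

lemma cnorm_nonneg: "x \<in> cspace R \<tau> \<Longrightarrow> 0 \<le> cnorm R \<tau> x"
  by (auto simp: cspace_def cnorm_def cinner_def hinner_nonneg)

lemma cnorm_zero [simp]: "cnorm R \<tau> 0 = 0"
  by (simp add: cnorm_def)

lemma cnorm_scale: "x \<in> cspace R \<tau> \<Longrightarrow> cnorm R \<tau> (cscale c x) = cmod c * cnorm R \<tau> x"
proof -
  assume x: "x \<in> cspace R \<tau>"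
  have "complex_of_real ((cnorm R \<tau> (cscale c x))\<^sup>2) = cinner R \<tau> (cscale c x) (cscale c x)"
    using x by (intro cinner_self[symmetric]) simp
  also have "\<dots> = (c * cnj c) * cinner R \<tau> x x"
    using x by (simp add: cinner_scale_left cinner_scale_right)
  also have "\<dots> = of_real ((cmod c * cnorm R \<tau> x)\<^sup>2)"
    using x by (simp only: cinner_self complex_norm_square[symmetric] of_real_mult[symmetric] power_mult_distrib)
  finally have "complex_of_real ((cnorm R \<tau> (cscale c x))\<^sup>2) = of_real ((cmod c * cnorm R \<tau> x)\<^sup>2)" .
  then have "(cnorm R \<tau> (cscale c x))\<^sup>2 = (cmod c * cnorm R \<tau> x)\<^sup>2" by (simp only: of_real_eq_iff)
  then show ?thesis using x cnorm_nonneg by (simp add: power2_eq_iff_nonneg)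
qed

lemma cnorm_definite: "x \<in> cspace R \<tau> \<Longrightarrow> cnorm R \<tau> x = 0 \<Longrightarrow> x = 0"
  by (auto simp: cspace_def cnorm_def cinner_def zero_prod_def intro!: hinner_definite)
     (metis add_nonneg_eq_0_iff hinner_nonneg hinner_definite)+

lemma cnorm_diff_square:
  assumes x: "x \<in> cspace R \<tau>" and y: "y \<in> cspace R \<tau>"
  shows "(cnorm R \<tau> (x + cscale (-1) y))\<^sup>2 = (cnorm R \<tau> x)\<^sup>2 - 2 * Re (cinner R \<tau> x y) + (cnorm R \<tau> y)\<^sup>2"
proof -
  have "complex_of_real ((cnorm R \<tau> (x + cscale (-1) y))\<^sup>2) = cinner R \<tau> (x + cscale (-1) y) (x + cscale (-1) y)"
    using x y by (intro cinner_self[symmetric]) simp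
  also have "\<dots> = cinner R \<tau> x x - cinner R \<tau> x y - cnj (cinner R \<tau> x y) + cinner R \<tau> y y"
    using x y cinner_commute[OF x y]
    by (simp add: cinner_add_left cinner_add_right cinner_scale_left cinner_scale_right)
  finally have "complex_of_real ((cnorm R \<tau> (x + cscale (-1) y))\<^sup>2) =
      of_real ((cnorm R \<tau> x)\<^sup>2) - cinner R \<tau> x y - cnj (cinner R \<tau> x y) + of_real ((cnorm R \<tau> y)\<^sup>2)"
    by (simp only: cinner_self[OF x] cinner_self[OF y])
  then have "Re (complex_of_real ((cnorm R \<tau> (x + cscale (-1) y))\<^sup>2)) =
      Re (of_real ((cnorm R \<tau> x)\<^sup>2) - cinner R \<tau> x y - cnj (cinner R \<tau> x y) + of_real ((cnorm R \<tau> y)\<^sup>2))"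
    by (simp only:)
  then show ?thesis by simp
qed

lemma cauchy_schwarz:
  assumes x: "x \<in> cspace R \<tau>" and y: "y \<in> cspace R \<tau>"
  shows "cmod (cinner R \<tau> x y) \<le> cnorm R \<tau> x * cnorm R \<tau> y"
proof (cases "cnorm R \<tau> y = 0")
  case True
  then have "y = 0" using y cnorm_definite by blast
  then have "cinner R \<tau> x y = 0" using cinner_commute[of x 0] x by simp
  then show ?thesis using True by simp
next
  case False
  let ?n = "cnorm R \<tau> y" and ?c = "cinner R \<tau> x y"
  define t where "t = ?c / of_real (?n\<^sup>2)"
  have "0 \<le> (cnorm R \<tau> (x + cscale (-1) (cscale t y)))\<^sup>2" by simp
  also have "\<dots> = (cnorm R \<tau> x)\<^sup>2 - 2 * Re (cnj t * ?c) + (cmod t * ?n)\<^sup>2"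
    using x y by (subst cnorm_diff_square) (auto simp: cinner_scale_right cnorm_scale)
  also have "cnj t * ?c = of_real ((cmod ?c)\<^sup>2 / ?n\<^sup>2)"
    using complex_norm_square[of ?c] by (simp add: t_def mult.commute)
  also have "(cmod t * ?n)\<^sup>2 = (cmod ?c)\<^sup>2 / ?n\<^sup>2"
  proof -
    have "cmod t = cmod ?c / ?n\<^sup>2" unfolding t_def norm_divide norm_of_real by simp
    then show ?thesis using False by (simp add: field_simps power2_eq_square)
  qed
  finally have "(cmod ?c)\<^sup>2 / ?n\<^sup>2 \<le> (cnorm R \<tau> x)\<^sup>2" by simp
  then have "(cmod ?c)\<^sup>2 \<le> (cnorm R \<tau> x * ?n)\<^sup>2"
    using False by (simp add: divide_le_eq power_mult_distrib)
  then show ?thesis using cnorm_nonneg x y by (simp add: power2_le_iff_abs_le)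
qed

lemma cnorm_add:
  assumes x: "x \<in> cspace R \<tau>" and y: "y \<in> cspace R \<tau>"
  shows "cnorm R \<tau> (x + y) \<le> cnorm R \<tau> x + cnorm R \<tau> y"
proof -
  have y2: "y = cscale (-1) (cscale (-1) y)" by (simp add: cscale_def)
  have "(cnorm R \<tau> (x + y))\<^sup>2 = (cnorm R \<tau> x)\<^sup>2 + 2 * Re (cinner R \<tau> x y) + (cnorm R \<tau> y)\<^sup>2"
    using cnorm_diff_square[OF x cscale_in[OF y, of "-1"]] x y
    by (simp add: y2[symmetric] cinner_scale_right cnorm_scale)
  also have "\<dots> \<le> (cnorm R \<tau> x + cnorm R \<tau> y)\<^sup>2"
    using cauchy_schwarz[OF x y] complex_Re_le_cmod[of "cinner R \<tau> x y"] by (simp add: power2_sum)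
  finally show ?thesis using x y cnorm_nonneg by (auto intro: power2_le_imp_le)
qed

lemma cnorm_ccomb:
  "x \<in> cspace R \<tau> \<Longrightarrow> y \<in> cspace R \<tau> \<Longrightarrow> cnorm R \<tau> (ccomb a x b y) \<le> cmod a * cnorm R \<tau> x + cmod b * cnorm R \<tau> y"
  using cnorm_add[of "cscale a x" "cscale b y"] by (simp add: ccomb_def cnorm_scale)

lemma cnorm_orthonormal_sum:
  assumes "finite E" "corthonormal R \<tau> E"
  shows "(cnorm R \<tau> (\<Sum>e\<in>E. cscale (c e) e))\<^sup>2 = (\<Sum>e\<in>E. (cmod (c e))\<^sup>2)"
proof -
  have E: "e \<in> cspace R \<tau>" if "e \<in> E" for e using assms that by (auto simp: corthonormal_def)
  have s: "(\<Sum>e\<in>E. cscale (c e) e) \<in> cspace R \<tau>" using E by (intro cspace_sum) auto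
  have 1: "cinner R \<tau> e (\<Sum>e\<in>E. cscale (c e) e) = cnj (c e)" if e: "e \<in> E" for e
  proof -
    have "cinner R \<tau> (\<Sum>e\<in>E. cscale (c e) e) e = (\<Sum>f\<in>E. c f * (if f = e then 1 else 0))"
      using E e assms by (subst cinner_sum_left) (auto simp: cinner_scale_left corthonormal_def intro!: sum.cong)
    also have "\<dots> = c e" using e assms(1) by (simp add: mult_delta_right)
    finally show ?thesis using cinner_commute[OF s E[OF e]] by simp
  qed
  have "complex_of_real ((cnorm R \<tau> (\<Sum>e\<in>E. cscale (c e) e))\<^sup>2)
      = cinner R \<tau> (\<Sum>e\<in>E. cscale (c e) e) (\<Sum>e\<in>E. cscale (c e) e)" using s by (simp add: cinner_self)
  also have "\<dots> = (\<Sum>e\<in>E. c e * cinner R \<tau> e (\<Sum>e\<in>E. cscale (c e) e))"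
    using E s by (subst cinner_sum_left) (auto simp: cinner_scale_left)
  also have "\<dots> = of_real (\<Sum>e\<in>E. (cmod (c e))\<^sup>2)"
    unfolding of_real_sum complex_norm_square by (rule sum.cong) (simp_all only: 1)
  finally show ?thesis by (simp only: of_real_eq_iff)
qed

lemma bessel:
  assumes E: "finite E" "corthonormal R \<tau> E" and x: "x \<in> cspace R \<tau>"
  shows "(\<Sum>e\<in>E. (cmod (cinner R \<tau> x e))\<^sup>2) \<le> (cnorm R \<tau> x)\<^sup>2"
proof -
  let ?y = "\<Sum>e\<in>E. cscale (cinner R \<tau> x e) e"
  have e: "e \<in> cspace R \<tau>" if "e \<in> E" for e using assms that by (auto simp: corthonormal_def)
  have y: "?y \<in> cspace R \<tau>" using e by (intro cspace_sum) auto
  have "cinner R \<tau> x ?y = cnj (\<Sum>e\<in>E. cinner R \<tau> (cscale (cinner R \<tau> x e) e) x)"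
    using cinner_commute[OF y x] e x by (subst (asm) cinner_sum_left) auto
  also have "\<dots> = cnj (\<Sum>e\<in>E. cinner R \<tau> x e * cnj (cinner R \<tau> x e))"
    using e x by (simp add: cinner_scale_left cinner_commute[OF x, symmetric])
  also have "\<dots> = of_real (\<Sum>e\<in>E. (cmod (cinner R \<tau> x e))\<^sup>2)"
    by (simp only: complex_norm_square[symmetric] of_real_sum[symmetric] complex_cnj_complex_of_real)
  finally have 1: "Re (cinner R \<tau> x ?y) = (\<Sum>e\<in>E. (cmod (cinner R \<tau> x e))\<^sup>2)" by simp
  have "0 \<le> (cnorm R \<tau> (x + cscale (-1) ?y))\<^sup>2" by simp
  also have "\<dots> = (cnorm R \<tau> x)\<^sup>2 - (\<Sum>e\<in>E. (cmod (cinner R \<tau> x e))\<^sup>2)"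
    by (subst cnorm_diff_square[OF x y]) (simp add: 1 cnorm_orthonormal_sum[OF E])
  finally show ?thesis by simp
qed

lemma hnorm_cnorm: "x \<in> hspace R \<tau> \<Longrightarrow> hnorm R \<tau> x = cnorm R \<tau> (x, 0)"
  by (simp add: hnorm_def cnorm_def cinner_def)

lemma cspace_real [simp]: "x \<in> hspace R \<tau> \<Longrightarrow> (x, 0) \<in> cspace R \<tau>"
  by (simp add: cspace_def)

lemma cnorm_le_hnorm: "(x, y) \<in> cspace R \<tau> \<Longrightarrow> cnorm R \<tau> (x, y) \<le> hnorm R \<tau> x + hnorm R \<tau> y"
  using sqrt_sum_squares_le_sum[of "hnorm R \<tau> x" "hnorm R \<tau> y"]
  by (auto simp: cnorm_def hnorm_def cinner_def cspace_def hinner_nonneg)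

lemma hnorm_square: "x \<in> hspace R \<tau> \<Longrightarrow> (hnorm R \<tau> x)\<^sup>2 = hinner R \<tau> x x"
  by (simp add: hnorm_def hinner_nonneg)

lemma hnorm_nonneg: "x \<in> hspace R \<tau> \<Longrightarrow> 0 \<le> hnorm R \<tau> x"
  by (simp add: hnorm_def hinner_nonneg)

lemma hinner_cauchy_schwarz:
  "x \<in> hspace R \<tau> \<Longrightarrow> y \<in> hspace R \<tau> \<Longrightarrow> \<bar>hinner R \<tau> x y\<bar> \<le> hnorm R \<tau> x * hnorm R \<tau> y"
  using cauchy_schwarz[of "(x, 0)" "(y, 0)"] by (simp add: hnorm_cnorm) (simp add: cinner_def cmod_def)

lemma hnorm_triangle: "x \<in> hspace R \<tau> \<Longrightarrow> y \<in> hspace R \<tau> \<Longrightarrow> hnorm R \<tau> (x + y) \<le> hnorm R \<tau> x + hnorm R \<tau> y"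
  using cnorm_add[of "(x, 0)" "(y, 0)"] by (simp add: hnorm_cnorm)

lemma hnorm_minus_commute:
  "x \<in> hspace R \<tau> \<Longrightarrow> y \<in> hspace R \<tau> \<Longrightarrow> hnorm R \<tau> (x - y) = hnorm R \<tau> (y - x)"
  by (simp add: hnorm_def hinner_simps)

sublocale hmetric: Metric_space "hspace R \<tau>" "hdist R \<tau>"
proof
  show "hdist R \<tau> x y = 0 \<longleftrightarrow> x = y" if "x \<in> hspace R \<tau>" "y \<in> hspace R \<tau>" for x y
    using that hinner_definite[of "x - y"] by (auto simp: hdist_def hnorm_def)
  show "hdist R \<tau> x z \<le> hdist R \<tau> x y + hdist R \<tau> y z"
    if "x \<in> hspace R \<tau>" "y \<in> hspace R \<tau>" "z \<in> hspace R \<tau>" for x y z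
    using that hnorm_triangle[of "x - y" "y - z"] by (simp add: hdist_def)
qed (auto simp: hdist_def hnorm_nonneg hnorm_minus_commute)

lemma cauchy_converges:
  assumes x: "\<And>n. x n \<in> hspace R \<tau>"
    and cauchy: "\<And>e. 0 < e \<Longrightarrow> \<exists>n0. \<forall>m\<ge>n0. \<forall>n\<ge>n0. hnorm R \<tau> (x m - x n) < e"
  obtains y where "y \<in> hspace R \<tau>" "(\<lambda>n. hnorm R \<tau> (x n - y)) \<longlonglongrightarrow> 0"
proof -
  have "hmetric.MCauchy x"
    unfolding hmetric.MCauchy_def using x cauchy by (auto simp: hdist_def)
  then obtain y where "limitin hmetric.mtopology x y sequentially"
    using hilbert by (auto simp: real_separable_hilbert_def hmetric.mcomplete_def)
  then have y: "y \<in> hspace R \<tau>" and l: "\<And>e. 0 < e \<Longrightarrow> \<forall>\<^sub>F n in sequentially. hdist R \<tau> (x n) y < e"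
    unfolding hmetric.limitin_metric by (auto elim: eventually_mono)
  have "(\<lambda>n. hnorm R \<tau> (x n - y)) \<longlonglongrightarrow> 0"
    unfolding tendsto_iff using l x y by (auto simp: hdist_def hnorm_nonneg)
  then show ?thesis using y that by blast
qed

lemma closure_approx:
  assumes "x \<in> htopology R \<tau> closure_of S" "0 < e"
  obtains y where "y \<in> S" "y \<in> hspace R \<tau>" "hnorm R \<tau> (x - y) < e" "x \<in> hspace R \<tau>"
  using assms unfolding htopology_def hmetric.metric_closure_of
  by (auto simp: hmetric.mball_def hdist_def)

text \<open>The energy \<open>\<parallel>x\<parallel>\<^sup>2 - 2 F x\<close> is bounded below on \<open>S\<close>; by the parallelogram law a minimizing
  sequence is Cauchy, and its limit represents \<open>F\<close>. The limit is taken in the whole space, of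
  which \<open>S\<close> will be the dense subspace of real test vectors.\<close>

lemma riesz_real:
  assumes S: "subspace S" "S \<subseteq> hspace R \<tau>"
    and add: "\<And>x y. x \<in> S \<Longrightarrow> y \<in> S \<Longrightarrow> F (x + y) = F x + F y"
    and scale: "\<And>c x. x \<in> S \<Longrightarrow> F (c *\<^sub>R x) = c * F x"
    and bound: "\<And>x. x \<in> S \<Longrightarrow> \<bar>F x\<bar> \<le> K * hnorm R \<tau> x"
  obtains e where "e \<in> hspace R \<tau>" "\<And>x. x \<in> S \<Longrightarrow> F x = hinner R \<tau> x e"
proof -
  define J where "J = (\<lambda>x. hinner R \<tau> x x - 2 * F x)"
  have SH: "x \<in> hspace R \<tau>" if "x \<in> S" for x using S that by blast
  have Jlow: "- K\<^sup>2 \<le> J x" if x: "x \<in> S" for x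
  proof -
    have "0 \<le> (hnorm R \<tau> x - K)\<^sup>2" by simp
    then have "- K\<^sup>2 \<le> hinner R \<tau> x x - 2 * (K * hnorm R \<tau> x)"
      using hnorm_square[OF SH[OF x]] by (simp add: power2_diff algebra_simps)
    then show ?thesis using bound[OF x] unfolding J_def by linarith
  qed
  define m where "m = Inf (J ` S)"
  have bdd: "bdd_below (J ` S)" using Jlow by (auto intro!: bdd_belowI)
  have mle: "m \<le> J x" if "x \<in> S" for x
    unfolding m_def using that bdd by (auto intro: cInf_lower)
  have "\<exists>x\<in>S. J x < m + inverse (real (Suc n))" for n
  proof -
    have "J ` S \<noteq> {}" using subspace_0[OF S(1)] by blast
    then have "\<exists>y\<in>J ` S. y < m + inverse (real (Suc n))"
      unfolding m_def by (intro cInf_lessD) auto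
    then show ?thesis by blast
  qed
  then obtain x where x: "\<And>n. x n \<in> S" "\<And>n. J (x n) < m + inverse (real (Suc n))" by metis
  have par: "(hnorm R \<tau> (u - v))\<^sup>2 = 2 * J u + 2 * J v - 4 * J ((1/2) *\<^sub>R (u + v))" if "u \<in> S" "v \<in> S" for u v
    using that SH S unfolding J_def
    using hinner_commute[OF SH[OF that(2)] SH[OF that(1)]]
    by (simp add: hnorm_square hinner_simps scale add subspace_add) (simp add: field_simps)
  have d: "(hnorm R \<tau> (x i - x j))\<^sup>2 \<le> 2 * inverse (real (Suc i)) + 2 * inverse (real (Suc j))" for i j
    using par[OF x(1) x(1), of i j] mle[of "(1/2) *\<^sub>R (x i + x j)"] x(2)[of i] x(2)[of j] x(1) S
    by (simp add: subspace_add subspace_scale)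
  obtain e where e: "e \<in> hspace R \<tau>" "(\<lambda>n. hnorm R \<tau> (x n - e)) \<longlonglongrightarrow> 0"
  proof (rule cauchy_converges[of x])
    fix \<epsilon> :: real assume \<epsilon>: "0 < \<epsilon>"
    then obtain n0 where n0: "inverse (real (Suc n0)) < \<epsilon>\<^sup>2 / 4"
      using reals_Archimedean[of "\<epsilon>\<^sup>2 / 4"] by auto
    have "hnorm R \<tau> (x i - x j) < \<epsilon>" if "n0 \<le> i" "n0 \<le> j" for i j
    proof -
      have "inverse (real (Suc i)) \<le> inverse (real (Suc n0))" "inverse (real (Suc j)) \<le> inverse (real (Suc n0))"
        using that by (simp_all add: le_imp_inverse_le)
      then have "(hnorm R \<tau> (x i - x j))\<^sup>2 < \<epsilon>\<^sup>2" using d[of i j] n0 by linarith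
      then show ?thesis using \<epsilon> by (meson less_eq_real_def power2_less_imp_less)
    qed
    then show "\<exists>n0. \<forall>m\<ge>n0. \<forall>n\<ge>n0. hnorm R \<tau> (x m - x n) < \<epsilon>" by blast
  qed (use x SH in auto)
  have "F h = hinner R \<tau> h e" if h: "h \<in> S" for h
  proof -
    define q where "q = hinner R \<tau> h h"
    define c where "c = hinner R \<tau> e h - F h"
    have q: "0 \<le> q" unfolding q_def using h SH hinner_nonneg by blast
    have lim: "(\<lambda>n. hinner R \<tau> (x n) h) \<longlonglongrightarrow> hinner R \<tau> e h"
    proof (rule LIM_zero_cancel, rule tendsto_0_le[where K = 1])
      show "(\<lambda>n. hnorm R \<tau> (x n - e) * hnorm R \<tau> h) \<longlonglongrightarrow> 0" using e by (auto intro: tendsto_eq_intros)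
      show "\<forall>\<^sub>F n in sequentially. norm (hinner R \<tau> (x n) h - hinner R \<tau> e h) \<le> norm (hnorm R \<tau> (x n - e) * hnorm R \<tau> h) * 1"
        using hinner_cauchy_schwarz[of "x _ - e" h] x e h SH
        by (intro always_eventually) (auto simp: hinner_diff_left intro: order_trans[OF _ abs_ge_self])
    qed
    \<comment> \<open>The energy at \<open>x n + t h\<close> is at least the infimum \<open>m\<close>, for every \<open>t\<close>; so the linear
      coefficient \<open>c\<close> must vanish.\<close>
    have "0 \<le> 2 * t * c + t\<^sup>2 * q" for t
    proof (rule LIMSEQ_le)
      show "(\<lambda>n. - inverse (real (Suc n))) \<longlonglongrightarrow> 0" using tendsto_minus[OF LIMSEQ_inverse_real_of_nat] by simp
      show "(\<lambda>n. 2 * t * (hinner R \<tau> (x n) h - F h) + t\<^sup>2 * q) \<longlonglongrightarrow> 2 * t * c + t\<^sup>2 * q"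
        unfolding c_def by (intro tendsto_intros lim)
      show "\<exists>N. \<forall>n\<ge>N. - inverse (real (Suc n)) \<le> 2 * t * (hinner R \<tau> (x n) h - F h) + t\<^sup>2 * q"
      proof (intro exI allI impI)
        fix n
        have "J (x n + t *\<^sub>R h) = J (x n) + (2 * t * (hinner R \<tau> (x n) h - F h) + t\<^sup>2 * q)"
          using x(1)[of n] h SH S hinner_commute[OF SH[OF h] SH[OF x(1)], of n] unfolding J_def q_def
          by (simp add: hinner_simps add scale subspace_scale) (simp add: algebra_simps power2_eq_square)
        moreover have "m \<le> J (x n + t *\<^sub>R h)" using x h S by (intro mle) (simp add: subspace_add subspace_scale)
        ultimately show "- inverse (real (Suc n)) \<le> 2 * t * (hinner R \<tau> (x n) h - F h) + t\<^sup>2 * q"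
          using x(2)[of n] by linarith
      qed
    qed
    note quadratic = this
    define d where "d = c / (q + 1)"
    have c: "c = d * (q + 1)" using q by (simp add: d_def)
    have "0 \<le> 2 * (- d) * c + (- d)\<^sup>2 * q" by (rule quadratic)
    then have "d\<^sup>2 * (q + 2) \<le> 0" by (simp add: c power2_eq_square algebra_simps)
    then have "d = 0" using q by (simp add: mult_le_0_iff)
    then have "c = 0" using c by simp
    then show ?thesis using e h SH by (simp add: c_def hinner_commute)
  qed
  then show ?thesis using e(1) that by blast
qed

end

section \<open>Dual norms\<close>

text \<open>The operation \<open>lc\<close> enters only through multiples \<open>lc c x 0 x\<close>, so that the lemma applies to
  vectors as well as to tensors. If \<open>N x = 0\<close>, then \<open>F x = 0\<close> by boundedness.\<close>

lemma dual_norm_bound: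
  assumes F: "F \<in> dual_of V lc N" and x: "x \<in> V"
    and lc: "\<And>c x. x \<in> V \<Longrightarrow> lc c x 0 x \<in> V"
    and scale: "\<And>c x. x \<in> V \<Longrightarrow> N (lc c x 0 x) = cmod c * N x"
    and nonneg: "\<And>x. x \<in> V \<Longrightarrow> 0 \<le> N x"
  shows "cmod (F x) \<le> dual_norm V N F * N x"
proof -
  obtain K where K: "\<And>x. x \<in> V \<Longrightarrow> cmod (F x) \<le> K * N x" using F unfolding dual_of_def by blast
  show ?thesis
  proof (cases "N x = 0")
    case True
    then show ?thesis using K[OF x] by simp
  next
    case False
    then have pos: "0 < N x" using nonneg[OF x] by simp
    let ?c = "complex_of_real (1 / N x)"
    have "bdd_above ((\<lambda>x. cmod (F x)) ` {x \<in> V. N x \<le> 1})"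
    proof (intro bdd_aboveI2)
      fix y assume y: "y \<in> {x \<in> V. N x \<le> 1}"
      then have "cmod (F y) \<le> K * N y" using K by blast
      also have "\<dots> \<le> \<bar>K\<bar> * 1" using y nonneg by (intro mult_mono) auto
      finally show "cmod (F y) \<le> \<bar>K\<bar> * 1" .
    qed
    then have "cmod (F (lc ?c x 0 x)) \<le> dual_norm V N F"
      unfolding dual_norm_def using x lc scale pos
      by (intro cSUP_upper) (auto simp: norm_divide)
    moreover have "F (lc ?c x 0 x) = ?c * F x" using F x by (auto simp: dual_of_def)
    ultimately show ?thesis using pos by (simp add: norm_mult norm_divide divide_le_eq)
  qed
qed

lemma dual_norm_least:
  assumes "x0 \<in> V" "N x0 \<le> 1" "0 \<le> M" and M: "\<And>x. x \<in> V \<Longrightarrow> cmod (F x) \<le> M * N x"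
  shows "dual_norm V N F \<le> M"
  unfolding dual_norm_def
proof (rule cSUP_least)
  fix x assume x: "x \<in> {x \<in> V. N x \<le> 1}"
  then have "cmod (F x) \<le> M * N x" using M by blast
  also have "\<dots> \<le> M" using x assms(3) by (simp add: mult_left_le)
  finally show "cmod (F x) \<le> M" .
next
  show "{x \<in> V. N x \<le> 1} \<noteq> {}" using assms(1,2) by blast
qed

section \<open>The dual space of the nuclear space\<close>

locale nuclear_family =
  fixes R :: "('t, 'v::real_vector) hilbert_family"
  assumes nuclear: "nuclear_hilbert_family R"
begin

lemma nuclear_facts:
  "\<forall>\<tau>\<in>indices R. real_separable_hilbert R \<tau>"
  "\<forall>\<tau>1\<in>indices R. \<forall>\<tau>2\<in>indices R. \<exists>\<tau>3\<in>indices R.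
      continuously_embedded R \<tau>3 \<tau>1 \<and> continuously_embedded R \<tau>3 \<tau>2"
  "\<forall>\<tau>1\<in>indices R. \<exists>\<tau>2\<in>indices R. hilbert_schmidt_embedded R \<tau>2 \<tau>1"
  "\<forall>\<tau>\<in>indices R. htopology R \<tau> closure_of (\<Inter>\<sigma>\<in>indices R. hspace R \<sigma>) = hspace R \<tau>"
  "center R \<in> indices R"
proof -
  note * = nuclear[unfolded nuclear_hilbert_family_def]
  note ** = conjunct2[OF conjunct2[OF *]]
  show "\<forall>\<tau>\<in>indices R. real_separable_hilbert R \<tau>" by (rule conjunct1[OF *])
  show "\<forall>\<tau>1\<in>indices R. \<forall>\<tau>2\<in>indices R. \<exists>\<tau>3\<in>indices R.
      continuously_embedded R \<tau>3 \<tau>1 \<and> continuously_embedded R \<tau>3 \<tau>2"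
    by (rule conjunct1[OF conjunct2[OF *]])
  show "\<forall>\<tau>1\<in>indices R. \<exists>\<tau>2\<in>indices R. hilbert_schmidt_embedded R \<tau>2 \<tau>1"
    by (rule conjunct1[OF **])
  show "\<forall>\<tau>\<in>indices R. htopology R \<tau> closure_of (\<Inter>\<sigma>\<in>indices R. hspace R \<sigma>) = hspace R \<tau>"
    by (rule conjunct1[OF conjunct2[OF **]])
  show "center R \<in> indices R"
    by (rule conjunct1[OF conjunct2[OF conjunct2[OF **]]])
qed

lemma member: "\<tau> \<in> indices R \<Longrightarrow> hilbert_member R \<tau>"
  using nuclear_facts(1) by (simp add: hilbert_member_def)

lemma center: "center R \<in> indices R"
  by (rule nuclear_facts(5))

definition PhiR :: "'v set" where "PhiR = (\<Inter>\<sigma>\<in>indices R. hspace R \<sigma>)"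

lemma Phi_iff: "(x, y) \<in> Phi R \<longleftrightarrow> x \<in> PhiR \<and> y \<in> PhiR"
  by (auto simp: Phi_def PhiR_def cspace_def)

lemma Phi_cspace: "\<tau> \<in> indices R \<Longrightarrow> z \<in> Phi R \<Longrightarrow> z \<in> cspace R \<tau>"
  by (auto simp: Phi_def)

lemma PhiR_hspace: "\<tau> \<in> indices R \<Longrightarrow> x \<in> PhiR \<Longrightarrow> x \<in> hspace R \<tau>"
  by (auto simp: PhiR_def)

lemma PhiR_subspace: "subspace PhiR"
  unfolding PhiR_def by (rule subspace_Inter) (auto intro!: hilbert_member.hspace_subspace[OF member])

lemma Phi_ccomb: "z \<in> Phi R \<Longrightarrow> w \<in> Phi R \<Longrightarrow> ccomb a z b w \<in> Phi R"
  unfolding Phi_def by (auto intro!: hilbert_member.ccomb_in[OF member])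

lemma Phi_zero: "0 \<in> Phi R"
  unfolding Phi_def by (auto intro!: hilbert_member.cspace_zero[OF member])

lemma PhiR_dense:
  assumes \<tau>: "\<tau> \<in> indices R" and "x \<in> hspace R \<tau>" "0 < e"
  obtains y where "y \<in> PhiR" "hnorm R \<tau> (x - y) < e"
proof -
  have "x \<in> htopology R \<tau> closure_of PhiR"
    using bspec[OF nuclear_facts(4) \<tau>] assms(2) by (simp add: PhiR_def)
  then obtain y where "y \<in> PhiR" "hnorm R \<tau> (x - y) < e"
    by (rule hilbert_member.closure_approx[OF member[OF \<tau>] _ \<open>0 < e\<close>])
  then show ?thesis by (rule that)
qed

lemma Phi_dense:
  assumes \<tau>: "\<tau> \<in> indices R" and z: "z \<in> cspace R \<tau>" and e: "0 < e"
  obtains w where "w \<in> Phi R" "cnorm R \<tau> (ccomb 1 z (-1) w) < e"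
proof -
  interpret hilbert_member R \<tau> by (rule member[OF \<tau>])
  obtain x y where zxy: "z = (x, y)" "x \<in> hspace R \<tau>" "y \<in> hspace R \<tau>" using z by (auto simp: cspace_def)
  obtain x' where x': "x' \<in> PhiR" "hnorm R \<tau> (x - x') < e / 2" using PhiR_dense[OF \<tau> zxy(2), of "e/2"] e by auto
  obtain y' where y': "y' \<in> PhiR" "hnorm R \<tau> (y - y') < e / 2" using PhiR_dense[OF \<tau> zxy(3), of "e/2"] e by auto
  have "cnorm R \<tau> (x - x', y - y') \<le> hnorm R \<tau> (x - x') + hnorm R \<tau> (y - y')"
    using zxy PhiR_hspace[OF \<tau>] x' y' by (intro cnorm_le_hnorm) (auto simp: cspace_def)
  then have "cnorm R \<tau> (ccomb 1 z (-1) (x', y')) < e"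
    using x' y' by (simp add: zxy ccomb_def cscale_def)
  then show ?thesis using that x' y' Phi_iff by blast
qed

lemma cnorm_bound_of_embedded:
  assumes \<sigma>: "\<sigma> \<in> indices R" and \<tau>: "\<tau> \<in> indices R" and "continuously_embedded R \<sigma> \<tau>"
  obtains K where "1 \<le> K" "\<And>z. z \<in> cspace R \<sigma> \<Longrightarrow> z \<in> cspace R \<tau> \<and> cnorm R \<tau> z \<le> K * cnorm R \<sigma> z"
proof -
  interpret s: hilbert_member R \<sigma> by (rule member[OF \<sigma>])
  interpret t: hilbert_member R \<tau> by (rule member[OF \<tau>])
  obtain K where sub: "hspace R \<sigma> \<subseteq> hspace R \<tau>" and K: "\<And>x. x \<in> hspace R \<sigma> \<Longrightarrow> hnorm R \<tau> x \<le> K * hnorm R \<sigma> x"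
    using assms unfolding continuously_embedded_def by blast
  define L where "L = max 1 K"
  have L: "1 \<le> L" by (simp add: L_def)
  have K2: "hinner R \<tau> x x \<le> L\<^sup>2 * hinner R \<sigma> x x" if x: "x \<in> hspace R \<sigma>" for x
  proof -
    have "hnorm R \<tau> x \<le> L * hnorm R \<sigma> x"
      using K[OF x] s.hnorm_nonneg[OF x] by (simp add: L_def) (smt (verit) mult_right_mono max.cobounded2)
    then have "(hnorm R \<tau> x)\<^sup>2 \<le> (L * hnorm R \<sigma> x)\<^sup>2"
      using t.hnorm_nonneg x sub by (intro power_mono) auto
    then show ?thesis using x sub t.hnorm_square s.hnorm_square by (auto simp: power_mult_distrib)
  qed
  have "cnorm R \<tau> z \<le> L * cnorm R \<sigma> z" if z: "z \<in> cspace R \<sigma>" for z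
  proof -
    have "hinner R \<tau> (fst z) (fst z) + hinner R \<tau> (snd z) (snd z)
       \<le> L\<^sup>2 * (hinner R \<sigma> (fst z) (fst z) + hinner R \<sigma> (snd z) (snd z))"
      using K2 z by (auto simp: cspace_def distrib_left intro!: add_mono)
    then have "cnorm R \<tau> z \<le> sqrt (L\<^sup>2 * (hinner R \<sigma> (fst z) (fst z) + hinner R \<sigma> (snd z) (snd z)))"
      by (simp add: cnorm_def cinner_def)
    also have "\<dots> = L * cnorm R \<sigma> z" using L by (simp add: real_sqrt_mult cnorm_def cinner_def)
    finally show ?thesis .
  qed
  moreover have "z \<in> cspace R \<tau>" if "z \<in> cspace R \<sigma>" for z using that sub by (auto simp: cspace_def)
  ultimately show ?thesis using that[OF L] by blast
qed

lemma neg_bound: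
  assumes \<tau>: "\<tau> \<in> indices R" and "\<omega> \<in> neg_space R \<tau>" "\<xi> \<in> Phi R"
  shows "cmod (\<omega> \<xi>) \<le> neg_norm R \<tau> \<omega> * cnorm R \<tau> \<xi>"
proof -
  interpret hilbert_member R \<tau> by (rule member[OF \<tau>])
  show ?thesis unfolding neg_norm_def
  proof (rule dual_norm_bound[OF _ assms(3)])
    show "\<omega> \<in> dual_of (Phi R) ccomb (cnorm R \<tau>)" using assms by (simp add: neg_space_def)
    fix c x assume x: "x \<in> Phi R"
    show "ccomb c x 0 x \<in> Phi R" using x Phi_ccomb by blast
    have "ccomb c x 0 x = cscale c x" by (simp add: ccomb_def cscale_def)
    then show "cnorm R \<tau> (ccomb c x 0 x) = cmod c * cnorm R \<tau> x"
      using x Phi_cspace \<tau> by (simp add: cnorm_scale)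
  qed (use Phi_cspace \<tau> cnorm_nonneg in blast)
qed

lemma neg_linear:
  "\<omega> \<in> neg_space R \<tau> \<Longrightarrow> z \<in> Phi R \<Longrightarrow> w \<in> Phi R \<Longrightarrow> \<omega> (ccomb a z b w) = a * \<omega> z + b * \<omega> w"
  by (simp add: neg_space_def dual_of_def)

lemma neg_vanish: "\<omega> \<in> neg_space R \<tau> \<Longrightarrow> x \<notin> Phi R \<Longrightarrow> \<omega> x = 0"
  unfolding neg_space_def dual_of_def by blast

lemma neg_norm_le:
  assumes \<tau>: "\<tau> \<in> indices R"
    and M: "0 \<le> M" "\<And>\<xi>. \<xi> \<in> Phi R \<Longrightarrow> cmod (\<omega> \<xi>) \<le> M * cnorm R \<tau> \<xi>"
  shows "neg_norm R \<tau> \<omega> \<le> M"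
proof -
  interpret hilbert_member R \<tau> by (rule member[OF \<tau>])
  show ?thesis unfolding neg_norm_def by (rule dual_norm_least[OF Phi_zero _ M]) simp_all
qed

lemma neg_norm_nonneg:
  assumes \<tau>: "\<tau> \<in> indices R" and \<omega>: "\<omega> \<in> neg_space R \<tau>"
  shows "0 \<le> neg_norm R \<tau> \<omega>"
proof -
  interpret hilbert_member R \<tau> by (rule member[OF \<tau>])
  obtain K where "\<And>x. x \<in> Phi R \<Longrightarrow> cmod (\<omega> x) \<le> K * cnorm R \<tau> x"
    using \<omega> unfolding neg_space_def dual_of_def by blast
  then have "bdd_above ((\<lambda>x. cmod (\<omega> x)) ` {x \<in> Phi R. cnorm R \<tau> x \<le> 1})"
    using cnorm_nonneg Phi_cspace[OF \<tau>]
    by (intro bdd_aboveI2[where M = "\<bar>K\<bar>"])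
       (smt (verit) mem_Collect_eq mult_left_le mult_right_mono abs_ge_self abs_ge_zero)
  then have "cmod (\<omega> 0) \<le> neg_norm R \<tau> \<omega>"
    unfolding neg_norm_def dual_norm_def using Phi_zero by (intro cSUP_upper) auto
  then show ?thesis using norm_ge_zero order_trans by blast
qed

lemma neg_space_intro:
  assumes "\<And>x. x \<notin> Phi R \<Longrightarrow> F x = 0"
    and "\<And>a b x y. x \<in> Phi R \<Longrightarrow> y \<in> Phi R \<Longrightarrow> F (ccomb a x b y) = a * F x + b * F y"
    and "\<And>x. x \<in> Phi R \<Longrightarrow> cmod (F x) \<le> K * cnorm R \<tau> x"
  shows "F \<in> neg_space R \<tau>"
  using assms unfolding neg_space_def dual_of_def by blast

lemma neg_fcomb_bound:
  assumes \<tau>: "\<tau> \<in> indices R" and v: "v \<in> neg_space R \<tau>" and w: "w \<in> neg_space R \<tau>" and \<xi>: "\<xi> \<in> Phi R"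
  shows "cmod (fcomb a v b w \<xi>) \<le> (cmod a * neg_norm R \<tau> v + cmod b * neg_norm R \<tau> w) * cnorm R \<tau> \<xi>"
proof -
  have "cmod (fcomb a v b w \<xi>) \<le> cmod a * cmod (v \<xi>) + cmod b * cmod (w \<xi>)"
    unfolding fcomb_def by (rule order_trans[OF norm_triangle_ineq]) (simp add: norm_mult)
  also have "\<dots> \<le> cmod a * (neg_norm R \<tau> v * cnorm R \<tau> \<xi>) + cmod b * (neg_norm R \<tau> w * cnorm R \<tau> \<xi>)"
    by (intro add_mono mult_left_mono neg_bound assms norm_ge_zero)
  finally show ?thesis by (simp add: algebra_simps)
qed

lemma seminormed_neg:
  assumes \<tau>: "\<tau> \<in> indices R"
  shows "seminormed (neg_space R \<tau>) (neg_norm R \<tau>)"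
proof
  show "(\<lambda>x. 0) \<in> neg_space R \<tau>" by (rule neg_space_intro[where K = 0]) auto
  fix v w a b assume v: "v \<in> neg_space R \<tau>" and w: "w \<in> neg_space R \<tau>"
  show "fcomb a v b w \<in> neg_space R \<tau>"
  proof (rule neg_space_intro)
    show "fcomb a v b w x = 0" if "x \<notin> Phi R" for x
      using neg_vanish[OF v that] neg_vanish[OF w that] by (simp add: fcomb_def)
    show "fcomb a v b w (ccomb a' x b' y) = a' * fcomb a v b w x + b' * fcomb a v b w y"
      if "x \<in> Phi R" "y \<in> Phi R" for a' b' x y
      using that neg_linear[OF v] neg_linear[OF w] by (simp add: fcomb_def algebra_simps)
  qed (rule neg_fcomb_bound[OF \<tau> v w])
  show "neg_norm R \<tau> (fcomb a v b w) \<le> cmod a * neg_norm R \<tau> v + cmod b * neg_norm R \<tau> w"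
    by (intro neg_norm_le[OF \<tau>] neg_fcomb_bound[OF \<tau> v w] add_nonneg_nonneg mult_nonneg_nonneg
        norm_ge_zero neg_norm_nonneg[OF \<tau>] v w)
qed (rule neg_norm_nonneg[OF \<tau>])

lemma neg_space_mono:
  assumes \<sigma>: "\<sigma> \<in> indices R" and \<tau>: "\<tau> \<in> indices R" and "continuously_embedded R \<sigma> \<tau>"
  obtains K where "1 \<le> K"
    "\<And>\<omega>. \<omega> \<in> neg_space R \<tau> \<Longrightarrow> \<omega> \<in> neg_space R \<sigma> \<and> neg_norm R \<sigma> \<omega> \<le> K * neg_norm R \<tau> \<omega>"
proof -
  obtain K where K: "1 \<le> K" "\<And>z. z \<in> cspace R \<sigma> \<Longrightarrow> z \<in> cspace R \<tau> \<and> cnorm R \<tau> z \<le> K * cnorm R \<sigma> z"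
    using cnorm_bound_of_embedded[OF assms] by blast
  have b: "cmod (\<omega> \<xi>) \<le> K * neg_norm R \<tau> \<omega> * cnorm R \<sigma> \<xi>" if "\<omega> \<in> neg_space R \<tau>" "\<xi> \<in> Phi R" for \<omega> \<xi>
  proof -
    have "cmod (\<omega> \<xi>) \<le> neg_norm R \<tau> \<omega> * cnorm R \<tau> \<xi>" using neg_bound \<tau> that by blast
    also have "\<dots> \<le> neg_norm R \<tau> \<omega> * (K * cnorm R \<sigma> \<xi>)"
      using K(2)[OF Phi_cspace[OF \<sigma> that(2)]] neg_norm_nonneg[OF \<tau> that(1)] by (intro mult_left_mono) auto
    finally show ?thesis by (simp add: mult_ac)
  qed
  show ?thesis
  proof (rule that[OF K(1)], intro conjI)
    fix \<omega> assume \<omega>: "\<omega> \<in> neg_space R \<tau>"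
    show "\<omega> \<in> neg_space R \<sigma>"
    proof (rule neg_space_intro)
      show "\<omega> x = 0" if "x \<notin> Phi R" for x
        by (rule neg_vanish[OF \<omega> that])
    qed (use neg_linear[OF \<omega>] b[OF \<omega>] in auto)
    show "neg_norm R \<sigma> \<omega> \<le> K * neg_norm R \<tau> \<omega>"
      using K(1) neg_norm_nonneg[OF \<tau> \<omega>] by (intro neg_norm_le[OF \<sigma>] b[OF \<omega>]) auto
  qed
qed

lemma directed:
  assumes "\<tau>1 \<in> indices R" "\<tau>2 \<in> indices R"
  obtains \<tau>3 where "\<tau>3 \<in> indices R" "continuously_embedded R \<tau>3 \<tau>1" "continuously_embedded R \<tau>3 \<tau>2"
  using nuclear_facts(2) assms by meson

lemma Phi_dual_common:
  assumes "\<omega> \<in> Phi_dual R" "\<eta> \<in> Phi_dual R"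
  obtains \<tau> where "\<tau> \<in> indices R" "\<omega> \<in> neg_space R \<tau>" "\<eta> \<in> neg_space R \<tau>"
proof -
  obtain \<tau>1 \<tau>2 where t: "\<tau>1 \<in> indices R" "\<omega> \<in> neg_space R \<tau>1" "\<tau>2 \<in> indices R" "\<eta> \<in> neg_space R \<tau>2"
    using assms by (auto simp: Phi_dual_def)
  obtain \<tau>3 where t3: "\<tau>3 \<in> indices R" "continuously_embedded R \<tau>3 \<tau>1" "continuously_embedded R \<tau>3 \<tau>2"
    using directed[OF t(1,3)] by blast
  have "\<omega> \<in> neg_space R \<tau>3" using neg_space_mono[OF t3(1) t(1) t3(2)] t(2) by metis
  moreover have "\<eta> \<in> neg_space R \<tau>3" using neg_space_mono[OF t3(1) t(3) t3(3)] t(4) by metis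
  ultimately show ?thesis using that t3(1) by blast
qed

lemma Phi_dual_fcomb: "\<omega> \<in> Phi_dual R \<Longrightarrow> \<eta> \<in> Phi_dual R \<Longrightarrow> fcomb a \<omega> b \<eta> \<in> Phi_dual R"
  by (erule (1) Phi_dual_common) (auto simp: Phi_dual_def intro: seminormed.V_fcomb[OF seminormed_neg])

text \<open>The dual spaces are directed upwards, so statements about finitely many elements of \<open>\<Phi>'\<close> can
  be checked in a single space \<open>\<H>\<^sub>-\<^sub>\<tau>\<close>.\<close>

lemma Phi_dual_common_list:
  assumes "set ws \<subseteq> Phi_dual R"
  obtains \<tau> where "\<tau> \<in> indices R" "set ws \<subseteq> neg_space R \<tau>"
  using assms
proof (induction ws arbitrary: thesis)
  case Nil
  then show ?case using center by auto
next
  case (Cons w ws)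
  obtain \<tau>1 where t1: "\<tau>1 \<in> indices R" "set ws \<subseteq> neg_space R \<tau>1" using Cons by auto
  obtain \<tau>2 where t2: "\<tau>2 \<in> indices R" "w \<in> neg_space R \<tau>2" using Cons.prems by (auto simp: Phi_dual_def)
  obtain \<tau>3 where t3: "\<tau>3 \<in> indices R" "continuously_embedded R \<tau>3 \<tau>1" "continuously_embedded R \<tau>3 \<tau>2"
    using directed[OF t1(1) t2(1)] by blast
  have "set ws \<subseteq> neg_space R \<tau>3" using neg_space_mono[OF t3(1) t1(1) t3(2)] t1(2) by (metis subset_iff)
  moreover have "w \<in> neg_space R \<tau>3" using neg_space_mono[OF t3(1) t2(1) t3(3)] t2(2) by metis
  ultimately show ?case using Cons.prems(1) t3(1) by simp
qed

lemma riesz_in: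
  assumes \<tau>: "\<tau> \<in> indices R" and e: "e \<in> cspace R \<tau>"
  shows "riesz R \<tau> e \<in> neg_space R \<tau>" "neg_norm R \<tau> (riesz R \<tau> e) \<le> cnorm R \<tau> e"
proof -
  interpret hilbert_member R \<tau> by (rule member[OF \<tau>])
  have b: "cmod (riesz R \<tau> e x) \<le> cnorm R \<tau> e * cnorm R \<tau> x" if "x \<in> Phi R" for x
    using cauchy_schwarz[OF Phi_cspace[OF \<tau> that] e] that by (simp add: riesz_def mult.commute)
  show "riesz R \<tau> e \<in> neg_space R \<tau>"
    by (rule neg_space_intro[OF _ _ b]) (use Phi_ccomb Phi_cspace[OF \<tau>] e in \<open>auto simp: riesz_def cinner_ccomb\<close>)
  show "neg_norm R \<tau> (riesz R \<tau> e) \<le> cnorm R \<tau> e"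
    by (rule neg_norm_le[OF \<tau> _ b]) (use cnorm_nonneg e in auto)
qed

text \<open>The norm of \<open>\<H>\<^sub>-\<^sub>\<tau>\<close> tests a functional on \<open>\<Phi>\<close> only. The vector \<open>e\<close>, at which the functional
  attains its norm, is therefore replaced by a nearby element of \<open>\<Phi>\<close>.\<close>

lemma cnorm_le_neg_norm_riesz:
  assumes \<tau>: "\<tau> \<in> indices R" and e: "e \<in> cspace R \<tau>"
  shows "cnorm R \<tau> e \<le> neg_norm R \<tau> (riesz R \<tau> e)"
proof -
  interpret hilbert_member R \<tau> by (rule member[OF \<tau>])
  let ?n = "cnorm R \<tau> e" and ?N = "neg_norm R \<tau> (riesz R \<tau> e)"
  have n: "0 \<le> ?n" using e cnorm_nonneg by blast
  have N: "0 \<le> ?N" using neg_norm_nonneg[OF \<tau> riesz_in(1)[OF \<tau> e]] .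
  have "?n\<^sup>2 \<le> ?N * ?n + d" if d: "0 < d" for d
  proof -
    define \<epsilon> where "\<epsilon> = d / (?n + ?N + 1)"
    have \<epsilon>: "0 < \<epsilon>" "\<epsilon> * (?n + ?N) \<le> d" using n N d by (auto simp: \<epsilon>_def field_simps)
    obtain w where w: "w \<in> Phi R" "cnorm R \<tau> (ccomb 1 e (-1) w) < \<epsilon>"
      using Phi_dense[OF \<tau> e \<epsilon>(1)] by blast
    have wc: "w \<in> cspace R \<tau>" using w Phi_cspace \<tau> by blast
    let ?d = "ccomb 1 e (-1) w"
    have dc: "?d \<in> cspace R \<tau>" using e wc by simp
    have ed: "e = ccomb 1 ?d 1 w" by (simp add: ccomb_def cscale_def prod_eq_iff)
    have wd: "w = ccomb 1 e (-1) ?d" by (simp add: ccomb_def cscale_def prod_eq_iff)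
    have "?n\<^sup>2 = cmod (cinner R \<tau> e e)" using e by (simp add: cinner_self norm_power)
    also have "\<dots> = cmod (cinner R \<tau> ?d e + cinner R \<tau> w e)"
      using dc wc e cinner_ccomb[OF dc wc e, of 1 1] ed by simp
    also have "\<dots> \<le> cnorm R \<tau> ?d * ?n + cmod (cinner R \<tau> w e)"
      by (intro norm_triangle_le add_mono cauchy_schwarz dc e order_refl)
    also have "cmod (cinner R \<tau> w e) \<le> ?N * cnorm R \<tau> w"
      using neg_bound[OF \<tau> riesz_in(1)[OF \<tau> e] w(1)] w(1) by (simp add: riesz_def)
    also have "cnorm R \<tau> w \<le> ?n + cnorm R \<tau> ?d"
      using cnorm_ccomb[OF e dc, of 1 "-1"] wd by simp
    finally have "?n\<^sup>2 \<le> cnorm R \<tau> ?d * ?n + ?N * (?n + cnorm R \<tau> ?d)" using N by (simp add: mult_left_mono)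
    also have "\<dots> = ?N * ?n + cnorm R \<tau> ?d * (?n + ?N)" by (simp add: algebra_simps)
    also have "cnorm R \<tau> ?d * (?n + ?N) \<le> \<epsilon> * (?n + ?N)" using w(2) n N by (intro mult_right_mono) auto
    finally show ?thesis using \<epsilon>(2) by linarith
  qed
  then have "?n\<^sup>2 \<le> ?N * ?n" by (rule field_le_epsilon)
  then show ?thesis using n N by (cases "?n = 0") (auto simp: power2_eq_square)
qed

text \<open>The real and the imaginary part of \<open>\<omega>\<close> on the real part of \<open>\<Phi>\<close> are represented separately;
  complex linearity then determines \<open>\<omega>\<close>.\<close>

lemma riesz_representation:
  assumes \<tau>: "\<tau> \<in> indices R" and \<omega>: "\<omega> \<in> neg_space R \<tau>"
  obtains e where "e \<in> cspace R \<tau>" "\<omega> = riesz R \<tau> e" "cnorm R \<tau> e \<le> neg_norm R \<tau> \<omega>"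
proof -
  interpret hilbert_member R \<tau> by (rule member[OF \<tau>])
  have sub: "PhiR \<subseteq> hspace R \<tau>" using PhiR_hspace \<tau> by blast
  have P: "(x, 0) \<in> Phi R" if "x \<in> PhiR" for x using that Phi_iff subspace_0[OF PhiR_subspace] by blast
  have add: "\<omega> (x + y, 0) = \<omega> (x, 0) + \<omega> (y, 0)" if "x \<in> PhiR" "y \<in> PhiR" for x y
    using neg_linear[OF \<omega> P[OF that(1)] P[OF that(2)], of 1 1] by (simp add: ccomb_def cscale_def)
  have scale: "\<omega> (c *\<^sub>R x, 0) = of_real c * \<omega> (x, 0)" if "x \<in> PhiR" for x c
    using neg_linear[OF \<omega> P[OF that] P[OF that], of "of_real c" 0] by (simp add: ccomb_def cscale_def)
  have bound: "cmod (\<omega> (x, 0)) \<le> neg_norm R \<tau> \<omega> * hnorm R \<tau> x" if "x \<in> PhiR" for x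
    using neg_bound[OF \<tau> \<omega> P[OF that]] that sub hnorm_cnorm by auto
  obtain e1 where e1: "e1 \<in> hspace R \<tau>" "\<And>x. x \<in> PhiR \<Longrightarrow> Re (\<omega> (x, 0)) = hinner R \<tau> x e1"
    by (rule riesz_real[OF PhiR_subspace sub, of "\<lambda>x. Re (\<omega> (x, 0))" "neg_norm R \<tau> \<omega>"])
       (auto simp: add scale intro: order_trans[OF abs_Re_le_cmod bound])
  obtain e2 where e2: "e2 \<in> hspace R \<tau>" "\<And>x. x \<in> PhiR \<Longrightarrow> Im (\<omega> (x, 0)) = hinner R \<tau> x e2"
    by (rule riesz_real[OF PhiR_subspace sub, of "\<lambda>x. Im (\<omega> (x, 0))" "neg_norm R \<tau> \<omega>"])
       (auto simp: add scale intro: order_trans[OF abs_Im_le_cmod bound])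
  \<comment> \<open>The sign is due to antilinearity of the inner product in its second argument.\<close>
  define e where "e = (e1, - e2)"
  have e: "e \<in> cspace R \<tau>" using e1 e2 subspace_neg[OF hspace_subspace] by (auto simp: e_def cspace_def)
  have "\<omega> = riesz R \<tau> e"
  proof
    fix \<xi>
    show "\<omega> \<xi> = riesz R \<tau> e \<xi>"
    proof (cases "\<xi> \<in> Phi R")
      case True
      obtain x y where xy: "\<xi> = (x, y)" "x \<in> PhiR" "y \<in> PhiR" using True Phi_iff by (cases \<xi>) auto
      have "\<xi> = ccomb 1 (x, 0) \<i> (y, 0)" by (simp add: xy ccomb_def cscale_def)
      then have "\<omega> \<xi> = \<omega> (x, 0) + \<i> * \<omega> (y, 0)" using neg_linear[OF \<omega> P P] xy by simp
      also have "\<dots> = cinner R \<tau> \<xi> e"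
        using xy sub e1 e2 hinner_scale_right[of e2 x "-1"] hinner_scale_right[of e2 y "-1"]
        by (auto simp: complex_eq_iff cinner_def e_def)
      finally show ?thesis using True by (simp add: riesz_def)
    qed (use neg_vanish[OF \<omega>] in \<open>simp add: riesz_def\<close>)
  qed
  then show ?thesis using that[OF e] cnorm_le_neg_norm_riesz[OF \<tau> e] by simp
qed

section \<open>Hilbert--Schmidt embeddings\<close>

lemma corthonormal_real:
  assumes "orthonormal_basis R \<sigma> B" "G \<subseteq> B" "\<sigma> \<in> indices R"
  shows "corthonormal R \<sigma> ((\<lambda>b. (b, 0)) ` G)"
proof -
  interpret hilbert_member R \<sigma> by (rule member[OF assms(3)])
  have "b \<in> hspace R \<sigma>" if "b \<in> G" for b using assms that by (auto simp: orthonormal_basis_def)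
  then show ?thesis
    using assms subsetD[OF assms(2)] by (auto simp: corthonormal_def orthonormal_basis_def cinner_def complex_eq_iff)
qed

text \<open>On finite combinations of basis vectors this is the Cauchy--Schwarz inequality, and these
  are dense. The crude constant \<open>K\<close> controls the passage to the limit.\<close>

lemma functional_bound_from_basis:
  assumes \<sigma>: "\<sigma> \<in> indices R" and B: "orthonormal_basis R \<sigma> B"
    and linear: "\<And>a b x y. x \<in> cspace R \<sigma> \<Longrightarrow> y \<in> cspace R \<sigma> \<Longrightarrow> L (ccomb a x b y) = a * L x + b * L y"
    and bounded: "\<And>x. x \<in> cspace R \<sigma> \<Longrightarrow> cmod (L x) \<le> K * cnorm R \<sigma> x"
    and M: "0 \<le> M" "\<And>G. finite G \<Longrightarrow> G \<subseteq> B \<Longrightarrow> (\<Sum>b\<in>G. (cmod (L (b, 0)))\<^sup>2) \<le> M\<^sup>2"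
    and x: "x \<in> cspace R \<sigma>"
  shows "cmod (L x) \<le> M * cnorm R \<sigma> x"
proof -
  interpret hilbert_member R \<sigma> by (rule member[OF \<sigma>])
  have Bh: "b \<in> hspace R \<sigma>" if "b \<in> B" for b using B that by (auto simp: orthonormal_basis_def)
  have K: "cmod (L x) \<le> \<bar>K\<bar> * cnorm R \<sigma> x" if "x \<in> cspace R \<sigma>" for x
    using bounded[OF that] cnorm_nonneg[OF that] by (smt (verit) mult_right_mono)
  have Lsum: "L (\<Sum>i\<in>I. cscale (c i) (f i)) = (\<Sum>i\<in>I. c i * L (f i))"
    if "finite I" "\<And>i. i \<in> I \<Longrightarrow> f i \<in> cspace R \<sigma>" for I :: "'v set" and c f
    using that
  proof (induction I rule: finite_induct)
    case empty
    then show ?case using linear[OF cspace_zero cspace_zero, of 0 0] by (simp add: ccomb_def cscale_def zero_prod_def)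
  next
    case (insert i I)
    have s: "(\<Sum>i\<in>I. cscale (c i) (f i)) \<in> cspace R \<sigma>" using insert by (intro cspace_sum) auto
    have "L (cscale (c i) (f i) + (\<Sum>i\<in>I. cscale (c i) (f i))) = c i * L (f i) + 1 * L (\<Sum>i\<in>I. cscale (c i) (f i))"
      using linear[OF _ s, of "f i" "c i" 1] insert by (simp add: ccomb_def cscale_def)
    then show ?case using insert by simp
  qed
  have fin: "cmod (L y) \<le> M * cnorm R \<sigma> y"
    if y: "y = (\<Sum>b\<in>G. cscale (c b) (b, 0))" and G: "finite G" "G \<subseteq> B" for y G c
  proof -
    have inj: "inj_on (\<lambda>b. (b, 0::'v)) G" by (auto simp: inj_on_def)
    have "(cnorm R \<sigma> (\<Sum>e\<in>(\<lambda>b. (b, 0)) ` G. cscale (c (fst e)) e))\<^sup>2 = (\<Sum>e\<in>(\<lambda>b. (b, 0::'v)) ` G. (cmod (c (fst e)))\<^sup>2)"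
      using cnorm_orthonormal_sum[OF finite_imageI[OF G(1)] corthonormal_real[OF B G(2) \<sigma>], of "\<lambda>e. c (fst e)"]
      by simp
    then have ny: "(cnorm R \<sigma> y)\<^sup>2 = (\<Sum>b\<in>G. (cmod (c b))\<^sup>2)"
      by (simp add: sum.reindex[OF inj] y)
    have ys: "y \<in> cspace R \<sigma>" unfolding y using G Bh by (intro cspace_sum cscale_in cspace_real) auto
    have "L y = (\<Sum>b\<in>G. c b * L (b, 0))" unfolding y using G Bh by (intro Lsum) auto
    then have "cmod (L y) \<le> (\<Sum>b\<in>G. cmod (c b) * cmod (L (b, 0)))"
      using norm_sum[of "\<lambda>b. c b * L (b, 0)" G] by (simp add: norm_mult)
    then have "(cmod (L y))\<^sup>2 \<le> (\<Sum>b\<in>G. cmod (c b) * cmod (L (b, 0)))\<^sup>2" by (intro power_mono) auto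
    also have "\<dots> \<le> (\<Sum>b\<in>G. (cmod (c b))\<^sup>2) * (\<Sum>b\<in>G. (cmod (L (b, 0)))\<^sup>2)"
      by (rule Cauchy_Schwarz_ineq_sum)
    also have "\<dots> \<le> (cnorm R \<sigma> y)\<^sup>2 * M\<^sup>2" unfolding ny using M(2)[OF G] by (intro mult_left_mono sum_nonneg) auto
    finally have "(cmod (L y))\<^sup>2 \<le> (M * cnorm R \<sigma> y)\<^sup>2" by (simp add: power_mult_distrib mult.commute)
    then show ?thesis using M(1) cnorm_nonneg[OF ys] by (auto intro: power2_le_imp_le)
  qed
  have "cmod (L x) \<le> M * cnorm R \<sigma> x + d" if d: "0 < d" for d
  proof -
    define \<epsilon> where "\<epsilon> = d / (\<bar>K\<bar> + M + 1)"
    have \<epsilon>: "0 < \<epsilon>" "(\<bar>K\<bar> + M) * \<epsilon> \<le> d" using M(1) d by (auto simp: \<epsilon>_def field_simps)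
    obtain x1 x2 where x12: "x = (x1, x2)" "x1 \<in> hspace R \<sigma>" "x2 \<in> hspace R \<sigma>" using x by (auto simp: cspace_def)
    have cl: "u \<in> htopology R \<sigma> closure_of span B" if "u \<in> hspace R \<sigma>" for u
      using B that by (auto simp: orthonormal_basis_def)
    obtain y1 where y1: "y1 \<in> span B" "hnorm R \<sigma> (x1 - y1) < \<epsilon> / 2" "y1 \<in> hspace R \<sigma>"
      using closure_approx[OF cl[OF x12(2)], of "\<epsilon>/2"] \<epsilon> by auto
    obtain y2 where y2: "y2 \<in> span B" "hnorm R \<sigma> (x2 - y2) < \<epsilon> / 2" "y2 \<in> hspace R \<sigma>"
      using closure_approx[OF cl[OF x12(3)], of "\<epsilon>/2"] \<epsilon> by auto
    obtain G1 r1 where g1: "finite G1" "G1 \<subseteq> B" "y1 = (\<Sum>b\<in>G1. r1 b *\<^sub>R b)"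
      using y1(1) unfolding span_explicit by blast
    obtain G2 r2 where g2: "finite G2" "G2 \<subseteq> B" "y2 = (\<Sum>b\<in>G2. r2 b *\<^sub>R b)"
      using y2(1) unfolding span_explicit by blast
    define c where "c = (\<lambda>b. Complex (if b \<in> G1 then r1 b else 0) (if b \<in> G2 then r2 b else 0))"
    have y: "(y1, y2) = (\<Sum>b\<in>G1 \<union> G2. cscale (c b) (b, 0))"
    proof -
      have "(\<Sum>b\<in>G1 \<union> G2. (if b \<in> G1 then r1 b else 0) *\<^sub>R b) = y1"
        unfolding g1(3) using g1(1) g2(1) by (intro sum.mono_neutral_cong_right) auto
      moreover have "(\<Sum>b\<in>G1 \<union> G2. (if b \<in> G2 then r2 b else 0) *\<^sub>R b) = y2"
        unfolding g2(3) using g1(1) g2(1) by (intro sum.mono_neutral_cong_right) auto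
      ultimately show ?thesis by (simp add: cscale_def c_def prod_eq_iff fst_sum snd_sum)
    qed
    have yc: "(y1, y2) \<in> cspace R \<sigma>" using y1 y2 by (simp add: cspace_def)
    let ?d = "ccomb 1 x (-1) (y1, y2)"
    have dc: "?d \<in> cspace R \<sigma>" using x yc by simp
    have "?d = (x1 - y1, x2 - y2)" by (simp add: x12 ccomb_def cscale_def)
    then have nd: "cnorm R \<sigma> ?d \<le> \<epsilon>"
      using cnorm_le_hnorm[of "x1 - y1" "x2 - y2"] dc y1 y2 by auto
    have xd: "x = ccomb 1 (y1, y2) 1 ?d" by (simp add: x12 ccomb_def cscale_def)
    have yd: "(y1, y2) = ccomb 1 x (-1) ?d" by (simp add: x12 ccomb_def cscale_def)
    have "L x = L (y1, y2) + L ?d" using linear[OF yc dc, of 1 1] xd by simp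
    then have "cmod (L x) \<le> cmod (L (y1, y2)) + cmod (L ?d)" using norm_triangle_ineq by metis
    also have "cmod (L (y1, y2)) \<le> M * cnorm R \<sigma> (y1, y2)"
      by (rule fin[OF y]) (use g1 g2 in auto)
    also have "cmod (L ?d) \<le> \<bar>K\<bar> * cnorm R \<sigma> ?d" by (rule K[OF dc])
    finally have "cmod (L x) \<le> M * cnorm R \<sigma> (y1, y2) + \<bar>K\<bar> * cnorm R \<sigma> ?d" by simp
    also have "\<dots> \<le> M * (cnorm R \<sigma> x + \<epsilon>) + \<bar>K\<bar> * \<epsilon>"
      using cnorm_ccomb[OF x dc, of 1 "-1"] yd nd M(1) by (intro add_mono mult_left_mono) auto
    also have "\<dots> = M * cnorm R \<sigma> x + (\<bar>K\<bar> + M) * \<epsilon>" by (simp add: algebra_simps)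
    also have "\<dots> \<le> M * cnorm R \<sigma> x + d" using \<epsilon> by simp
    finally show ?thesis .
  qed
  then show ?thesis by (rule field_le_epsilon)
qed

lemma hilbert_schmidt_imp_continuous:
  "hilbert_schmidt_embedded R \<sigma> \<tau> \<Longrightarrow> continuously_embedded R \<sigma> \<tau>"
  by (simp add: hilbert_schmidt_embedded_def)

lemma embedding_subset: "continuously_embedded R \<sigma> \<tau> \<Longrightarrow> hspace R \<sigma> \<subseteq> hspace R \<tau>"
  by (simp add: continuously_embedded_def)

lemma embedding_bound:
  assumes "continuously_embedded R \<sigma> \<tau>"
  obtains K where "hspace R \<sigma> \<subseteq> hspace R \<tau>" "\<And>x. x \<in> hspace R \<sigma> \<Longrightarrow> hnorm R \<tau> x \<le> K * hnorm R \<sigma> x"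
  using assms unfolding continuously_embedded_def by blast

text \<open>A Hilbert--Schmidt embedding into a space that is continuously embedded in \<open>\<H>\<^sub>\<tau>\<close> is
  Hilbert--Schmidt as an embedding into \<open>\<H>\<^sub>\<tau>\<close>, with the same basis.\<close>

lemma hilbert_schmidt_below:
  assumes \<tau>: "\<tau> \<in> indices R" and \<tau>': "\<tau>' \<in> indices R"
  obtains \<sigma> where "\<sigma> \<in> indices R" "hilbert_schmidt_embedded R \<sigma> \<tau>" "continuously_embedded R \<sigma> \<tau>'"
proof -
  obtain \<tau>3 where t3: "\<tau>3 \<in> indices R" "continuously_embedded R \<tau>3 \<tau>" "continuously_embedded R \<tau>3 \<tau>'"
    using directed[OF \<tau> \<tau>'] by blast
  obtain \<sigma> where \<sigma>: "\<sigma> \<in> indices R" "hilbert_schmidt_embedded R \<sigma> \<tau>3"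
    using bspec[OF nuclear_facts(3) t3(1)] by blast
  have trans: "continuously_embedded R \<sigma> \<rho>"
    if emb: "continuously_embedded R \<tau>3 \<rho>" for \<rho>
  proof -
    obtain K where sub1: "hspace R \<sigma> \<subseteq> hspace R \<tau>3"
      and K: "\<And>x. x \<in> hspace R \<sigma> \<Longrightarrow> hnorm R \<tau>3 x \<le> K * hnorm R \<sigma> x"
      using embedding_bound[OF hilbert_schmidt_imp_continuous[OF \<sigma>(2)]] by metis
    obtain L where sub2: "hspace R \<tau>3 \<subseteq> hspace R \<rho>"
      and L: "\<And>x. x \<in> hspace R \<tau>3 \<Longrightarrow> hnorm R \<rho> x \<le> L * hnorm R \<tau>3 x"
      using embedding_bound[OF emb] by metis
    note sub = sub1 sub2
    have "hnorm R \<rho> x \<le> (\<bar>L\<bar> * K) * hnorm R \<sigma> x" if x: "x \<in> hspace R \<sigma>" for x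
    proof -
      have "hnorm R \<rho> x \<le> \<bar>L\<bar> * hnorm R \<tau>3 x"
      proof -
        have x3: "x \<in> hspace R \<tau>3" using x sub1 by blast
        then have "hnorm R \<rho> x \<le> L * hnorm R \<tau>3 x" by (rule L)
        also have "\<dots> \<le> \<bar>L\<bar> * hnorm R \<tau>3 x"
          using hilbert_member.hnorm_nonneg[OF member[OF t3(1)] x3] by (intro mult_right_mono) auto
        finally show ?thesis .
      qed
      also have "\<dots> \<le> \<bar>L\<bar> * (K * hnorm R \<sigma> x)" using K x by (intro mult_left_mono) auto
      finally show ?thesis by simp
    qed
    moreover have "hspace R \<sigma> \<subseteq> hspace R \<rho>" using sub by (rule subset_trans)
    ultimately show ?thesis unfolding continuously_embedded_def by (intro conjI exI ballI)
  qed
  obtain B where B: "orthonormal_basis R \<sigma> B" "(\<lambda>e. (hnorm R \<tau>3 e)\<^sup>2) summable_on B"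
    using \<sigma>(2) unfolding hilbert_schmidt_embedded_def by blast
  obtain K where sub2: "hspace R \<tau>3 \<subseteq> hspace R \<tau>"
    and K: "\<And>x. x \<in> hspace R \<tau>3 \<Longrightarrow> hnorm R \<tau> x \<le> K * hnorm R \<tau>3 x"
    using embedding_bound[OF t3(2)] by metis
  note sub = embedding_subset[OF hilbert_schmidt_imp_continuous[OF \<sigma>(2)]] sub2
  have "(\<lambda>e. (hnorm R \<tau> e)\<^sup>2) summable_on B"
  proof (rule summable_on_comparison_test)
    show "(\<lambda>e. K\<^sup>2 * (hnorm R \<tau>3 e)\<^sup>2) summable_on B" by (intro summable_on_cmult_right B)
    fix e assume "e \<in> B"
    then have e: "e \<in> hspace R \<tau>3" "e \<in> hspace R \<tau>" using B sub by (auto simp: orthonormal_basis_def)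
    then show "(hnorm R \<tau> e)\<^sup>2 \<le> K\<^sup>2 * (hnorm R \<tau>3 e)\<^sup>2"
      using K[OF e(1)] hilbert_member.hnorm_nonneg[OF member[OF \<tau>]]
      by (metis power_mono power_mult_distrib)
  qed simp
  then have "hilbert_schmidt_embedded R \<sigma> \<tau>"
    unfolding hilbert_schmidt_embedded_def using trans[OF t3(2)] B(1) by (intro conjI exI)
  then show ?thesis by (rule that[OF \<sigma>(1) _ trans[OF t3(3)]])
qed

text \<open>The inclusion \<open>\<H>\<^sub>-\<^sub>\<tau> \<subseteq> \<H>\<^sub>-\<^sub>\<sigma>\<close> is the adjoint of a Hilbert--Schmidt embedding, hence itself
  Hilbert--Schmidt. With an orthonormal basis \<open>B\<close> of \<open>\<H>\<^sub>\<sigma>\<close> one estimates \<open>\<Sum>\<^sub>e \<Sum>\<^sub>b \<bar>(b, e)\<^sub>\<tau>\<bar>\<^sup>2\<close>: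
  the sum over \<open>b\<close> bounds the norm of the functional given by \<open>e\<close>, and after an exchange of the
  sums the sum over \<open>e\<close> is at most \<open>\<parallel>b\<parallel>\<^sub>\<tau>\<^sup>2\<close> by Bessel's inequality.\<close>

lemma hilbert_schmidt_riesz:
  assumes \<sigma>: "\<sigma> \<in> indices R" and \<tau>: "\<tau> \<in> indices R" and hs: "hilbert_schmidt_embedded R \<sigma> \<tau>"
  obtains M where "1 \<le> M" "\<And>E. finite E \<Longrightarrow> corthonormal R \<tau> E \<Longrightarrow>
      (\<Sum>e\<in>E. (neg_norm R \<sigma> (riesz R \<tau> e))\<^sup>2) \<le> M\<^sup>2"
proof -
  interpret s: hilbert_member R \<sigma> by (rule member[OF \<sigma>])
  interpret t: hilbert_member R \<tau> by (rule member[OF \<tau>])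
  obtain B where B: "orthonormal_basis R \<sigma> B" "(\<lambda>e. (hnorm R \<tau> e)\<^sup>2) summable_on B"
    using hs unfolding hilbert_schmidt_embedded_def by blast
  have emb: "continuously_embedded R \<sigma> \<tau>" using hs by (simp add: hilbert_schmidt_embedded_def)
  obtain K where K: "1 \<le> K" "\<And>z. z \<in> cspace R \<sigma> \<Longrightarrow> z \<in> cspace R \<tau> \<and> cnorm R \<tau> z \<le> K * cnorm R \<sigma> z"
    using cnorm_bound_of_embedded[OF \<sigma> \<tau> emb] by blast
  have Bh: "b \<in> hspace R \<sigma>" "b \<in> hspace R \<tau>" if "b \<in> B" for b
    using B that emb by (auto simp: orthonormal_basis_def continuously_embedded_def)
  define T where "T = (\<Sum>\<^sub>\<infinity>b\<in>B. (hnorm R \<tau> b)\<^sup>2)"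
  define M where "M = sqrt (T + 1)"
  have T0: "0 \<le> T" unfolding T_def by (rule infsum_nonneg) simp
  have M: "1 \<le> M" "M\<^sup>2 = T + 1" using T0 by (auto simp: M_def)
  have T: "(\<Sum>b\<in>G. (hnorm R \<tau> b)\<^sup>2) \<le> T" if "finite G" "G \<subseteq> B" for G
    unfolding T_def using that B(2) by (intro finite_sum_le_infsum) auto
  have "(\<Sum>e\<in>E. (neg_norm R \<sigma> (riesz R \<tau> e))\<^sup>2) \<le> M\<^sup>2" if E: "finite E" "corthonormal R \<tau> E" for E
  proof -
    have Ec: "e \<in> cspace R \<tau>" if "e \<in> E" for e using E that by (auto simp: corthonormal_def)
    define s where "s = (\<lambda>e. \<Sum>\<^sub>\<infinity>b\<in>B. (cmod (cinner R \<tau> (b, 0) e))\<^sup>2)"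
    have summ: "(\<lambda>b. (cmod (cinner R \<tau> (b, 0) e))\<^sup>2) summable_on B" if e: "e \<in> E" for e
    proof (rule summable_on_comparison_test)
      show "(\<lambda>b. (cnorm R \<tau> e)\<^sup>2 * (hnorm R \<tau> b)\<^sup>2) summable_on B" by (intro summable_on_cmult_right B)
      fix b assume b: "b \<in> B"
      have "cmod (cinner R \<tau> (b, 0) e) \<le> cnorm R \<tau> e * hnorm R \<tau> b"
        using t.cauchy_schwarz[OF t.cspace_real[OF Bh(2)[OF b]] Ec[OF e]] t.hnorm_cnorm[OF Bh(2)[OF b]]
        by (simp add: mult.commute)
      then show "(cmod (cinner R \<tau> (b, 0) e))\<^sup>2 \<le> (cnorm R \<tau> e)\<^sup>2 * (hnorm R \<tau> b)\<^sup>2"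
        by (metis norm_ge_zero power_mono power_mult_distrib)
    qed simp
    have one: "(neg_norm R \<sigma> (riesz R \<tau> e))\<^sup>2 \<le> s e" if e: "e \<in> E" for e
    proof -
      have s0: "0 \<le> s e" unfolding s_def by (rule infsum_nonneg) simp
      have "cmod (cinner R \<tau> x e) \<le> sqrt (s e) * cnorm R \<sigma> x" if x: "x \<in> cspace R \<sigma>" for x
      proof (rule functional_bound_from_basis[OF \<sigma> B(1), where L = "\<lambda>x. cinner R \<tau> x e" and K = "K * cnorm R \<tau> e"])
        show "cinner R \<tau> (ccomb a x b y) e = a * cinner R \<tau> x e + b * cinner R \<tau> y e"
          if "x \<in> cspace R \<sigma>" "y \<in> cspace R \<sigma>" for a b x y
          using that K Ec[OF e] t.cinner_ccomb by blast
        show "cmod (cinner R \<tau> x e) \<le> K * cnorm R \<tau> e * cnorm R \<sigma> x" if x: "x \<in> cspace R \<sigma>" for x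
        proof -
          have "cmod (cinner R \<tau> x e) \<le> cnorm R \<tau> x * cnorm R \<tau> e"
            using K(2)[OF x] Ec[OF e] by (intro t.cauchy_schwarz) auto
          also have "\<dots> \<le> (K * cnorm R \<sigma> x) * cnorm R \<tau> e"
            using K(2)[OF x] t.cnorm_nonneg[OF Ec[OF e]] by (intro mult_right_mono) auto
          finally show ?thesis by (simp add: mult_ac)
        qed
        show "(\<Sum>b\<in>G. (cmod (cinner R \<tau> (b, 0) e))\<^sup>2) \<le> (sqrt (s e))\<^sup>2" if "finite G" "G \<subseteq> B" for G
          using finite_sum_le_infsum[OF summ[OF e] that] s0 by (simp add: s_def)
      qed (use s0 x in auto)
      then have "neg_norm R \<sigma> (riesz R \<tau> e) \<le> sqrt (s e)"
        using s0 Phi_cspace[OF \<sigma>] by (intro neg_norm_le[OF \<sigma>]) (auto simp: riesz_def)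
      then have "(neg_norm R \<sigma> (riesz R \<tau> e))\<^sup>2 \<le> (sqrt (s e))\<^sup>2"
        using neg_norm_nonneg[OF \<sigma>] neg_space_mono[OF \<sigma> \<tau> emb] riesz_in(1)[OF \<tau> Ec[OF e]]
        by (intro power_mono) metis+
      then show ?thesis using s0 by simp
    qed
    have "(\<Sum>e\<in>E. s e) \<le> T"
    proof -
      have "((\<lambda>b. \<Sum>e\<in>E. (cmod (cinner R \<tau> (b, 0) e))\<^sup>2) has_sum (\<Sum>e\<in>E. s e)) B"
        using E(1) by (rule has_sum_sum_finite) (auto simp: s_def intro!: has_sum_infsum summ)
      moreover have "((\<lambda>b. (hnorm R \<tau> b)\<^sup>2) has_sum T) B"
        unfolding T_def by (intro has_sum_infsum B)
      ultimately show ?thesis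
      proof (rule has_sum_mono)
        fix b assume "b \<in> B"
        then show "(\<Sum>e\<in>E. (cmod (cinner R \<tau> (b, 0) e))\<^sup>2) \<le> (hnorm R \<tau> b)\<^sup>2"
          using t.bessel[OF E t.cspace_real] t.hnorm_cnorm Bh by simp
      qed
    qed
    moreover have "(\<Sum>e\<in>E. (neg_norm R \<sigma> (riesz R \<tau> e))\<^sup>2) \<le> (\<Sum>e\<in>E. s e)" by (rule sum_mono) (rule one)
    ultimately show ?thesis using M by linarith
  qed
  then show ?thesis using that M by blast
qed

section \<open>Entire functions of bounded type on the dual space\<close>

text \<open>The space \<open>\<H>\<^sub>-\<^sub>\<tau>\<close> is contained in \<open>\<H>\<^sub>-\<^sub>\<sigma>\<close> and \<open>M\<close> bounds the Hilbert--Schmidt norm of the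
  inclusion.\<close>

definition hs_below :: "'t \<Rightarrow> 't \<Rightarrow> real \<Rightarrow> bool" where
  "hs_below \<tau> \<sigma> M \<longleftrightarrow> \<tau> \<in> indices R \<and> \<sigma> \<in> indices R \<and> 1 \<le> M \<and> neg_space R \<tau> \<subseteq> neg_space R \<sigma> \<and>
     (\<forall>E. finite E \<longrightarrow> corthonormal R \<tau> E \<longrightarrow> (\<Sum>e\<in>E. (neg_norm R \<sigma> (riesz R \<tau> e))\<^sup>2) \<le> M\<^sup>2)"

lemma hs_belowD:
  assumes "hs_below \<tau> \<sigma> M"
  shows "\<tau> \<in> indices R" "\<sigma> \<in> indices R" "1 \<le> M" "\<And>\<omega>. \<omega> \<in> neg_space R \<tau> \<Longrightarrow> \<omega> \<in> neg_space R \<sigma>"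
    "\<And>E. finite E \<Longrightarrow> corthonormal R \<tau> E \<Longrightarrow> (\<Sum>e\<in>E. (neg_norm R \<sigma> (riesz R \<tau> e))\<^sup>2) \<le> M\<^sup>2"
  using assms by (simp_all add: hs_below_def subset_iff)

text \<open>The space \<open>\<H>\<^sub>-\<^sub>\<sigma>\<close> can be made to contain a second space \<open>\<H>\<^sub>-\<^sub>\<tau>\<^sub>'\<close>, which will hold the
  points at which functions are evaluated.\<close>

lemma hs_below_exists:
  assumes \<tau>: "\<tau> \<in> indices R" and \<tau>': "\<tau>' \<in> indices R"
  obtains \<sigma> M K where "hs_below \<tau> \<sigma> M" "1 \<le> K"
    "\<And>\<omega>. \<omega> \<in> neg_space R \<tau>' \<Longrightarrow> \<omega> \<in> neg_space R \<sigma> \<and> neg_norm R \<sigma> \<omega> \<le> K * neg_norm R \<tau>' \<omega>"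
proof -
  obtain \<sigma> where \<sigma>: "\<sigma> \<in> indices R" "hilbert_schmidt_embedded R \<sigma> \<tau>" "continuously_embedded R \<sigma> \<tau>'"
    using hilbert_schmidt_below[OF \<tau> \<tau>'] by blast
  obtain M where M: "1 \<le> M" "\<And>E. finite E \<Longrightarrow> corthonormal R \<tau> E \<Longrightarrow>
      (\<Sum>e\<in>E. (neg_norm R \<sigma> (riesz R \<tau> e))\<^sup>2) \<le> M\<^sup>2"
    using hilbert_schmidt_riesz[OF \<sigma>(1) \<tau> \<sigma>(2)] by blast
  obtain K where K: "1 \<le> K"
    "\<And>\<omega>. \<omega> \<in> neg_space R \<tau>' \<Longrightarrow> \<omega> \<in> neg_space R \<sigma> \<and> neg_norm R \<sigma> \<omega> \<le> K * neg_norm R \<tau>' \<omega>"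
    using neg_space_mono[OF \<sigma>(1) \<tau>' \<sigma>(3)] by blast
  have "neg_space R \<tau> \<subseteq> neg_space R \<sigma>"
    by (rule neg_space_mono[OF \<sigma>(1) \<tau> hilbert_schmidt_imp_continuous[OF \<sigma>(2)]]) blast
  then have "hs_below \<tau> \<sigma> M" using \<sigma>(1) \<tau> M by (simp add: hs_below_def)
  then show ?thesis by (rule that[OF _ K])
qed

lemma Phi_dualI: "\<tau> \<in> indices R \<Longrightarrow> \<omega> \<in> neg_space R \<tau> \<Longrightarrow> \<omega> \<in> Phi_dual R"
  by (auto simp: Phi_dual_def)

lemma Phi_dual_zero: "(\<lambda>x. 0) \<in> Phi_dual R"
  by (rule Phi_dualI[OF center]) (rule seminormed.V_zero[OF seminormed_neg[OF center]])

abbreviation "bounded_type_on \<tau> \<equiv> seminormed.bounded_type (neg_space R \<tau>) (neg_norm R \<tau>)"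

definition entire_bounded_type :: "('v dual \<Rightarrow> complex) \<Rightarrow> bool" where
  "entire_bounded_type f \<longleftrightarrow> (\<forall>\<tau>\<in>indices R. bounded_type_on \<tau> f)"

lemma entire_bounded_typeD: "entire_bounded_type f \<Longrightarrow> \<tau> \<in> indices R \<Longrightarrow> bounded_type_on \<tau> f"
  by (simp add: entire_bounded_type_def)

lemma bounded_type_on_mono:
  assumes \<sigma>: "\<sigma> \<in> indices R" and \<tau>: "\<tau> \<in> indices R" and emb: "continuously_embedded R \<sigma> \<tau>" and f: "bounded_type_on \<sigma> f"
  shows "bounded_type_on \<tau> f"
proof -
  interpret s: seminormed "neg_space R \<sigma>" "neg_norm R \<sigma>" by (rule seminormed_neg[OF \<sigma>])
  interpret t: seminormed "neg_space R \<tau>" "neg_norm R \<tau>" by (rule seminormed_neg[OF \<tau>])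
  obtain K where K: "1 \<le> K"
    "\<And>\<omega>. \<omega> \<in> neg_space R \<tau> \<Longrightarrow> \<omega> \<in> neg_space R \<sigma> \<and> neg_norm R \<sigma> \<omega> \<le> K * neg_norm R \<tau> \<omega>"
    using neg_space_mono[OF \<sigma> \<tau> emb] by blast
  show ?thesis unfolding t.bounded_type_def
  proof (intro conjI ballI allI)
    show "(\<lambda>z. f (fcomb 1 \<omega> z \<eta>)) holomorphic_on UNIV" if "\<omega> \<in> neg_space R \<tau>" "\<eta> \<in> neg_space R \<tau>" for \<omega> \<eta>
      using that K(2) by (intro s.bounded_type_holo[OF f]) auto
    fix r
    obtain M where M: "\<And>\<omega>. \<omega> \<in> neg_space R \<sigma> \<Longrightarrow> neg_norm R \<sigma> \<omega> \<le> K * r \<Longrightarrow> cmod (f \<omega>) \<le> M"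
      using s.bounded_type_bounded[OF f] by blast
    have "cmod (f \<omega>) \<le> M" if "\<omega> \<in> neg_space R \<tau>" "neg_norm R \<tau> \<omega> \<le> r" for \<omega>
    proof (rule M)
      show "\<omega> \<in> neg_space R \<sigma>" using K(2) that(1) by blast
      have "neg_norm R \<sigma> \<omega> \<le> K * neg_norm R \<tau> \<omega>" using K(2) that(1) by blast
      also have "\<dots> \<le> K * r" using K(1) that(2) by (intro mult_left_mono) auto
      finally show "neg_norm R \<sigma> \<omega> \<le> K * r" .
    qed
    then show "\<exists>M. \<forall>\<omega>\<in>neg_space R \<tau>. neg_norm R \<tau> \<omega> \<le> r \<longrightarrow> cmod (f \<omega>) \<le> M" by blast
  qed
qed

text \<open>An operation that involves a direction \<open>w \<in> \<Phi>'\<close> makes sense only on those \<open>\<H>\<^sub>-\<^sub>\<sigma>\<close> that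
  contain \<open>w\<close>. These exhaust \<open>\<Phi>'\<close>, and bounded type is inherited by smaller dual spaces.\<close>

lemma entire_bounded_type_cofinal:
  assumes w: "w \<in> Phi_dual R"
    and g: "\<And>\<sigma>. \<sigma> \<in> indices R \<Longrightarrow> w \<in> neg_space R \<sigma> \<Longrightarrow> bounded_type_on \<sigma> g"
  shows "entire_bounded_type g"
  unfolding entire_bounded_type_def
proof
  fix \<tau> assume \<tau>: "\<tau> \<in> indices R"
  obtain \<tau>1 where t1: "\<tau>1 \<in> indices R" "w \<in> neg_space R \<tau>1" using w by (auto simp: Phi_dual_def)
  obtain \<sigma> where \<sigma>: "\<sigma> \<in> indices R" "continuously_embedded R \<sigma> \<tau>" "continuously_embedded R \<sigma> \<tau>1"
    by (rule directed[OF \<tau> t1(1)])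
  have "w \<in> neg_space R \<sigma>" using t1(2) by (rule_tac neg_space_mono[OF \<sigma>(1) t1(1) \<sigma>(3)]) blast
  then show "bounded_type_on \<tau> g" by (intro bounded_type_on_mono[OF \<sigma>(1) \<tau> \<sigma>(2)] g \<sigma>(1))
qed

lemma entire_bounded_type_fcomb: "entire_bounded_type f \<Longrightarrow> entire_bounded_type g \<Longrightarrow> entire_bounded_type (fcomb a f b g)"
  unfolding entire_bounded_type_def by (intro ballI seminormed.bounded_type_combine[OF seminormed_neg]) auto

lemma entire_bounded_type_translate: "entire_bounded_type f \<Longrightarrow> w \<in> Phi_dual R \<Longrightarrow> entire_bounded_type (\<lambda>\<omega>. f (fcomb 1 \<omega> t w))"
  by (erule entire_bounded_type_cofinal) (intro seminormed.bounded_type_translate[OF seminormed_neg] entire_bounded_typeD)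

lemma entire_bounded_type_D: "entire_bounded_type f \<Longrightarrow> w \<in> Phi_dual R \<Longrightarrow> entire_bounded_type (D w f)"
  by (erule entire_bounded_type_cofinal) (intro seminormed.bounded_type_D[OF seminormed_neg] entire_bounded_typeD)

lemma D_cong_dual:
  assumes "\<And>\<zeta>. \<zeta> \<in> Phi_dual R \<Longrightarrow> f \<zeta> = g \<zeta>" "w \<in> Phi_dual R" "\<omega> \<in> Phi_dual R"
  shows "D w f \<omega> = D w g \<omega>"
  unfolding D_def using assms Phi_dual_fcomb by simp

section \<open>Symmetric tensors\<close>

lemma hs_sums_nonempty: "hs_sums R \<tau> n \<phi> \<noteq> {}"
  unfolding hs_sums_def by (auto simp: corthonormal_def intro!: exI[of _ "{}"])

lemma hs_sums_memI:
  "finite E \<Longrightarrow> corthonormal R \<tau> E \<Longrightarrow>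
    (\<Sum>es\<in>{es. length es = n \<and> set es \<subseteq> E}. (cmod (\<phi> (map (riesz R \<tau>) es)))\<^sup>2) \<in> hs_sums R \<tau> n \<phi>"
  unfolding hs_sums_def by blast

lemma hs_sums_nonneg: "s \<in> hs_sums R \<tau> n \<phi> \<Longrightarrow> 0 \<le> s"
  unfolding hs_sums_def by (auto intro: sum_nonneg)

lemma hs_sums_cong:
  assumes \<tau>: "\<tau> \<in> indices R"
    and eq: "\<And>ws. length ws = n \<Longrightarrow> set ws \<subseteq> neg_space R \<tau> \<Longrightarrow> \<phi> ws = \<psi> ws"
  shows "hs_sums R \<tau> n \<phi> = hs_sums R \<tau> n \<psi>"
proof -
  have "\<phi> (map (riesz R \<tau>) es) = \<psi> (map (riesz R \<tau>) es)"
    if "corthonormal R \<tau> E" "length es = n" "set es \<subseteq> E" for E es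
  proof (rule eq)
    show "set (map (riesz R \<tau>) es) \<subseteq> neg_space R \<tau>"
      using that riesz_in(1)[OF \<tau>] unfolding corthonormal_def by fastforce
  qed (use that in simp)
  then have "(\<Sum>es\<in>{es. length es = n \<and> set es \<subseteq> E}. (cmod (\<phi> (map (riesz R \<tau>) es)))\<^sup>2)
      = (\<Sum>es\<in>{es. length es = n \<and> set es \<subseteq> E}. (cmod (\<psi> (map (riesz R \<tau>) es)))\<^sup>2)"
    if "corthonormal R \<tau> E" for E
    using that by (intro sum.cong) auto
  then show ?thesis unfolding hs_sums_def by (smt (verit, ccfv_SIG) Collect_cong)
qed

lemma hs_sums_restrict:
  "\<tau> \<in> indices R \<Longrightarrow> hs_sums R \<tau> n (restrict_tensor (neg_space R \<tau>) \<phi>) = hs_sums R \<tau> n \<phi>"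
  by (rule hs_sums_cong) (auto simp: restrict_tensor_def)

lemma sym_norm_le:
  assumes "0 \<le> c" "\<And>s. s \<in> hs_sums R \<tau> n \<phi> \<Longrightarrow> s \<le> c\<^sup>2"
  shows "sym_norm R \<tau> n \<phi> \<le> c"
proof -
  have "Sup (hs_sums R \<tau> n \<phi>) \<le> c\<^sup>2" using assms(2) by (intro cSup_least hs_sums_nonempty)
  then have "sym_norm R \<tau> n \<phi> \<le> sqrt (c\<^sup>2)" unfolding sym_norm_def by (rule real_sqrt_le_mono)
  then show ?thesis using assms(1) by simp
qed

lemma sym_norm_upper:
  assumes "bdd_above (hs_sums R \<tau> n \<phi>)" "s \<in> hs_sums R \<tau> n \<phi>"
  shows "s \<le> (sym_norm R \<tau> n \<phi>)\<^sup>2"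
proof -
  have "s \<le> Sup (hs_sums R \<tau> n \<phi>)" by (rule cSup_upper[OF assms(2,1)])
  moreover have "0 \<le> s" using assms(2) by (rule hs_sums_nonneg)
  ultimately show ?thesis by (simp add: sym_norm_def)
qed

lemma sym_norm_nonneg:
  assumes "bdd_above (hs_sums R \<tau> n \<phi>)"
  shows "0 \<le> sym_norm R \<tau> n \<phi>"
proof -
  obtain s where s: "s \<in> hs_sums R \<tau> n \<phi>" using hs_sums_nonempty by blast
  have "0 \<le> s" by (rule hs_sums_nonneg[OF s])
  also have "s \<le> Sup (hs_sums R \<tau> n \<phi>)" by (rule cSup_upper[OF s assms])
  finally show ?thesis by (simp add: sym_norm_def)
qed

text \<open>The sum over all \<open>n\<close>-tuples from \<open>E\<close> factorizes into \<open>n\<close> sums over \<open>E\<close>, each at most \<open>M\<^sup>2\<close>: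
  boundedness on the larger space \<open>\<H>\<^sub>-\<^sub>\<sigma>\<close> implies the Hilbert--Schmidt property on \<open>\<H>\<^sub>-\<^sub>\<tau>\<close>.\<close>

lemma hs_sums_bound:
  assumes hs: "hs_below \<tau> \<sigma> M" and c: "0 \<le> c"
    and bound: "\<And>ws. length ws = n \<Longrightarrow> set ws \<subseteq> neg_space R \<tau> \<Longrightarrow> cmod (\<phi> ws) \<le> c * prod_list (map (neg_norm R \<sigma>) ws)"
    and s: "s \<in> hs_sums R \<tau> n \<phi>"
  shows "s \<le> (c * M ^ n)\<^sup>2"
proof -
  note hsD = hs_belowD[OF hs]
  obtain E where E: "finite E" "corthonormal R \<tau> E"
    and s: "s = (\<Sum>es\<in>{es. length es = n \<and> set es \<subseteq> E}. (cmod (\<phi> (map (riesz R \<tau>) es)))\<^sup>2)"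
    using s unfolding hs_sums_def by blast
  define g where "g = (\<lambda>e. (neg_norm R \<sigma> (riesz R \<tau> e))\<^sup>2)"
  have sq: "(prod_list (map h ws))\<^sup>2 = prod_list (map (\<lambda>w. (h w)\<^sup>2) ws)" for h :: "'w \<Rightarrow> real" and ws
    by (induction ws) (simp_all add: power_mult_distrib)
  have "s \<le> (\<Sum>es\<in>{es. length es = n \<and> set es \<subseteq> E}. c\<^sup>2 * prod_list (map g es))"
    unfolding s
  proof (rule sum_mono)
    fix es assume es: "es \<in> {es. length es = n \<and> set es \<subseteq> E}"
    have "cmod (\<phi> (map (riesz R \<tau>) es)) \<le> c * prod_list (map (neg_norm R \<sigma>) (map (riesz R \<tau>) es))"
    proof (rule bound)
      show "set (map (riesz R \<tau>) es) \<subseteq> neg_space R \<tau>"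
        using es riesz_in(1)[OF hsD(1)] E(2) unfolding corthonormal_def by fastforce
    qed (use es in simp)
    then have "(cmod (\<phi> (map (riesz R \<tau>) es)))\<^sup>2 \<le> (c * prod_list (map (neg_norm R \<sigma>) (map (riesz R \<tau>) es)))\<^sup>2"
      by (intro power_mono) auto
    also have "\<dots> = c\<^sup>2 * prod_list (map g es)"
      by (simp add: power_mult_distrib sq g_def comp_def)
    finally show "(cmod (\<phi> (map (riesz R \<tau>) es)))\<^sup>2 \<le> c\<^sup>2 * prod_list (map g es)" .
  qed
  also have "\<dots> = c\<^sup>2 * (\<Sum>e\<in>E. g e) ^ n"
    using sum_lists_prod_list[OF E(1)] by (simp add: sum_distrib_left[symmetric])
  also have "\<dots> \<le> c\<^sup>2 * (M\<^sup>2) ^ n"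
    using hsD(5)[OF E] by (intro mult_left_mono power_mono) (auto simp: g_def sum_nonneg)
  also have "\<dots> = (c * M ^ n)\<^sup>2" by (simp add: power_mult_distrib power_mult[symmetric] mult.commute)
  finally show ?thesis .
qed

lemma Phi_symD:
  assumes "\<phi> \<in> Phi_sym R n"
  shows "\<And>ws. \<not> (length ws = n \<and> set ws \<subseteq> Phi_dual R) \<Longrightarrow> \<phi> ws = 0"
    and "\<And>\<tau>. \<tau> \<in> indices R \<Longrightarrow> symmetric_multilinear (neg_space R \<tau>) n (restrict_tensor (neg_space R \<tau>) \<phi>)"
    and "\<And>\<tau>. \<tau> \<in> indices R \<Longrightarrow> bdd_above (hs_sums R \<tau> n \<phi>)"
proof -
  show "\<And>ws. \<not> (length ws = n \<and> set ws \<subseteq> Phi_dual R) \<Longrightarrow> \<phi> ws = 0"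
    using assms by (simp add: Phi_sym_def)
  fix \<tau> assume \<tau>: "\<tau> \<in> indices R"
  then have *: "restrict_tensor (neg_space R \<tau>) \<phi> \<in> sym_power R \<tau> n" using assms by (simp add: Phi_sym_def)
  show "symmetric_multilinear (neg_space R \<tau>) n (restrict_tensor (neg_space R \<tau>) \<phi>)"
    using * by (simp add: sym_power_def)
  show "bdd_above (hs_sums R \<tau> n \<phi>)"
    using * hs_sums_restrict[OF \<tau>, of n \<phi>] by (simp add: sym_power_def)
qed

text \<open>Symmetry and linearity are stated on \<open>\<Phi>'\<close> at once; they restrict to each \<open>\<H>\<^sub>-\<^sub>\<tau>\<close>.\<close>

lemma Phi_symI:
  assumes vanish: "\<And>ws. \<not> (length ws = n \<and> set ws \<subseteq> Phi_dual R) \<Longrightarrow> \<phi> ws = 0"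
    and perm: "\<And>ws vs. mset ws = mset vs \<Longrightarrow> length ws = n \<Longrightarrow> set ws \<subseteq> Phi_dual R \<Longrightarrow> \<phi> ws = \<phi> vs"
    and linear: "\<And>ws i a b v w. v \<in> Phi_dual R \<Longrightarrow> w \<in> Phi_dual R \<Longrightarrow> i < n \<Longrightarrow> length ws = n \<Longrightarrow> set ws \<subseteq> Phi_dual R
        \<Longrightarrow> \<phi> (ws[i := fcomb a v b w]) = a * \<phi> (ws[i := v]) + b * \<phi> (ws[i := w])"
    and bdd: "\<And>\<tau>. \<tau> \<in> indices R \<Longrightarrow> bdd_above (hs_sums R \<tau> n \<phi>)"
  shows "\<phi> \<in> Phi_sym R n"
  unfolding Phi_sym_def
proof (rule CollectI, intro conjI allI ballI)
  show "\<not> (length ws = n \<and> set ws \<subseteq> Phi_dual R) \<longrightarrow> \<phi> ws = 0" for ws using vanish by blast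
  fix \<tau> assume \<tau>: "\<tau> \<in> indices R"
  let ?N = "neg_space R \<tau>"
  have sub: "?N \<subseteq> Phi_dual R" using Phi_dualI[OF \<tau>] by blast
  have "symmetric_multilinear ?N n (restrict_tensor ?N \<phi>)"
    unfolding symmetric_multilinear_def
  proof (intro conjI allI ballI impI)
    show "restrict_tensor ?N \<phi> ws = 0" if "\<not> (length ws = n \<and> set ws \<subseteq> ?N)" for ws
      using that vanish[of ws] by (auto simp: restrict_tensor_def)
    show "restrict_tensor ?N \<phi> ws = restrict_tensor ?N \<phi> vs" if m: "mset ws = mset vs" for ws vs
    proof -
      have s: "set ws = set vs" "length ws = length vs" using m mset_eq_setD mset_eq_length by blast+
      have "\<phi> ws = \<phi> vs"
      proof (cases "length ws = n \<and> set ws \<subseteq> Phi_dual R")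
        case True then show ?thesis using perm m by blast
      next
        case False then show ?thesis using vanish[of ws] vanish[of vs] s by metis
      qed
      then show ?thesis using s by (simp add: restrict_tensor_def)
    qed
    fix ws a b v w i
    assume *: "v \<in> ?N" "w \<in> ?N" "i < n" "length ws = n \<and> set ws \<subseteq> ?N"
    have f: "fcomb a v b w \<in> ?N" using * seminormed.V_fcomb[OF seminormed_neg[OF \<tau>]] by blast
    have "set (ws[i := x]) \<subseteq> ?N" if "x \<in> ?N" for x
      using that * set_update_subset_insert[of ws i x] by blast
    then show "restrict_tensor ?N \<phi> (ws[i := fcomb a v b w])
        = a * restrict_tensor ?N \<phi> (ws[i := v]) + b * restrict_tensor ?N \<phi> (ws[i := w])"
      using * f linear[of v w i ws a b] sub by (auto simp: restrict_tensor_def)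
  qed
  then show "restrict_tensor ?N \<phi> \<in> sym_power R \<tau> n"
    using bdd[OF \<tau>] hs_sums_restrict[OF \<tau>, of n \<phi>] by (simp add: sym_power_def)
qed

lemma symmetric_multilinearD:
  assumes "symmetric_multilinear V n \<phi>"
  shows "mset ws = mset vs \<Longrightarrow> \<phi> ws = \<phi> vs"
    and "v \<in> V \<Longrightarrow> w \<in> V \<Longrightarrow> i < n \<Longrightarrow> length ws = n \<Longrightarrow> set ws \<subseteq> V \<Longrightarrow>
      \<phi> (ws[i := fcomb a v b w]) = a * \<phi> (ws[i := v]) + b * \<phi> (ws[i := w])"
proof -
  note * = assms[unfolded symmetric_multilinear_def]
  show "mset ws = mset vs \<Longrightarrow> \<phi> ws = \<phi> vs"
    by (rule conjunct1[OF conjunct2[OF *], rule_format])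
  show "v \<in> V \<Longrightarrow> w \<in> V \<Longrightarrow> i < n \<Longrightarrow> length ws = n \<Longrightarrow> set ws \<subseteq> V \<Longrightarrow>
      \<phi> (ws[i := fcomb a v b w]) = a * \<phi> (ws[i := v]) + b * \<phi> (ws[i := w])"
    by (rule conjunct2[OF conjunct2[OF *], rule_format]) auto
qed

lemma sym_perm:
  assumes \<phi>: "\<phi> \<in> Phi_sym R n" and m: "mset ws = mset vs"
  shows "\<phi> ws = \<phi> vs"
proof -
  have s: "set ws = set vs" "length ws = length vs" using m mset_eq_setD mset_eq_length by blast+
  show ?thesis
  proof (cases "length ws = n \<and> set ws \<subseteq> Phi_dual R")
    case True
    obtain \<tau> where \<tau>: "\<tau> \<in> indices R" "set ws \<subseteq> neg_space R \<tau>"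
      using Phi_dual_common_list True by blast
    have "restrict_tensor (neg_space R \<tau>) \<phi> ws = restrict_tensor (neg_space R \<tau>) \<phi> vs"
      by (rule symmetric_multilinearD(1)[OF Phi_symD(2)[OF \<phi> \<tau>(1)] m])
    then show ?thesis using \<tau>(2) s by (simp add: restrict_tensor_def)
  next
    case False then show ?thesis using Phi_symD(1)[OF \<phi>, of ws] Phi_symD(1)[OF \<phi>, of vs] s by metis
  qed
qed

lemma sym_linear_update:
  assumes \<phi>: "\<phi> \<in> Phi_sym R n" and v: "v \<in> Phi_dual R" and w: "w \<in> Phi_dual R"
    and ws: "i < n" "length ws = n" "set ws \<subseteq> Phi_dual R"
  shows "\<phi> (ws[i := fcomb a v b w]) = a * \<phi> (ws[i := v]) + b * \<phi> (ws[i := w])"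
proof -
  have "set (v # w # ws) \<subseteq> Phi_dual R" using v w ws by simp
  then obtain \<tau> where \<tau>: "\<tau> \<in> indices R" and "set (v # w # ws) \<subseteq> neg_space R \<tau>"
    using Phi_dual_common_list by blast
  then have N: "v \<in> neg_space R \<tau>" "w \<in> neg_space R \<tau>" "set ws \<subseteq> neg_space R \<tau>" by auto
  have f: "fcomb a v b w \<in> neg_space R \<tau>" using N seminormed.V_fcomb[OF seminormed_neg[OF \<tau>]] by blast
  have u: "set (ws[i := x]) \<subseteq> neg_space R \<tau>" if "x \<in> neg_space R \<tau>" for x
    using that N(3) set_update_subset_insert[of ws i x] by blast
  have "restrict_tensor (neg_space R \<tau>) \<phi> (ws[i := fcomb a v b w])
      = a * restrict_tensor (neg_space R \<tau>) \<phi> (ws[i := v]) + b * restrict_tensor (neg_space R \<tau>) \<phi> (ws[i := w])"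
    by (rule symmetric_multilinearD(2)[OF Phi_symD(2)[OF \<phi> \<tau>] N(1,2) ws(1,2) N(3)])
  then show ?thesis using u[OF f] u[OF N(1)] u[OF N(2)] by (simp add: restrict_tensor_def)
qed

lemma sym_linear:
  assumes \<phi>: "\<phi> \<in> Phi_sym R n" and v: "v \<in> Phi_dual R" and w: "w \<in> Phi_dual R"
    and "Suc (length as + length bs) = n" "set as \<subseteq> Phi_dual R" "set bs \<subseteq> Phi_dual R"
  shows "\<phi> (as @ fcomb a v b w # bs) = a * \<phi> (as @ v # bs) + b * \<phi> (as @ w # bs)"
  using sym_linear_update[OF \<phi> v w, of "length as" "as @ v # bs" a b] assms by simp

lemma Phi_sym_fcomb:
  assumes \<phi>: "\<phi> \<in> Phi_sym R n" and \<psi>: "\<psi> \<in> Phi_sym R n"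
  shows "fcomb a \<phi> b \<psi> \<in> Phi_sym R n"
proof (rule Phi_symI)
  show "fcomb a \<phi> b \<psi> ws = 0" if "\<not> (length ws = n \<and> set ws \<subseteq> Phi_dual R)" for ws
    using Phi_symD(1)[OF \<phi> that] Phi_symD(1)[OF \<psi> that] by (simp add: fcomb_def)
  show "fcomb a \<phi> b \<psi> ws = fcomb a \<phi> b \<psi> vs" if "mset ws = mset vs" for ws vs
    using sym_perm[OF \<phi> that] sym_perm[OF \<psi> that] by (simp add: fcomb_def)
  show "fcomb a \<phi> b \<psi> (ws[i := fcomb c v d w]) = c * fcomb a \<phi> b \<psi> (ws[i := v]) + d * fcomb a \<phi> b \<psi> (ws[i := w])"
    if "v \<in> Phi_dual R" "w \<in> Phi_dual R" "i < n" "length ws = n" "set ws \<subseteq> Phi_dual R" for ws i c d v w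
    using sym_linear_update[OF \<phi> that, of c d] sym_linear_update[OF \<psi> that, of c d]
    by (simp add: fcomb_def[of a \<phi>] algebra_simps)
  fix \<tau> assume \<tau>: "\<tau> \<in> indices R"
  obtain A where A: "\<And>s. s \<in> hs_sums R \<tau> n \<phi> \<Longrightarrow> s \<le> A" using Phi_symD(3)[OF \<phi> \<tau>] unfolding bdd_above_def by blast
  obtain B where B: "\<And>s. s \<in> hs_sums R \<tau> n \<psi> \<Longrightarrow> s \<le> B" using Phi_symD(3)[OF \<psi> \<tau>] unfolding bdd_above_def by blast
  show "bdd_above (hs_sums R \<tau> n (fcomb a \<phi> b \<psi>))"
  proof (rule bdd_aboveI)
    fix s assume "s \<in> hs_sums R \<tau> n (fcomb a \<phi> b \<psi>)"
    then obtain E where E: "finite E" "corthonormal R \<tau> E"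
      and s: "s = (\<Sum>es\<in>{es. length es = n \<and> set es \<subseteq> E}. (cmod (fcomb a \<phi> b \<psi> (map (riesz R \<tau>) es)))\<^sup>2)"
      unfolding hs_sums_def by blast
    let ?S = "\<lambda>\<phi>. \<Sum>es\<in>{es. length es = n \<and> set es \<subseteq> E}. (cmod (\<phi> (map (riesz R \<tau>) es)))\<^sup>2"
    have AB: "?S \<phi> \<le> A" "?S \<psi> \<le> B" by (intro A B, unfold hs_sums_def, use E in blast)+
    have "s \<le> (\<Sum>es\<in>{es. length es = n \<and> set es \<subseteq> E}. 2 * (cmod a)\<^sup>2 * (cmod (\<phi> (map (riesz R \<tau>) es)))\<^sup>2
        + 2 * (cmod b)\<^sup>2 * (cmod (\<psi> (map (riesz R \<tau>) es)))\<^sup>2)"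
      unfolding s
    proof (rule sum_mono)
      fix es
      let ?x = "a * \<phi> (map (riesz R \<tau>) es)" and ?y = "b * \<psi> (map (riesz R \<tau>) es)"
      have "(cmod (?x + ?y))\<^sup>2 \<le> (cmod ?x + cmod ?y)\<^sup>2" by (intro power_mono norm_triangle_ineq) auto
      also have "\<dots> \<le> 2 * (cmod ?x)\<^sup>2 + 2 * (cmod ?y)\<^sup>2"
        using sum_squares_bound[of "cmod ?x" "cmod ?y"] by (simp add: power2_sum)
      finally show "(cmod (fcomb a \<phi> b \<psi> (map (riesz R \<tau>) es)))\<^sup>2
          \<le> 2 * (cmod a)\<^sup>2 * (cmod (\<phi> (map (riesz R \<tau>) es)))\<^sup>2 + 2 * (cmod b)\<^sup>2 * (cmod (\<psi> (map (riesz R \<tau>) es)))\<^sup>2"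
        by (simp add: fcomb_def norm_mult power_mult_distrib)
    qed
    also have "\<dots> = 2 * (cmod a)\<^sup>2 * ?S \<phi> + 2 * (cmod b)\<^sup>2 * ?S \<psi>"
      by (simp add: sum.distrib sum_distrib_left)
    also have "\<dots> \<le> 2 * (cmod a)\<^sup>2 * A + 2 * (cmod b)\<^sup>2 * B"
      using AB by (intro add_mono mult_left_mono) auto
    finally show "s \<le> 2 * (cmod a)\<^sup>2 * A + 2 * (cmod b)\<^sup>2 * B" .
  qed
qed

lemma sym_norm_scale:
  "sym_norm R \<tau> n (fcomb c \<phi> 0 \<phi>) = cmod c * sym_norm R \<tau> n \<phi>" if "bdd_above (hs_sums R \<tau> n \<phi>)"
proof -
  have im: "hs_sums R \<tau> n \<psi> = (\<lambda>E. \<Sum>es\<in>{es. length es = n \<and> set es \<subseteq> E}. (cmod (\<psi> (map (riesz R \<tau>) es)))\<^sup>2)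
      ` {E. finite E \<and> corthonormal R \<tau> E}" for \<psi>
    by (auto simp: hs_sums_def)
  have "hs_sums R \<tau> n (fcomb c \<phi> 0 \<phi>) = (\<lambda>s. (cmod c)\<^sup>2 * s) ` hs_sums R \<tau> n \<phi>"
    unfolding im image_image by (simp add: fcomb_def norm_mult power_mult_distrib sum_distrib_left)
  then have "Sup (hs_sums R \<tau> n (fcomb c \<phi> 0 \<phi>)) = (cmod c)\<^sup>2 * Sup (hs_sums R \<tau> n \<phi>)"
    using continuous_at_Sup_mono[of "\<lambda>s. (cmod c)\<^sup>2 * s" "hs_sums R \<tau> n \<phi>"] that hs_sums_nonempty
    by (simp add: monoI mult_left_mono continuous_intros)
  then show ?thesis by (simp add: sym_norm_def real_sqrt_mult)
qed

lemma neg_sym_bound: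
  assumes "\<tau> \<in> indices R" "F \<in> neg_sym R \<tau> n" "\<phi> \<in> Phi_sym R n"
  shows "cmod (F \<phi>) \<le> neg_sym_norm R \<tau> n F * sym_norm R \<tau> n \<phi>"
  unfolding neg_sym_norm_def
proof (rule dual_norm_bound[OF assms(2)[unfolded neg_sym_def] assms(3)])
  fix c \<psi> assume \<psi>: "\<psi> \<in> Phi_sym R n"
  show "fcomb c \<psi> 0 \<psi> \<in> Phi_sym R n" by (rule Phi_sym_fcomb[OF \<psi> \<psi>])
  show "sym_norm R \<tau> n (fcomb c \<psi> 0 \<psi>) = cmod c * sym_norm R \<tau> n \<psi>"
    by (rule sym_norm_scale[OF Phi_symD(3)[OF \<psi> assms(1)]])
  show "0 \<le> sym_norm R \<tau> n \<psi>" by (rule sym_norm_nonneg[OF Phi_symD(3)[OF \<psi> assms(1)]])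
qed

lemma sym_homogeneous:
  assumes \<phi>: "\<phi> \<in> Phi_sym R n" and \<omega>: "\<omega> \<in> Phi_dual R"
  shows "\<phi> (replicate n (fcomb c \<omega> 0 \<omega>)) = c ^ n * \<phi> (replicate n \<omega>)"
proof -
  let ?v = "fcomb c \<omega> 0 \<omega>"
  have v: "?v \<in> Phi_dual R" using Phi_dual_fcomb \<omega> by blast
  have "\<phi> (replicate k ?v @ replicate (n - k) \<omega>) = c ^ k * \<phi> (replicate n \<omega>)" if "k \<le> n" for k
    using that
  proof (induction k)
    case (Suc k)
    have r: "replicate (n - k) \<omega> = \<omega> # replicate (n - Suc k) \<omega>"
      using Suc.prems by (metis Suc_diff_Suc Suc_le_lessD replicate_Suc)
    have "\<phi> (replicate (Suc k) ?v @ replicate (n - Suc k) \<omega>) = \<phi> (replicate k ?v @ ?v # replicate (n - Suc k) \<omega>)"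
      by (rule sym_perm[OF \<phi>]) simp
    also have "\<dots> = c * \<phi> (replicate k ?v @ \<omega> # replicate (n - Suc k) \<omega>)"
      using sym_linear[OF \<phi> \<omega> \<omega>, of "replicate k ?v" "replicate (n - Suc k) \<omega>" c 0] Suc.prems v \<omega>
      by (simp add: set_replicate_conv_if)
    also have "\<dots> = c * (c ^ k * \<phi> (replicate n \<omega>))" using Suc r by simp
    finally show ?case by simp
  qed simp
  from this[of n] show ?thesis by simp
qed

text \<open>A single unit vector is an orthonormal system, so the value of \<open>\<phi>\<close> on the diagonal at the
  corresponding functional is one of the numbers in the supremum that defines the norm. The
  general case follows by homogeneity.\<close>

lemma diagonal_bound:
  assumes \<tau>: "\<tau> \<in> indices R" and \<phi>: "\<phi> \<in> Phi_sym R n" and \<omega>: "\<omega> \<in> neg_space R \<tau>"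
  shows "cmod (\<phi> (replicate n \<omega>)) \<le> sym_norm R \<tau> n \<phi> * neg_norm R \<tau> \<omega> ^ n"
proof -
  interpret hilbert_member R \<tau> by (rule member[OF \<tau>])
  have bdd: "bdd_above (hs_sums R \<tau> n \<phi>)" by (rule Phi_symD(3)[OF \<phi> \<tau>])
  have nn: "0 \<le> sym_norm R \<tau> n \<phi>" by (rule sym_norm_nonneg[OF bdd])
  obtain e where e: "e \<in> cspace R \<tau>" "\<omega> = riesz R \<tau> e" "cnorm R \<tau> e \<le> neg_norm R \<tau> \<omega>"
    by (rule riesz_representation[OF \<tau> \<omega>])
  have u: "cmod (\<phi> (replicate n (riesz R \<tau> u))) \<le> sym_norm R \<tau> n \<phi>"
    if u: "u \<in> cspace R \<tau>" "cnorm R \<tau> u = 1" for u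
  proof -
    have co: "corthonormal R \<tau> {u}" using u by (simp add: corthonormal_def cinner_self)
    have "{es. length es = n \<and> set es \<subseteq> {u}} = {replicate n u}"
      by (auto simp: replicate_eqI subset_iff intro!: replicate_eqI)
    then have "(cmod (\<phi> (replicate n (riesz R \<tau> u))))\<^sup>2 \<in> hs_sums R \<tau> n \<phi>"
      using hs_sums_memI[OF _ co, where n = n and \<phi> = \<phi>] by simp
    then have "(cmod (\<phi> (replicate n (riesz R \<tau> u))))\<^sup>2 \<le> (sym_norm R \<tau> n \<phi>)\<^sup>2"
      by (rule sym_norm_upper[OF bdd])
    then show ?thesis using nn by (rule power2_le_imp_le)
  qed
  show ?thesis
  proof (cases "cnorm R \<tau> e = 0")
    case True
    then have "e = 0" using e(1) cnorm_definite by blast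
    then have \<omega>0: "\<omega> = (\<lambda>x. 0)"
      using e(2) Phi_cspace[OF \<tau>] cinner_commute[of _ 0] by (auto simp: riesz_def fun_eq_iff)
    show ?thesis
    proof (cases n)
      case 0
      have "{es :: 'v cplx list. length es = n \<and> set es \<subseteq> {}} = {[]}" using 0 by auto
      moreover have "corthonormal R \<tau> {}" by (simp add: corthonormal_def)
      ultimately have "(cmod (\<phi> []))\<^sup>2 \<in> hs_sums R \<tau> n \<phi>"
        using hs_sums_memI[of "{}" \<tau>, where n = n and \<phi> = \<phi>] by (simp only: sum.insert sum.empty finite.emptyI simp_thms
          empty_iff list.map add_0_right)
      then have "(cmod (\<phi> []))\<^sup>2 \<le> (sym_norm R \<tau> n \<phi>)\<^sup>2" by (rule sym_norm_upper[OF bdd])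
      then have "cmod (\<phi> []) \<le> sym_norm R \<tau> n \<phi>" using nn by (rule power2_le_imp_le)
      then show ?thesis using 0 by simp
    next
      case (Suc m)
      have "fcomb 0 \<omega> 0 \<omega> = \<omega>" by (simp add: fcomb_def \<omega>0)
      then have "\<phi> (replicate n \<omega>) = 0"
        using sym_homogeneous[OF \<phi> Phi_dualI[OF \<tau> \<omega>], of 0] Suc by simp
      then show ?thesis using nn neg_norm_nonneg[OF \<tau> \<omega>] by simp
    qed
  next
    case False
    let ?r = "cnorm R \<tau> e"
    have r: "0 < ?r" using False cnorm_nonneg[OF e(1)] by simp
    let ?u = "cscale (of_real (1 / ?r)) e"
    have u1: "?u \<in> cspace R \<tau>" "cnorm R \<tau> ?u = 1" using e(1) r by (simp_all add: cnorm_scale norm_divide)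
    have "\<omega> = fcomb (of_real ?r) (riesz R \<tau> ?u) 0 (riesz R \<tau> ?u)"
      using e(2) r e(1) Phi_cspace[OF \<tau>] by (auto simp: riesz_def fun_eq_iff fcomb_def cinner_scale_right)
    then have "\<phi> (replicate n \<omega>) = of_real ?r ^ n * \<phi> (replicate n (riesz R \<tau> ?u))"
      using sym_homogeneous[OF \<phi> Phi_dualI[OF \<tau> riesz_in(1)[OF \<tau> u1(1)]]] by metis
    then have "cmod (\<phi> (replicate n \<omega>)) = ?r ^ n * cmod (\<phi> (replicate n (riesz R \<tau> ?u)))"
      using r by (simp add: norm_mult norm_power)
    also have "\<dots> \<le> neg_norm R \<tau> \<omega> ^ n * sym_norm R \<tau> n \<phi>"
      using r e(3) u[OF u1] nn by (intro mult_mono power_mono) auto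
    finally show ?thesis by (simp add: mult.commute)
  qed
qed

section \<open>Homogeneous polynomials and derivatives\<close>

lemma monomial_eq: "\<phi> \<in> Phi_sym R n \<Longrightarrow> \<omega> \<in> Phi_dual R \<Longrightarrow> monomial R n \<phi> \<omega> = \<phi> (replicate n \<omega>)"
  by (simp add: monomial_def dual_pow_def)

text \<open>The product rule. The fixed arguments \<open>gs\<close> are kept as a parameter because expanding one of
  the \<open>k\<close> equal arguments moves \<open>\<omega>\<close> and \<open>\<eta>\<close> to that place.\<close>

lemma sym_line_derivative:
  assumes \<phi>: "\<phi> \<in> Phi_sym R n" and \<omega>: "\<omega> \<in> Phi_dual R" and \<eta>: "\<eta> \<in> Phi_dual R"
    and "length gs + k = n" "set gs \<subseteq> Phi_dual R"
  shows "((\<lambda>z. \<phi> (gs @ replicate k (fcomb 1 \<omega> z \<eta>))) has_field_derivative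
      of_nat k * \<phi> (gs @ \<eta> # replicate (k - 1) (fcomb 1 \<omega> t \<eta>))) (at t)"
  using assms(4,5)
proof (induction k arbitrary: gs)
  case (Suc k)
  let ?x = "\<lambda>z. fcomb 1 \<omega> z \<eta>"
  have x: "?x z \<in> Phi_dual R" for z using Phi_dual_fcomb \<omega> \<eta> by blast
  have "(\<lambda>z. \<phi> (gs @ replicate (Suc k) (?x z)))
      = (\<lambda>z. \<phi> ((gs @ [\<omega>]) @ replicate k (?x z)) + z * \<phi> ((gs @ [\<eta>]) @ replicate k (?x z)))"
    using sym_linear[OF \<phi> \<omega> \<eta>, of gs "replicate k (?x _)" 1] Suc.prems x
    by (simp add: set_replicate_conv_if)
  moreover have "((\<lambda>z. \<phi> ((gs @ [\<omega>]) @ replicate k (?x z)) + z * \<phi> ((gs @ [\<eta>]) @ replicate k (?x z)))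
      has_field_derivative of_nat k * \<phi> ((gs @ [\<omega>]) @ \<eta> # replicate (k - 1) (?x t))
        + (1 * \<phi> ((gs @ [\<eta>]) @ replicate k (?x t))
           + t * (of_nat k * \<phi> ((gs @ [\<eta>]) @ \<eta> # replicate (k - 1) (?x t))))) (at t)"
    using Suc.prems \<omega> \<eta>
    by (intro DERIV_add Suc.IH DERIV_cong[OF DERIV_mult[OF DERIV_ident Suc.IH]]) auto
  moreover have "of_nat k * \<phi> ((gs @ [\<omega>]) @ \<eta> # replicate (k - 1) (?x t))
        + (1 * \<phi> ((gs @ [\<eta>]) @ replicate k (?x t))
           + t * (of_nat k * \<phi> ((gs @ [\<eta>]) @ \<eta> # replicate (k - 1) (?x t))))
      = of_nat (Suc k) * \<phi> (gs @ \<eta> # replicate k (?x t))"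
  proof (cases k)
    case (Suc j)
    have "\<phi> (gs @ \<eta> # replicate k (?x t)) = \<phi> ((gs @ [\<eta>]) @ ?x t # replicate j (?x t))" using Suc by simp
    also have "\<dots> = \<phi> ((gs @ [\<eta>]) @ \<omega> # replicate j (?x t)) + t * \<phi> ((gs @ [\<eta>]) @ \<eta> # replicate j (?x t))"
      using sym_linear[OF \<phi> \<omega> \<eta>, of "gs @ [\<eta>]" "replicate j (?x t)" 1 t] Suc Suc.prems x \<eta>
      by (simp add: set_replicate_conv_if)
    also have "\<phi> ((gs @ [\<eta>]) @ \<omega> # replicate j (?x t)) = \<phi> ((gs @ [\<omega>]) @ \<eta> # replicate j (?x t))"
      by (rule sym_perm[OF \<phi>]) simp
    finally show ?thesis using Suc by (simp add: algebra_simps)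
  qed simp
  ultimately show ?case by simp
qed simp

lemma monomial_entire:
  assumes \<phi>: "\<phi> \<in> Phi_sym R n"
  shows "entire_bounded_type (monomial R n \<phi>)"
  unfolding entire_bounded_type_def
proof
  fix \<tau> assume \<tau>: "\<tau> \<in> indices R"
  interpret seminormed "neg_space R \<tau>" "neg_norm R \<tau>" by (rule seminormed_neg[OF \<tau>])
  show "bounded_type (monomial R n \<phi>)"
    unfolding bounded_type_def
  proof (intro conjI ballI allI)
    fix \<omega> \<eta> assume "\<omega> \<in> neg_space R \<tau>" "\<eta> \<in> neg_space R \<tau>"
    then have \<omega>: "\<omega> \<in> Phi_dual R" and \<eta>: "\<eta> \<in> Phi_dual R" using Phi_dualI[OF \<tau>] by auto
    have "(\<lambda>z. monomial R n \<phi> (fcomb 1 \<omega> z \<eta>)) = (\<lambda>z. \<phi> ([] @ replicate n (fcomb 1 \<omega> z \<eta>)))"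
      using monomial_eq[OF \<phi>] Phi_dual_fcomb[OF \<omega> \<eta>] by simp
    moreover have "(\<lambda>z. \<phi> ([] @ replicate n (fcomb 1 \<omega> z \<eta>))) holomorphic_on UNIV"
      unfolding holomorphic_on_def field_differentiable_def
      using sym_line_derivative[OF \<phi> \<omega> \<eta>, of "[]" n] has_field_derivative_at_within by fastforce
    ultimately show "(\<lambda>z. monomial R n \<phi> (fcomb 1 \<omega> z \<eta>)) holomorphic_on UNIV" by simp
  next
    fix r
    have "cmod (monomial R n \<phi> \<omega>) \<le> sym_norm R \<tau> n \<phi> * \<bar>r\<bar> ^ n"
      if \<omega>: "\<omega> \<in> neg_space R \<tau>" "neg_norm R \<tau> \<omega> \<le> r" for \<omega>
    proof -
      have "cmod (monomial R n \<phi> \<omega>) \<le> sym_norm R \<tau> n \<phi> * neg_norm R \<tau> \<omega> ^ n"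
        using diagonal_bound[OF \<tau> \<phi> \<omega>(1)] monomial_eq[OF \<phi> Phi_dualI[OF \<tau> \<omega>(1)]] by simp
      also have "\<dots> \<le> sym_norm R \<tau> n \<phi> * \<bar>r\<bar> ^ n"
        using \<omega> neg_norm_nonneg[OF \<tau> \<omega>(1)] sym_norm_nonneg[OF Phi_symD(3)[OF \<phi> \<tau>]]
        by (intro mult_left_mono power_mono) auto
      finally show ?thesis .
    qed
    then show "\<exists>M. \<forall>\<omega>\<in>neg_space R \<tau>. neg_norm R \<tau> \<omega> \<le> r \<longrightarrow> cmod (monomial R n \<phi> \<omega>) \<le> M" by blast
  qed
qed

lemma Ds_monomial:
  assumes \<phi>: "\<phi> \<in> Phi_sym R n" and "set ws \<subseteq> Phi_dual R" "length ws \<le> n" "\<omega> \<in> Phi_dual R"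
  shows "Ds ws (monomial R n \<phi>) \<omega> = fact n / fact (n - length ws) * \<phi> (ws @ replicate (n - length ws) \<omega>)"
  using assms(2-4)
proof (induction ws arbitrary: \<omega>)
  case Nil
  then show ?case using monomial_eq[OF \<phi> Nil(3)] by simp
next
  case (Cons w ws)
  let ?k = "n - length ws"
  let ?C = "fact n / fact ?k :: complex"
  have k: "?k = Suc (n - length (w # ws))" using Cons.prems by simp
  have "D w (Ds ws (monomial R n \<phi>)) \<omega> = D w (\<lambda>\<omega>. ?C * \<phi> (ws @ replicate ?k \<omega>)) \<omega>"
    by (rule D_cong_dual) (use Cons in auto)
  also have "\<dots> = ?C * (of_nat ?k * \<phi> (ws @ w # replicate (?k - 1) \<omega>))"
    unfolding D_def
  proof (rule DERIV_imp_deriv, rule DERIV_cmult)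
    show "((\<lambda>z. \<phi> (ws @ replicate ?k (fcomb 1 \<omega> z w))) has_field_derivative
        of_nat ?k * \<phi> (ws @ w # replicate (?k - 1) \<omega>)) (at 0)"
      using sym_line_derivative[OF \<phi>, of \<omega> w ws ?k 0] Cons.prems by simp
  qed
  also have "\<phi> (ws @ w # replicate (?k - 1) \<omega>) = \<phi> ((w # ws) @ replicate (n - length (w # ws)) \<omega>)"
    by (rule sym_perm[OF \<phi>]) (use k in simp)
  also have "?C * (of_nat ?k * x) = fact n / fact (n - length (w # ws)) * x" for x
  proof -
    have "fact (Suc m) = of_nat (Suc m) * (fact m :: complex)" for m by simp
    moreover have "of_nat (Suc m) \<noteq> (0 :: complex)" for m by (simp del: of_nat_Suc)
    ultimately show ?thesis unfolding k by (simp add: field_simps del: fact_Suc of_nat_Suc)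
  qed
  finally show ?case by simp
qed

definition deriv_form :: "nat \<Rightarrow> ('v dual \<Rightarrow> complex) \<Rightarrow> 'v dual \<Rightarrow> 'v tensor" where
  "deriv_form n f \<omega> = (\<lambda>ws. if length ws = n \<and> set ws \<subseteq> Phi_dual R then Ds ws f \<omega> else 0)"

text \<open>Cauchy's estimate in \<open>\<H>\<^sub>-\<^sub>\<sigma>\<close>, turned into a Hilbert--Schmidt estimate over \<open>\<H>\<^sub>-\<^sub>\<tau>\<close>.\<close>

lemma deriv_form_bound:
  assumes f: "entire_bounded_type f" and hs: "hs_below \<tau> \<sigma> M" and \<omega>: "\<omega> \<in> neg_space R \<sigma>" and s: "0 < s"
    and c: "\<And>\<zeta>. \<zeta> \<in> neg_space R \<sigma> \<Longrightarrow> neg_norm R \<sigma> \<zeta> \<le> real n * s \<Longrightarrow> cmod (f (fcomb 1 \<omega> 1 \<zeta>)) \<le> c"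
    and x: "x \<in> hs_sums R \<tau> n (deriv_form n f \<omega>)"
  shows "x \<le> ((M / s) ^ n * c)\<^sup>2"
proof -
  note hsD = hs_belowD[OF hs]
  interpret seminormed "neg_space R \<sigma>" "neg_norm R \<sigma>" by (rule seminormed_neg[OF hsD(2)])
  have "neg_norm R \<sigma> (\<lambda>x. 0) \<le> 0" using N_fcomb[OF V_zero V_zero, of 0 0] by (simp add: fcomb_def)
  then have c0: "0 \<le> c" using c[OF V_zero] s norm_ge_zero order_trans by (metis mult_nonneg_nonneg of_nat_0_le_iff less_imp_le)
  have "x \<le> ((c / s ^ n) * M ^ n)\<^sup>2"
  proof (rule hs_sums_bound[OF hs _ _ x])
    show "0 \<le> c / s ^ n" using c0 s by simp
    fix ws assume ws: "length ws = n" "set ws \<subseteq> neg_space R \<tau>"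
    have ws': "set ws \<subseteq> neg_space R \<sigma>" using ws(2) hsD(4) by blast
    have "deriv_form n f \<omega> ws = Ds ws f \<omega>"
      using ws Phi_dualI[OF hsD(1)] by (auto simp: deriv_form_def)
    also have "cmod \<dots> \<le> prod_list (map (neg_norm R \<sigma>) ws) / s ^ length ws * c"
      by (rule Ds_bound[OF entire_bounded_typeD[OF f hsD(2)] s ws' \<omega>]) (use c ws in auto)
    finally show "cmod (deriv_form n f \<omega> ws) \<le> c / s ^ n * prod_list (map (neg_norm R \<sigma>) ws)"
      using ws by (simp add: mult.commute)
  qed
  also have "(c / s ^ n) * M ^ n = (M / s) ^ n * c" by (simp add: power_divide)
  finally show ?thesis .
qed

lemma deriv_form_norm:
  assumes f: "entire_bounded_type f" and hs: "hs_below \<tau> \<sigma> M" and \<omega>: "\<omega> \<in> neg_space R \<sigma>" and s: "0 < s"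
    and c: "\<And>\<zeta>. \<zeta> \<in> neg_space R \<sigma> \<Longrightarrow> neg_norm R \<sigma> \<zeta> \<le> real n * s \<Longrightarrow> cmod (f (fcomb 1 \<omega> 1 \<zeta>)) \<le> c"
  shows "sym_norm R \<tau> n (deriv_form n f \<omega>) \<le> (M / s) ^ n * c"
proof (rule sym_norm_le)
  note hsD = hs_belowD[OF hs]
  interpret seminormed "neg_space R \<sigma>" "neg_norm R \<sigma>" by (rule seminormed_neg[OF hsD(2)])
  have "neg_norm R \<sigma> (\<lambda>x. 0) \<le> 0" using N_fcomb[OF V_zero V_zero, of 0 0] by (simp add: fcomb_def)
  then have c0: "0 \<le> c" using c[OF V_zero] s norm_ge_zero order_trans by (metis mult_nonneg_nonneg of_nat_0_le_iff less_imp_le)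
  then show "0 \<le> (M / s) ^ n * c" using s hsD(3) by simp
qed (rule deriv_form_bound[OF assms])

text \<open>Symmetry and multilinearity hold for derivatives of any function of bounded type. The
  Hilbert--Schmidt property over every \<open>\<H>\<^sub>-\<^sub>\<tau>\<close> holds because \<open>\<Phi>\<close> is nuclear.\<close>

lemma deriv_form_in:
  assumes f: "entire_bounded_type f" and \<omega>: "\<omega> \<in> Phi_dual R"
  shows "deriv_form n f \<omega> \<in> Phi_sym R n"
proof (rule Phi_symI)
  show "deriv_form n f \<omega> ws = 0" if "\<not> (length ws = n \<and> set ws \<subseteq> Phi_dual R)" for ws
    using that by (simp only: deriv_form_def if_False)
next
  fix ws vs assume ws: "mset ws = mset vs" "length ws = n" "set ws \<subseteq> Phi_dual R"
  have s: "set ws = set vs" "length ws = length vs" using ws(1) mset_eq_setD mset_eq_length by blast+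
  have "set (\<omega> # ws) \<subseteq> Phi_dual R" using ws \<omega> by simp
  then obtain \<tau> where \<tau>: "\<tau> \<in> indices R" and "set (\<omega> # ws) \<subseteq> neg_space R \<tau>"
    using Phi_dual_common_list by blast
  then have "Ds ws f \<omega> = Ds vs f \<omega>"
    using ws(1) by (intro seminormed.Ds_perm[OF seminormed_neg[OF \<tau>] entire_bounded_typeD[OF f \<tau>]]) auto
  then show "deriv_form n f \<omega> ws = deriv_form n f \<omega> vs" using s by (simp add: deriv_form_def)
next
  fix ws i a b v w
  assume v: "v \<in> Phi_dual R" and w: "w \<in> Phi_dual R" and i: "i < n" "length ws = n" "set ws \<subseteq> Phi_dual R"
  have "set (\<omega> # v # w # ws) \<subseteq> Phi_dual R" using v w i \<omega> by simp
  then obtain \<tau> where \<tau>: "\<tau> \<in> indices R" and "set (\<omega> # v # w # ws) \<subseteq> neg_space R \<tau>"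
    using Phi_dual_common_list by blast
  then have *: "Ds (ws[i := fcomb a v b w]) f \<omega> = a * Ds (ws[i := v]) f \<omega> + b * Ds (ws[i := w]) f \<omega>"
    using i by (intro seminormed.Ds_slot_linear[OF seminormed_neg[OF \<tau>] entire_bounded_typeD[OF f \<tau>]]) auto
  have "set (ws[i := x]) \<subseteq> Phi_dual R" if "x \<in> Phi_dual R" for x
    using that i set_update_subset_insert[of ws i x] by blast
  then show "deriv_form n f \<omega> (ws[i := fcomb a v b w]) = a * deriv_form n f \<omega> (ws[i := v]) + b * deriv_form n f \<omega> (ws[i := w])"
    using * v w Phi_dual_fcomb[OF v w] i by (simp add: deriv_form_def)
next
  fix \<tau> assume \<tau>: "\<tau> \<in> indices R"
  obtain \<tau>' where \<tau>': "\<tau>' \<in> indices R" "\<omega> \<in> neg_space R \<tau>'" using \<omega> by (auto simp: Phi_dual_def)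
  obtain \<sigma> M K where hs: "hs_below \<tau> \<sigma> M"
    and K: "\<And>\<omega>. \<omega> \<in> neg_space R \<tau>' \<Longrightarrow> \<omega> \<in> neg_space R \<sigma> \<and> neg_norm R \<sigma> \<omega> \<le> K * neg_norm R \<tau>' \<omega>"
    using hs_below_exists[OF \<tau> \<tau>'(1)] by blast
  have \<omega>': "\<omega> \<in> neg_space R \<sigma>" using K \<tau>'(2) by blast
  interpret seminormed "neg_space R \<sigma>" "neg_norm R \<sigma>" by (rule seminormed_neg[OF hs_belowD(2)[OF hs]])
  obtain c where c: "\<And>\<zeta>. \<zeta> \<in> neg_space R \<sigma> \<Longrightarrow> neg_norm R \<sigma> \<zeta> \<le> neg_norm R \<sigma> \<omega> + real n \<Longrightarrow> cmod (f \<zeta>) \<le> c"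
    using bounded_type_bounded[OF entire_bounded_typeD[OF f hs_belowD(2)[OF hs]]] by blast
  show "bdd_above (hs_sums R \<tau> n (deriv_form n f \<omega>))"
  proof (rule bdd_aboveI, rule deriv_form_bound[OF f hs \<omega>', where s = 1])
    fix \<zeta> assume \<zeta>: "\<zeta> \<in> neg_space R \<sigma>" "neg_norm R \<sigma> \<zeta> \<le> real n * 1"
    then show "cmod (f (fcomb 1 \<omega> 1 \<zeta>)) \<le> c"
      using N_line[OF \<omega>' \<zeta>(1), of 1 "real n"] by (intro c V_fcomb \<omega>' \<zeta>) simp_all
  qed simp_all
qed

text \<open>Polarization: \<open>n! \<phi>\<close> is the \<open>n\<close>-th derivative at \<open>0\<close> of the homogeneous polynomial given by
  \<open>\<phi>\<close>, so the estimate for derivatives applies. The balls of radius \<open>1/n\<close> chosen for the single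
  derivatives add up to the unit ball.\<close>

lemma sym_norm_le_diagonal:
  assumes \<phi>: "\<phi> \<in> Phi_sym R n" and hs: "hs_below \<tau> \<sigma> M"
    and c: "\<And>\<zeta>. \<zeta> \<in> neg_space R \<sigma> \<Longrightarrow> neg_norm R \<sigma> \<zeta> \<le> 1 \<Longrightarrow> cmod (\<phi> (replicate n \<zeta>)) \<le> c"
  shows "sym_norm R \<tau> n \<phi> \<le> (M * exp 1) ^ n * c"
proof -
  note hsD = hs_belowD[OF hs]
  interpret seminormed "neg_space R \<sigma>" "neg_norm R \<sigma>" by (rule seminormed_neg[OF hsD(2)])
  have "neg_norm R \<sigma> (\<lambda>x. 0) \<le> 1" using N_fcomb[OF V_zero V_zero, of 0 0] by (simp add: fcomb_def)
  then have c0: "0 \<le> c" using c[OF V_zero] norm_ge_zero order_trans by blast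
  let ?f = "monomial R n \<phi>"
  define s where "s = (if n = 0 then 1 else 1 / real n)"
  have s: "0 < s" "real n * s \<le> 1" by (auto simp: s_def)
  have sn: "1 / s ^ n \<le> exp 1 ^ n * fact n"
    using power_self_le_exp_fact[of n] by (auto simp: s_def power_divide)
  have "sym_norm R \<tau> n (deriv_form n ?f (\<lambda>x. 0)) \<le> (M / s) ^ n * c"
  proof (rule deriv_form_norm[OF monomial_entire[OF \<phi>] hs V_zero s(1)])
    fix \<zeta> assume \<zeta>: "\<zeta> \<in> neg_space R \<sigma>" "neg_norm R \<sigma> \<zeta> \<le> real n * s"
    have "fcomb 1 (\<lambda>x. 0) 1 \<zeta> = \<zeta>" by (simp add: fcomb_def)
    then show "cmod (?f (fcomb 1 (\<lambda>x. 0) 1 \<zeta>)) \<le> c"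
      using c[OF \<zeta>(1)] \<zeta>(2) s(2) monomial_eq[OF \<phi> Phi_dualI[OF hsD(2) \<zeta>(1)]] by simp
  qed
  moreover have "hs_sums R \<tau> n (deriv_form n ?f (\<lambda>x. 0)) = hs_sums R \<tau> n (fcomb (fact n) \<phi> 0 \<phi>)"
  proof (rule hs_sums_cong[OF hsD(1)])
    fix ws assume ws: "length ws = n" "set ws \<subseteq> neg_space R \<tau>"
    then have "set ws \<subseteq> Phi_dual R" using Phi_dualI[OF hsD(1)] by blast
    then show "deriv_form n ?f (\<lambda>x. 0) ws = fcomb (fact n) \<phi> 0 \<phi> ws"
      using ws Ds_monomial[OF \<phi>, of ws "\<lambda>x. 0"] Phi_dual_zero by (simp add: deriv_form_def fcomb_def)
  qed
  then have "sym_norm R \<tau> n (deriv_form n ?f (\<lambda>x. 0)) = fact n * sym_norm R \<tau> n \<phi>"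
    using sym_norm_scale[OF Phi_symD(3)[OF \<phi> hsD(1)], of "fact n"] by (simp add: sym_norm_def)
  ultimately have "fact n * sym_norm R \<tau> n \<phi> \<le> M ^ n * c * (1 / s ^ n)" by (simp add: power_divide)
  also have "\<dots> \<le> M ^ n * c * (exp 1 ^ n * fact n)"
    using sn c0 hsD(3) by (intro mult_left_mono) auto
  also have "\<dots> = fact n * ((M * exp 1) ^ n * c)" by (simp add: power_mult_distrib)
  finally show ?thesis by simp
qed

end

section \<open>Density of powers in the symmetric tensors\<close>

text \<open>With \<open>w\<close> a primitive root of unity of order \<open>m + 1\<close>, the average over \<open>s\<close> of
  \<open>w\<^sup>s\<^sup>m (a + w\<^sup>s b)\<^sup>m\<close> keeps the terms \<open>a\<^sup>j b\<^sup>m\<^sup>-\<^sup>j\<close> for which \<open>m + 1\<close> divides \<open>m + (m - j)\<close>, and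
  \<open>j = m - 1\<close> is the only one.\<close>

lemma roots_of_unity_filter:
  assumes m: "1 \<le> m"
  shows "\<exists>(N::nat) c t. \<forall>a b :: complex. (\<Sum>s<N. c s * (a + t s * b) ^ m) = a ^ (m - 1) * b"
proof -
  define N where "N = Suc m"
  define w where "w = exp (2 * of_real pi * \<i> * of_nat 1 / of_nat N)"
  have w1: "w ^ j = 1 \<longleftrightarrow> N dvd j" for j
  proof -
    have "w ^ j = exp (2 * of_real pi * \<i> * of_nat j / of_nat N)"
      unfolding w_def by (subst exp_of_nat_mult[symmetric]) (simp add: mult_ac)
    then show ?thesis using complex_root_unity_eq_1[of N j] by (simp add: N_def)
  qed
  have inner: "(\<Sum>s<N. (w ^ (2 * m - j)) ^ s) = (if j = m - 1 then of_nat N else 0)" if j: "j \<le> m" for j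
  proof (cases "N dvd 2 * m - j")
    case True
    then obtain q where q: "2 * m - j = N * q" by blast
    have "q = 1"
    proof -
      have "q \<noteq> 0" using q j m by (metis N_def add_diff_cancel_left' diff_is_0_eq mult_0_right mult_2 not_one_le_zero le_add_diff_inverse2 le_trans nat_le_linear)
      moreover have "q < 2"
      proof (rule ccontr)
        assume "\<not> q < 2"
        then have "N * 2 \<le> N * q" by (intro mult_le_mono2) simp
        then show False using q by (simp add: N_def)
      qed
      ultimately show ?thesis by simp
    qed
    then have "j = m - 1" using q j m by (simp add: N_def)
    then show ?thesis using w1[of "2 * m - j"] True by simp
  next
    case False
    then have "w ^ (2 * m - j) \<noteq> 1" using w1 by blast
    then have "(\<Sum>s<N. (w ^ (2 * m - j)) ^ s) = ((w ^ (2 * m - j)) ^ N - 1) / (w ^ (2 * m - j) - 1)"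
      by (rule geometric_sum)
    also have "(w ^ (2 * m - j)) ^ N = 1" using w1[of "(2 * m - j) * N"] by (simp add: power_mult)
    finally have "(\<Sum>s<N. (w ^ (2 * m - j)) ^ s) = 0" by simp
    moreover have "j \<noteq> m - 1"
    proof
      assume "j = m - 1"
      then have "2 * m - j = N" using m by (simp add: N_def)
      then show False using False by simp
    qed
    ultimately show ?thesis by simp
  qed
  have "(\<Sum>s<N. (w ^ (s * m) / (of_nat N * of_nat m)) * (a + w ^ s * b) ^ m) = a ^ (m - 1) * b" for a b :: complex
  proof -
    have "(\<Sum>s<N. w ^ (s * m) * (a + w ^ s * b) ^ m)
        = (\<Sum>s<N. \<Sum>j\<le>m. of_nat (m choose j) * a ^ j * b ^ (m - j) * (w ^ (2 * m - j)) ^ s)"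
    proof (rule sum.cong[OF refl])
      fix s
      have "w ^ (s * m) * (a + w ^ s * b) ^ m = (\<Sum>j\<le>m. w ^ (s * m) * (of_nat (m choose j) * a ^ j * (w ^ s * b) ^ (m - j)))"
        by (simp add: binomial_ring sum_distrib_left)
      also have "\<dots> = (\<Sum>j\<le>m. of_nat (m choose j) * a ^ j * b ^ (m - j) * (w ^ (2 * m - j)) ^ s)"
      proof (rule sum.cong[OF refl])
        fix j assume "j \<in> {..m}"
        then have "s * m + s * (m - j) = (2 * m - j) * s" by (simp add: algebra_simps diff_mult_distrib2)
        then have "w ^ (s * m) * w ^ (s * (m - j)) = w ^ ((2 * m - j) * s)" by (simp only: power_add[symmetric])
        then have "w ^ (s * m) * (w ^ s) ^ (m - j) = (w ^ (2 * m - j)) ^ s" by (simp only: power_mult[symmetric])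
        then show "w ^ (s * m) * (of_nat (m choose j) * a ^ j * (w ^ s * b) ^ (m - j))
            = of_nat (m choose j) * a ^ j * b ^ (m - j) * (w ^ (2 * m - j)) ^ s"
          by (simp add: power_mult_distrib mult_ac)
      qed
      finally show "w ^ (s * m) * (a + w ^ s * b) ^ m
          = (\<Sum>j\<le>m. of_nat (m choose j) * a ^ j * b ^ (m - j) * (w ^ (2 * m - j)) ^ s)" .
    qed
    also have "\<dots> = (\<Sum>j\<le>m. of_nat (m choose j) * a ^ j * b ^ (m - j) * (\<Sum>s<N. (w ^ (2 * m - j)) ^ s))"
      by (subst sum.swap) (simp add: sum_distrib_left)
    also have "\<dots> = (\<Sum>j\<le>m. of_nat (m choose j) * a ^ j * b ^ (m - j) * (if j = m - 1 then of_nat N else 0))"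
      by (intro sum.cong) (auto simp: inner)
    also have "\<dots> = of_nat (m choose (m - 1)) * a ^ (m - 1) * b ^ (m - (m - 1)) * of_nat N"
      by (simp add: mult_delta_right)
    also have "\<dots> = of_nat N * of_nat m * (a ^ (m - 1) * b)"
      using m binomial_symmetric[of 1 m] by (simp add: mult_ac)
    finally have "(\<Sum>s<N. w ^ (s * m) * (a + w ^ s * b) ^ m) / (of_nat N * of_nat m) = a ^ (m - 1) * b"
      using m by (simp add: N_def del: of_nat_Suc)
    then show ?thesis by (simp add: sum_divide_distrib)
  qed
  then show ?thesis
    by (intro exI[of _ N] exI[of _ "\<lambda>s. w ^ (s * m) / (of_nat N * of_nat m)"] exI[of _ "\<lambda>s. w ^ s"] allI)
qed

lemma prod_list_mset_eq:
  fixes f :: "'a \<Rightarrow> complex"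
  assumes "mset ws = mset vs"
  shows "prod_list (map f ws) = prod_list (map f vs)"
  using assms by (metis mset_map prod_mset_prod_list)

context nuclear_family
begin

lemma Phi_dual_linear:
  assumes "\<omega> \<in> Phi_dual R" "z \<in> Phi R" "w \<in> Phi R"
  shows "\<omega> (ccomb a z b w) = a * \<omega> z + b * \<omega> w"
  using assms neg_linear unfolding Phi_dual_def by blast

lemma tensor_pow_in:
  assumes \<xi>: "\<xi> \<in> Phi R"
  shows "tensor_pow R n \<xi> \<in> Phi_sym R n"
proof (rule Phi_symI)
  show "tensor_pow R n \<xi> ws = 0" if "\<not> (length ws = n \<and> set ws \<subseteq> Phi_dual R)" for ws
    using that by (simp only: tensor_pow_def if_False)
  show "tensor_pow R n \<xi> ws = tensor_pow R n \<xi> vs" if "mset ws = mset vs" for ws vs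
    using prod_list_mset_eq[OF that, of "\<lambda>\<omega>. \<omega> \<xi>"] mset_eq_setD[OF that] mset_eq_length[OF that]
    by (simp add: tensor_pow_def)
  show "tensor_pow R n \<xi> (ws[i := fcomb a v b w]) = a * tensor_pow R n \<xi> (ws[i := v]) + b * tensor_pow R n \<xi> (ws[i := w])"
    if vw: "v \<in> Phi_dual R" "w \<in> Phi_dual R" and i: "i < n" "length ws = n" "set ws \<subseteq> Phi_dual R" for ws i a b v w
  proof -
    have "set (ws[i := x]) \<subseteq> Phi_dual R" if "x \<in> Phi_dual R" for x
      using that i set_update_subset_insert[of ws i x] by blast
    then have "tensor_pow R n \<xi> (ws[i := x])
        = prod_list (take i (map (\<lambda>\<omega>. \<omega> \<xi>) ws)) * (x \<xi> * prod_list (drop (Suc i) (map (\<lambda>\<omega>. \<omega> \<xi>) ws)))"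
      if "x \<in> Phi_dual R" for x
      using that i by (simp add: tensor_pow_def map_update upd_conv_take_nth_drop take_map drop_map)
    then show ?thesis using vw Phi_dual_fcomb[OF vw] by (simp add: fcomb_def algebra_simps)
  qed
  fix \<tau> assume \<tau>: "\<tau> \<in> indices R"
  obtain \<sigma> M K where hs: "hs_below \<tau> \<sigma> M" using hs_below_exists[OF \<tau> \<tau>] by blast
  note hsD = hs_belowD[OF hs]
  interpret s: hilbert_member R \<sigma> by (rule member[OF hsD(2)])
  let ?x = "cnorm R \<sigma> \<xi>"
  have x: "0 \<le> ?x" by (rule s.cnorm_nonneg[OF Phi_cspace[OF hsD(2) \<xi>]])
  have b: "cmod (prod_list (map (\<lambda>\<omega>. \<omega> \<xi>) ws)) \<le> ?x ^ length ws * prod_list (map (neg_norm R \<sigma>) ws)"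
    if "set ws \<subseteq> neg_space R \<sigma>" for ws
    using that
  proof (induction ws)
    case (Cons w ws)
    have "cmod (w \<xi> * prod_list (map (\<lambda>\<omega>. \<omega> \<xi>) ws))
        \<le> (neg_norm R \<sigma> w * ?x) * (?x ^ length ws * prod_list (map (neg_norm R \<sigma>) ws))"
      unfolding norm_mult
      by (intro mult_mono neg_bound[OF hsD(2) _ \<xi>] Cons.IH mult_nonneg_nonneg neg_norm_nonneg[OF hsD(2)] x norm_ge_zero)
         (use Cons.prems in auto)
    then show ?case by (simp add: mult_ac)
  qed simp
  show "bdd_above (hs_sums R \<tau> n (tensor_pow R n \<xi>))"
  proof (rule bdd_aboveI, rule hs_sums_bound[OF hs])
    show "0 \<le> ?x ^ n" using x by simp
    fix ws assume ws: "length ws = n" "set ws \<subseteq> neg_space R \<tau>"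
    have "set ws \<subseteq> neg_space R \<sigma>" "set ws \<subseteq> Phi_dual R" using ws(2) hsD(4) Phi_dualI[OF hsD(1)] by blast+
    then show "cmod (tensor_pow R n \<xi> ws) \<le> ?x ^ n * prod_list (map (neg_norm R \<sigma>) ws)"
      using b[of ws] ws(1) by (simp add: tensor_pow_def)
  qed
qed

lemma tensor_pow_replicate:
  "\<omega> \<in> Phi_dual R \<Longrightarrow> tensor_pow R n \<xi> (replicate n \<omega>) = \<omega> \<xi> ^ n"
  by (simp add: tensor_pow_def set_replicate_conv_if)

text \<open>A symmetric tensor enters as the homogeneous polynomial \<open>h\<close> that it induces on \<open>\<Phi>'\<close>. The
  functional \<open>F\<close> is one that vanishes on powers, and the aim is to find more and more polynomials
  on which it vanishes.\<close>

definition diagonal_in :: "nat \<Rightarrow> ('v tensor \<Rightarrow> complex) \<Rightarrow> ('v dual \<Rightarrow> complex) \<Rightarrow> bool" where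
  "diagonal_in n F h \<longleftrightarrow> (\<exists>\<psi>\<in>Phi_sym R n. F \<psi> = 0 \<and> (\<forall>\<omega>\<in>Phi_dual R. \<psi> (replicate n \<omega>) = h \<omega>))"

lemma diagonal_in_cong:
  "diagonal_in n F h \<Longrightarrow> (\<And>\<omega>. \<omega> \<in> Phi_dual R \<Longrightarrow> h \<omega> = k \<omega>) \<Longrightarrow> diagonal_in n F k"
  unfolding diagonal_in_def by auto

context
  fixes n :: nat and F :: "'v tensor \<Rightarrow> complex"
  assumes linear: "\<And>a b \<phi> \<psi>. \<phi> \<in> Phi_sym R n \<Longrightarrow> \<psi> \<in> Phi_sym R n \<Longrightarrow> F (fcomb a \<phi> b \<psi>) = a * F \<phi> + b * F \<psi>"
    and powers: "\<And>\<xi>. \<xi> \<in> Phi R \<Longrightarrow> F (tensor_pow R n \<xi>) = 0"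
begin

lemma diagonal_in_fcomb:
  assumes "diagonal_in n F h" "diagonal_in n F k"
  shows "diagonal_in n F (\<lambda>\<omega>. a * h \<omega> + b * k \<omega>)"
proof -
  obtain \<phi> where \<phi>: "\<phi> \<in> Phi_sym R n" "F \<phi> = 0" "\<And>\<omega>. \<omega> \<in> Phi_dual R \<Longrightarrow> \<phi> (replicate n \<omega>) = h \<omega>"
    using assms(1) unfolding diagonal_in_def by blast
  obtain \<psi> where \<psi>: "\<psi> \<in> Phi_sym R n" "F \<psi> = 0" "\<And>\<omega>. \<omega> \<in> Phi_dual R \<Longrightarrow> \<psi> (replicate n \<omega>) = k \<omega>"
    using assms(2) unfolding diagonal_in_def by blast
  show ?thesis unfolding diagonal_in_def
  proof (intro bexI conjI ballI)
    show "fcomb a \<phi> b \<psi> \<in> Phi_sym R n" by (rule Phi_sym_fcomb[OF \<phi>(1) \<psi>(1)])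
    show "F (fcomb a \<phi> b \<psi>) = 0" using linear[OF \<phi>(1) \<psi>(1)] \<phi>(2) \<psi>(2) by simp
    show "fcomb a \<phi> b \<psi> (replicate n \<omega>) = a * h \<omega> + b * k \<omega>" if "\<omega> \<in> Phi_dual R" for \<omega>
      using \<phi>(3)[OF that] \<psi>(3)[OF that] by (simp add: fcomb_def)
  qed
qed

lemma diagonal_in_power: "\<xi> \<in> Phi R \<Longrightarrow> diagonal_in n F (\<lambda>\<omega>. \<omega> \<xi> ^ n)"
  unfolding diagonal_in_def
  by (rule bexI[OF _ tensor_pow_in]) (simp_all add: powers tensor_pow_replicate)

lemma diagonal_in_sum:
  "finite I \<Longrightarrow> (\<And>i. i \<in> I \<Longrightarrow> diagonal_in n F (h i)) \<Longrightarrow> diagonal_in n F (\<lambda>\<omega>. \<Sum>i\<in>I. c i * h i \<omega>)"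
proof (induction I rule: finite_induct)
  case empty
  show ?case
    using diagonal_in_fcomb[OF diagonal_in_power[OF Phi_zero] diagonal_in_power[OF Phi_zero], of 0 0] by simp
next
  case (insert i I)
  have "diagonal_in n F (\<lambda>\<omega>. c i * h i \<omega> + 1 * (\<Sum>i\<in>I. c i * h i \<omega>))"
    by (rule diagonal_in_fcomb) (use insert in auto)
  then show ?case using insert by simp
qed

text \<open>Starting from the power \<open>\<omega> x ^ n\<close>, each use of the filter replaces one factor \<open>\<omega> x\<close> by a
  factor \<open>\<omega> y\<close>; the powers of \<open>\<omega> x + t \<omega> y = \<omega> (x + t y)\<close> that occur are covered since \<open>x\<close> is
  arbitrary.\<close>

lemma diagonal_in_product:
  assumes "set ys \<subseteq> Phi R" "length ys \<le> n" "x \<in> Phi R"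
  shows "diagonal_in n F (\<lambda>\<omega>. prod_list (map \<omega> ys) * \<omega> x ^ (n - length ys))"
  using assms
proof (induction ys arbitrary: x)
  case Nil
  then show ?case using diagonal_in_power by simp
next
  case (Cons y ys)
  let ?m = "n - length ys"
  have m: "1 \<le> ?m" "?m - 1 = n - length (y # ys)" using Cons.prems by auto
  obtain N :: nat and c t where filter: "\<forall>a b :: complex. (\<Sum>s<N. c s * (a + t s * b) ^ ?m) = a ^ (?m - 1) * b"
    using roots_of_unity_filter[OF m(1)] by blast
  have "diagonal_in n F (\<lambda>\<omega>. \<Sum>s<N. c s * (prod_list (map \<omega> ys) * \<omega> (ccomb 1 x (t s) y) ^ ?m))"
    by (rule diagonal_in_sum) (use Cons Phi_ccomb in auto)
  then show ?case
  proof (rule diagonal_in_cong)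
    fix \<omega> assume \<omega>: "\<omega> \<in> Phi_dual R"
    have "(\<Sum>s<N. c s * (prod_list (map \<omega> ys) * \<omega> (ccomb 1 x (t s) y) ^ ?m))
        = prod_list (map \<omega> ys) * (\<Sum>s<N. c s * (\<omega> x + t s * \<omega> y) ^ ?m)"
      using Phi_dual_linear[OF \<omega> Cons.prems(3), of y 1] Cons.prems by (simp add: sum_distrib_left mult_ac)
    also have "\<dots> = prod_list (map \<omega> ys) * (\<omega> x ^ (?m - 1) * \<omega> y)" by (simp only: filter[rule_format])
    finally show "(\<Sum>s<N. c s * (prod_list (map \<omega> ys) * \<omega> (ccomb 1 x (t s) y) ^ ?m))
        = prod_list (map \<omega> (y # ys)) * \<omega> x ^ (n - length (y # ys))"
      unfolding m(2) by (simp add: mult_ac)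
  qed
qed

lemma sym_linear_sum:
  assumes \<phi>: "\<phi> \<in> Phi_sym R n" and I: "finite I" and g: "\<And>i. i \<in> I \<Longrightarrow> g i \<in> Phi_dual R"
    and as: "Suc (length as + length bs) = n" "set as \<subseteq> Phi_dual R" "set bs \<subseteq> Phi_dual R"
  shows "(\<lambda>\<xi>. \<Sum>i\<in>I. c i * g i \<xi>) \<in> Phi_dual R \<and>
    \<phi> (as @ (\<lambda>\<xi>. \<Sum>i\<in>I. c i * g i \<xi>) # bs) = (\<Sum>i\<in>I. c i * \<phi> (as @ g i # bs))"
  using I g
proof (induction I rule: finite_induct)
  case empty
  have "fcomb 0 (\<lambda>x. 0) 0 (\<lambda>x. 0) = (\<lambda>x :: 'v cplx. 0)" by (simp add: fcomb_def)
  then show ?case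
    using sym_linear[OF \<phi> Phi_dual_zero Phi_dual_zero as, of 0 0] Phi_dual_zero by simp
next
  case (insert i I)
  let ?g = "\<lambda>\<xi>. \<Sum>i\<in>I. c i * g i \<xi>"
  have IH: "?g \<in> Phi_dual R" "\<phi> (as @ ?g # bs) = (\<Sum>i\<in>I. c i * \<phi> (as @ g i # bs))" using insert by auto
  have gi: "g i \<in> Phi_dual R" using insert by blast
  have "fcomb (c i) (g i) 1 ?g = (\<lambda>\<xi>. \<Sum>i\<in>insert i I. c i * g i \<xi>)" using insert by (simp add: fcomb_def)
  then show ?case
    using sym_linear[OF \<phi> gi IH(1) as, of "c i" 1] Phi_dual_fcomb[OF gi IH(1), of "c i" 1] IH(2) insert(1,2)
    by simp
qed

text \<open>Multilinear expansion of all \<open>n\<close> arguments leaves a combination of products of evaluations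
  \<open>\<omega> (x i)\<close>. In the induction \<open>gs\<close> and \<open>ys\<close> collect the functionals and points from the arguments
  that are already expanded.\<close>

lemma diagonal_in_finite_rank:
  assumes \<phi>: "\<phi> \<in> Phi_sym R n" and I: "finite I"
    and g: "\<And>i. i \<in> I \<Longrightarrow> g i \<in> Phi_dual R" and x: "\<And>i. i \<in> I \<Longrightarrow> x i \<in> Phi R"
  shows "diagonal_in n F (\<lambda>\<omega>. \<phi> (replicate n (\<lambda>\<xi>. \<Sum>i\<in>I. \<omega> (x i) * g i \<xi>)))"
proof -
  let ?P = "\<lambda>\<omega> \<xi>. \<Sum>i\<in>I. \<omega> (x i) * g i \<xi>"
  have "diagonal_in n F (\<lambda>\<omega>. prod_list (map \<omega> ys) * \<phi> (gs @ replicate m (?P \<omega>)))"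
    if "length gs + m = n" "length ys = length gs" "set gs \<subseteq> Phi_dual R" "set ys \<subseteq> Phi R" for gs ys m
    using that
  proof (induction m arbitrary: gs ys)
    case 0
    have "diagonal_in n F (\<lambda>\<omega>. prod_list (map \<omega> ys) * \<omega> 0 ^ (n - length ys))"
      by (rule diagonal_in_product) (use 0 Phi_zero in auto)
    then have p: "diagonal_in n F (\<lambda>\<omega>. prod_list (map \<omega> ys))" using 0 by simp
    show ?case using diagonal_in_fcomb[OF p p, of "\<phi> gs" 0] by (simp add: mult.commute)
  next
    case (Suc m)
    have "diagonal_in n F (\<lambda>\<omega>. \<Sum>i\<in>I. 1 * (prod_list (map \<omega> (ys @ [x i])) * \<phi> ((gs @ [g i]) @ replicate m (?P \<omega>))))"
      by (rule diagonal_in_sum[OF I], rule Suc.IH) (use Suc.prems g x in auto)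
    then show ?case
    proof (rule diagonal_in_cong)
      fix \<omega>
      have P: "?P \<omega> \<in> Phi_dual R"
        using sym_linear_sum[OF \<phi> I g, where as = gs and bs = "replicate m (\<lambda>x. 0)" and c = "\<lambda>i. \<omega> (x i)"] Suc.prems Phi_dual_zero
        by (simp add: set_replicate_conv_if)
      have "\<phi> (gs @ replicate (Suc m) (?P \<omega>)) = (\<Sum>i\<in>I. \<omega> (x i) * \<phi> (gs @ g i # replicate m (?P \<omega>)))"
        using sym_linear_sum[OF \<phi> I g, where as = gs and bs = "replicate m (?P \<omega>)" and c = "\<lambda>i. \<omega> (x i)"] Suc.prems P
        by (simp add: set_replicate_conv_if)
      then show "(\<Sum>i\<in>I. 1 * (prod_list (map \<omega> (ys @ [x i])) * \<phi> ((gs @ [g i]) @ replicate m (?P \<omega>))))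
          = prod_list (map \<omega> ys) * \<phi> (gs @ replicate (Suc m) (?P \<omega>))"
        by (simp add: sum_distrib_left mult_ac)
    qed
  qed
  from this[of "[]" n "[]"] show ?thesis by simp
qed

end

text \<open>Being Hilbert--Schmidt, the inclusion \<open>\<H>\<^sub>-\<^sub>\<tau> \<subseteq> \<H>\<^sub>-\<^sub>\<sigma>\<close> is a norm limit of finite rank
  operators, obtained by restricting the expansion in an orthonormal basis of \<open>\<H>\<^sub>\<sigma>\<close> to a finite
  subset \<open>G\<close>. By density of \<open>\<Phi>\<close> the basis vectors at which \<open>\<omega>\<close> is evaluated can be replaced by
  points of \<open>\<Phi>\<close>.\<close>

lemma finite_rank_approximation:
  assumes \<sigma>: "\<sigma> \<in> indices R" and \<tau>: "\<tau> \<in> indices R" and hs: "hilbert_schmidt_embedded R \<sigma> \<tau>" and d: "0 < d"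
  obtains I :: "'v set" and x g where "finite I" "\<And>i. i \<in> I \<Longrightarrow> x i \<in> Phi R" "\<And>i. i \<in> I \<Longrightarrow> g i \<in> neg_space R \<sigma>"
    "\<And>\<omega>. \<omega> \<in> neg_space R \<tau> \<Longrightarrow> neg_norm R \<sigma> (fcomb 1 \<omega> (-1) (\<lambda>\<xi>. \<Sum>i\<in>I. \<omega> (x i) * g i \<xi>)) \<le> d * neg_norm R \<tau> \<omega>"
proof -
  interpret s: hilbert_member R \<sigma> by (rule member[OF \<sigma>])
  interpret t: hilbert_member R \<tau> by (rule member[OF \<tau>])
  obtain B where B: "orthonormal_basis R \<sigma> B" "(\<lambda>e. (hnorm R \<tau> e)\<^sup>2) summable_on B"
    using hs unfolding hilbert_schmidt_embedded_def by blast
  have emb: "continuously_embedded R \<sigma> \<tau>" by (rule hilbert_schmidt_imp_continuous[OF hs])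
  obtain K where K: "1 \<le> K" "\<And>z. z \<in> cspace R \<sigma> \<Longrightarrow> z \<in> cspace R \<tau> \<and> cnorm R \<tau> z \<le> K * cnorm R \<sigma> z"
    using cnorm_bound_of_embedded[OF \<sigma> \<tau> emb] by blast
  have Bs: "b \<in> hspace R \<sigma>" if "b \<in> B" for b using B that by (auto simp: orthonormal_basis_def)
  have Bt: "b \<in> hspace R \<tau>" if "b \<in> B" for b using Bs[OF that] embedding_subset[OF emb] by blast
  have Bo: "hinner R \<sigma> e f = (if e = f then 1 else 0)" if "e \<in> B" "f \<in> B" for e f
    using B that by (auto simp: orthonormal_basis_def)
  obtain G where G: "finite G" "G \<subseteq> B"
    and G': "dist (\<Sum>b\<in>G. (hnorm R \<tau> b)\<^sup>2) (\<Sum>\<^sub>\<infinity>b\<in>B. (hnorm R \<tau> b)\<^sup>2) \<le> d\<^sup>2 / 2"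
    using infsum_finite_approximation[OF B(2), of "d\<^sup>2 / 2"] d by auto
  have tail: "(\<Sum>b\<in>H. (hnorm R \<tau> b)\<^sup>2) \<le> d\<^sup>2 / 2" if H: "finite H" "H \<subseteq> B - G" for H
  proof -
    have "(\<Sum>b\<in>G. (hnorm R \<tau> b)\<^sup>2) + (\<Sum>b\<in>H. (hnorm R \<tau> b)\<^sup>2) = (\<Sum>b\<in>G \<union> H. (hnorm R \<tau> b)\<^sup>2)"
      using G H by (intro sum.union_disjoint[symmetric]) auto
    also have "\<dots> \<le> (\<Sum>\<^sub>\<infinity>b\<in>B. (hnorm R \<tau> b)\<^sup>2)"
      using G H B(2) by (intro finite_sum_le_infsum) auto
    finally show ?thesis using G' unfolding dist_real_def by linarith
  qed
  \<comment> \<open>Half of \<open>d\<^sup>2\<close> is spent on the basis vectors outside \<open>G\<close>, the other half on moving the vectors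
    of \<open>G\<close> into \<open>\<Phi>\<close>.\<close>
  define \<epsilon> where "\<epsilon> = d / sqrt (2 * (real (card G) + 1))"
  have \<epsilon>: "0 < \<epsilon>" "real (card G) * \<epsilon>\<^sup>2 \<le> d\<^sup>2 / 2"
    using d by (auto simp: \<epsilon>_def power_divide field_simps)
  have "\<exists>y\<in>PhiR. hnorm R \<tau> (b - y) < \<epsilon>" if "b \<in> G" for b
  proof -
    have "b \<in> hspace R \<tau>" using that G Bt by blast
    then obtain y where "y \<in> PhiR" "hnorm R \<tau> (b - y) < \<epsilon>" by (rule PhiR_dense[OF \<tau> _ \<epsilon>(1)])
    then show ?thesis by blast
  qed
  then obtain y where y: "\<And>b. b \<in> G \<Longrightarrow> y b \<in> PhiR" "\<And>b. b \<in> G \<Longrightarrow> hnorm R \<tau> (b - y b) < \<epsilon>" by metis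
  have yt: "y b \<in> hspace R \<tau>" if "b \<in> G" for b by (rule PhiR_hspace[OF \<tau> y(1)[OF that]])
  have yP: "(y b, 0) \<in> Phi R" if "b \<in> G" for b
    using y(1)[OF that] Phi_iff subspace_0[OF PhiR_subspace] by blast
  have bc: "(b, 0) \<in> cspace R \<sigma>" if "b \<in> B" for b by (rule s.cspace_real[OF Bs[OF that]])
  define u where "u = (\<lambda>b. if b \<in> G then (hnorm R \<tau> (b - y b))\<^sup>2 else (hnorm R \<tau> b)\<^sup>2)"
  have u: "(\<Sum>b\<in>H. u b) \<le> d\<^sup>2" if H: "finite H" "H \<subseteq> B" for H
  proof -
    have "(\<Sum>b\<in>H. u b) = (\<Sum>b\<in>H \<inter> G. u b) + (\<Sum>b\<in>H - G. u b)"
      using H by (rule_tac sum.Int_Diff) auto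
    also have "(\<Sum>b\<in>H - G. u b) \<le> d\<^sup>2 / 2"
      using tail[of "H - G"] H by (auto simp: u_def)
    also have "(\<Sum>b\<in>H \<inter> G. u b) \<le> (\<Sum>b\<in>H \<inter> G. \<epsilon>\<^sup>2)"
    proof (rule sum_mono)
      fix b assume b: "b \<in> H \<inter> G"
      have "b - y b \<in> hspace R \<tau>" using b G Bt yt by (intro t.hspace_intros) auto
      then have "(hnorm R \<tau> (b - y b))\<^sup>2 \<le> \<epsilon>\<^sup>2"
        using y(2)[of b] b t.hnorm_nonneg by (intro power_mono) auto
      then show "u b \<le> \<epsilon>\<^sup>2" using b by (simp add: u_def)
    qed
    also have "\<dots> \<le> real (card G) * \<epsilon>\<^sup>2"
      using G card_mono[of G "H \<inter> G"] by (simp add: mult_right_mono)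
    finally show ?thesis using \<epsilon>(2) by simp
  qed
  let ?g = "\<lambda>b. riesz R \<sigma> (b, 0)"
  show ?thesis
  proof (rule that[of G "\<lambda>b. (y b, 0)" ?g])
    show "finite G" by (rule G)
    show "(y b, 0) \<in> Phi R" if "b \<in> G" for b by (rule yP[OF that])
    show "?g b \<in> neg_space R \<sigma>" if "b \<in> G" for b using that G bc by (intro riesz_in(1)[OF \<sigma>]) auto
    fix \<omega> assume \<omega>: "\<omega> \<in> neg_space R \<tau>"
    obtain e where e: "e \<in> cspace R \<tau>" "\<omega> = riesz R \<tau> e" "cnorm R \<tau> e \<le> neg_norm R \<tau> \<omega>"
      by (rule riesz_representation[OF \<tau> \<omega>])
    have e0: "0 \<le> cnorm R \<tau> e" by (rule t.cnorm_nonneg[OF e(1)])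
    \<comment> \<open>The error functional. At a basis vector \<open>b\<close> it is the product with \<open>e\<close> of \<open>b - y b\<close> or of
      \<open>b\<close>, so its coefficients are dominated by \<open>u\<close>.\<close>
    define L where "L = (\<lambda>\<xi>. cinner R \<tau> \<xi> e - (\<Sum>b\<in>G. \<omega> (y b, 0) * cinner R \<sigma> \<xi> (b, 0)))"
    have bound: "cmod (L x) \<le> (d * cnorm R \<tau> e) * cnorm R \<sigma> x" if x: "x \<in> cspace R \<sigma>" for x
    proof (rule functional_bound_from_basis[OF \<sigma> B(1)])
      show "L (ccomb a x b y) = a * L x + b * L y" if xy: "x \<in> cspace R \<sigma>" "y \<in> cspace R \<sigma>" for a b x y
      proof -
        have 1: "cinner R \<tau> (ccomb a x b y) e = a * cinner R \<tau> x e + b * cinner R \<tau> y e"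
          using K(2)[OF xy(1)] K(2)[OF xy(2)] e(1) by (intro t.cinner_ccomb) auto
        have 2: "cinner R \<sigma> (ccomb a x b y) (v, 0) = a * cinner R \<sigma> x (v, 0) + b * cinner R \<sigma> y (v, 0)" if "v \<in> G" for v
          using xy bc that G by (intro s.cinner_ccomb) auto
        show ?thesis unfolding L_def 1
          by (simp add: 2 algebra_simps sum.distrib sum_distrib_left cong: sum.cong)
      qed
      show "cmod (L x) \<le> (K * cnorm R \<tau> e + (\<Sum>b\<in>G. cmod (\<omega> (y b, 0)) * cnorm R \<sigma> (b, 0))) * cnorm R \<sigma> x"
        if x: "x \<in> cspace R \<sigma>" for x
      proof -
        have "cmod (cinner R \<tau> x e) \<le> cnorm R \<tau> x * cnorm R \<tau> e"
          using K(2)[OF x] e(1) by (intro t.cauchy_schwarz) auto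
        also have "\<dots> \<le> (K * cnorm R \<sigma> x) * cnorm R \<tau> e"
          using K(2)[OF x] e0 by (intro mult_right_mono) auto
        finally have 1: "cmod (cinner R \<tau> x e) \<le> K * cnorm R \<tau> e * cnorm R \<sigma> x" by (simp add: mult_ac)
        have 2: "cmod (\<Sum>b\<in>G. \<omega> (y b, 0) * cinner R \<sigma> x (b, 0)) \<le> (\<Sum>b\<in>G. cmod (\<omega> (y b, 0)) * (cnorm R \<sigma> (b, 0) * cnorm R \<sigma> x))"
        proof (rule sum_norm_le)
          fix b assume b: "b \<in> G"
          have "cmod (cinner R \<sigma> x (b, 0)) \<le> cnorm R \<sigma> x * cnorm R \<sigma> (b, 0)"
            using x b G bc by (intro s.cauchy_schwarz) auto
          then show "cmod (\<omega> (y b, 0) * cinner R \<sigma> x (b, 0)) \<le> cmod (\<omega> (y b, 0)) * (cnorm R \<sigma> (b, 0) * cnorm R \<sigma> x)"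
            by (simp add: norm_mult mult_left_mono mult.commute)
        qed
        have "cmod (L x) \<le> K * cnorm R \<tau> e * cnorm R \<sigma> x + (\<Sum>b\<in>G. cmod (\<omega> (y b, 0)) * (cnorm R \<sigma> (b, 0) * cnorm R \<sigma> x))"
          unfolding L_def by (rule order_trans[OF norm_triangle_ineq4 add_mono[OF 1 2]])
        then show ?thesis by (simp add: algebra_simps sum_distrib_left)
      qed
      show "0 \<le> d * cnorm R \<tau> e" using d e0 by simp
      show "(\<Sum>b\<in>H. (cmod (L (b, 0)))\<^sup>2) \<le> (d * cnorm R \<tau> e)\<^sup>2" if H: "finite H" "H \<subseteq> B" for H
      proof -
        have "(cmod (L (b, 0)))\<^sup>2 \<le> (cnorm R \<tau> e)\<^sup>2 * u b" if b: "b \<in> B" for b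
        proof -
          have "(\<Sum>b'\<in>G. \<omega> (y b', 0) * cinner R \<sigma> (b, 0) (b', 0)) = (\<Sum>b'\<in>G. if b = b' then \<omega> (y b', 0) else 0)"
          proof (rule sum.cong[OF refl])
            fix b' assume "b' \<in> G"
            then have "b' \<in> B" using G by blast
            then have "cinner R \<sigma> (b, 0) (b', 0) = (if b = b' then 1 else 0)"
              using Bo[OF b] Bs[OF b] Bs[of b'] by (simp add: cinner_def complex_eq_iff)
            then show "\<omega> (y b', 0) * cinner R \<sigma> (b, 0) (b', 0) = (if b = b' then \<omega> (y b', 0) else 0)" by simp
          qed
          also have "\<dots> = (if b \<in> G then \<omega> (y b, 0) else 0)" using G by simp
          finally have Lb: "L (b, 0) = cinner R \<tau> (b, 0) e - (if b \<in> G then \<omega> (y b, 0) else 0)"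
            unfolding L_def by simp
          define v where "v = (if b \<in> G then b - y b else b)"
          have v: "v \<in> hspace R \<tau>" using Bt[OF b] yt by (auto simp: v_def)
          have "L (b, 0) = cinner R \<tau> (v, 0) e"
          proof (cases "b \<in> G")
            case True
            have "\<omega> (y b, 0) = cinner R \<tau> (y b, 0) e" using e(2) yP[OF True] by (simp add: riesz_def)
            moreover have "cinner R \<tau> (ccomb 1 (b, 0) (-1) (y b, 0)) e = 1 * cinner R \<tau> (b, 0) e + (-1) * cinner R \<tau> (y b, 0) e"
              using Bt[OF b] yt[OF True] e(1) by (intro t.cinner_ccomb t.cspace_real)
            ultimately show ?thesis using True Lb by (simp add: v_def ccomb_def cscale_def)
          qed (simp add: Lb v_def)
          then have "cmod (L (b, 0)) \<le> hnorm R \<tau> v * cnorm R \<tau> e"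
            using t.cauchy_schwarz[OF t.cspace_real[OF v] e(1)] t.hnorm_cnorm[OF v] by simp
          then have "(cmod (L (b, 0)))\<^sup>2 \<le> (hnorm R \<tau> v * cnorm R \<tau> e)\<^sup>2" by (intro power_mono) auto
          also have "\<dots> = (cnorm R \<tau> e)\<^sup>2 * u b" by (simp add: v_def u_def power_mult_distrib)
          finally show ?thesis .
        qed
        then have "(\<Sum>b\<in>H. (cmod (L (b, 0)))\<^sup>2) \<le> (\<Sum>b\<in>H. (cnorm R \<tau> e)\<^sup>2 * u b)" using H by (intro sum_mono) blast
        also have "\<dots> = (cnorm R \<tau> e)\<^sup>2 * (\<Sum>b\<in>H. u b)" by (simp add: sum_distrib_left)
        also have "\<dots> \<le> (cnorm R \<tau> e)\<^sup>2 * d\<^sup>2" by (intro mult_left_mono u H) simp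
        finally show ?thesis by (simp add: power_mult_distrib mult.commute)
      qed
    qed (rule x)
    show "neg_norm R \<sigma> (fcomb 1 \<omega> (-1) (\<lambda>\<xi>. \<Sum>b\<in>G. \<omega> (y b, 0) * ?g b \<xi>)) \<le> d * neg_norm R \<tau> \<omega>"
    proof (rule neg_norm_le[OF \<sigma>])
      show "0 \<le> d * neg_norm R \<tau> \<omega>" using d neg_norm_nonneg[OF \<tau> \<omega>] by simp
      fix \<xi> assume \<xi>: "\<xi> \<in> Phi R"
      have "fcomb 1 \<omega> (-1) (\<lambda>\<xi>. \<Sum>b\<in>G. \<omega> (y b, 0) * ?g b \<xi>) \<xi> = L \<xi>"
        using \<xi> e(2) by (simp add: fcomb_def L_def riesz_def)
      also have "cmod (L \<xi>) \<le> (d * cnorm R \<tau> e) * cnorm R \<sigma> \<xi>" by (rule bound[OF Phi_cspace[OF \<sigma> \<xi>]])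
      also have "\<dots> \<le> d * neg_norm R \<tau> \<omega> * cnorm R \<sigma> \<xi>"
        using d e(3) s.cnorm_nonneg[OF Phi_cspace[OF \<sigma> \<xi>]] by (intro mult_right_mono mult_left_mono) auto
      finally show "cmod (fcomb 1 \<omega> (-1) (\<lambda>\<xi>. \<Sum>b\<in>G. \<omega> (y b, 0) * ?g b \<xi>) \<xi>) \<le> d * neg_norm R \<tau> \<omega> * cnorm R \<sigma> \<xi>" .
    qed
  qed
qed

text \<open>On the unit ball of \<open>\<H>\<^sub>-\<^sub>\<tau>\<close> the operators of finite rank approximate the inclusion into
  \<open>\<H>\<^sub>-\<^sub>\<sigma>\<close> uniformly, and the polynomial \<open>\<phi>\<close> is Lipschitz on balls of \<open>\<H>\<^sub>-\<^sub>\<sigma>\<close>. So \<open>\<phi>\<close> is uniformly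
  close to polynomials of finite rank, on which \<open>F\<close> vanishes.\<close>

lemma functional_determined_by_powers:
  assumes linear: "\<And>a b \<phi> \<psi>. \<phi> \<in> Phi_sym R n \<Longrightarrow> \<psi> \<in> Phi_sym R n \<Longrightarrow> F (fcomb a \<phi> b \<psi>) = a * F \<phi> + b * F \<psi>"
    and powers: "\<And>\<xi>. \<xi> \<in> Phi R \<Longrightarrow> F (tensor_pow R n \<xi>) = 0"
    and \<tau>: "\<tau> \<in> indices R" and K: "0 \<le> K"
    and bound: "\<And>\<phi> c. \<phi> \<in> Phi_sym R n \<Longrightarrow>
      (\<And>\<omega>. \<omega> \<in> neg_space R \<tau> \<Longrightarrow> neg_norm R \<tau> \<omega> \<le> 1 \<Longrightarrow> cmod (\<phi> (replicate n \<omega>)) \<le> c) \<Longrightarrow> cmod (F \<phi>) \<le> K * c"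
    and \<phi>: "\<phi> \<in> Phi_sym R n"
  shows "F \<phi> = 0"
proof -
  obtain \<sigma> where \<sigma>: "\<sigma> \<in> indices R" "hilbert_schmidt_embedded R \<sigma> \<tau>" using hilbert_schmidt_below[OF \<tau> \<tau>] by blast
  have emb: "continuously_embedded R \<sigma> \<tau>" by (rule hilbert_schmidt_imp_continuous[OF \<sigma>(2)])
  obtain L where L: "1 \<le> L"
    "\<And>\<omega>. \<omega> \<in> neg_space R \<tau> \<Longrightarrow> \<omega> \<in> neg_space R \<sigma> \<and> neg_norm R \<sigma> \<omega> \<le> L * neg_norm R \<tau> \<omega>"
    using neg_space_mono[OF \<sigma>(1) \<tau> emb] by blast
  interpret seminormed "neg_space R \<sigma>" "neg_norm R \<sigma>" by (rule seminormed_neg[OF \<sigma>(1)])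
  let ?f = "monomial R n \<phi>"
  have f: "bounded_type ?f" by (rule entire_bounded_typeD[OF monomial_entire[OF \<phi>] \<sigma>(1)])
  obtain M where M: "0 \<le> M" "\<And>\<zeta>. \<zeta> \<in> neg_space R \<sigma> \<Longrightarrow> neg_norm R \<sigma> \<zeta> \<le> L + 1 \<Longrightarrow> cmod (?f \<zeta>) \<le> M"
    using bounded_type_bounded[OF f] by blast
  have small: "cmod (F \<phi>) \<le> K * (2 * M * d)" if d: "0 < d" "d \<le> 1 / 2" for d
  proof -
    obtain I :: "'v set" and x g where I: "finite I" "\<And>i. i \<in> I \<Longrightarrow> x i \<in> Phi R" "\<And>i. i \<in> I \<Longrightarrow> g i \<in> neg_space R \<sigma>"
      "\<And>\<omega>. \<omega> \<in> neg_space R \<tau> \<Longrightarrow> neg_norm R \<sigma> (fcomb 1 \<omega> (-1) (\<lambda>\<xi>. \<Sum>i\<in>I. \<omega> (x i) * g i \<xi>)) \<le> d * neg_norm R \<tau> \<omega>"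
      using finite_rank_approximation[OF \<sigma>(1) \<tau> \<sigma>(2) d(1)] by blast
    let ?P = "\<lambda>\<omega> \<xi>. \<Sum>i\<in>I. \<omega> (x i) * g i \<xi>"
    have "diagonal_in n F (\<lambda>\<omega>. \<phi> (replicate n (?P \<omega>)))"
      by (rule diagonal_in_finite_rank[OF linear powers \<phi> I(1) Phi_dualI[OF \<sigma>(1) I(3)] I(2)])
    then obtain \<psi> where \<psi>: "\<psi> \<in> Phi_sym R n" "F \<psi> = 0"
      "\<And>\<omega>. \<omega> \<in> Phi_dual R \<Longrightarrow> \<psi> (replicate n \<omega>) = \<phi> (replicate n (?P \<omega>))"
      unfolding diagonal_in_def by blast
    have P: "?P \<omega> \<in> neg_space R \<sigma>" for \<omega>
      using I(1,3)
    proof (induction I rule: finite_induct)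
      case (insert i I)
      have "fcomb (\<omega> (x i)) (g i) 1 (\<lambda>\<xi>. \<Sum>i\<in>I. \<omega> (x i) * g i \<xi>) \<in> neg_space R \<sigma>"
        by (rule V_fcomb) (use insert in auto)
      then show ?case using insert(1,2) by (simp add: fcomb_def)
    qed (simp add: V_zero)
    have "cmod (F (fcomb 1 \<phi> (-1) \<psi>)) \<le> K * (2 * M * d)"
    proof (rule bound[OF Phi_sym_fcomb[OF \<phi> \<psi>(1)]])
      fix \<omega> assume \<omega>: "\<omega> \<in> neg_space R \<tau>" "neg_norm R \<tau> \<omega> \<le> 1"
      have \<omega>s: "\<omega> \<in> neg_space R \<sigma>" using L(2) \<omega>(1) by blast
      have nw: "neg_norm R \<sigma> \<omega> \<le> L"
        using conjunct2[OF L(2)[OF \<omega>(1)]] mult_left_mono[OF \<omega>(2), of L] L(1) by linarith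
      have nd: "neg_norm R \<sigma> (fcomb 1 \<omega> (-1) (?P \<omega>)) \<le> d"
        using I(4)[OF \<omega>(1)] mult_left_mono[OF \<omega>(2), of d] d(1) by linarith
      have "neg_norm R \<sigma> (fcomb 1 (?P \<omega>) (-1) \<omega>) \<le> d"
      proof -
        have "fcomb 1 (?P \<omega>) (-1) \<omega> = fcomb (-1) (fcomb 1 \<omega> (-1) (?P \<omega>)) 0 \<omega>" by (simp add: fcomb_def)
        moreover have "fcomb 1 \<omega> (-1) (?P \<omega>) \<in> neg_space R \<sigma>" by (rule V_fcomb[OF \<omega>s P])
        ultimately show ?thesis using N_fcomb[OF _ \<omega>s, of "fcomb 1 \<omega> (-1) (?P \<omega>)" "-1" 0] nd by simp
      qed
      then have "cmod (?f (?P \<omega>) - ?f \<omega>) \<le> 2 * M * d"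
        using nw by (intro bounded_type_lipschitz[OF f \<omega>s P d] M) auto
      moreover have "?f (?P \<omega>) = \<psi> (replicate n \<omega>)" "?f \<omega> = \<phi> (replicate n \<omega>)"
        using monomial_eq[OF \<phi>] \<psi>(3) Phi_dualI[OF \<tau> \<omega>(1)] Phi_dualI[OF \<sigma>(1) P] by auto
      ultimately show "cmod (fcomb 1 \<phi> (-1) \<psi> (replicate n \<omega>)) \<le> 2 * M * d"
        by (simp add: fcomb_def norm_minus_commute)
    qed
    moreover have "F (fcomb 1 \<phi> (-1) \<psi>) = F \<phi>" using linear[OF \<phi> \<psi>(1)] \<psi>(2) by simp
    ultimately show ?thesis by simp
  qed
  have "cmod (F \<phi>) \<le> 0 + e" if e: "0 < e" for e
  proof -
    define d where "d = min (1 / 2) (e / (K * (2 * M) + 1))"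
    have KM: "0 \<le> K * (2 * M)" using K M by simp
    have d: "0 < d" "d \<le> 1 / 2" unfolding d_def using e KM by (simp add: add_nonneg_pos, simp only: min.cobounded1)
    have "cmod (F \<phi>) \<le> K * (2 * M) * d" using small[OF d] by (simp add: mult_ac)
    also have "\<dots> \<le> K * (2 * M) * (e / (K * (2 * M) + 1))" using KM by (intro mult_left_mono) (auto simp: d_def)
    also have "\<dots> = e * (K * (2 * M) / (K * (2 * M) + 1))" by simp
    also have "\<dots> \<le> e * 1" using e KM by (intro mult_left_mono) (auto simp: divide_le_eq)
    finally show ?thesis by simp
  qed
  then have "cmod (F \<phi>) \<le> 0" by (rule field_le_epsilon)
  then show ?thesis by simp
qed

section \<open>The spaces of entire functions of minimal type\<close>

abbreviation growth_weight :: "'t \<Rightarrow> nat \<Rightarrow> real \<Rightarrow> 'v dual \<Rightarrow> real" where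
  "growth_weight \<tau> l a \<omega> \<equiv> exp ((1/2) ^ l * neg_norm R \<tau> \<omega> powr a)"

lemma growth_quotient_le_iff:
  "growth_quotient R \<tau> l a f \<omega> \<le> c \<longleftrightarrow> cmod (f \<omega>) \<le> c * growth_weight \<tau> l a \<omega>"
  by (simp add: growth_quotient_def exp_minus divide_inverse[symmetric] divide_le_eq)

lemma growth_norm_le:
  assumes "\<tau> \<in> indices R" "\<And>\<omega>. \<omega> \<in> neg_space R \<tau> \<Longrightarrow> cmod (f \<omega>) \<le> c * growth_weight \<tau> l a \<omega>"
  shows "growth_norm R \<tau> l a f \<le> c"
  unfolding growth_norm_def
proof (rule cSUP_least)
  show "neg_space R \<tau> \<noteq> {}" using seminormed.V_zero[OF seminormed_neg[OF assms(1)]] by blast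
qed (simp only: growth_quotient_le_iff assms(2))

lemma exponent_positive: "0 \<le> \<alpha> \<Longrightarrow> a \<in> growth_exponents \<alpha> \<Longrightarrow> 0 < a"
  by (auto simp: growth_exponents_def split: if_splits)

lemma E_min_vanish: "f \<in> E_min R \<alpha> \<Longrightarrow> \<omega> \<notin> Phi_dual R \<Longrightarrow> f \<omega> = 0"
  by (simp add: E_min_def)

lemma growth_bound:
  assumes "f \<in> E_min R \<alpha>" "a \<in> growth_exponents \<alpha>" "\<tau> \<in> indices R" "\<omega> \<in> neg_space R \<tau>"
  shows "cmod (f \<omega>) \<le> growth_norm R \<tau> l a f * growth_weight \<tau> l a \<omega>"
proof -
  have "bdd_above (growth_quotient R \<tau> l a f ` neg_space R \<tau>)" using assms(1-3) by (simp add: E_min_def)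
  then have "growth_quotient R \<tau> l a f \<omega> \<le> growth_norm R \<tau> l a f"
    unfolding growth_norm_def by (rule cSUP_upper[OF assms(4)])
  then show ?thesis by (simp only: growth_quotient_le_iff)
qed

lemma growth_norm_nonneg:
  assumes "f \<in> E_min R \<alpha>" "a \<in> growth_exponents \<alpha>" "\<tau> \<in> indices R"
  shows "0 \<le> growth_norm R \<tau> l a f"
proof -
  have "0 \<le> growth_norm R \<tau> l a f * growth_weight \<tau> l a (\<lambda>x. 0)"
    by (rule order_trans[OF norm_ge_zero growth_bound[OF assms seminormed.V_zero[OF seminormed_neg[OF assms(3)]]]])
  then show ?thesis by (simp add: zero_le_mult_iff)
qed

lemma exponent_exists: "0 \<le> \<alpha> \<Longrightarrow> \<exists>a. a \<in> growth_exponents \<alpha>"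
  by (auto simp: growth_exponents_def intro: exI[of _ 1])

lemma E_min_entire:
  assumes \<alpha>: "0 \<le> \<alpha>" and f: "f \<in> E_min R \<alpha>"
  shows "entire_bounded_type f"
  unfolding entire_bounded_type_def
proof
  fix \<tau> assume \<tau>: "\<tau> \<in> indices R"
  interpret seminormed "neg_space R \<tau>" "neg_norm R \<tau>" by (rule seminormed_neg[OF \<tau>])
  obtain a where a: "a \<in> growth_exponents \<alpha>" "0 < a" using exponent_exists[OF \<alpha>] exponent_positive[OF \<alpha>] by blast
  show "bounded_type f" unfolding bounded_type_def
  proof (intro conjI ballI allI)
    show "(\<lambda>z. f (fcomb 1 \<omega> z \<eta>)) holomorphic_on UNIV"
      if "\<omega> \<in> neg_space R \<tau>" "\<eta> \<in> neg_space R \<tau>" for \<omega> \<eta>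
      using f \<tau> that by (simp add: E_min_def entire_on_neg_def)
    fix r
    have "cmod (f \<omega>) \<le> growth_norm R \<tau> 0 a f * exp (\<bar>r\<bar> powr a)"
      if \<omega>: "\<omega> \<in> neg_space R \<tau>" "neg_norm R \<tau> \<omega> \<le> r" for \<omega>
    proof -
      have "cmod (f \<omega>) \<le> growth_norm R \<tau> 0 a f * growth_weight \<tau> 0 a \<omega>" by (rule growth_bound[OF f a(1) \<tau> \<omega>(1)])
      also have "\<dots> \<le> growth_norm R \<tau> 0 a f * exp (\<bar>r\<bar> powr a)"
        using \<omega> N_nonneg[OF \<omega>(1)] a(2) growth_norm_nonneg[OF f a(1) \<tau>]
        by (intro mult_left_mono) (auto intro!: powr_mono2)
      finally show ?thesis .
    qed
    then show "\<exists>M. \<forall>\<omega>\<in>neg_space R \<tau>. neg_norm R \<tau> \<omega> \<le> r \<longrightarrow> cmod (f \<omega>) \<le> M" by blast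
  qed
qed

lemma bounded_type_on_continuous:
  assumes \<tau>: "\<tau> \<in> indices R" and f: "bounded_type_on \<tau> f"
  shows "continuous_map (seminorm_topology (neg_space R \<tau>) {neg_norm R \<tau>}) euclidean f"
proof -
  interpret seminormed "neg_space R \<tau>" "neg_norm R \<tau>" by (rule seminormed_neg[OF \<tau>])
  let ?X = "seminorm_topology (neg_space R \<tau>) {neg_norm R \<tau>}"
  have N0: "neg_norm R \<tau> (\<lambda>x. 0) = 0"
    using N_fcomb[OF V_zero V_zero, of 0 0] N_nonneg[OF V_zero] by (simp add: fcomb_def)
  have top: "topspace ?X = neg_space R \<tau>" by (rule topspace_seminorm_topology) (auto simp: N0)
  show ?thesis
    unfolding continuous_map_def top
  proof (intro conjI allI impI)
    fix U :: "complex set" assume U: "openin euclidean U"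
    show "openin ?X {\<omega> \<in> neg_space R \<tau>. f \<omega> \<in> U}"
    proof (subst openin_subopen, intro ballI)
      fix \<omega> assume "\<omega> \<in> {\<omega> \<in> neg_space R \<tau>. f \<omega> \<in> U}"
      then have \<omega>: "\<omega> \<in> neg_space R \<tau>" "f \<omega> \<in> U" by auto
      obtain e where e: "0 < e" "ball (f \<omega>) e \<subseteq> U"
        using U \<omega>(2) open_contains_ball by (metis open_openin)
      obtain M where M: "0 \<le> M" "\<And>\<zeta>. \<zeta> \<in> neg_space R \<tau> \<Longrightarrow> neg_norm R \<tau> \<zeta> \<le> neg_norm R \<tau> \<omega> + 1 \<Longrightarrow> cmod (f \<zeta>) \<le> M"
        using bounded_type_bounded[OF f] by blast
      define d where "d = min (1/2) (e / (2 * M + 1))"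
      have d: "0 < d" "d \<le> 1/2" unfolding d_def using e(1) M(1) by (simp add: add_nonneg_pos, simp only: min.cobounded1)
      have dM: "2 * M * d < e"
      proof -
        have "2 * M * d \<le> 2 * M * (e / (2 * M + 1))" using M(1) by (intro mult_left_mono) (auto simp: d_def)
        also have "\<dots> < e" using e(1) M(1) by (simp add: field_simps)
        finally show ?thesis .
      qed
      let ?W = "{g \<in> neg_space R \<tau>. neg_norm R \<tau> (fcomb 1 g (-1) \<omega>) < d}"
      have "openin ?X ?W"
        unfolding seminorm_topology_def by (rule topology_generated_by_Basis) (use \<omega>(1) d(1) in blast)
      moreover have "\<omega> \<in> ?W" using \<omega>(1) d(1) N0 by (simp add: fcomb_def)
      moreover have "?W \<subseteq> {\<omega> \<in> neg_space R \<tau>. f \<omega> \<in> U}"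
      proof
        fix \<eta> assume \<eta>: "\<eta> \<in> ?W"
        then have "cmod (f \<eta> - f \<omega>) \<le> 2 * M * d"
          by (intro bounded_type_lipschitz[OF f \<omega>(1) _ d] M) auto
        then have "f \<eta> \<in> ball (f \<omega>) e" using dM by (simp add: dist_norm norm_minus_commute)
        then show "\<eta> \<in> {\<omega> \<in> neg_space R \<tau>. f \<omega> \<in> U}" using \<eta> e(2) by blast
      qed
      ultimately show "\<exists>T. openin ?X T \<and> \<omega> \<in> T \<and> T \<subseteq> {\<omega> \<in> neg_space R \<tau>. f \<omega> \<in> U}" by blast
    qed
  qed simp
qed

text \<open>Continuity on each \<open>\<H>\<^sub>-\<^sub>\<tau>\<close> is a consequence of bounded type.\<close>

lemma E_minI:
  assumes "\<And>\<omega>. \<omega> \<notin> Phi_dual R \<Longrightarrow> f \<omega> = 0" and f: "entire_bounded_type f"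
    and growth: "\<And>a \<tau> l. a \<in> growth_exponents \<alpha> \<Longrightarrow> \<tau> \<in> indices R \<Longrightarrow>
      \<exists>c. \<forall>\<omega>\<in>neg_space R \<tau>. cmod (f \<omega>) \<le> c * growth_weight \<tau> l a \<omega>"
  shows "f \<in> E_min R \<alpha>"
  unfolding E_min_def
proof (rule CollectI, intro conjI allI ballI)
  show "\<omega> \<notin> Phi_dual R \<longrightarrow> f \<omega> = 0" for \<omega> using assms(1) by blast
  show "entire_on_neg R \<tau> f" if \<tau>: "\<tau> \<in> indices R" for \<tau>
    unfolding entire_on_neg_def
    using bounded_type_on_continuous[OF \<tau> entire_bounded_typeD[OF f \<tau>]] seminormed.bounded_type_holo[OF seminormed_neg[OF \<tau>] entire_bounded_typeD[OF f \<tau>]]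
    by blast
  fix a \<tau> l assume a: "a \<in> growth_exponents \<alpha>" and \<tau>: "\<tau> \<in> indices R"
  obtain c where "\<forall>\<omega>\<in>neg_space R \<tau>. cmod (f \<omega>) \<le> c * growth_weight \<tau> l a \<omega>" using growth[OF a \<tau>] by blast
  then show "bdd_above (growth_quotient R \<tau> l a f ` neg_space R \<tau>)"
    by (intro bdd_aboveI2[where M = c]) (simp only: growth_quotient_le_iff)
qed

lemma growth_bound_fcomb:
  assumes f: "f \<in> E_min R \<alpha>" and g: "g \<in> E_min R \<alpha>" and a: "a \<in> growth_exponents \<alpha>" and \<tau>: "\<tau> \<in> indices R"
    and \<omega>: "\<omega> \<in> neg_space R \<tau>"
  shows "cmod (fcomb c f d g \<omega>) \<le> (cmod c * growth_norm R \<tau> l a f + cmod d * growth_norm R \<tau> l a g) * growth_weight \<tau> l a \<omega>"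
proof -
  have "cmod (fcomb c f d g \<omega>) \<le> cmod c * cmod (f \<omega>) + cmod d * cmod (g \<omega>)"
    unfolding fcomb_def by (rule order_trans[OF norm_triangle_ineq]) (simp add: norm_mult)
  also have "\<dots> \<le> cmod c * (growth_norm R \<tau> l a f * growth_weight \<tau> l a \<omega>) + cmod d * (growth_norm R \<tau> l a g * growth_weight \<tau> l a \<omega>)"
    by (intro add_mono mult_left_mono growth_bound[OF f a \<tau> \<omega>] growth_bound[OF g a \<tau> \<omega>] norm_ge_zero)
  finally show ?thesis by (simp add: algebra_simps)
qed

lemma E_min_fcomb:
  assumes \<alpha>: "0 \<le> \<alpha>" and f: "f \<in> E_min R \<alpha>" and g: "g \<in> E_min R \<alpha>"
  shows "fcomb c f d g \<in> E_min R \<alpha>"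
proof (rule E_minI)
  show "fcomb c f d g \<omega> = 0" if "\<omega> \<notin> Phi_dual R" for \<omega>
    using E_min_vanish[OF f that] E_min_vanish[OF g that] by (simp add: fcomb_def)
  show "entire_bounded_type (fcomb c f d g)" by (intro entire_bounded_type_fcomb E_min_entire[OF \<alpha>] f g)
qed (use growth_bound_fcomb[OF f g] in blast)

lemma growth_norm_fcomb:
  assumes f: "f \<in> E_min R \<alpha>" and g: "g \<in> E_min R \<alpha>" and a: "a \<in> growth_exponents \<alpha>" and \<tau>: "\<tau> \<in> indices R"
  shows "growth_norm R \<tau> l a (fcomb c f d g) \<le> cmod c * growth_norm R \<tau> l a f + cmod d * growth_norm R \<tau> l a g"
  by (rule growth_norm_le[OF \<tau> growth_bound_fcomb[OF f g a \<tau>]])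

text \<open>By homogeneity. If \<open>\<omega>\<close> has norm \<open>0\<close>, all its multiples lie in the unit ball, so the values
  of the polynomial at \<open>r \<omega>\<close>, which grow like \<open>r\<^sup>n\<close>, are bounded; for \<open>n > 0\<close> the value at \<open>\<omega>\<close> is
  therefore \<open>0\<close>.\<close>

lemma monomial_bound_from_ball:
  assumes \<tau>: "\<tau> \<in> indices R" and \<phi>: "\<phi> \<in> Phi_sym R n" and \<omega>: "\<omega> \<in> neg_space R \<tau>"
    and c: "\<And>\<zeta>. \<zeta> \<in> neg_space R \<tau> \<Longrightarrow> neg_norm R \<tau> \<zeta> \<le> 1 \<Longrightarrow> cmod (\<phi> (replicate n \<zeta>)) \<le> c"
  shows "cmod (monomial R n \<phi> \<omega>) \<le> c * neg_norm R \<tau> \<omega> ^ n"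
proof -
  interpret seminormed "neg_space R \<tau>" "neg_norm R \<tau>" by (rule seminormed_neg[OF \<tau>])
  note wd = Phi_dualI[OF \<tau> \<omega>]
  have scaled: "r ^ n * cmod (\<phi> (replicate n \<omega>)) \<le> c" if r: "0 \<le> r" "r * neg_norm R \<tau> \<omega> \<le> 1" for r
  proof -
    have "neg_norm R \<tau> (fcomb (of_real r) \<omega> 0 \<omega>) \<le> 1"
      using N_fcomb[OF \<omega> \<omega>, of "of_real r" 0] r by simp
    then have "cmod (\<phi> (replicate n (fcomb (of_real r) \<omega> 0 \<omega>))) \<le> c" by (intro c V_fcomb \<omega>)
    then show ?thesis using sym_homogeneous[OF \<phi> wd, of "of_real r"] r by (simp add: norm_mult norm_power)
  qed
  have "0 \<le> 0 ^ n * cmod (\<phi> (replicate n \<omega>))" by simp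
  also have "\<dots> \<le> c" by (rule scaled) simp_all
  finally have c0: "0 \<le> c" .
  have "cmod (\<phi> (replicate n \<omega>)) \<le> c * neg_norm R \<tau> \<omega> ^ n"
  proof (cases "neg_norm R \<tau> \<omega> = 0")
    case False
    then have N: "0 < neg_norm R \<tau> \<omega>" using N_nonneg[OF \<omega>] by simp
    show ?thesis using scaled[of "1 / neg_norm R \<tau> \<omega>"] N by (simp add: power_divide divide_le_eq mult.commute)
  next
    case True
    show ?thesis
    proof (cases n)
      case 0
      then show ?thesis using scaled[of 0] by simp
    next
      case (Suc m)
      have "cmod (\<phi> (replicate n \<omega>)) \<le> 0 + e" if e: "0 < e" for e
      proof -
        define r where "r = max 1 (c / e)"
        have r: "1 \<le> r" by (simp add: r_def)
        have "r * cmod (\<phi> (replicate n \<omega>)) \<le> r ^ n * cmod (\<phi> (replicate n \<omega>))"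
          using r Suc by (intro mult_right_mono) (auto simp: self_le_power)
        also have "\<dots> \<le> c" by (rule scaled) (use r True in auto)
        also have "c \<le> r * e" using e by (simp add: r_def max_def field_simps)
        finally show ?thesis using r by simp
      qed
      then have "cmod (\<phi> (replicate n \<omega>)) \<le> 0" by (rule field_le_epsilon)
      then show ?thesis using True Suc by simp
    qed
  qed
  then show ?thesis using monomial_eq[OF \<phi> wd] by simp
qed

lemma diagonal_le_sym_norm:
  assumes \<tau>: "\<tau> \<in> indices R" and \<phi>: "\<phi> \<in> Phi_sym R n"
    and \<zeta>: "\<zeta> \<in> neg_space R \<tau>" "neg_norm R \<tau> \<zeta> \<le> 1"
  shows "cmod (\<phi> (replicate n \<zeta>)) \<le> sym_norm R \<tau> n \<phi>"
proof -
  have "cmod (\<phi> (replicate n \<zeta>)) \<le> sym_norm R \<tau> n \<phi> * neg_norm R \<tau> \<zeta> ^ n" by (rule diagonal_bound[OF \<tau> \<phi> \<zeta>(1)])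
  also have "\<dots> \<le> sym_norm R \<tau> n \<phi> * 1"
    using \<zeta> neg_norm_nonneg[OF \<tau> \<zeta>(1)] sym_norm_nonneg[OF Phi_symD(3)[OF \<phi> \<tau>]]
    by (intro mult_left_mono power_le_one) auto
  finally show ?thesis by simp
qed

text \<open>The constant \<open>Q\<close> is uniform in the tensor, so that a functional that is bounded in a growth
  norm gives a functional of the tensor that is bounded by diagonal values.\<close>

lemma monomial_growth:
  assumes a: "0 < a" and \<tau>: "\<tau> \<in> indices R"
  shows "\<exists>Q\<ge>0. \<forall>\<phi>\<in>Phi_sym R n. \<forall>c. (\<forall>\<zeta>\<in>neg_space R \<tau>. neg_norm R \<tau> \<zeta> \<le> 1 \<longrightarrow> cmod (\<phi> (replicate n \<zeta>)) \<le> c) \<longrightarrow>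
      (\<forall>\<omega>\<in>neg_space R \<tau>. cmod (monomial R n \<phi> \<omega>) \<le> Q * c * growth_weight \<tau> l a \<omega>)"
proof -
  interpret seminormed "neg_space R \<tau>" "neg_norm R \<tau>" by (rule seminormed_neg[OF \<tau>])
  have N0: "neg_norm R \<tau> (\<lambda>x. 0) \<le> 1" using N_fcomb[OF V_zero V_zero, of 0 0] by (simp add: fcomb_def)
  obtain Q where Q: "0 \<le> Q" "\<And>t. 0 \<le> t \<Longrightarrow> t ^ n \<le> Q * exp ((1/2) ^ l * t powr a)"
    using power_le_exp_powr[OF a, of "(1/2) ^ l" n] by auto
  have "cmod (monomial R n \<phi> \<omega>) \<le> Q * c * growth_weight \<tau> l a \<omega>"
    if \<phi>: "\<phi> \<in> Phi_sym R n" and \<omega>: "\<omega> \<in> neg_space R \<tau>"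
      and c: "\<And>\<zeta>. \<zeta> \<in> neg_space R \<tau> \<Longrightarrow> neg_norm R \<tau> \<zeta> \<le> 1 \<Longrightarrow> cmod (\<phi> (replicate n \<zeta>)) \<le> c" for \<phi> c \<omega>
  proof -
    have c0: "0 \<le> c" by (rule order_trans[OF norm_ge_zero c[OF V_zero N0]])
    have "cmod (monomial R n \<phi> \<omega>) \<le> c * neg_norm R \<tau> \<omega> ^ n" by (rule monomial_bound_from_ball[OF \<tau> \<phi> \<omega> c])
    also have "\<dots> \<le> c * (Q * growth_weight \<tau> l a \<omega>)" by (intro mult_left_mono Q(2) N_nonneg \<omega> c0)
    finally show ?thesis by (simp add: mult_ac)
  qed
  then show ?thesis by (intro exI[of _ Q] conjI Q(1) ballI allI impI) blast
qed

lemma monomial_in: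
  assumes \<alpha>: "0 \<le> \<alpha>" and \<phi>: "\<phi> \<in> Phi_sym R n"
  shows "monomial R n \<phi> \<in> E_min R \<alpha>"
proof (rule E_minI)
  show "monomial R n \<phi> \<omega> = 0" if "\<omega> \<notin> Phi_dual R" for \<omega> using that by (simp add: monomial_def)
  show "entire_bounded_type (monomial R n \<phi>)" by (rule monomial_entire[OF \<phi>])
  fix a \<tau> l assume a: "a \<in> growth_exponents \<alpha>" and \<tau>: "\<tau> \<in> indices R"
  obtain Q where Q: "\<forall>\<phi>\<in>Phi_sym R n. \<forall>c. (\<forall>\<zeta>\<in>neg_space R \<tau>. neg_norm R \<tau> \<zeta> \<le> 1 \<longrightarrow> cmod (\<phi> (replicate n \<zeta>)) \<le> c) \<longrightarrow>
      (\<forall>\<omega>\<in>neg_space R \<tau>. cmod (monomial R n \<phi> \<omega>) \<le> Q * c * growth_weight \<tau> l a \<omega>)"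
    using monomial_growth[OF exponent_positive[OF \<alpha> a] \<tau>, of n l] by metis
  have "\<forall>\<omega>\<in>neg_space R \<tau>. cmod (monomial R n \<phi> \<omega>) \<le> Q * sym_norm R \<tau> n \<phi> * growth_weight \<tau> l a \<omega>"
    by (rule mp[OF spec[OF bspec[OF Q \<phi>]]]) (use diagonal_le_sym_norm[OF \<tau> \<phi>] in auto)
  then show "\<exists>c. \<forall>\<omega>\<in>neg_space R \<tau>. cmod (monomial R n \<phi> \<omega>) \<le> c * growth_weight \<tau> l a \<omega>" by blast
qed

section \<open>Taylor expansion\<close>

definition taylor_coefficient :: "('v dual \<Rightarrow> complex) \<Rightarrow> nat \<Rightarrow> 'v tensor" where
  "taylor_coefficient f n = fcomb (1 / fact n) (deriv_form n f (\<lambda>x. 0)) 0 (deriv_form n f (\<lambda>x. 0))"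

definition taylor_polynomial :: "nat \<Rightarrow> ('v dual \<Rightarrow> complex) \<Rightarrow> 'v dual \<Rightarrow> complex" where
  "taylor_polynomial m f = (\<lambda>\<omega>. \<Sum>k<m. monomial R k (taylor_coefficient f k) \<omega>)"

lemma taylor_coefficient_in: "entire_bounded_type f \<Longrightarrow> taylor_coefficient f n \<in> Phi_sym R n"
  unfolding taylor_coefficient_def by (intro Phi_sym_fcomb deriv_form_in Phi_dual_zero)

lemma taylor_monomial:
  assumes f: "entire_bounded_type f" and \<omega>: "\<omega> \<in> Phi_dual R"
  shows "monomial R n (taylor_coefficient f n) \<omega> = Ds (replicate n \<omega>) f (\<lambda>x. 0) / fact n"
  using monomial_eq[OF taylor_coefficient_in[OF f] \<omega>] \<omega>
  by (simp add: taylor_coefficient_def fcomb_def deriv_form_def set_replicate_conv_if)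

text \<open>The Taylor terms at \<open>\<omega>\<close> are controlled by \<open>f\<close> on the ball of radius \<open>2 \<parallel>\<omega>\<parallel>\<close>, where the
  weight is \<open>exp(2\<^sup>-\<^sup>l (2 \<parallel>\<omega>\<parallel>) powr a)\<close>. The factor \<open>2 powr a\<close> in the exponent is compensated by
  starting from a growth norm with a larger \<open>l\<close>.\<close>

lemma taylor_remainder:
  assumes \<alpha>: "0 \<le> \<alpha>" and f: "f \<in> E_min R \<alpha>" and a: "a \<in> growth_exponents \<alpha>" and \<tau>: "\<tau> \<in> indices R"
  obtains c where "0 \<le> c" "\<And>m \<omega>. \<omega> \<in> neg_space R \<tau> \<Longrightarrow>
      cmod (f \<omega> - taylor_polynomial m f \<omega>) \<le> c * (1/2) ^ m * growth_weight \<tau> l a \<omega>"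
proof -
  interpret seminormed "neg_space R \<tau>" "neg_norm R \<tau>" by (rule seminormed_neg[OF \<tau>])
  have ent: "entire_bounded_type f" by (rule E_min_entire[OF \<alpha> f])
  have a0: "0 < a" by (rule exponent_positive[OF \<alpha> a])
  obtain l2 :: nat where "\<And>k. l2 \<le> k \<Longrightarrow> 2 powr a * (1/2) ^ k \<le> (1/2) ^ l"
    using half_power_small[of "(1/2) ^ l" "2 powr a"] by auto
  then have l2: "2 powr a * (1/2) ^ l2 \<le> (1/2) ^ l" by blast
  let ?c = "growth_norm R \<tau> l2 a f"
  have c0: "0 \<le> ?c" by (rule growth_norm_nonneg[OF f a \<tau>])
  have "cmod (f \<omega> - taylor_polynomial m f \<omega>) \<le> (2 * ?c) * (1/2) ^ m * growth_weight \<tau> l a \<omega>"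
    if \<omega>: "\<omega> \<in> neg_space R \<tau>" for m \<omega>
  proof -
    let ?t = "\<lambda>n. Ds (replicate n \<omega>) f (\<lambda>x. 0) / fact n"
    have b: "cmod (?t n) \<le> ?c * growth_weight \<tau> l a \<omega> / 2 ^ n" for n
    proof (rule Taylor_coefficient_bound[OF entire_bounded_typeD[OF ent \<tau>] \<omega>])
      fix \<zeta> assume \<zeta>: "\<zeta> \<in> neg_space R \<tau>" "neg_norm R \<tau> \<zeta> \<le> 2 * neg_norm R \<tau> \<omega>"
      have "cmod (f \<zeta>) \<le> ?c * growth_weight \<tau> l2 a \<zeta>" by (rule growth_bound[OF f a \<tau> \<zeta>(1)])
      also have "growth_weight \<tau> l2 a \<zeta> \<le> growth_weight \<tau> l a \<omega>"
      proof -
        have "neg_norm R \<tau> \<zeta> powr a \<le> (2 * neg_norm R \<tau> \<omega>) powr a"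
          using \<zeta> a0 N_nonneg by (intro powr_mono2) auto
        also have "\<dots> = 2 powr a * neg_norm R \<tau> \<omega> powr a" using N_nonneg[OF \<omega>] by (simp add: powr_mult)
        finally have "(1/2) ^ l2 * neg_norm R \<tau> \<zeta> powr a \<le> (1/2) ^ l2 * (2 powr a * neg_norm R \<tau> \<omega> powr a)"
          by (intro mult_left_mono) auto
        also have "\<dots> = (2 powr a * (1/2) ^ l2) * neg_norm R \<tau> \<omega> powr a" by simp
        also have "\<dots> \<le> (1/2) ^ l * neg_norm R \<tau> \<omega> powr a" by (intro mult_right_mono l2) auto
        finally show ?thesis by simp
      qed
      finally show "cmod (f \<zeta>) \<le> ?c * growth_weight \<tau> l a \<omega>" using c0 by (simp add: mult_left_mono)
    qed
    have s: "?t sums f \<omega>" by (rule Taylor_sums[OF entire_bounded_typeD[OF ent \<tau>] \<omega>])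
    have "f \<omega> - taylor_polynomial m f \<omega> = (\<Sum>n. ?t (n + m))"
      using suminf_minus_initial_segment[OF sums_summable[OF s], of m] sums_unique[OF s]
        taylor_monomial[OF ent Phi_dualI[OF \<tau> \<omega>]] by (simp add: taylor_polynomial_def)
    also have "cmod \<dots> \<le> (\<Sum>n. (?c * growth_weight \<tau> l a \<omega> * (1/2) ^ m) * (1/2) ^ n)"
    proof (rule norm_suminf_le)
      show "cmod (?t (n + m)) \<le> (?c * growth_weight \<tau> l a \<omega> * (1/2) ^ m) * (1/2) ^ n" for n
        using b[of "n + m"] by (simp add: power_add power_divide mult.commute)
      show "summable (\<lambda>n. (?c * growth_weight \<tau> l a \<omega> * (1/2) ^ m) * (1/2) ^ n)"
        by (intro summable_mult summable_geometric) simp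
    qed
    also have "\<dots> = (?c * growth_weight \<tau> l a \<omega> * (1/2) ^ m) * 2"
      by (subst suminf_mult) (simp_all add: suminf_geometric)
    finally show ?thesis by (simp add: mult_ac)
  qed
  moreover have "0 \<le> 2 * ?c" using c0 by simp
  ultimately show ?thesis using that by blast
qed

section \<open>Differential operators of infinite order\<close>

lemma deriv_form_fcomb:
  assumes f: "entire_bounded_type f" and g: "entire_bounded_type g" and \<omega>: "\<omega> \<in> Phi_dual R"
  shows "deriv_form n (fcomb a f b g) \<omega> = fcomb a (deriv_form n f \<omega>) b (deriv_form n g \<omega>)"
proof
  fix ws
  show "deriv_form n (fcomb a f b g) \<omega> ws = fcomb a (deriv_form n f \<omega>) b (deriv_form n g \<omega>) ws"
  proof (cases "length ws = n \<and> set ws \<subseteq> Phi_dual R")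
    case True
    then have "set (\<omega> # ws) \<subseteq> Phi_dual R" using \<omega> by simp
    then obtain \<tau> where \<tau>: "\<tau> \<in> indices R" and "set (\<omega> # ws) \<subseteq> neg_space R \<tau>"
      using Phi_dual_common_list by blast
    then have "Ds ws (fcomb a f b g) \<omega> = a * Ds ws f \<omega> + b * Ds ws g \<omega>"
      by (intro seminormed.Ds_fcomb[OF seminormed_neg[OF \<tau>] entire_bounded_typeD[OF f \<tau>] entire_bounded_typeD[OF g \<tau>]]) auto
    then show ?thesis using True by (simp add: deriv_form_def fcomb_def[of _ "\<lambda>ws. if _ ws then _ ws else _ ws"])
  next
    case False
    then show ?thesis by (simp only: deriv_form_def fcomb_def if_False mult_zero_right add_0_right)
  qed
qed

lemma deriv_form_translate:
  "deriv_form n (\<lambda>\<omega>. f (fcomb 1 \<omega> t w)) \<omega> = deriv_form n f (fcomb 1 \<omega> t w)"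
  by (simp only: deriv_form_def Ds_translate[of _ f t w])

lemma neg_sym_linear:
  assumes "F \<in> neg_sym R \<tau> n" "\<phi> \<in> Phi_sym R n" "\<psi> \<in> Phi_sym R n"
  shows "F (fcomb a \<phi> b \<psi>) = a * F \<phi> + b * F \<psi>"
  using assms unfolding neg_sym_def dual_of_def by blast

end

text \<open>The coefficient sequences \<open>\<theta>\<close> and \<open>\<rho>\<close> both satisfy these conditions, the first one giving
  the Sheffer operator and the second one its inverse.\<close>

locale appell_coefficients = nuclear_family +
  fixes \<kappa> :: "nat \<Rightarrow> 'b dual_tensor" and \<tau> :: 'a and \<beta> C :: real
  assumes \<tau>: "\<tau> \<in> indices R" and \<beta>: "1 < \<beta>" and C: "1 \<le> C"
    and coeff_zero: "\<And>\<phi>. \<phi> \<in> Phi_sym R 0 \<Longrightarrow> \<kappa> 0 \<phi> = \<phi> []"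
    and coeff_in: "\<And>n. 1 \<le> n \<Longrightarrow> \<kappa> n \<in> neg_sym R \<tau> n"
    and coeff_norm: "\<And>n. 1 \<le> n \<Longrightarrow> neg_sym_norm R \<tau> n (\<kappa> n) \<le> C ^ n * fact n powr (1 / \<beta> - 1)"
begin

lemma coeff_linear:
  assumes \<phi>: "\<phi> \<in> Phi_sym R n" and \<psi>: "\<psi> \<in> Phi_sym R n"
  shows "\<kappa> n (fcomb a \<phi> b \<psi>) = a * \<kappa> n \<phi> + b * \<kappa> n \<psi>"
proof (cases n)
  case 0
  then show ?thesis using coeff_zero[of \<phi>] coeff_zero[of \<psi>] coeff_zero[of "fcomb a \<phi> b \<psi>"] \<phi> \<psi> Phi_sym_fcomb[OF \<phi> \<psi>]
    by (simp add: fcomb_def)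
next
  case (Suc m)
  then show ?thesis using neg_sym_linear[OF coeff_in \<phi> \<psi>] by simp
qed

lemma coeff_bound:
  assumes \<phi>: "\<phi> \<in> Phi_sym R n"
  shows "cmod (\<kappa> n \<phi>) \<le> C ^ n * fact n powr (1 / \<beta> - 1) * sym_norm R \<tau> n \<phi>"
proof (cases n)
  case 0
  then show ?thesis
    using diagonal_bound[OF \<tau> \<phi> seminormed.V_zero[OF seminormed_neg[OF \<tau>]]] coeff_zero \<phi> by simp
next
  case (Suc m)
  have "cmod (\<kappa> n \<phi>) \<le> neg_sym_norm R \<tau> n (\<kappa> n) * sym_norm R \<tau> n \<phi>"
    using Suc by (intro neg_sym_bound \<tau> coeff_in \<phi>) simp
  also have "\<dots> \<le> C ^ n * fact n powr (1 / \<beta> - 1) * sym_norm R \<tau> n \<phi>"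
    using Suc by (intro mult_right_mono coeff_norm sym_norm_nonneg[OF Phi_symD(3)[OF \<phi> \<tau>]]) simp
  finally show ?thesis .
qed

definition summand :: "nat \<Rightarrow> ('b dual \<Rightarrow> complex) \<Rightarrow> 'b dual \<Rightarrow> complex" where
  "summand n f \<omega> = \<kappa> n (deriv_form n f \<omega>)"

text \<open>The operator \<open>\<kappa>(D)\<close>, where \<open>\<kappa>(\<xi>)\<close> is the generating series of the coefficients.\<close>

definition diff_op :: "('b dual \<Rightarrow> complex) \<Rightarrow> 'b dual \<Rightarrow> complex" where
  "diff_op f \<omega> = (if \<omega> \<in> Phi_dual R then \<Sum>n. summand n f \<omega> else 0)"

lemma summand_fcomb:
  "entire_bounded_type f \<Longrightarrow> entire_bounded_type g \<Longrightarrow> \<omega> \<in> Phi_dual R \<Longrightarrow>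
    summand n (fcomb a f b g) \<omega> = a * summand n f \<omega> + b * summand n g \<omega>"
  unfolding summand_def by (subst deriv_form_fcomb) (simp_all add: coeff_linear deriv_form_in)

lemma summand_bound:
  assumes f: "entire_bounded_type f" and hs: "hs_below \<tau> \<sigma> M" and \<omega>: "\<omega> \<in> neg_space R \<sigma>" and s: "0 < s"
    and c: "\<And>\<zeta>. \<zeta> \<in> neg_space R \<sigma> \<Longrightarrow> neg_norm R \<sigma> \<zeta> \<le> real n * s \<Longrightarrow> cmod (f (fcomb 1 \<omega> 1 \<zeta>)) \<le> c"
  shows "cmod (summand n f \<omega>) \<le> C ^ n * fact n powr (1 / \<beta> - 1) * ((M / s) ^ n * c)"
proof -
  have "cmod (summand n f \<omega>) \<le> C ^ n * fact n powr (1 / \<beta> - 1) * sym_norm R \<tau> n (deriv_form n f \<omega>)"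
    unfolding summand_def by (intro coeff_bound deriv_form_in f Phi_dualI[OF hs_belowD(2)[OF hs] \<omega>])
  also have "\<dots> \<le> C ^ n * fact n powr (1 / \<beta> - 1) * ((M / s) ^ n * c)"
    using C by (intro mult_left_mono deriv_form_norm[OF f hs \<omega> s c]) auto
  finally show ?thesis .
qed

text \<open>Each term commutes with translations and depends on \<open>f\<close> near the point only, so its
  derivative along a line is the same term for the derivative of \<open>f\<close>.\<close>

lemma summand_holomorphic:
  assumes f: "entire_bounded_type f" and \<omega>: "\<omega> \<in> Phi_dual R" and \<eta>: "\<eta> \<in> Phi_dual R"
  shows "(\<lambda>z. summand n f (fcomb 1 \<omega> z \<eta>)) holomorphic_on UNIV"
proof -
  obtain \<tau>1 where t1: "\<tau>1 \<in> indices R" "\<omega> \<in> neg_space R \<tau>1" "\<eta> \<in> neg_space R \<tau>1"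
    by (rule Phi_dual_common[OF \<omega> \<eta>])
  obtain \<sigma> M K where hs: "hs_below \<tau> \<sigma> M"
    and K: "\<And>\<omega>. \<omega> \<in> neg_space R \<tau>1 \<Longrightarrow> \<omega> \<in> neg_space R \<sigma> \<and> neg_norm R \<sigma> \<omega> \<le> K * neg_norm R \<tau>1 \<omega>"
    using hs_below_exists[OF \<tau> t1(1)] by blast
  note hsD = hs_belowD[OF hs]
  have \<omega>s: "\<omega> \<in> neg_space R \<sigma>" and \<eta>s: "\<eta> \<in> neg_space R \<sigma>" using K t1 by blast+
  interpret seminormed "neg_space R \<sigma>" "neg_norm R \<sigma>" by (rule seminormed_neg[OF hsD(2)])
  note wd = Phi_dualI[OF hsD(2)]
  have der0: "((\<lambda>t. summand n f (fcomb 1 \<omega>' t \<eta>)) has_field_derivative summand n (D \<eta> f) \<omega>') (at 0)"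
    if \<omega>': "\<omega>' \<in> neg_space R \<sigma>" for \<omega>'
  proof (rule local_operator_has_derivative[where P = entire_bounded_type and r = "real n" and
      K = "C ^ n * fact n powr (1 / \<beta> - 1) * M ^ n"])
    show "0 \<le> C ^ n * fact n powr (1 / \<beta> - 1) * M ^ n" using C hsD(3) by simp
    fix f \<omega> c assume *: "entire_bounded_type f" "\<omega> \<in> neg_space R \<sigma>"
      and c: "\<And>\<zeta>. \<zeta> \<in> neg_space R \<sigma> \<Longrightarrow> neg_norm R \<sigma> \<zeta> \<le> real n \<Longrightarrow> cmod (f (fcomb 1 \<omega> 1 \<zeta>)) \<le> c"
    show "cmod (summand n f \<omega>) \<le> C ^ n * fact n powr (1 / \<beta> - 1) * M ^ n * c"
      using summand_bound[OF *(1) hs *(2), of 1 n c] c by (simp add: mult.assoc)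
  next
    fix f t w \<omega> show "summand n (\<lambda>\<omega>. f (fcomb 1 \<omega> t w)) \<omega> = summand n f (fcomb 1 \<omega> t w)"
      by (simp add: summand_def deriv_form_translate)
  qed (use entire_bounded_typeD[OF _ hsD(2)] entire_bounded_type_fcomb entire_bounded_type_translate entire_bounded_type_D wd summand_fcomb f \<eta>s \<omega>' in auto)
  have der: "((\<lambda>t. summand n f (fcomb 1 \<omega> (z + t) \<eta>)) has_field_derivative
      summand n (D \<eta> f) (fcomb 1 \<omega> z \<eta>)) (at 0)" for z
    using der0[OF V_fcomb[OF \<omega>s \<eta>s, of 1 z]] by (simp only: fcomb_add)
  have "((\<lambda>z. summand n f (fcomb 1 \<omega> z \<eta>)) has_field_derivative summand n (D \<eta> f) (fcomb 1 \<omega> z \<eta>)) (at z)" for z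
  proof -
    have "((\<lambda>z. summand n f (fcomb 1 \<omega> z \<eta>)) has_field_derivative summand n (D \<eta> f) (fcomb 1 \<omega> z \<eta>)) (at (0 + z))"
      by (subst DERIV_shift) (use der[of z] in \<open>simp only: add.commute\<close>)
    then show ?thesis by simp
  qed
  then show ?thesis unfolding holomorphic_on_def field_differentiable_def by blast
qed

text \<open>The radius \<open>(L n) powr (1/\<beta>)\<close> in Cauchy's estimate matches the decay of the coefficients:
  since \<open>n\<^sup>n \<le> e\<^sup>n n!\<close>, the factor \<open>n! powr (1/\<beta> - 1)\<close> cancels \<open>n\<^sup>n / (n\<^sup>n) powr (1/\<beta>)\<close> up to a
  geometric factor, and that one is small for large \<open>L\<close>.\<close>

lemma coefficient_asymptotics:
  assumes n: "1 \<le> n" and L: "0 < L" and M: "0 \<le> M"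
  shows "C ^ n * fact n powr (1 / \<beta> - 1) * (M * real n / (L * real n) powr (1 / \<beta>)) ^ n
    \<le> (C * M * exp 1 / L powr (1 / \<beta>)) ^ n"
proof -
  let ?p = "1 - 1 / \<beta>" and ?n = "real n"
  have p: "0 \<le> ?p" "?p \<le> 1" using \<beta> by auto
  have n0: "0 < ?n" using n by simp
  have "fact n powr (1 / \<beta> - 1) * (?n / (L * ?n) powr (1 / \<beta>)) ^ n
      = (?n ^ n / fact n) powr ?p / (L powr (1 / \<beta>)) ^ n"
  proof -
    have i: "((L * ?n) powr (1 / \<beta>)) ^ n = (L powr (1 / \<beta>)) ^ n * (?n powr (1 / \<beta>)) ^ n"
      using L n0 by (simp add: powr_mult power_mult_distrib)
    have ii: "?n ^ n / (?n powr (1 / \<beta>)) ^ n = (?n ^ n) powr ?p"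
    proof -
      have "?n / ?n powr (1 / \<beta>) = ?n powr ?p" using n0 by (simp add: powr_diff)
      then have "?n ^ n / (?n powr (1 / \<beta>)) ^ n = (?n powr ?p) ^ n" by (simp add: power_divide[symmetric])
      also have "\<dots> = ?n powr (?p * ?n)" using n0 by (simp add: powr_powr[symmetric] powr_realpow)
      also have "\<dots> = (?n powr ?n) powr ?p" by (simp add: powr_powr mult.commute)
      also have "?n powr ?n = ?n ^ n" using n0 by (simp add: powr_realpow)
      finally show ?thesis .
    qed
    have iii: "fact n powr (1 / \<beta> - 1) = 1 / (fact n powr ?p :: real)"
      using powr_minus_divide[of "fact n" ?p] by simp
    have "fact n powr (1 / \<beta> - 1) * (?n / (L * ?n) powr (1 / \<beta>)) ^ n
      = 1 / (fact n powr ?p) * (?n ^ n / ((L powr (1 / \<beta>)) ^ n * (?n powr (1 / \<beta>)) ^ n))"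
      by (simp only: power_divide i iii)
    also have "\<dots> = (?n ^ n / (?n powr (1 / \<beta>)) ^ n) / (fact n powr ?p) / (L powr (1 / \<beta>)) ^ n" by simp
    also have "\<dots> = (?n ^ n) powr ?p / (fact n powr ?p) / (L powr (1 / \<beta>)) ^ n" by (simp only: ii)
    finally show ?thesis using n0 by (simp add: powr_divide)
  qed
  also have "\<dots> \<le> exp 1 ^ n / (L powr (1 / \<beta>)) ^ n"
  proof (rule divide_right_mono)
    have "?n ^ n / fact n \<le> exp 1 ^ n" using power_self_le_exp_fact[of n] by (simp add: divide_le_eq)
    then have "(?n ^ n / fact n) powr ?p \<le> (exp 1 ^ n) powr ?p" using p n0 by (intro powr_mono2) auto
    also have "\<dots> \<le> (exp 1 ^ n) powr 1" using p by (intro powr_mono one_le_power) auto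
    finally show "(?n ^ n / fact n) powr ?p \<le> exp 1 ^ n" by simp
  qed simp
  finally have *: "fact n powr (1 / \<beta> - 1) * (?n / (L * ?n) powr (1 / \<beta>)) ^ n \<le> exp 1 ^ n / (L powr (1 / \<beta>)) ^ n" .
  have "(C * M) ^ n * (fact n powr (1 / \<beta> - 1) * (?n / (L * ?n) powr (1 / \<beta>)) ^ n)
      \<le> (C * M) ^ n * (exp 1 ^ n / (L powr (1 / \<beta>)) ^ n)"
    using C M by (intro mult_left_mono[OF *]) simp
  then show ?thesis by (simp add: power_mult_distrib power_divide mult_ac)
qed

text \<open>The radius in Cauchy's estimate for the \<open>n\<close>-th term is \<open>r = (L n) powr (1/\<beta>)\<close>, with \<open>L\<close> such
  that the coefficients contribute \<open>(1/4)\<^sup>n\<close>. On a ball of this radius the weight of \<open>f\<close> grows by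
  \<open>exp(q r powr a)\<close>, where \<open>r powr a \<le> L n\<close> because of \<open>a \<le> \<beta>\<close>; for large \<open>l\<close> the number \<open>q\<close> is so
  small that this is at most \<open>2\<^sup>n\<close>.\<close>

lemma summand_growth:
  assumes hs: "hs_below \<tau> \<sigma> M" and a: "0 < a" "a \<le> \<beta>"
  shows "\<exists>l0. \<forall>l\<ge>l0. \<forall>f c \<omega> n. entire_bounded_type f \<longrightarrow> 0 \<le> c \<longrightarrow>
    (\<forall>\<zeta>\<in>neg_space R \<sigma>. cmod (f \<zeta>) \<le> c * growth_weight \<sigma> l a \<zeta>) \<longrightarrow> \<omega> \<in> neg_space R \<sigma> \<longrightarrow>
    cmod (summand n f \<omega>) \<le> (1/2) ^ n * (c * exp (2 powr a * (1/2) ^ l * neg_norm R \<sigma> \<omega> powr a))"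
proof -
  note hsD = hs_belowD[OF hs]
  interpret seminormed "neg_space R \<sigma>" "neg_norm R \<sigma>" by (rule seminormed_neg[OF hsD(2)])
  \<comment> \<open>With this choice \<open>C M e / L powr (1/\<beta>) = 1/4\<close>.\<close>
  define L where "L = (4 * C * M * exp 1) powr \<beta>"
  have CM: "1 \<le> 4 * C * M * exp 1"
  proof -
    have "1 \<le> C * M" using mult_mono[of 1 C 1 M] C hsD(3) by simp
    moreover have "1 \<le> exp (1::real)" by simp
    ultimately have "1 * 1 \<le> (C * M) * exp 1" by (intro mult_mono) auto
    then show ?thesis by simp
  qed
  have L: "1 \<le> L" unfolding L_def using CM \<beta> by (intro ge_one_powr_ge_zero) auto
  have Lr: "L powr (1 / \<beta>) = 4 * C * M * exp 1" unfolding L_def using CM \<beta> by (simp add: powr_powr)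
  obtain l0 :: nat where l0: "\<And>l. l0 \<le> l \<Longrightarrow> (2 powr a * L) * (1/2) ^ l \<le> ln 2"
    using half_power_small[of "ln 2" "2 powr a * L"] by auto
  have "cmod (summand n f \<omega>) \<le> (1/2) ^ n * (c * exp (2 powr a * (1/2) ^ l * neg_norm R \<sigma> \<omega> powr a))"
    if l: "l0 \<le> l" and f: "entire_bounded_type f" and c: "0 \<le> c"
      and growth: "\<forall>\<zeta>\<in>neg_space R \<sigma>. cmod (f \<zeta>) \<le> c * growth_weight \<sigma> l a \<zeta>"
      and \<omega>: "\<omega> \<in> neg_space R \<sigma>" for l f c \<omega> n
  proof -
    let ?N = "neg_norm R \<sigma> \<omega>"
    define q where "q = 2 powr a * (1/2) ^ l"
    have ball: "cmod (f (fcomb 1 \<omega> 1 \<zeta>)) \<le> c * exp (q * ?N powr a) * exp (q * r powr a)"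
      if \<zeta>: "\<zeta> \<in> neg_space R \<sigma>" "neg_norm R \<sigma> \<zeta> \<le> r" for \<zeta> r
    proof -
      have r: "0 \<le> r" using N_nonneg[OF \<zeta>(1)] \<zeta>(2) by simp
      have x: "fcomb 1 \<omega> 1 \<zeta> \<in> neg_space R \<sigma>" by (rule V_fcomb[OF \<omega> \<zeta>(1)])
      have "neg_norm R \<sigma> (fcomb 1 \<omega> 1 \<zeta>) \<le> ?N + r" using N_line[OF \<omega> \<zeta>(1), of 1 r] \<zeta>(2) by simp
      then have "neg_norm R \<sigma> (fcomb 1 \<omega> 1 \<zeta>) powr a \<le> (?N + r) powr a"
        using N_nonneg[OF x] a(1) by (intro powr_mono2) auto
      also have "\<dots> \<le> 2 powr a * (?N powr a + r powr a)" by (rule powr_add_le[OF N_nonneg[OF \<omega>] r a(1)])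
      finally have "(1/2) ^ l * neg_norm R \<sigma> (fcomb 1 \<omega> 1 \<zeta>) powr a \<le> (1/2) ^ l * (2 powr a * (?N powr a + r powr a))"
        by (intro mult_left_mono) auto
      also have "\<dots> = q * ?N powr a + q * r powr a" by (simp add: q_def algebra_simps)
      finally have "growth_weight \<sigma> l a (fcomb 1 \<omega> 1 \<zeta>) \<le> exp (q * ?N powr a) * exp (q * r powr a)"
        by (simp add: exp_add[symmetric])
      then have "c * growth_weight \<sigma> l a (fcomb 1 \<omega> 1 \<zeta>) \<le> c * (exp (q * ?N powr a) * exp (q * r powr a))"
        by (rule mult_left_mono[OF _ c])
      then show ?thesis using growth x by (simp add: mult.assoc) (meson order_trans)
    qed
    show ?thesis
    proof (cases "n = 0")
      case True
      have "cmod (summand n f \<omega>) \<le> C ^ n * fact n powr (1 / \<beta> - 1) * ((M / 1) ^ n * (c * exp (q * ?N powr a) * exp (q * 0 powr a)))"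
        by (rule summand_bound[OF f hs \<omega>]) (use True ball[of _ 0] in auto)
      then show ?thesis using True by (simp add: q_def)
    next
      case False
      then have n: "1 \<le> n" by simp
      define r where "r = (L * real n) powr (1 / \<beta>)"
      have r: "0 < r" using L n by (simp add: r_def)
      have "1 * 1 \<le> L * real n" using L n by (intro mult_mono) auto
      then have Ln: "1 \<le> L * real n" by simp
      have ra: "r powr a \<le> L * real n"
      proof -
        have "r powr a = (L * real n) powr (a / \<beta>)" unfolding r_def by (simp add: powr_powr)
        also have "\<dots> \<le> (L * real n) powr 1" using Ln a \<beta> by (intro powr_mono) (auto simp: divide_le_eq)
        finally show ?thesis using Ln by simp
      qed
      have e2: "exp (q * r powr a) \<le> 2 ^ n"
      proof -
        have "q * r powr a \<le> q * (L * real n)" by (intro mult_left_mono ra) (simp add: q_def)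
        also have "\<dots> = ((2 powr a * L) * (1/2) ^ l) * real n" by (simp add: q_def)
        also have "\<dots> \<le> ln 2 * real n" by (intro mult_right_mono l0 l) simp
        finally have "exp (q * r powr a) \<le> exp (real n * ln 2)" by (simp add: mult.commute)
        also have "\<dots> = 2 ^ n" by (simp add: exp_of_nat_mult)
        finally show ?thesis .
      qed
      have "cmod (summand n f \<omega>) \<le> C ^ n * fact n powr (1 / \<beta> - 1) *
          ((M / (r / real n)) ^ n * (c * exp (q * ?N powr a) * exp (q * r powr a)))"
      proof (rule summand_bound[OF f hs \<omega>])
        show "0 < r / real n" using r n by simp
        fix \<zeta> assume "\<zeta> \<in> neg_space R \<sigma>" "neg_norm R \<sigma> \<zeta> \<le> real n * (r / real n)"
        then show "cmod (f (fcomb 1 \<omega> 1 \<zeta>)) \<le> c * exp (q * ?N powr a) * exp (q * r powr a)"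
          using n by (intro ball) auto
      qed
      also have "\<dots> = (C ^ n * fact n powr (1 / \<beta> - 1) * (M * real n / r) ^ n) * (c * exp (q * ?N powr a) * exp (q * r powr a))"
        by simp
      also have "\<dots> \<le> (1/4) ^ n * (c * exp (q * ?N powr a) * 2 ^ n)"
      proof (intro mult_mono e2 order_refl)
        have "C ^ n * fact n powr (1 / \<beta> - 1) * (M * real n / r) ^ n \<le> (C * M * exp 1 / L powr (1 / \<beta>)) ^ n"
          unfolding r_def using L hsD(3) by (intro coefficient_asymptotics n) auto
        also have "C * M * exp 1 / L powr (1 / \<beta>) = 1/4" unfolding Lr using C hsD(3) by simp
        finally show "C ^ n * fact n powr (1 / \<beta> - 1) * (M * real n / r) ^ n \<le> (1/4) ^ n" .
      qed (use c in auto)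
      also have "\<dots> = (1/2) ^ n * (c * exp (q * ?N powr a))"
      proof -
        have "(1/4) ^ n * 2 ^ n = ((1/2) ^ n :: real)" by (simp add: power_mult_distrib[symmetric])
        then show ?thesis by (metis mult.commute mult.left_commute)
      qed
      finally show ?thesis by (simp add: q_def)
    qed
  qed
  then show ?thesis by blast
qed

text \<open>The losses, a factor \<open>2 powr a\<close> in the exponent and the constant \<open>K\<close> of the inclusion
  \<open>\<H>\<^sub>-\<^sub>\<tau>\<^sub>' \<subseteq> \<H>\<^sub>-\<^sub>\<sigma>\<close>, are absorbed by taking \<open>l\<close> large: this is where functions of minimal type are
  better than functions of finite type.\<close>

lemma summand_growth_uniform:
  assumes \<tau>': "\<tau>' \<in> indices R" and a: "0 < a" "a \<le> \<beta>"
  shows "\<exists>\<sigma>\<in>indices R. \<exists>l. \<forall>f c \<omega> n. entire_bounded_type f \<longrightarrow> 0 \<le> c \<longrightarrow>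
    (\<forall>\<zeta>\<in>neg_space R \<sigma>. cmod (f \<zeta>) \<le> c * growth_weight \<sigma> l a \<zeta>) \<longrightarrow> \<omega> \<in> neg_space R \<tau>' \<longrightarrow>
    cmod (summand n f \<omega>) \<le> (1/2) ^ n * (c * growth_weight \<tau>' l' a \<omega>)"
proof -
  obtain \<sigma> M K where hs: "hs_below \<tau> \<sigma> M" and K: "1 \<le> K"
    "\<And>\<omega>. \<omega> \<in> neg_space R \<tau>' \<Longrightarrow> \<omega> \<in> neg_space R \<sigma> \<and> neg_norm R \<sigma> \<omega> \<le> K * neg_norm R \<tau>' \<omega>"
    using hs_below_exists[OF \<tau> \<tau>'] by blast
  note hsD = hs_belowD[OF hs]
  obtain l0 where l0: "\<forall>l\<ge>l0. \<forall>f c \<omega> n. entire_bounded_type f \<longrightarrow> 0 \<le> c \<longrightarrow>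
    (\<forall>\<zeta>\<in>neg_space R \<sigma>. cmod (f \<zeta>) \<le> c * growth_weight \<sigma> l a \<zeta>) \<longrightarrow> \<omega> \<in> neg_space R \<sigma> \<longrightarrow>
    cmod (summand n f \<omega>) \<le> (1/2) ^ n * (c * exp (2 powr a * (1/2) ^ l * neg_norm R \<sigma> \<omega> powr a))"
    using summand_growth[OF hs a] by metis
  obtain l1 :: nat where l1: "\<And>l. l1 \<le> l \<Longrightarrow> (2 powr a * K powr a) * (1/2) ^ l \<le> (1/2) ^ l'"
    using half_power_small[of "(1/2) ^ l'" "2 powr a * K powr a"] by auto
  define l where "l = max l0 l1"
  have l: "l0 \<le> l" "l1 \<le> l" by (auto simp: l_def)
  have "cmod (summand n f \<omega>) \<le> (1/2) ^ n * (c * growth_weight \<tau>' l' a \<omega>)"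
    if f: "entire_bounded_type f" and c: "0 \<le> c"
      and growth: "\<forall>\<zeta>\<in>neg_space R \<sigma>. cmod (f \<zeta>) \<le> c * growth_weight \<sigma> l a \<zeta>"
      and \<omega>: "\<omega> \<in> neg_space R \<tau>'" for f c \<omega> n
  proof -
    have \<omega>s: "\<omega> \<in> neg_space R \<sigma>" using K(2)[OF \<omega>] by blast
    have N: "0 \<le> neg_norm R \<sigma> \<omega>" "0 \<le> neg_norm R \<tau>' \<omega>"
      using neg_norm_nonneg[OF hsD(2) \<omega>s] neg_norm_nonneg[OF \<tau>' \<omega>] by auto
    have "cmod (summand n f \<omega>) \<le> (1/2) ^ n * (c * exp (2 powr a * (1/2) ^ l * neg_norm R \<sigma> \<omega> powr a))"
      using l0 l(1) f c growth \<omega>s by metis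
    also have "\<dots> \<le> (1/2) ^ n * (c * growth_weight \<tau>' l' a \<omega>)"
    proof (intro mult_left_mono)
      have "neg_norm R \<sigma> \<omega> powr a \<le> (K * neg_norm R \<tau>' \<omega>) powr a"
        using K(2)[OF \<omega>] N a(1) by (intro powr_mono2) auto
      also have "\<dots> = K powr a * neg_norm R \<tau>' \<omega> powr a" using K(1) N by (simp add: powr_mult)
      finally have "2 powr a * (1/2) ^ l * neg_norm R \<sigma> \<omega> powr a \<le> 2 powr a * (1/2) ^ l * (K powr a * neg_norm R \<tau>' \<omega> powr a)"
        by (intro mult_left_mono) auto
      also have "\<dots> = ((2 powr a * K powr a) * (1/2) ^ l) * neg_norm R \<tau>' \<omega> powr a" by simp
      also have "\<dots> \<le> (1/2) ^ l' * neg_norm R \<tau>' \<omega> powr a" by (intro mult_right_mono l1 l) simp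
      finally show "exp (2 powr a * (1/2) ^ l * neg_norm R \<sigma> \<omega> powr a) \<le> growth_weight \<tau>' l' a \<omega>" by simp
    qed (use c in auto)
    finally show ?thesis .
  qed
  then show ?thesis using hsD(2) by blast
qed

text \<open>For \<open>\<alpha> = 0\<close> all positive exponents belong to the space, but the estimate of the terms holds
  for exponents up to \<open>\<beta>\<close>. Larger exponents are reduced to \<open>\<beta>\<close>.\<close>

definition usable_exponent :: "real \<Rightarrow> real \<Rightarrow> bool" where
  "usable_exponent \<alpha> a \<longleftrightarrow> a \<in> growth_exponents \<alpha> \<and> 0 < a \<and> a \<le> \<beta>"

lemma usable_exponent_below:
  assumes "0 \<le> \<alpha>" "\<alpha> \<le> \<beta>" "a \<in> growth_exponents \<alpha>"
  shows "usable_exponent \<alpha> (min a \<beta>)"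
  using assms \<beta> by (auto simp: usable_exponent_def growth_exponents_def min_def split: if_splits)

lemma summand_estimate:
  assumes \<alpha>: "0 \<le> \<alpha>" and a: "usable_exponent \<alpha> a" and \<tau>': "\<tau>' \<in> indices R"
  shows "\<exists>\<sigma>\<in>indices R. \<exists>l. \<forall>f\<in>E_min R \<alpha>. \<forall>\<omega>\<in>neg_space R \<tau>'. \<forall>n.
    cmod (summand n f \<omega>) \<le> (1/2) ^ n * (growth_norm R \<sigma> l a f * growth_weight \<tau>' l' a \<omega>)"
proof -
  have a: "a \<in> growth_exponents \<alpha>" "0 < a" "a \<le> \<beta>" using a by (auto simp: usable_exponent_def)
  obtain \<sigma> l where \<sigma>: "\<sigma> \<in> indices R" and est: "\<forall>f c \<omega> n. entire_bounded_type f \<longrightarrow> 0 \<le> c \<longrightarrow>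
    (\<forall>\<zeta>\<in>neg_space R \<sigma>. cmod (f \<zeta>) \<le> c * growth_weight \<sigma> l a \<zeta>) \<longrightarrow> \<omega> \<in> neg_space R \<tau>' \<longrightarrow>
    cmod (summand n f \<omega>) \<le> (1/2) ^ n * (c * growth_weight \<tau>' l' a \<omega>)"
    using summand_growth_uniform[OF \<tau>' a(2,3), of l'] by metis
  have "cmod (summand n f \<omega>) \<le> (1/2) ^ n * (growth_norm R \<sigma> l a f * growth_weight \<tau>' l' a \<omega>)"
    if f: "f \<in> E_min R \<alpha>" and \<omega>: "\<omega> \<in> neg_space R \<tau>'" for f \<omega> n
    by (rule est[rule_format, OF E_min_entire[OF \<alpha> f] growth_norm_nonneg[OF f a(1) \<sigma>] growth_bound[OF f a(1) \<sigma>] \<omega>])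
  then show ?thesis using \<sigma> by blast
qed

lemma diff_op_estimate:
  assumes \<alpha>: "0 \<le> \<alpha>" and a: "usable_exponent \<alpha> a" and \<tau>': "\<tau>' \<in> indices R"
  shows "\<exists>\<sigma>\<in>indices R. \<exists>l. \<forall>f\<in>E_min R \<alpha>. \<forall>\<omega>\<in>neg_space R \<tau>'.
    summable (\<lambda>n. summand n f \<omega>) \<and> cmod (diff_op f \<omega>) \<le> 2 * growth_norm R \<sigma> l a f * growth_weight \<tau>' l' a \<omega>"
proof -
  obtain \<sigma> l where \<sigma>: "\<sigma> \<in> indices R" and est: "\<forall>f\<in>E_min R \<alpha>. \<forall>\<omega>\<in>neg_space R \<tau>'. \<forall>n.
    cmod (summand n f \<omega>) \<le> (1/2) ^ n * (growth_norm R \<sigma> l a f * growth_weight \<tau>' l' a \<omega>)"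
    using summand_estimate[OF \<alpha> a \<tau>', of l'] by metis
  have "summable (\<lambda>n. summand n f \<omega>) \<and> cmod (diff_op f \<omega>) \<le> 2 * growth_norm R \<sigma> l a f * growth_weight \<tau>' l' a \<omega>"
    if f: "f \<in> E_min R \<alpha>" and \<omega>: "\<omega> \<in> neg_space R \<tau>'" for f \<omega>
  proof
    let ?c = "growth_norm R \<sigma> l a f * growth_weight \<tau>' l' a \<omega>"
    have b: "cmod (summand n f \<omega>) \<le> (1/2) ^ n * ?c" for n using est f \<omega> by blast
    have s: "summable (\<lambda>n. (1/2 :: real) ^ n * ?c)" by (intro summable_mult2 summable_geometric) simp
    show "summable (\<lambda>n. summand n f \<omega>)" by (rule summable_comparison_test'[OF s]) (rule b)
    have "cmod (\<Sum>n. summand n f \<omega>) \<le> (\<Sum>n. (1/2 :: real) ^ n * ?c)" by (rule norm_suminf_le[OF b s])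
    also have "\<dots> = 2 * ?c" by (subst suminf_mult2[symmetric]) (simp_all add: suminf_geometric)
    finally show "cmod (diff_op f \<omega>) \<le> 2 * growth_norm R \<sigma> l a f * growth_weight \<tau>' l' a \<omega>"
      using Phi_dualI[OF \<tau>' \<omega>] by (simp add: diff_op_def mult.assoc)
  qed
  then show ?thesis using \<sigma> by blast
qed

lemma growth_weight_exponent:
  assumes "0 < a'" "a' \<le> a" "\<tau>' \<in> indices R" "\<omega> \<in> neg_space R \<tau>'"
  shows "growth_weight \<tau>' l a' \<omega> \<le> exp 1 * growth_weight \<tau>' l a \<omega>"
proof -
  let ?N = "neg_norm R \<tau>' \<omega>"
  have N: "0 \<le> ?N" by (rule neg_norm_nonneg[OF assms(3,4)])
  have "?N powr a' \<le> 1 + ?N powr a"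
  proof (cases "?N \<le> 1")
    case True
    have "?N powr a' \<le> 1 powr a'" using True N assms(1) by (intro powr_mono2) auto
    also have "\<dots> \<le> 1 + ?N powr a" by simp
    finally show ?thesis .
  next
    case False
    then have "?N powr a' \<le> ?N powr a" using assms(2) by (intro powr_mono) auto
    then show ?thesis by simp
  qed
  then have "(1/2) ^ l * ?N powr a' \<le> (1/2) ^ l * (1 + ?N powr a)" by (intro mult_left_mono) auto
  also have "\<dots> \<le> 1 + (1/2) ^ l * ?N powr a" by (simp add: distrib_left power_le_one)
  finally show ?thesis by (simp add: exp_add[symmetric])
qed

lemma diff_op_bounded:
  assumes \<alpha>: "0 \<le> \<alpha>" "\<alpha> \<le> \<beta>" and a: "a \<in> growth_exponents \<alpha>" and \<tau>': "\<tau>' \<in> indices R"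
  shows "\<exists>\<sigma>\<in>indices R. \<exists>l. \<exists>a'\<in>growth_exponents \<alpha>. \<forall>f\<in>E_min R \<alpha>. \<forall>\<omega>\<in>neg_space R \<tau>'.
    cmod (diff_op f \<omega>) \<le> 2 * exp 1 * growth_norm R \<sigma> l a' f * growth_weight \<tau>' l' a \<omega>"
proof -
  define a' where "a' = min a \<beta>"
  have a': "usable_exponent \<alpha> a'" unfolding a'_def by (rule usable_exponent_below[OF \<alpha> a])
  then have a'2: "a' \<in> growth_exponents \<alpha>" "0 < a'" by (auto simp: usable_exponent_def)
  obtain \<sigma> l where \<sigma>: "\<sigma> \<in> indices R" and est: "\<forall>f\<in>E_min R \<alpha>. \<forall>\<omega>\<in>neg_space R \<tau>'.
    summable (\<lambda>n. summand n f \<omega>) \<and> cmod (diff_op f \<omega>) \<le> 2 * growth_norm R \<sigma> l a' f * growth_weight \<tau>' l' a' \<omega>"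
    using diff_op_estimate[OF \<alpha>(1) a' \<tau>', of l'] by metis
  have "cmod (diff_op f \<omega>) \<le> 2 * exp 1 * growth_norm R \<sigma> l a' f * growth_weight \<tau>' l' a \<omega>"
    if f: "f \<in> E_min R \<alpha>" and \<omega>: "\<omega> \<in> neg_space R \<tau>'" for f \<omega>
  proof -
    have "cmod (diff_op f \<omega>) \<le> 2 * growth_norm R \<sigma> l a' f * growth_weight \<tau>' l' a' \<omega>" using est f \<omega> by blast
    also have "\<dots> \<le> 2 * growth_norm R \<sigma> l a' f * (exp 1 * growth_weight \<tau>' l' a \<omega>)"
      using a'2(2) growth_norm_nonneg[OF f a'2(1) \<sigma>]
      by (intro mult_left_mono growth_weight_exponent \<tau>' \<omega>) (auto simp: a'_def)
    finally show ?thesis by (simp add: mult_ac)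
  qed
  then show ?thesis using \<sigma> a'2(1) by blast
qed

lemma usable_exponent_exists: "0 \<le> \<alpha> \<Longrightarrow> \<alpha> \<le> \<beta> \<Longrightarrow> \<exists>a. usable_exponent \<alpha> a"
  using exponent_exists usable_exponent_below by blast

lemma summand_summable:
  assumes \<alpha>: "0 \<le> \<alpha>" "\<alpha> \<le> \<beta>" and f: "f \<in> E_min R \<alpha>" and \<omega>: "\<omega> \<in> Phi_dual R"
  shows "summable (\<lambda>n. summand n f \<omega>)"
proof -
  obtain a where a: "usable_exponent \<alpha> a" using usable_exponent_exists[OF \<alpha>] by blast
  obtain \<tau>' where \<tau>': "\<tau>' \<in> indices R" "\<omega> \<in> neg_space R \<tau>'" using \<omega> by (auto simp: Phi_dual_def)
  show ?thesis using diff_op_estimate[OF \<alpha>(1) a \<tau>'(1), of 0] f \<tau>'(2) by metis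
qed

lemma diff_op_fcomb:
  assumes \<alpha>: "0 \<le> \<alpha>" "\<alpha> \<le> \<beta>" and f: "f \<in> E_min R \<alpha>" and g: "g \<in> E_min R \<alpha>"
  shows "diff_op (fcomb a f b g) = fcomb a (diff_op f) b (diff_op g)"
proof
  fix \<omega>
  show "diff_op (fcomb a f b g) \<omega> = fcomb a (diff_op f) b (diff_op g) \<omega>"
  proof (cases "\<omega> \<in> Phi_dual R")
    case True
    note s = summand_summable[OF \<alpha> f True] summand_summable[OF \<alpha> g True]
    have "(\<Sum>n. summand n (fcomb a f b g) \<omega>) = (\<Sum>n. a * summand n f \<omega> + b * summand n g \<omega>)"
      using summand_fcomb[OF E_min_entire[OF \<alpha>(1) f] E_min_entire[OF \<alpha>(1) g] True] by simp
    also have "\<dots> = a * (\<Sum>n. summand n f \<omega>) + b * (\<Sum>n. summand n g \<omega>)"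
      using s by (simp add: suminf_add[symmetric] suminf_mult summable_mult)
    finally show ?thesis using True by (simp add: diff_op_def fcomb_def[of a "diff_op f" b "diff_op g"])
  qed (simp add: diff_op_def fcomb_def)
qed

lemma diff_op_entire:
  assumes \<alpha>: "0 \<le> \<alpha>" "\<alpha> \<le> \<beta>" and f: "f \<in> E_min R \<alpha>"
  shows "entire_bounded_type (diff_op f)"
  unfolding entire_bounded_type_def
proof
  fix \<tau>' assume \<tau>': "\<tau>' \<in> indices R"
  interpret seminormed "neg_space R \<tau>'" "neg_norm R \<tau>'" by (rule seminormed_neg[OF \<tau>'])
  obtain a where a: "usable_exponent \<alpha> a" using usable_exponent_exists[OF \<alpha>] by blast
  then have a2: "a \<in> growth_exponents \<alpha>" "0 < a" by (auto simp: usable_exponent_def)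
  obtain \<sigma> l where \<sigma>: "\<sigma> \<in> indices R" and est: "\<forall>f\<in>E_min R \<alpha>. \<forall>\<omega>\<in>neg_space R \<tau>'. \<forall>n.
    cmod (summand n f \<omega>) \<le> (1/2) ^ n * (growth_norm R \<sigma> l a f * growth_weight \<tau>' 0 a \<omega>)"
    using summand_estimate[OF \<alpha>(1) a \<tau>', of 0] by metis
  obtain \<sigma>2 l2 where est2: "\<forall>f\<in>E_min R \<alpha>. \<forall>\<omega>\<in>neg_space R \<tau>'.
    summable (\<lambda>n. summand n f \<omega>) \<and> cmod (diff_op f \<omega>) \<le> 2 * growth_norm R \<sigma>2 l2 a f * growth_weight \<tau>' 0 a \<omega>"
    and \<sigma>2: "\<sigma>2 \<in> indices R"
    using diff_op_estimate[OF \<alpha>(1) a \<tau>', of 0] by metis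
  have c: "0 \<le> growth_norm R \<sigma> l a f" "0 \<le> growth_norm R \<sigma>2 l2 a f"
    by (intro growth_norm_nonneg[OF f a2(1)] \<sigma> \<sigma>2)+
  have weight: "growth_weight \<tau>' 0 a \<omega> \<le> exp (r powr a)" if "\<omega> \<in> neg_space R \<tau>'" "neg_norm R \<tau>' \<omega> \<le> r" for \<omega> r
    using that N_nonneg a2(2) by (auto intro!: powr_mono2)
  show "bounded_type (diff_op f)"
    unfolding bounded_type_def
  proof (intro conjI ballI allI)
    fix r
    have "cmod (diff_op f \<omega>) \<le> 2 * growth_norm R \<sigma>2 l2 a f * exp (r powr a)"
      if \<omega>: "\<omega> \<in> neg_space R \<tau>'" "neg_norm R \<tau>' \<omega> \<le> r" for \<omega>
    proof -
      have "cmod (diff_op f \<omega>) \<le> 2 * growth_norm R \<sigma>2 l2 a f * growth_weight \<tau>' 0 a \<omega>" using est2 f \<omega>(1) by blast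
      also have "\<dots> \<le> 2 * growth_norm R \<sigma>2 l2 a f * exp (r powr a)"
        using c(2) by (intro mult_left_mono weight \<omega>) simp
      finally show ?thesis .
    qed
    then show "\<exists>M. \<forall>\<omega>\<in>neg_space R \<tau>'. neg_norm R \<tau>' \<omega> \<le> r \<longrightarrow> cmod (diff_op f \<omega>) \<le> M" by blast
  next
    fix \<omega> \<eta> assume \<omega>: "\<omega> \<in> neg_space R \<tau>'" and \<eta>: "\<eta> \<in> neg_space R \<tau>'"
    let ?x = "\<lambda>z. fcomb 1 \<omega> z \<eta>"
    have x: "?x z \<in> neg_space R \<tau>'" for z by (rule V_fcomb[OF \<omega> \<eta>])
    have eq: "diff_op f (?x z) = (\<Sum>n. summand n f (?x z))" for z
      using Phi_dualI[OF \<tau>' x] by (simp add: diff_op_def)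
    show "(\<lambda>z. diff_op f (?x z)) holomorphic_on UNIV"
      unfolding eq
    proof (rule holomorphic_uniform_sequence[where f = "\<lambda>n z. \<Sum>i<n. summand i f (?x z)"])
      show "(\<lambda>z. \<Sum>i<n. summand i f (?x z)) holomorphic_on UNIV" for n
        by (intro holomorphic_intros summand_holomorphic E_min_entire[OF \<alpha>(1) f] Phi_dualI[OF \<tau>'] \<omega> \<eta>)
      fix z0 :: complex
      define r where "r = neg_norm R \<tau>' \<omega> + (cmod z0 + 1) * neg_norm R \<tau>' \<eta>"
      have "uniform_limit (cball z0 1) (\<lambda>n z. \<Sum>i<n. summand i f (?x z)) (\<lambda>z. \<Sum>n. summand n f (?x z)) sequentially"
      proof (rule Weierstrass_m_test)
        show "summable (\<lambda>n. (1/2 :: real) ^ n * (growth_norm R \<sigma> l a f * exp (r powr a)))"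
          by (intro summable_mult2 summable_geometric) simp
        fix n z assume z: "z \<in> cball z0 1"
        have "cmod z \<le> cmod z0 + 1"
          using z norm_triangle_ineq[of z0 "z - z0"] by (auto simp: dist_norm norm_minus_commute)
        then have "neg_norm R \<tau>' (?x z) \<le> r" unfolding r_def by (intro N_line \<omega> \<eta> mult_right_mono N_nonneg)
        then have "growth_weight \<tau>' 0 a (?x z) \<le> exp (r powr a)" by (rule weight[OF x])
        then have "(1/2) ^ n * (growth_norm R \<sigma> l a f * growth_weight \<tau>' 0 a (?x z)) \<le> (1/2) ^ n * (growth_norm R \<sigma> l a f * exp (r powr a))"
          using c(1) by (intro mult_left_mono) auto
        then show "norm (summand n f (?x z)) \<le> (1/2) ^ n * (growth_norm R \<sigma> l a f * exp (r powr a))"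
          using est f x by (meson order_trans)
      qed
      then show "\<exists>d>0. cball z0 d \<subseteq> UNIV \<and> uniform_limit (cball z0 d) (\<lambda>n z. \<Sum>i<n. summand i f (?x z)) (\<lambda>z. \<Sum>n. summand n f (?x z)) sequentially"
        by (intro exI[of _ 1]) simp
    qed simp
  qed
qed

lemma diff_op_in:
  assumes \<alpha>: "0 \<le> \<alpha>" "\<alpha> \<le> \<beta>" and f: "f \<in> E_min R \<alpha>"
  shows "diff_op f \<in> E_min R \<alpha>"
proof (rule E_minI)
  show "diff_op f \<omega> = 0" if "\<omega> \<notin> Phi_dual R" for \<omega> using that by (simp add: diff_op_def)
  show "entire_bounded_type (diff_op f)" by (rule diff_op_entire[OF \<alpha> f])
  fix a \<tau>' l' assume a: "a \<in> growth_exponents \<alpha>" and \<tau>': "\<tau>' \<in> indices R"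
  obtain \<sigma> l a' where "\<forall>f\<in>E_min R \<alpha>. \<forall>\<omega>\<in>neg_space R \<tau>'.
    cmod (diff_op f \<omega>) \<le> 2 * exp 1 * growth_norm R \<sigma> l a' f * growth_weight \<tau>' l' a \<omega>"
    using diff_op_bounded[OF \<alpha> a \<tau>', of l'] by metis
  then show "\<exists>c. \<forall>\<omega>\<in>neg_space R \<tau>'. cmod (diff_op f \<omega>) \<le> c * growth_weight \<tau>' l' a \<omega>" using f by blast
qed

lemma diff_op_growth_norm:
  assumes \<alpha>: "0 \<le> \<alpha>" "\<alpha> \<le> \<beta>" and a: "a \<in> growth_exponents \<alpha>" and \<tau>': "\<tau>' \<in> indices R"
  shows "\<exists>\<sigma>\<in>indices R. \<exists>l. \<exists>a'\<in>growth_exponents \<alpha>. \<forall>f\<in>E_min R \<alpha>.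
    growth_norm R \<tau>' l' a (diff_op f) \<le> 2 * exp 1 * growth_norm R \<sigma> l a' f"
proof -
  obtain \<sigma> l a' where \<sigma>: "\<sigma> \<in> indices R" and a': "a' \<in> growth_exponents \<alpha>"
    and est: "\<forall>f\<in>E_min R \<alpha>. \<forall>\<omega>\<in>neg_space R \<tau>'.
    cmod (diff_op f \<omega>) \<le> 2 * exp 1 * growth_norm R \<sigma> l a' f * growth_weight \<tau>' l' a \<omega>"
    using diff_op_bounded[OF \<alpha> a \<tau>', of l'] by metis
  have "growth_norm R \<tau>' l' a (diff_op f) \<le> 2 * exp 1 * growth_norm R \<sigma> l a' f" if f: "f \<in> E_min R \<alpha>" for f
    by (rule growth_norm_le[OF \<tau>' est[rule_format, OF f]])
  then show ?thesis using \<sigma> a' by blast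
qed

end

section \<open>Identities on powers extend to all functions\<close>

context nuclear_family
begin

text \<open>Boundedness by the supremum norm of the homogeneous polynomial on the unit ball of some
  \<open>\<H>\<^sub>-\<^sub>\<tau>\<close>. By polarization the elements of the dual of \<open>\<Phi>\<^sup>\<odot>\<^sup>n\<close> have this property, and so does
  every functional of the tensor that comes from a continuous functional of entire functions.\<close>

definition diag_bounded :: "nat \<Rightarrow> ('v tensor \<Rightarrow> complex) \<Rightarrow> bool" where
  "diag_bounded n F \<longleftrightarrow> (\<exists>\<tau>\<in>indices R. \<exists>K\<ge>0. \<forall>\<phi>\<in>Phi_sym R n. \<forall>c.
     (\<forall>\<zeta>\<in>neg_space R \<tau>. neg_norm R \<tau> \<zeta> \<le> 1 \<longrightarrow> cmod (\<phi> (replicate n \<zeta>)) \<le> c) \<longrightarrow> cmod (F \<phi>) \<le> K * c)"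

definition sym_linear_functional :: "nat \<Rightarrow> ('v tensor \<Rightarrow> complex) \<Rightarrow> bool" where
  "sym_linear_functional n F \<longleftrightarrow>
     (\<forall>a b. \<forall>\<phi>\<in>Phi_sym R n. \<forall>\<psi>\<in>Phi_sym R n. F (fcomb a \<phi> b \<psi>) = a * F \<phi> + b * F \<psi>)"

lemma diag_boundedI:
  assumes "\<tau> \<in> indices R" "0 \<le> K"
    "\<And>\<phi> c. \<phi> \<in> Phi_sym R n \<Longrightarrow> (\<And>\<zeta>. \<zeta> \<in> neg_space R \<tau> \<Longrightarrow> neg_norm R \<tau> \<zeta> \<le> 1 \<Longrightarrow> cmod (\<phi> (replicate n \<zeta>)) \<le> c)
      \<Longrightarrow> cmod (F \<phi>) \<le> K * c"
  shows "diag_bounded n F"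
  unfolding diag_bounded_def using assms by (intro bexI[of _ \<tau>] exI[of _ K]) auto

lemma diag_boundedE:
  assumes "diag_bounded n F"
  obtains \<tau> K where "\<tau> \<in> indices R" "0 \<le> K" "\<forall>\<phi>\<in>Phi_sym R n. \<forall>c.
     (\<forall>\<zeta>\<in>neg_space R \<tau>. neg_norm R \<tau> \<zeta> \<le> 1 \<longrightarrow> cmod (\<phi> (replicate n \<zeta>)) \<le> c) \<longrightarrow> cmod (F \<phi>) \<le> K * c"
  using assms unfolding diag_bounded_def by (elim bexE exE conjE) (rule that)

lemma diag_bounded_below:
  assumes F: "\<forall>\<phi>\<in>Phi_sym R n. \<forall>c.
     (\<forall>\<zeta>\<in>neg_space R \<tau>. neg_norm R \<tau> \<zeta> \<le> 1 \<longrightarrow> cmod (\<phi> (replicate n \<zeta>)) \<le> c) \<longrightarrow> cmod (F \<phi>) \<le> K * c"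
    and \<sigma>: "\<sigma> \<in> indices R" and \<tau>: "\<tau> \<in> indices R" and emb: "continuously_embedded R \<sigma> \<tau>" and K: "0 \<le> K"
  shows "\<exists>K'\<ge>0. \<forall>\<phi>\<in>Phi_sym R n. \<forall>c.
     (\<forall>\<zeta>\<in>neg_space R \<sigma>. neg_norm R \<sigma> \<zeta> \<le> 1 \<longrightarrow> cmod (\<phi> (replicate n \<zeta>)) \<le> c) \<longrightarrow> cmod (F \<phi>) \<le> K' * c"
proof -
  obtain L where L: "1 \<le> L"
    "\<And>\<omega>. \<omega> \<in> neg_space R \<tau> \<Longrightarrow> \<omega> \<in> neg_space R \<sigma> \<and> neg_norm R \<sigma> \<omega> \<le> L * neg_norm R \<tau> \<omega>"
    using neg_space_mono[OF \<sigma> \<tau> emb] by blast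
  have "cmod (F \<phi>) \<le> (K * L ^ n) * c"
    if \<phi>: "\<phi> \<in> Phi_sym R n" and c: "\<forall>\<zeta>\<in>neg_space R \<sigma>. neg_norm R \<sigma> \<zeta> \<le> 1 \<longrightarrow> cmod (\<phi> (replicate n \<zeta>)) \<le> c" for \<phi> c
  proof -
    have "cmod (\<phi> (replicate n \<zeta>)) \<le> c * L ^ n" if \<zeta>: "\<zeta> \<in> neg_space R \<tau>" "neg_norm R \<tau> \<zeta> \<le> 1" for \<zeta>
    proof -
      have \<zeta>s: "\<zeta> \<in> neg_space R \<sigma>" using L(2) \<zeta>(1) by blast
      have N: "neg_norm R \<sigma> \<zeta> \<le> L"
        using conjunct2[OF L(2)[OF \<zeta>(1)]] mult_left_mono[OF \<zeta>(2), of L] L(1) by linarith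
      have N0: "0 \<le> neg_norm R \<sigma> \<zeta>" by (rule neg_norm_nonneg[OF \<sigma> \<zeta>s])
      have zero: "(\<lambda>x. 0) \<in> neg_space R \<sigma>" "neg_norm R \<sigma> (\<lambda>x. 0) \<le> 1"
        using seminormed.V_zero[OF seminormed_neg[OF \<sigma>]] by (auto intro!: neg_norm_le[OF \<sigma>] mult_nonneg_nonneg
            hilbert_member.cnorm_nonneg[OF member[OF \<sigma>]] Phi_cspace[OF \<sigma>])
      have c0: "0 \<le> c" using c zero norm_ge_zero order_trans by metis
      have "cmod (monomial R n \<phi> \<zeta>) \<le> c * neg_norm R \<sigma> \<zeta> ^ n"
        by (rule monomial_bound_from_ball[OF \<sigma> \<phi> \<zeta>s]) (use c in blast)
      also have "\<dots> \<le> c * L ^ n" using N N0 c0 by (intro mult_left_mono power_mono) auto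
      finally show ?thesis using monomial_eq[OF \<phi> Phi_dualI[OF \<sigma> \<zeta>s]] by simp
    qed
    then have "cmod (F \<phi>) \<le> K * (c * L ^ n)" using F \<phi> by blast
    then show ?thesis by (simp add: mult_ac)
  qed
  moreover have "0 \<le> K * L ^ n" using K L(1) by simp
  ultimately show ?thesis by blast
qed

lemma diag_bounded_fcomb:
  assumes "diag_bounded n F" "diag_bounded n G"
  shows "diag_bounded n (fcomb a F b G)"
proof -
  obtain \<tau>1 K1 where F: "\<tau>1 \<in> indices R" "0 \<le> K1" "\<forall>\<phi>\<in>Phi_sym R n. \<forall>c.
     (\<forall>\<zeta>\<in>neg_space R \<tau>1. neg_norm R \<tau>1 \<zeta> \<le> 1 \<longrightarrow> cmod (\<phi> (replicate n \<zeta>)) \<le> c) \<longrightarrow> cmod (F \<phi>) \<le> K1 * c"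
    by (rule diag_boundedE[OF assms(1)])
  obtain \<tau>2 K2 where G: "\<tau>2 \<in> indices R" "0 \<le> K2" "\<forall>\<phi>\<in>Phi_sym R n. \<forall>c.
     (\<forall>\<zeta>\<in>neg_space R \<tau>2. neg_norm R \<tau>2 \<zeta> \<le> 1 \<longrightarrow> cmod (\<phi> (replicate n \<zeta>)) \<le> c) \<longrightarrow> cmod (G \<phi>) \<le> K2 * c"
    by (rule diag_boundedE[OF assms(2)])
  obtain \<sigma> where \<sigma>: "\<sigma> \<in> indices R" "continuously_embedded R \<sigma> \<tau>1" "continuously_embedded R \<sigma> \<tau>2"
    by (rule directed[OF F(1) G(1)])
  obtain L1 where L1: "0 \<le> L1" "\<forall>\<phi>\<in>Phi_sym R n. \<forall>c.
     (\<forall>\<zeta>\<in>neg_space R \<sigma>. neg_norm R \<sigma> \<zeta> \<le> 1 \<longrightarrow> cmod (\<phi> (replicate n \<zeta>)) \<le> c) \<longrightarrow> cmod (F \<phi>) \<le> L1 * c"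
    using diag_bounded_below[OF F(3) \<sigma>(1) F(1) \<sigma>(2) F(2)] by blast
  obtain L2 where L2: "0 \<le> L2" "\<forall>\<phi>\<in>Phi_sym R n. \<forall>c.
     (\<forall>\<zeta>\<in>neg_space R \<sigma>. neg_norm R \<sigma> \<zeta> \<le> 1 \<longrightarrow> cmod (\<phi> (replicate n \<zeta>)) \<le> c) \<longrightarrow> cmod (G \<phi>) \<le> L2 * c"
    using diag_bounded_below[OF G(3) \<sigma>(1) G(1) \<sigma>(3) G(2)] by blast
  show ?thesis
  proof (rule diag_boundedI[OF \<sigma>(1)])
    show "0 \<le> cmod a * L1 + cmod b * L2" using L1(1) L2(1) by simp
    fix \<phi> c assume \<phi>: "\<phi> \<in> Phi_sym R n"
      and c: "\<And>\<zeta>. \<zeta> \<in> neg_space R \<sigma> \<Longrightarrow> neg_norm R \<sigma> \<zeta> \<le> 1 \<Longrightarrow> cmod (\<phi> (replicate n \<zeta>)) \<le> c"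
    have "cmod (F \<phi>) \<le> L1 * c" "cmod (G \<phi>) \<le> L2 * c" using L1(2) L2(2) \<phi> c by blast+
    then have "cmod a * cmod (F \<phi>) + cmod b * cmod (G \<phi>) \<le> cmod a * (L1 * c) + cmod b * (L2 * c)"
      by (intro add_mono mult_left_mono) auto
    moreover have "cmod (fcomb a F b G \<phi>) \<le> cmod a * cmod (F \<phi>) + cmod b * cmod (G \<phi>)"
      unfolding fcomb_def by (rule order_trans[OF norm_triangle_ineq]) (simp add: norm_mult)
    ultimately show "cmod (fcomb a F b G \<phi>) \<le> (cmod a * L1 + cmod b * L2) * c" by (simp add: algebra_simps)
  qed
qed

lemma sym_linear_functional_fcomb:
  "sym_linear_functional n F \<Longrightarrow> sym_linear_functional n G \<Longrightarrow> sym_linear_functional n (fcomb a F b G)"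
  unfolding sym_linear_functional_def by (simp add: fcomb_def[of a F] algebra_simps)

lemma neg_sym_bounded: "F \<in> neg_sym R \<tau> n \<Longrightarrow> \<exists>k. \<forall>\<phi>\<in>Phi_sym R n. cmod (F \<phi>) \<le> k * sym_norm R \<tau> n \<phi>"
  by (simp add: neg_sym_def dual_of_def)

lemma diag_bounded_neg_sym:
  assumes F: "F \<in> neg_sym R \<tau> n" and \<tau>: "\<tau> \<in> indices R"
  shows "diag_bounded n F"
proof -
  obtain \<sigma> M K where hs: "hs_below \<tau> \<sigma> M" using hs_below_exists[OF \<tau> \<tau>] by blast
  note hsD = hs_belowD[OF hs]
  obtain k where k: "\<forall>\<phi>\<in>Phi_sym R n. cmod (F \<phi>) \<le> k * sym_norm R \<tau> n \<phi>"
    using neg_sym_bounded[OF F] by (elim exE) (rule that)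
  show ?thesis
  proof (rule diag_boundedI[OF hsD(2)])
    show "0 \<le> \<bar>k\<bar> * (M * exp 1) ^ n" using hsD(3) by simp
    fix \<phi> c assume \<phi>: "\<phi> \<in> Phi_sym R n"
      and c: "\<And>\<zeta>. \<zeta> \<in> neg_space R \<sigma> \<Longrightarrow> neg_norm R \<sigma> \<zeta> \<le> 1 \<Longrightarrow> cmod (\<phi> (replicate n \<zeta>)) \<le> c"
    have "cmod (F \<phi>) \<le> k * sym_norm R \<tau> n \<phi>" by (rule bspec[OF k \<phi>])
    also have "\<dots> \<le> \<bar>k\<bar> * sym_norm R \<tau> n \<phi>"
      using sym_norm_nonneg[OF Phi_symD(3)[OF \<phi> \<tau>]] by (intro mult_right_mono) auto
    also have "\<dots> \<le> \<bar>k\<bar> * ((M * exp 1) ^ n * c)"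
      by (intro mult_left_mono sym_norm_le_diagonal[OF \<phi> hs] c) auto
    finally show "cmod (F \<phi>) \<le> \<bar>k\<bar> * (M * exp 1) ^ n * c" by (simp add: mult.assoc)
  qed
qed

lemma functional_vanishes:
  assumes lin: "sym_linear_functional n F" and bounded: "diag_bounded n F"
    and powers: "\<And>\<xi>. \<xi> \<in> Phi R \<Longrightarrow> F (tensor_pow R n \<xi>) = 0" and \<phi>: "\<phi> \<in> Phi_sym R n"
  shows "F \<phi> = 0"
proof -
  obtain \<tau> K where F: "\<tau> \<in> indices R" "0 \<le> K" "\<forall>\<phi>\<in>Phi_sym R n. \<forall>c.
     (\<forall>\<zeta>\<in>neg_space R \<tau>. neg_norm R \<tau> \<zeta> \<le> 1 \<longrightarrow> cmod (\<phi> (replicate n \<zeta>)) \<le> c) \<longrightarrow> cmod (F \<phi>) \<le> K * c"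
    by (rule diag_boundedE[OF bounded])
  show ?thesis
  proof (rule functional_determined_by_powers[where F = F and n = n and \<tau> = \<tau> and K = K])
    show "\<tau> \<in> indices R" "0 \<le> K" "\<phi> \<in> Phi_sym R n" by (rule F(1) F(2) \<phi>)+
    show "F (tensor_pow R n \<xi>) = 0" if "\<xi> \<in> Phi R" for \<xi> by (rule powers[OF that])
    show "F (fcomb a \<phi> b \<psi>) = a * F \<phi> + b * F \<psi>" if "\<phi> \<in> Phi_sym R n" "\<psi> \<in> Phi_sym R n" for a b \<phi> \<psi>
      using lin that by (simp add: sym_linear_functional_def)
    show "cmod (F \<phi>) \<le> K * c" if "\<phi> \<in> Phi_sym R n"
      "\<And>\<omega>. \<omega> \<in> neg_space R \<tau> \<Longrightarrow> neg_norm R \<tau> \<omega> \<le> 1 \<Longrightarrow> cmod (\<phi> (replicate n \<omega>)) \<le> c" for \<phi> c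
      using F(3) that by blast
  qed
qed

definition bounded_functional :: "real \<Rightarrow> (('v dual \<Rightarrow> complex) \<Rightarrow> complex) \<Rightarrow> bool" where
  "bounded_functional \<alpha> G \<longleftrightarrow>
     (\<forall>a b. \<forall>f\<in>E_min R \<alpha>. \<forall>g\<in>E_min R \<alpha>. G (fcomb a f b g) = a * G f + b * G g) \<and>
     (\<exists>\<sigma>\<in>indices R. \<exists>l. \<exists>a\<in>growth_exponents \<alpha>. \<exists>K\<ge>0. \<forall>f\<in>E_min R \<alpha>. cmod (G f) \<le> K * growth_norm R \<sigma> l a f)"

lemma bounded_functionalD:
  "bounded_functional \<alpha> G \<Longrightarrow> f \<in> E_min R \<alpha> \<Longrightarrow> g \<in> E_min R \<alpha> \<Longrightarrow> G (fcomb a f b g) = a * G f + b * G g"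
  by (simp add: bounded_functional_def)

lemma bounded_functionalE:
  assumes "bounded_functional \<alpha> G"
  obtains \<sigma> l a K where "\<sigma> \<in> indices R" "a \<in> growth_exponents \<alpha>" "0 \<le> K"
    "\<forall>f\<in>E_min R \<alpha>. cmod (G f) \<le> K * growth_norm R \<sigma> l a f"
  using assms unfolding bounded_functional_def by (elim conjE bexE exE) (rule that)

lemma monomial_fcomb:
  assumes \<phi>: "\<phi> \<in> Phi_sym R n" and \<psi>: "\<psi> \<in> Phi_sym R n"
  shows "monomial R n (fcomb a \<phi> b \<psi>) = fcomb a (monomial R n \<phi>) b (monomial R n \<psi>)"
  using \<phi> \<psi> Phi_sym_fcomb[OF \<phi> \<psi>] by (simp add: fun_eq_iff monomial_def dual_pow_def fcomb_def)

lemma bounded_functional_monomials: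
  assumes \<alpha>: "0 \<le> \<alpha>" and G: "bounded_functional \<alpha> G"
  shows "sym_linear_functional n (\<lambda>\<phi>. G (monomial R n \<phi>))" "diag_bounded n (\<lambda>\<phi>. G (monomial R n \<phi>))"
proof -
  show "sym_linear_functional n (\<lambda>\<phi>. G (monomial R n \<phi>))"
    unfolding sym_linear_functional_def
    by (simp add: monomial_fcomb bounded_functionalD[OF G] monomial_in[OF \<alpha>])
  obtain \<sigma> l a K where \<sigma>: "\<sigma> \<in> indices R" and a: "a \<in> growth_exponents \<alpha>" and K: "0 \<le> K"
    "\<forall>f\<in>E_min R \<alpha>. cmod (G f) \<le> K * growth_norm R \<sigma> l a f"
    by (rule bounded_functionalE[OF G])
  obtain Q where Q: "0 \<le> Q" "\<forall>\<phi>\<in>Phi_sym R n. \<forall>c. (\<forall>\<zeta>\<in>neg_space R \<sigma>. neg_norm R \<sigma> \<zeta> \<le> 1 \<longrightarrow> cmod (\<phi> (replicate n \<zeta>)) \<le> c) \<longrightarrow>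
      (\<forall>\<omega>\<in>neg_space R \<sigma>. cmod (monomial R n \<phi> \<omega>) \<le> Q * c * growth_weight \<sigma> l a \<omega>)"
    using monomial_growth[OF exponent_positive[OF \<alpha> a] \<sigma>, of n l] by metis
  show "diag_bounded n (\<lambda>\<phi>. G (monomial R n \<phi>))"
  proof (rule diag_boundedI[OF \<sigma>])
    show "0 \<le> K * Q" using K(1) Q(1) by simp
    fix \<phi> c assume \<phi>: "\<phi> \<in> Phi_sym R n"
      and c: "\<And>\<zeta>. \<zeta> \<in> neg_space R \<sigma> \<Longrightarrow> neg_norm R \<sigma> \<zeta> \<le> 1 \<Longrightarrow> cmod (\<phi> (replicate n \<zeta>)) \<le> c"
    have "\<forall>\<omega>\<in>neg_space R \<sigma>. cmod (monomial R n \<phi> \<omega>) \<le> Q * c * growth_weight \<sigma> l a \<omega>"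
      by (rule mp[OF spec[OF bspec[OF Q(2) \<phi>]]]) (use c in blast)
    then have "growth_norm R \<sigma> l a (monomial R n \<phi>) \<le> Q * c" by (intro growth_norm_le[OF \<sigma>]) blast
    then have "K * growth_norm R \<sigma> l a (monomial R n \<phi>) \<le> K * (Q * c)" by (rule mult_left_mono[OF _ K(1)])
    moreover have "cmod (G (monomial R n \<phi>)) \<le> K * growth_norm R \<sigma> l a (monomial R n \<phi>)"
      using K(2) monomial_in[OF \<alpha> \<phi>] by blast
    ultimately show "cmod (G (monomial R n \<phi>)) \<le> K * Q * c" by (simp add: mult.assoc)
  qed
qed

lemma taylor_polynomial_Suc:
  "taylor_polynomial (Suc m) f = fcomb 1 (taylor_polynomial m f) 1 (monomial R m (taylor_coefficient f m))"
  by (simp add: taylor_polynomial_def fcomb_def)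

lemma E_min_zero: "0 \<le> \<alpha> \<Longrightarrow> f \<in> E_min R \<alpha> \<Longrightarrow> (\<lambda>\<omega>. 0) \<in> E_min R \<alpha>"
  using E_min_fcomb[of \<alpha> f f 0 0] by (simp add: fcomb_def)

lemma taylor_polynomial_in:
  assumes "0 \<le> \<alpha>" "f \<in> E_min R \<alpha>"
  shows "taylor_polynomial m f \<in> E_min R \<alpha>"
proof (induction m)
  case 0
  then show ?case using E_min_zero[OF assms] by (simp add: taylor_polynomial_def)
next
  case (Suc m)
  then show ?case unfolding taylor_polynomial_Suc
    by (intro E_min_fcomb assms(1) monomial_in taylor_coefficient_in E_min_entire[OF assms])
qed

lemma taylor_polynomial_converges:
  assumes "0 \<le> \<alpha>" "f \<in> E_min R \<alpha>" "a \<in> growth_exponents \<alpha>" "\<tau> \<in> indices R"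
  shows "(\<lambda>m. growth_norm R \<tau> l a (fcomb 1 (taylor_polynomial m f) (-1) f)) \<longlonglongrightarrow> 0"
proof -
  obtain c where c: "0 \<le> c" "\<And>m \<omega>. \<omega> \<in> neg_space R \<tau> \<Longrightarrow>
      cmod (f \<omega> - taylor_polynomial m f \<omega>) \<le> c * (1/2) ^ m * growth_weight \<tau> l a \<omega>"
    using taylor_remainder[OF assms, of l] by blast
  have upper: "growth_norm R \<tau> l a (fcomb 1 (taylor_polynomial m f) (-1) f) \<le> c * (1/2) ^ m" for m
    using c(2) by (intro growth_norm_le[OF assms(4)]) (simp add: fcomb_def norm_minus_commute)
  have lower: "0 \<le> growth_norm R \<tau> l a (fcomb 1 (taylor_polynomial m f) (-1) f)" for m
    by (intro growth_norm_nonneg[OF _ assms(3,4)] E_min_fcomb taylor_polynomial_in assms(1,2))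
  have "(\<lambda>m. c * (1/2) ^ m) \<longlonglongrightarrow> c * 0" by (intro tendsto_intros LIMSEQ_realpow_zero) auto
  then have lim: "(\<lambda>m. c * (1/2) ^ m) \<longlonglongrightarrow> 0" by simp
  show ?thesis
    by (rule tendsto_sandwich[OF _ _ tendsto_const lim]) (simp_all add: upper lower always_eventually)
qed

lemma functionals_agree:
  assumes F: "sym_linear_functional n F" "diag_bounded n F" and G: "sym_linear_functional n G" "diag_bounded n G"
    and powers: "\<And>\<xi>. \<xi> \<in> Phi R \<Longrightarrow> F (tensor_pow R n \<xi>) = G (tensor_pow R n \<xi>)" and \<phi>: "\<phi> \<in> Phi_sym R n"
  shows "F \<phi> = G \<phi>"
proof -
  have "fcomb 1 F (-1) G \<phi> = 0"
    by (rule functional_vanishes[OF sym_linear_functional_fcomb[OF F(1) G(1)] diag_bounded_fcomb[OF F(2) G(2)] _ \<phi>])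
       (simp add: fcomb_def powers)
  then show ?thesis by (simp add: fcomb_def)
qed

lemma bounded_functional_taylor:
  assumes \<alpha>: "0 \<le> \<alpha>" and G: "bounded_functional \<alpha> G" and f: "f \<in> E_min R \<alpha>"
  shows "(\<lambda>m. G (taylor_polynomial m f)) \<longlonglongrightarrow> G f"
proof -
  obtain \<sigma> l a K where \<sigma>: "\<sigma> \<in> indices R" and a: "a \<in> growth_exponents \<alpha>" and K: "0 \<le> K"
    "\<forall>f\<in>E_min R \<alpha>. cmod (G f) \<le> K * growth_norm R \<sigma> l a f"
    by (rule bounded_functionalE[OF G])
  have "cmod (G (taylor_polynomial m f) - G f) \<le> K * growth_norm R \<sigma> l a (fcomb 1 (taylor_polynomial m f) (-1) f)" for m
  proof -
    have "G (fcomb 1 (taylor_polynomial m f) (-1) f) = G (taylor_polynomial m f) - G f"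
      using bounded_functionalD[OF G taylor_polynomial_in[OF \<alpha> f] f, of 1 m "-1"] by simp
    then show ?thesis
      using K(2) E_min_fcomb[OF \<alpha> taylor_polynomial_in[OF \<alpha> f] f] by metis
  qed
  moreover have "(\<lambda>m. K * growth_norm R \<sigma> l a (fcomb 1 (taylor_polynomial m f) (-1) f)) \<longlonglongrightarrow> 0"
    by (rule tendsto_mult_right_zero[OF taylor_polynomial_converges[OF \<alpha> f a \<sigma>]])
  ultimately have "(\<lambda>m. G (taylor_polynomial m f) - G f) \<longlonglongrightarrow> 0"
    by (rule Lim_null_comparison[OF always_eventually[OF allI]])
  then show ?thesis by (rule LIM_zero_cancel)
qed

text \<open>For each \<open>n\<close> the functionals agree on all homogeneous polynomials of degree \<open>n\<close>, since these
  are determined by powers; hence on Taylor polynomials, and these converge.\<close>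

lemma bounded_functionals_agree:
  assumes \<alpha>: "0 \<le> \<alpha>" and F: "bounded_functional \<alpha> F" and G: "bounded_functional \<alpha> G"
    and powers: "\<And>n \<xi>. \<xi> \<in> Phi R \<Longrightarrow> F (monomial R n (tensor_pow R n \<xi>)) = G (monomial R n (tensor_pow R n \<xi>))"
    and f: "f \<in> E_min R \<alpha>"
  shows "F f = G f"
proof -
  have mono: "F (monomial R n \<phi>) = G (monomial R n \<phi>)" if "\<phi> \<in> Phi_sym R n" for n \<phi>
    by (rule functionals_agree[OF bounded_functional_monomials[OF \<alpha> F] bounded_functional_monomials[OF \<alpha> G] powers that])
  have taylor: "F (taylor_polynomial m f) = G (taylor_polynomial m f)" for m
  proof (induction m)
    case 0
    have "taylor_polynomial 0 f = fcomb 0 f 0 f" by (simp add: taylor_polynomial_def fcomb_def)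
    then show ?case using bounded_functionalD[OF F f f, of 0 0] bounded_functionalD[OF G f f, of 0 0] by simp
  next
    case (Suc m)
    have t: "taylor_coefficient f m \<in> Phi_sym R m" by (rule taylor_coefficient_in[OF E_min_entire[OF \<alpha> f]])
    show ?case unfolding taylor_polynomial_Suc
      using bounded_functionalD[OF F taylor_polynomial_in[OF \<alpha> f] monomial_in[OF \<alpha> t], of 1 m 1]
        bounded_functionalD[OF G taylor_polynomial_in[OF \<alpha> f] monomial_in[OF \<alpha> t], of 1 m 1] Suc mono[OF t] by simp
  qed
  show ?thesis
    using bounded_functional_taylor[OF \<alpha> F f] bounded_functional_taylor[OF \<alpha> G f] unfolding taylor
    by (rule LIMSEQ_unique)
qed

lemma evaluation_bounded:
  assumes \<alpha>: "0 \<le> \<alpha>" and \<omega>: "\<omega> \<in> Phi_dual R"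
  shows "bounded_functional \<alpha> (\<lambda>f. f \<omega>)"
proof -
  obtain \<tau> where \<tau>: "\<tau> \<in> indices R" "\<omega> \<in> neg_space R \<tau>" using \<omega> by (auto simp: Phi_dual_def)
  obtain a where a: "a \<in> growth_exponents \<alpha>" using exponent_exists[OF \<alpha>] by blast
  have "cmod (f \<omega>) \<le> growth_weight \<tau> 0 a \<omega> * growth_norm R \<tau> 0 a f" if "f \<in> E_min R \<alpha>" for f
    using growth_bound[OF that a \<tau>, of 0] by (simp only: mult.commute)
  then show ?thesis unfolding bounded_functional_def
    by (intro conjI bexI[OF _ \<tau>(1)] bexI[OF _ a] exI[of _ 0] exI[of _ "growth_weight \<tau> 0 a \<omega>"])
       (auto simp: fcomb_def)
qed

definition power_function :: "nat \<Rightarrow> 'v cplx \<Rightarrow> 'v dual \<Rightarrow> complex" where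
  "power_function n \<xi> = monomial R n (tensor_pow R n \<xi>)"

lemma power_function_eq: "\<xi> \<in> Phi R \<Longrightarrow> \<omega> \<in> Phi_dual R \<Longrightarrow> power_function n \<xi> \<omega> = \<omega> \<xi> ^ n"
  by (simp add: power_function_def monomial_eq tensor_pow_in tensor_pow_replicate)

lemma power_function_in: "0 \<le> \<alpha> \<Longrightarrow> \<xi> \<in> Phi R \<Longrightarrow> power_function n \<xi> \<in> E_min R \<alpha>"
  unfolding power_function_def by (intro monomial_in tensor_pow_in)

lemma Ds_monomial_eq_0:
  assumes \<phi>: "\<phi> \<in> Phi_sym R n" and "set ws \<subseteq> Phi_dual R" "n < length ws" "\<omega> \<in> Phi_dual R"
  shows "Ds ws (monomial R n \<phi>) \<omega> = 0"
  using assms(2-4)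
proof (induction ws arbitrary: \<omega>)
  case (Cons w ws)
  have "D w (Ds ws (monomial R n \<phi>)) \<omega> = D w (\<lambda>\<omega>. if n < length ws then 0 else fact n * \<phi> ws) \<omega>"
  proof (rule D_cong_dual)
    fix \<zeta> assume \<zeta>: "\<zeta> \<in> Phi_dual R"
    show "Ds ws (monomial R n \<phi>) \<zeta> = (if n < length ws then 0 else fact n * \<phi> ws)"
    proof (cases "n < length ws")
      case True then show ?thesis using Cons \<zeta> by simp
    next
      case False
      then have "length ws = n" using Cons.prems by simp
      then show ?thesis using Ds_monomial[OF \<phi>, of ws \<zeta>] Cons.prems \<zeta> by simp
    qed
  qed (use Cons.prems in auto)
  also have "\<dots> = 0" by (simp add: D_def)
  finally show ?case by simp
qed simp

lemma deriv_form_power_function: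
  assumes \<xi>: "\<xi> \<in> Phi R" and \<omega>: "\<omega> \<in> Phi_dual R"
  shows "deriv_form k (power_function n \<xi>) \<omega> =
    fcomb (if k \<le> n then fact n / fact (n - k) * \<omega> \<xi> ^ (n - k) else 0) (tensor_pow R k \<xi>) 0 (tensor_pow R k \<xi>)"
proof
  fix ws
  show "deriv_form k (power_function n \<xi>) \<omega> ws =
    fcomb (if k \<le> n then fact n / fact (n - k) * \<omega> \<xi> ^ (n - k) else 0) (tensor_pow R k \<xi>) 0 (tensor_pow R k \<xi>) ws"
  proof (cases "length ws = k \<and> set ws \<subseteq> Phi_dual R")
    case True
    then show ?thesis
      using Ds_monomial[OF tensor_pow_in[OF \<xi>], of ws n \<omega>] Ds_monomial_eq_0[OF tensor_pow_in[OF \<xi>], of ws n \<omega>] \<omega>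
      by (auto simp: deriv_form_def power_function_def fcomb_def tensor_pow_def set_replicate_conv_if)
  next
    case False
    then show ?thesis by (simp only: deriv_form_def tensor_pow_def fcomb_def if_False mult_zero_right add_0_right)
  qed
qed

end

context appell_coefficients
begin

lemma summand_power_function:
  assumes \<xi>: "\<xi> \<in> Phi R" and \<omega>: "\<omega> \<in> Phi_dual R"
  shows "summand k (power_function n \<xi>) \<omega> =
    (if k \<le> n then fact n / fact (n - k) * \<omega> \<xi> ^ (n - k) * \<kappa> k (tensor_pow R k \<xi>) else 0)"
  unfolding summand_def deriv_form_power_function[OF assms]
  using coeff_linear[OF tensor_pow_in[OF \<xi>] tensor_pow_in[OF \<xi>]] by simp

lemma diff_op_power_function:
  assumes \<xi>: "\<xi> \<in> Phi R" and \<omega>: "\<omega> \<in> Phi_dual R"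
  shows "diff_op (power_function n \<xi>) \<omega> =
    (\<Sum>k\<le>n. fact n / fact (n - k) * \<kappa> k (tensor_pow R k \<xi>) * power_function (n - k) \<xi> \<omega>)"
proof -
  have "diff_op (power_function n \<xi>) \<omega> = (\<Sum>k\<le>n. summand k (power_function n \<xi>) \<omega>)"
    using \<omega> by (simp add: diff_op_def) (rule suminf_finite; simp add: summand_power_function[OF assms])
  also have "\<dots> = (\<Sum>k\<le>n. fact n / fact (n - k) * \<kappa> k (tensor_pow R k \<xi>) * power_function (n - k) \<xi> \<omega>)"
    by (intro sum.cong) (simp_all add: summand_power_function[OF assms] power_function_eq[OF assms])
  finally show ?thesis .
qed

text \<open>On powers the operator multiplies the exponential generating series \<open>exp(z \<langle>\<omega>, \<xi>\<rangle>)\<close> by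
  \<open>\<kappa>(z \<xi>)\<close>.\<close>

lemma diff_op_power_series:
  assumes \<xi>: "\<xi> \<in> Phi R" and \<omega>: "\<omega> \<in> Phi_dual R"
  shows "diff_op (power_function n \<xi>) \<omega> / fact n = (gen_series R \<kappa> \<xi> * fps_exp (\<omega> \<xi>)) $ n"
  unfolding diff_op_power_function[OF assms] fps_mult_nth sum_divide_distrib atLeast0AtMost
  by (rule sum.cong) (simp_all add: gen_series_def power_function_eq[OF assms])

lemma diff_op_zero_outside: "\<omega> \<notin> Phi_dual R \<Longrightarrow> diff_op f \<omega> = 0"
  by (simp add: diff_op_def)

lemma diff_op_sum:
  assumes \<alpha>: "0 \<le> \<alpha>" "\<alpha> \<le> \<beta>" and I: "finite I" and h: "\<And>i. i \<in> I \<Longrightarrow> h i \<in> E_min R \<alpha>" and f: "f \<in> E_min R \<alpha>"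
  shows "(\<lambda>\<omega>. \<Sum>i\<in>I. c i * h i \<omega>) \<in> E_min R \<alpha> \<and>
    diff_op (\<lambda>\<omega>. \<Sum>i\<in>I. c i * h i \<omega>) = (\<lambda>\<omega>. \<Sum>i\<in>I. c i * diff_op (h i) \<omega>)"
  using I h
proof (induction I rule: finite_induct)
  case empty
  have "(\<lambda>\<omega>. 0) = fcomb 0 f 0 f" by (simp add: fcomb_def)
  then have "diff_op (\<lambda>\<omega>. 0) = (\<lambda>\<omega>. 0)" using diff_op_fcomb[OF \<alpha> f f, of 0 0] by (simp add: fcomb_def)
  then show ?case using E_min_zero[OF \<alpha>(1) f] by simp
next
  case (insert i I)
  let ?h = "\<lambda>\<omega>. \<Sum>i\<in>I. c i * h i \<omega>"
  have IH: "?h \<in> E_min R \<alpha>" "diff_op ?h = (\<lambda>\<omega>. \<Sum>i\<in>I. c i * diff_op (h i) \<omega>)" and hi: "h i \<in> E_min R \<alpha>"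
    using insert by auto
  have eq: "(\<lambda>\<omega>. \<Sum>i\<in>insert i I. c i * h i \<omega>) = fcomb (c i) (h i) 1 ?h"
    using insert by (simp add: fcomb_def)
  show ?case unfolding eq diff_op_fcomb[OF \<alpha> hi IH(1)] IH(2)
    using E_min_fcomb[OF \<alpha>(1) hi IH(1), of "c i" 1] insert(1,2) by (simp add: fcomb_def)
qed

end

text \<open>The composed operator, evaluated at \<open>\<omega>\<close>, is a bounded functional, and so is evaluation at
  \<open>\<omega>\<close>. They agree on powers because the generating series are multiplied successively by two
  series with product \<open>1\<close>.\<close>

lemma (in nuclear_family) diff_op_inverse:
  assumes A: "appell_coefficients R \<kappa>1 \<tau> \<beta> C" and B: "appell_coefficients R \<kappa>2 \<tau> \<beta> C"
    and gen: "\<And>\<xi>. \<xi> \<in> Phi R \<Longrightarrow> gen_series R \<kappa>1 \<xi> * gen_series R \<kappa>2 \<xi> = 1"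
    and \<alpha>: "0 \<le> \<alpha>" "\<alpha> \<le> \<beta>" and f: "f \<in> E_min R \<alpha>"
  shows "appell_coefficients.diff_op R \<kappa>2 (appell_coefficients.diff_op R \<kappa>1 f) = f"
proof -
  interpret A: appell_coefficients R \<kappa>1 \<tau> \<beta> C by (rule A)
  interpret B: appell_coefficients R \<kappa>2 \<tau> \<beta> C by (rule B)
  show ?thesis
  proof
    fix \<omega>
    show "B.diff_op (A.diff_op f) \<omega> = f \<omega>"
    proof (cases "\<omega> \<in> Phi_dual R")
      case False
      then show ?thesis using E_min_vanish[OF f False] B.diff_op_zero_outside by simp
    next
      case True
      obtain \<tau>' where \<tau>': "\<tau>' \<in> indices R" "\<omega> \<in> neg_space R \<tau>'" using True by (auto simp: Phi_dual_def)
      obtain a where a: "a \<in> growth_exponents \<alpha>" using exponent_exists[OF \<alpha>(1)] by blast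
      have power: "B.diff_op (A.diff_op (power_function n \<xi>)) \<omega> = power_function n \<xi> \<omega>" if \<xi>: "\<xi> \<in> Phi R" for n \<xi>
      proof -
        let ?c = "\<lambda>k. fact n / fact (n - k) * \<kappa>1 k (tensor_pow R k \<xi>)"
        have "A.diff_op (power_function n \<xi>) = (\<lambda>\<omega>. \<Sum>k\<le>n. ?c k * power_function (n - k) \<xi> \<omega>)"
        proof
          fix \<eta>
          show "A.diff_op (power_function n \<xi>) \<eta> = (\<Sum>k\<le>n. ?c k * power_function (n - k) \<xi> \<eta>)"
          proof (cases "\<eta> \<in> Phi_dual R")
            case True then show ?thesis by (rule A.diff_op_power_function[OF \<xi>])
          next
            case False then show ?thesis by (simp add: A.diff_op_zero_outside power_function_def monomial_def)
          qed
        qed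
        then have "B.diff_op (A.diff_op (power_function n \<xi>)) \<omega> = (\<Sum>k\<le>n. ?c k * B.diff_op (power_function (n - k) \<xi>) \<omega>)"
          using B.diff_op_sum[OF \<alpha> finite_atMost power_function_in[OF \<alpha>(1) \<xi>] f, where c = ?c] by simp
        also have "\<dots> = fact n * (\<Sum>k\<le>n. \<kappa>1 k (tensor_pow R k \<xi>) * (B.diff_op (power_function (n - k) \<xi>) \<omega> / fact (n - k)))"
          by (simp add: sum_distrib_left mult_ac)
        also have "\<dots> = fact n * (gen_series R \<kappa>1 \<xi> * (gen_series R \<kappa>2 \<xi> * fps_exp (\<omega> \<xi>))) $ n"
          unfolding B.diff_op_power_series[OF \<xi> True] fps_mult_nth[of "gen_series R \<kappa>1 \<xi>"]
          by (simp add: gen_series_def atLeast0AtMost)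
        also have "gen_series R \<kappa>1 \<xi> * (gen_series R \<kappa>2 \<xi> * fps_exp (\<omega> \<xi>)) = fps_exp (\<omega> \<xi>)"
          using gen[OF \<xi>] by (simp add: mult.assoc[symmetric])
        also have "fact n * fps_exp (\<omega> \<xi>) $ n = power_function n \<xi> \<omega>" using power_function_eq[OF \<xi> True] by simp
        finally show ?thesis .
      qed
      obtain \<sigma>1 l1 a1 where 1: "\<sigma>1 \<in> indices R" "a1 \<in> growth_exponents \<alpha>" and b1: "\<forall>f\<in>E_min R \<alpha>.
          growth_norm R \<tau>' 0 a (B.diff_op f) \<le> 2 * exp 1 * growth_norm R \<sigma>1 l1 a1 f"
        using B.diff_op_growth_norm[OF \<alpha> a \<tau>'(1), of 0] by metis
      obtain \<sigma>2 l2 a2 where 2: "\<sigma>2 \<in> indices R" "a2 \<in> growth_exponents \<alpha>" and b2: "\<forall>f\<in>E_min R \<alpha>.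
          growth_norm R \<sigma>1 l1 a1 (A.diff_op f) \<le> 2 * exp 1 * growth_norm R \<sigma>2 l2 a2 f"
        using A.diff_op_growth_norm[OF \<alpha> 1(2,1), of l1] by metis
      define H where "H = (\<lambda>f. B.diff_op (A.diff_op f) \<omega>)"
      have H: "bounded_functional \<alpha> H"
        unfolding bounded_functional_def
      proof (intro conjI allI ballI bexI[OF _ 2(1)] bexI[OF _ 2(2)] exI[of _ l2] exI[of _ "growth_weight \<tau>' 0 a \<omega> * (2 * exp 1) * (2 * exp 1)"])
        show "H (fcomb c f d g) = c * H f + d * H g" if "f \<in> E_min R \<alpha>" "g \<in> E_min R \<alpha>" for c d f g
          unfolding H_def A.diff_op_fcomb[OF \<alpha> that]
            B.diff_op_fcomb[OF \<alpha> A.diff_op_in[OF \<alpha> that(1)] A.diff_op_in[OF \<alpha> that(2)]] by (simp add: fcomb_def)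
        fix f assume f: "f \<in> E_min R \<alpha>"
        have Af: "A.diff_op f \<in> E_min R \<alpha>" by (rule A.diff_op_in[OF \<alpha> f])
        have "cmod (H f) \<le> growth_norm R \<tau>' 0 a (B.diff_op (A.diff_op f)) * growth_weight \<tau>' 0 a \<omega>"
          unfolding H_def by (rule growth_bound[OF B.diff_op_in[OF \<alpha> Af] a \<tau>'])
        also have "\<dots> \<le> (2 * exp 1 * (2 * exp 1 * growth_norm R \<sigma>2 l2 a2 f)) * growth_weight \<tau>' 0 a \<omega>"
        proof (rule mult_right_mono)
          have "growth_norm R \<tau>' 0 a (B.diff_op (A.diff_op f)) \<le> 2 * exp 1 * growth_norm R \<sigma>1 l1 a1 (A.diff_op f)"
            using b1 Af by blast
          also have "\<dots> \<le> 2 * exp 1 * (2 * exp 1 * growth_norm R \<sigma>2 l2 a2 f)"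
            using b2 f by (intro mult_left_mono) auto
          finally show "growth_norm R \<tau>' 0 a (B.diff_op (A.diff_op f)) \<le> 2 * exp 1 * (2 * exp 1 * growth_norm R \<sigma>2 l2 a2 f)" .
        qed simp
        finally show "cmod (H f) \<le> growth_weight \<tau>' 0 a \<omega> * (2 * exp 1) * (2 * exp 1) * growth_norm R \<sigma>2 l2 a2 f"
          by (simp only: mult_ac)
      qed simp
      show ?thesis
        using bounded_functionals_agree[OF \<alpha>(1) H evaluation_bounded[OF \<alpha>(1) True] _ f] power
        by (simp add: H_def power_function_def)
    qed
  qed
qed

section \<open>Topologies given by seminorms\<close>

text \<open>The generating sets are balls around arbitrary points of \<open>V\<close>; the triangle inequality moves
  the centre to the point under consideration.\<close>

lemma continuous_map_seminorm_topology:
  assumes V: "\<And>f g. f \<in> V \<Longrightarrow> g \<in> V \<Longrightarrow> fcomb 1 f (-1) g \<in> V" and Q: "Q \<noteq> {}"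
    and zero: "\<And>q. q \<in> Q \<Longrightarrow> q (\<lambda>x. 0) = 0"
    and triangle: "\<And>q f g h. q \<in> Q \<Longrightarrow> f \<in> V \<Longrightarrow> g \<in> V \<Longrightarrow> h \<in> V \<Longrightarrow>
      q (fcomb 1 f (-1) h) \<le> q (fcomb 1 f (-1) g) + q (fcomb 1 g (-1) h)"
    and T: "\<And>f. f \<in> V \<Longrightarrow> T f \<in> V"
    and T_diff: "\<And>f g. f \<in> V \<Longrightarrow> g \<in> V \<Longrightarrow> T (fcomb 1 f (-1) g) = fcomb 1 (T f) (-1) (T g)"
    and bound: "\<And>q. q \<in> Q \<Longrightarrow> \<exists>q'\<in>Q. \<exists>K\<ge>0. \<forall>f\<in>V. q (T f) \<le> K * q' f"
  shows "continuous_map (seminorm_topology V Q) (seminorm_topology V Q) T"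
proof -
  let ?X = "seminorm_topology V Q"
  have top: "topspace ?X = V" by (rule topspace_seminorm_topology[OF Q]) (rule zero)
  have diff_self: "fcomb 1 f (-1) f = (\<lambda>x. 0)" for f :: "'a \<Rightarrow> complex" by (simp add: fcomb_def)
  have basic: "openin ?X {g \<in> V. q (fcomb 1 g (-1) f) < e}" if "f \<in> V" "q \<in> Q" "0 < e" for f q e
    unfolding seminorm_topology_def by (rule topology_generated_by_Basis) (use that in blast)
  have "continuous_map ?X (topology_generated_by {{g \<in> V. q (fcomb 1 g (-1) f) < e} | f q e. f \<in> V \<and> q \<in> Q \<and> 0 < e}) T"
  proof (rule continuous_on_generated_topo)
    fix U assume "U \<in> {{g \<in> V. q (fcomb 1 g (-1) f) < e} | f q e. f \<in> V \<and> q \<in> Q \<and> 0 < e}"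
    then obtain f q e where U: "U = {g \<in> V. q (fcomb 1 g (-1) f) < e}" and f: "f \<in> V" and q: "q \<in> Q" and e: "0 < e"
      by blast
    obtain q' K where q': "q' \<in> Q" and K: "0 \<le> K" "\<forall>f\<in>V. q (T f) \<le> K * q' f" using bound[OF q] by blast
    show "openin ?X (T -` U \<inter> topspace ?X)"
    proof (subst openin_subopen, intro ballI)
      fix g assume "g \<in> T -` U \<inter> topspace ?X"
      then have g: "g \<in> V" "q (fcomb 1 (T g) (-1) f) < e" by (auto simp: top U)
      define d where "d = (e - q (fcomb 1 (T g) (-1) f)) / (K + 1)"
      have d: "0 < d" using g(2) K(1) by (simp add: d_def)
      have Kd: "K * d + q (fcomb 1 (T g) (-1) f) < e"
      proof -
        have "K * d < (K + 1) * d" using d by simp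
        also have "(K + 1) * d = e - q (fcomb 1 (T g) (-1) f)" using K(1) by (simp add: d_def)
        finally show ?thesis by simp
      qed
      have "{h \<in> V. q' (fcomb 1 h (-1) g) < d} \<subseteq> T -` U \<inter> topspace ?X"
      proof
        fix h assume h: "h \<in> {h \<in> V. q' (fcomb 1 h (-1) g) < d}"
        then have hV: "h \<in> V" by blast
        have "q (fcomb 1 (T h) (-1) f) \<le> q (fcomb 1 (T h) (-1) (T g)) + q (fcomb 1 (T g) (-1) f)"
          by (rule triangle[OF q T[OF hV] T[OF g(1)] f])
        also have "q (fcomb 1 (T h) (-1) (T g)) \<le> K * q' (fcomb 1 h (-1) g)"
          using K(2) V[OF hV g(1)] T_diff[OF hV g(1)] by metis
        also have "\<dots> \<le> K * d" using h K(1) by (intro mult_left_mono) auto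
        finally have "q (fcomb 1 (T h) (-1) f) < e" using Kd by simp
        then show "h \<in> T -` U \<inter> topspace ?X" using T[OF hV] hV by (simp add: top U)
      qed
      moreover have "g \<in> {h \<in> V. q' (fcomb 1 h (-1) g) < d}" using g(1) d zero[OF q'] by (simp add: diff_self)
      ultimately show "\<exists>W. openin ?X W \<and> g \<in> W \<and> W \<subseteq> T -` U \<inter> topspace ?X"
        using basic[OF g(1) q' d] by blast
    qed
  next
    obtain q where q: "q \<in> Q" using Q by blast
    show "T ` topspace ?X \<subseteq> \<Union> {{g \<in> V. q (fcomb 1 g (-1) f) < e} | f q e. f \<in> V \<and> q \<in> Q \<and> 0 < e}"
    proof
      fix h assume "h \<in> T ` topspace ?X"
      then have h: "h \<in> V" using T by (auto simp: top)
      then have "h \<in> {g \<in> V. q (fcomb 1 g (-1) h) < 1}" using zero[OF q] by (simp add: diff_self)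
      then show "h \<in> \<Union> {{g \<in> V. q (fcomb 1 g (-1) f) < e} | f q e. f \<in> V \<and> q \<in> Q \<and> 0 < e}"
        using h q zero_less_one by blast
    qed
  qed
  then show ?thesis unfolding seminorm_topology_def .
qed

text \<open>A sequence that converges for every seminorm is eventually in every generating set that
  contains the limit, hence in every open set that contains it.\<close>

lemma closure_of_seminorm_topology:
  assumes Q: "Q \<noteq> {}" and zero: "\<And>q. q \<in> Q \<Longrightarrow> q (\<lambda>x. 0) = 0"
    and triangle: "\<And>q f g h. q \<in> Q \<Longrightarrow> f \<in> V \<Longrightarrow> g \<in> V \<Longrightarrow> h \<in> V \<Longrightarrow>
      q (fcomb 1 f (-1) h) \<le> q (fcomb 1 f (-1) g) + q (fcomb 1 g (-1) h)"
    and P: "P \<subseteq> V"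
    and approx: "\<And>f. f \<in> V \<Longrightarrow> \<exists>p :: nat \<Rightarrow> _. (\<forall>n. p n \<in> P) \<and> (\<forall>q\<in>Q. (\<lambda>n. q (fcomb 1 (p n) (-1) f)) \<longlonglongrightarrow> 0)"
  shows "seminorm_topology V Q closure_of P = V"
proof -
  let ?X = "seminorm_topology V Q"
  have top: "topspace ?X = V" by (rule topspace_seminorm_topology[OF Q]) (rule zero)
  have "f \<in> ?X closure_of P" if f: "f \<in> V" for f
  proof -
    obtain p where p: "\<And>n :: nat. p n \<in> P" and lim: "\<And>q. q \<in> Q \<Longrightarrow> (\<lambda>n. q (fcomb 1 (p n) (-1) f)) \<longlonglongrightarrow> 0"
      using approx[OF f] by blast
    have eventually_in: "\<forall>\<^sub>F n in sequentially. p n \<in> U"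
      if "generate_topology_on {{g \<in> V. q (fcomb 1 g (-1) f) < e} | f q e. f \<in> V \<and> q \<in> Q \<and> 0 < e} U" "f \<in> U" for U
      using that
    proof (induction U rule: generate_topology_on.induct)
      case (Int A B)
      then show ?case by (simp add: eventually_conj)
    next
      case (UN K)
      then obtain k where k: "k \<in> K" "f \<in> k" by blast
      then have "\<forall>\<^sub>F n in sequentially. p n \<in> k" using UN by blast
      then show ?case by (rule eventually_mono) (use k in blast)
    next
      case (Basis U)
      then obtain h q e where U: "U = {g \<in> V. q (fcomb 1 g (-1) h) < e}" and h: "h \<in> V" and q: "q \<in> Q" and e: "0 < e"
        by blast
      have "q (fcomb 1 f (-1) h) < e" using Basis.prems U by blast
      then have "\<forall>\<^sub>F n in sequentially. q (fcomb 1 (p n) (-1) f) < e - q (fcomb 1 f (-1) h)"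
        by (intro order_tendstoD[OF lim[OF q]]) simp
      then show ?case
      proof (rule eventually_mono)
        fix n assume n: "q (fcomb 1 (p n) (-1) f) < e - q (fcomb 1 f (-1) h)"
        have pV: "p n \<in> V" using p P by blast
        have "q (fcomb 1 (p n) (-1) h) \<le> q (fcomb 1 (p n) (-1) f) + q (fcomb 1 f (-1) h)" by (rule triangle[OF q pV f h])
        then show "p n \<in> U" using n pV by (simp add: U)
      qed
    qed simp
    have "\<exists>n. p n \<in> U" if U: "openin ?X U" "f \<in> U" for U
    proof -
      have "generate_topology_on {{g \<in> V. q (fcomb 1 g (-1) f) < e} | f q e. f \<in> V \<and> q \<in> Q \<and> 0 < e} U"
        by (rule openin_topology_generated_by[OF U(1)[unfolded seminorm_topology_def]])
      then show ?thesis by (rule eventually_happens'[OF sequentially_bot eventually_in[OF _ U(2)]])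
    qed
    then show ?thesis unfolding in_closure_of top using f p by blast
  qed
  then show ?thesis using closure_of_subset_topspace[of ?X P] top by blast
qed

section \<open>Appell sequences and Sheffer operators\<close>

context nuclear_family
begin

lemma growth_norm_zero:
  assumes "\<tau> \<in> indices R"
  shows "growth_norm R \<tau> l a (\<lambda>\<omega>. 0) = 0"
proof -
  have "neg_space R \<tau> \<noteq> {}" using seminormed.V_zero[OF seminormed_neg[OF assms]] by blast
  then show ?thesis by (simp add: growth_norm_def growth_quotient_def)
qed

lemma growth_norm_triangle:
  assumes \<alpha>: "0 \<le> \<alpha>" and f: "f \<in> E_min R \<alpha>" and g: "g \<in> E_min R \<alpha>" and h: "h \<in> E_min R \<alpha>"
    and \<tau>: "\<tau> \<in> indices R" and a: "a \<in> growth_exponents \<alpha>"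
  shows "growth_norm R \<tau> l a (fcomb 1 f (-1) h) \<le> growth_norm R \<tau> l a (fcomb 1 f (-1) g) + growth_norm R \<tau> l a (fcomb 1 g (-1) h)"
  using growth_norm_fcomb[OF E_min_fcomb[OF \<alpha> f g, of 1 "-1"] E_min_fcomb[OF \<alpha> g h, of 1 "-1"] a \<tau>, of l 1 1]
  unfolding fcomb_triangle[of f h g] by simp

lemma E_min_continuous_map:
  assumes \<alpha>: "0 \<le> \<alpha>" and T: "\<And>f. f \<in> E_min R \<alpha> \<Longrightarrow> T f \<in> E_min R \<alpha>"
    and lin: "\<And>f g a b. f \<in> E_min R \<alpha> \<Longrightarrow> g \<in> E_min R \<alpha> \<Longrightarrow> T (fcomb a f b g) = fcomb a (T f) b (T g)"
    and bound: "\<And>\<tau> l a. \<tau> \<in> indices R \<Longrightarrow> a \<in> growth_exponents \<alpha> \<Longrightarrow> \<exists>\<sigma>\<in>indices R. \<exists>l'. \<exists>a'\<in>growth_exponents \<alpha>.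
      \<forall>f\<in>E_min R \<alpha>. growth_norm R \<tau> l a (T f) \<le> K * growth_norm R \<sigma> l' a' f" and K: "0 \<le> K"
  shows "continuous_map (E_min_topology R \<alpha>) (E_min_topology R \<alpha>) T"
  unfolding E_min_topology_def
proof (rule continuous_map_seminorm_topology)
  show "{growth_norm R \<tau> l a | \<tau> l a. \<tau> \<in> indices R \<and> a \<in> growth_exponents \<alpha>} \<noteq> {}"
    using center exponent_exists[OF \<alpha>] by blast
  fix q assume "q \<in> {growth_norm R \<tau> l a | \<tau> l a. \<tau> \<in> indices R \<and> a \<in> growth_exponents \<alpha>}"
  then obtain \<tau> l a where q: "q = growth_norm R \<tau> l a" and \<tau>: "\<tau> \<in> indices R" and a: "a \<in> growth_exponents \<alpha>" by blast
  show "q (\<lambda>x. 0) = 0" unfolding q by (rule growth_norm_zero[OF \<tau>])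
  show "q (fcomb 1 f (-1) h) \<le> q (fcomb 1 f (-1) g) + q (fcomb 1 g (-1) h)"
    if "f \<in> E_min R \<alpha>" "g \<in> E_min R \<alpha>" "h \<in> E_min R \<alpha>" for f g h
    unfolding q by (rule growth_norm_triangle[OF \<alpha> that \<tau> a])
  obtain \<sigma> l' a' where "\<sigma> \<in> indices R" "a' \<in> growth_exponents \<alpha>"
    "\<forall>f\<in>E_min R \<alpha>. growth_norm R \<tau> l a (T f) \<le> K * growth_norm R \<sigma> l' a' f"
    using bound[OF \<tau> a, of l] by blast
  then show "\<exists>q'\<in>{growth_norm R \<tau> l a | \<tau> l a. \<tau> \<in> indices R \<and> a \<in> growth_exponents \<alpha>}.
      \<exists>K\<ge>0. \<forall>f\<in>E_min R \<alpha>. q (T f) \<le> K * q' f"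
    unfolding q using K by (intro bexI[of _ "growth_norm R \<sigma> l' a'"] exI[of _ K]) auto
qed (use T lin E_min_fcomb[OF \<alpha>] in auto)

lemma Phi_sym_zero: "(\<lambda>ws. 0) \<in> Phi_sym R n"
proof -
  have "fcomb 0 (tensor_pow R n 0) 0 (tensor_pow R n 0) \<in> Phi_sym R n"
    by (intro Phi_sym_fcomb tensor_pow_in Phi_zero)
  then show ?thesis by (simp add: fcomb_def)
qed

lemma monomial_zero: "monomial R k (\<lambda>ws. 0) = (\<lambda>\<omega>. 0)"
  by (simp add: monomial_def dual_pow_def fun_eq_iff)

lemma partial_sum_polynomial:
  "(\<And>k. \<phi> k \<in> Phi_sym R k) \<Longrightarrow> (\<lambda>\<omega>. \<Sum>k\<le>n. monomial R k (\<phi> k) \<omega>) \<in> polynomials R"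
  unfolding polynomials_def by blast

lemma monomial_polynomial:
  assumes \<phi>: "\<phi> \<in> Phi_sym R n"
  shows "monomial R n \<phi> \<in> polynomials R"
proof -
  let ?\<phi> = "\<lambda>k. if k = n then \<phi> else (\<lambda>ws. 0)"
  have "(\<lambda>\<omega>. \<Sum>k\<le>n. monomial R k (?\<phi> k) \<omega>) \<in> polynomials R"
    by (rule partial_sum_polynomial) (use \<phi> Phi_sym_zero in auto)
  moreover have "(\<Sum>k\<le>n. monomial R k (?\<phi> k) \<omega>) = (\<Sum>k\<le>n. if k = n then monomial R n \<phi> \<omega> else 0)" for \<omega>
    by (intro sum.cong) (auto simp: monomial_zero)
  ultimately show ?thesis by simp
qed

lemma polynomialE:
  assumes "p \<in> polynomials R"
  obtains n \<phi> where "p = (\<lambda>\<omega>. \<Sum>k\<le>n. monomial R k (\<phi> k) \<omega>)" "\<forall>k. \<phi> k \<in> Phi_sym R k"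
  using assms unfolding polynomials_def by (elim CollectE exE conjE) (rule that)

lemma polynomials_in:
  assumes \<alpha>: "0 \<le> \<alpha>"
  shows "polynomials R \<subseteq> E_min R \<alpha>"
proof
  fix p assume "p \<in> polynomials R"
  then obtain n \<phi> where p: "p = (\<lambda>\<omega>. \<Sum>k\<le>n. monomial R k (\<phi> k) \<omega>)" and all: "\<forall>k. \<phi> k \<in> Phi_sym R k"
    by (rule polynomialE)
  have \<phi>: "\<phi> k \<in> Phi_sym R k" for k by (rule spec[OF all])
  have "(\<lambda>\<omega>. \<Sum>k\<le>n. monomial R k (\<phi> k) \<omega>) \<in> E_min R \<alpha>" for n
  proof (induction n)
    case 0 then show ?case using monomial_in[OF \<alpha> \<phi>[of 0]] by simp
  next
    case (Suc n)
    have "fcomb 1 (\<lambda>\<omega>. \<Sum>k\<le>n. monomial R k (\<phi> k) \<omega>) 1 (monomial R (Suc n) (\<phi> (Suc n))) \<in> E_min R \<alpha>"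
      by (rule E_min_fcomb[OF \<alpha> Suc monomial_in[OF \<alpha> \<phi>]])
    then show ?case by (simp add: fcomb_def)
  qed
  then show "p \<in> E_min R \<alpha>" using p by blast
qed

lemma polynomials_dense:
  assumes \<alpha>: "0 \<le> \<alpha>"
  shows "E_min_topology R \<alpha> closure_of polynomials R = E_min R \<alpha>"
  unfolding E_min_topology_def
proof (rule closure_of_seminorm_topology)
  show "{growth_norm R \<tau> l a | \<tau> l a. \<tau> \<in> indices R \<and> a \<in> growth_exponents \<alpha>} \<noteq> {}"
    using center exponent_exists[OF \<alpha>] by blast
  show "polynomials R \<subseteq> E_min R \<alpha>" by (rule polynomials_in[OF \<alpha>])
next
  fix q assume "q \<in> {growth_norm R \<tau> l a | \<tau> l a. \<tau> \<in> indices R \<and> a \<in> growth_exponents \<alpha>}"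
  then obtain \<tau> l a where q: "q = growth_norm R \<tau> l a" and \<tau>: "\<tau> \<in> indices R" and a: "a \<in> growth_exponents \<alpha>" by blast
  show "q (\<lambda>x. 0) = 0" unfolding q by (rule growth_norm_zero[OF \<tau>])
  show "q (fcomb 1 f (-1) h) \<le> q (fcomb 1 f (-1) g) + q (fcomb 1 g (-1) h)"
    if "f \<in> E_min R \<alpha>" "g \<in> E_min R \<alpha>" "h \<in> E_min R \<alpha>" for f g h
    unfolding q by (rule growth_norm_triangle[OF \<alpha> that \<tau> a])
next
  fix f assume f: "f \<in> E_min R \<alpha>"
  show "\<exists>p :: nat \<Rightarrow> _. (\<forall>n. p n \<in> polynomials R) \<and>
     (\<forall>q\<in>{growth_norm R \<tau> l a | \<tau> l a. \<tau> \<in> indices R \<and> a \<in> growth_exponents \<alpha>}. (\<lambda>n. q (fcomb 1 (p n) (-1) f)) \<longlonglongrightarrow> 0)"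
  proof (intro exI conjI allI ballI)
    show "taylor_polynomial (Suc n) f \<in> polynomials R" for n
      unfolding taylor_polynomial_def lessThan_Suc_atMost
      by (intro partial_sum_polynomial taylor_coefficient_in E_min_entire[OF \<alpha> f])
    fix q assume "q \<in> {growth_norm R \<tau> l a | \<tau> l a. \<tau> \<in> indices R \<and> a \<in> growth_exponents \<alpha>}"
    then obtain \<tau> l a where q: "q = growth_norm R \<tau> l a" and \<tau>: "\<tau> \<in> indices R" and a: "a \<in> growth_exponents \<alpha>" by blast
    show "(\<lambda>n. q (fcomb 1 (taylor_polynomial (Suc n) f) (-1) f)) \<longlonglongrightarrow> 0"
      unfolding q by (rule LIMSEQ_Suc[OF taylor_polynomial_converges[OF \<alpha> f a \<tau>]])
  qed
qed

text \<open>The Sheffer operator is known by two properties only, linearity and its values on monomials;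
  this lemma identifies it with the differential operator on polynomials.\<close>

lemma linear_on_polynomials_determined:
  assumes A: "flinear_on (polynomials R) A" and B: "flinear_on (polynomials R) B"
    and eq: "\<And>n \<phi>. \<phi> \<in> Phi_sym R n \<Longrightarrow> A (monomial R n \<phi>) = B (monomial R n \<phi>)"
    and p: "p \<in> polynomials R"
  shows "A p = B p"
proof -
  obtain n \<phi> where p_eq: "p = (\<lambda>\<omega>. \<Sum>k\<le>n. monomial R k (\<phi> k) \<omega>)" and all: "\<forall>k. \<phi> k \<in> Phi_sym R k"
    by (rule polynomialE[OF p])
  have \<phi>: "\<phi> k \<in> Phi_sym R k" for k by (rule spec[OF all])
  have "A (\<lambda>\<omega>. \<Sum>k\<le>n. monomial R k (\<phi> k) \<omega>) = B (\<lambda>\<omega>. \<Sum>k\<le>n. monomial R k (\<phi> k) \<omega>)" for n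
  proof (induction n)
    case 0 then show ?case using eq[OF \<phi>[of 0]] by simp
  next
    case (Suc n)
    let ?p = "\<lambda>\<omega>. \<Sum>k\<le>n. monomial R k (\<phi> k) \<omega>" and ?m = "monomial R (Suc n) (\<phi> (Suc n))"
    have s: "(\<lambda>\<omega>. \<Sum>k\<le>Suc n. monomial R k (\<phi> k) \<omega>) = fcomb 1 ?p 1 ?m" by (simp add: fcomb_def)
    have "?p \<in> polynomials R" "?m \<in> polynomials R"
      by (rule partial_sum_polynomial[OF \<phi>], rule monomial_polynomial[OF \<phi>])
    then have "A (fcomb 1 ?p 1 ?m) = fcomb 1 (A ?p) 1 (A ?m)" "B (fcomb 1 ?p 1 ?m) = fcomb 1 (B ?p) 1 (B ?m)"
      using A B unfolding flinear_on_def by blast+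
    then show ?case unfolding s by (simp only: Suc eq[OF \<phi>])
  qed
  then show ?thesis unfolding p_eq .
qed

lemma dual_pow_in:
  assumes \<omega>: "\<omega> \<in> Phi_dual R"
  shows "dual_pow R k \<omega> \<in> Phi_dual_sym R k"
proof -
  obtain \<tau> where \<tau>: "\<tau> \<in> indices R" "\<omega> \<in> neg_space R \<tau>" using \<omega> by (auto simp: Phi_dual_def)
  have "dual_pow R k \<omega> \<in> neg_sym R \<tau> k"
    unfolding neg_sym_def dual_of_def
  proof (rule CollectI, intro conjI allI ballI impI exI)
    show "dual_pow R k \<omega> \<phi> = 0" if "\<phi> \<notin> Phi_sym R k" for \<phi> using that by (simp add: dual_pow_def)
    show "dual_pow R k \<omega> (fcomb a \<phi> b \<psi>) = a * dual_pow R k \<omega> \<phi> + b * dual_pow R k \<omega> \<psi>"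
      if "\<phi> \<in> Phi_sym R k" "\<psi> \<in> Phi_sym R k" for a b \<phi> \<psi>
      using that Phi_sym_fcomb[OF that] by (simp add: dual_pow_def) (simp add: fcomb_def)
    show "cmod (dual_pow R k \<omega> \<phi>) \<le> neg_norm R \<tau> \<omega> ^ k * sym_norm R \<tau> k \<phi>" if "\<phi> \<in> Phi_sym R k" for \<phi>
      using that diagonal_bound[OF \<tau>(1) that \<tau>(2)] by (simp add: dual_pow_def mult.commute)
  qed
  then show ?thesis using \<tau>(1) by (auto simp: Phi_dual_sym_def)
qed

lemma topspace_ind_lim: "topspace (ind_lim_topology R n) = Phi_dual_sym R n"
  unfolding ind_lim_topology_def
proof (rule topspace_seminorm_topology)
  have z: "(\<lambda>\<phi>. 0) \<in> Phi_dual_sym R n"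
    using center by (auto simp: Phi_dual_sym_def neg_sym_def dual_of_def intro!: bexI[of _ "center R"] exI[of _ 0])
  show "{q. seminorm_on (Phi_dual_sym R n) q \<and>
      (\<forall>\<tau>\<in>indices R. \<exists>K. \<forall>F\<in>neg_sym R \<tau> n. q F \<le> K * neg_sym_norm R \<tau> n F)} \<noteq> {}"
    by (auto simp: seminorm_on_def intro!: exI[of _ "\<lambda>_. 0"] exI[of _ 0])
  fix q assume "q \<in> {q. seminorm_on (Phi_dual_sym R n) q \<and>
      (\<forall>\<tau>\<in>indices R. \<exists>K. \<forall>F\<in>neg_sym R \<tau> n. q F \<le> K * neg_sym_norm R \<tau> n F)}"
  then have "\<forall>c. \<forall>f\<in>Phi_dual_sym R n. q (\<lambda>x. c * f x) = cmod c * q f" by (simp add: seminorm_on_def)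
  from spec[OF this, of 0] show "q (\<lambda>x. 0) = 0" using z by auto
qed

lemma Phi_dual_sym_functional:
  assumes "F \<in> Phi_dual_sym R n"
  shows "sym_linear_functional n F" "diag_bounded n F"
proof -
  obtain \<tau> where \<tau>: "\<tau> \<in> indices R" "F \<in> neg_sym R \<tau> n" using assms by (auto simp: Phi_dual_sym_def)
  show "sym_linear_functional n F" unfolding sym_linear_functional_def
    by (intro allI ballI neg_sym_linear[OF \<tau>(2)])
  show "diag_bounded n F" by (rule diag_bounded_neg_sym[OF \<tau>(2,1)])
qed

text \<open>Since \<open>U\<^sub>n\<^sub>,\<^sub>k\<close> maps \<open>\<Phi>'\<^sup>\<odot>\<^sup>k\<close> to \<open>\<Phi>'\<^sup>\<odot>\<^sup>n\<close>, the value \<open>S\<^sub>n(\<omega>)\<close> is a sum of elements of the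
  dual of \<open>\<Phi>\<^sup>\<odot>\<^sup>n\<close>.\<close>

lemma monic_sequence_functional:
  assumes S: "monic_polynomial_sequence R S" and \<omega>: "\<omega> \<in> Phi_dual R"
  shows "sym_linear_functional n (S n \<omega>)" "diag_bounded n (S n \<omega>)"
proof -
  obtain U where U: "\<forall>n. \<forall>k\<le>n. flinear_on (Phi_dual_sym R k) (U n k) \<and>
      continuous_map (ind_lim_topology R k) (ind_lim_topology R n) (U n k)"
    and SU: "\<forall>n. \<forall>\<omega>\<in>Phi_dual R. S n \<omega> = (\<lambda>\<phi>. \<Sum>k\<le>n. U n k (dual_pow R k \<omega>) \<phi>)"
    using S unfolding monic_polynomial_sequence_def by (elim exE conjE) (rule that)
  have in_dual: "U n k (dual_pow R k \<omega>) \<in> Phi_dual_sym R n" if "k \<le> n" for k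
  proof -
    have "continuous_map (ind_lim_topology R k) (ind_lim_topology R n) (U n k)" using U that by blast
    then have "U n k ` topspace (ind_lim_topology R k) \<subseteq> topspace (ind_lim_topology R n)"
      by (rule continuous_map_image_subset_topspace)
    then show ?thesis unfolding topspace_ind_lim using dual_pow_in[OF \<omega>] by blast
  qed
  have "sym_linear_functional n (\<lambda>\<phi>. \<Sum>k\<le>m. U n k (dual_pow R k \<omega>) \<phi>) \<and>
      diag_bounded n (\<lambda>\<phi>. \<Sum>k\<le>m. U n k (dual_pow R k \<omega>) \<phi>)" if "m \<le> n" for m
    using that
  proof (induction m)
    case 0 then show ?case using Phi_dual_sym_functional[OF in_dual[of 0]] by simp
  next
    case (Suc m)
    let ?F = "\<lambda>\<phi>. \<Sum>k\<le>m. U n k (dual_pow R k \<omega>) \<phi>" and ?G = "U n (Suc m) (dual_pow R (Suc m) \<omega>)"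
    have s: "(\<lambda>\<phi>. \<Sum>k\<le>Suc m. U n k (dual_pow R k \<omega>) \<phi>) = fcomb 1 ?F 1 ?G" by (simp add: fcomb_def)
    show ?case unfolding s
      using Suc sym_linear_functional_fcomb diag_bounded_fcomb Phi_dual_sym_functional[OF in_dual[OF Suc.prems]] by simp
  qed
  from this[of n] show "sym_linear_functional n (S n \<omega>)" "diag_bounded n (S n \<omega>)" using SU \<omega> by auto
qed

end

context appell_coefficients
begin

lemma diff_op_at_bounded:
  assumes \<alpha>: "0 \<le> \<alpha>" "\<alpha> \<le> \<beta>" and \<omega>: "\<omega> \<in> Phi_dual R"
  shows "bounded_functional \<alpha> (\<lambda>f. diff_op f \<omega>)"
proof -
  obtain \<tau>' where \<tau>': "\<tau>' \<in> indices R" "\<omega> \<in> neg_space R \<tau>'" using \<omega> by (auto simp: Phi_dual_def)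
  obtain a where a: "a \<in> growth_exponents \<alpha>" using exponent_exists[OF \<alpha>(1)] by blast
  obtain \<sigma> l a' where 1: "\<sigma> \<in> indices R" "a' \<in> growth_exponents \<alpha>" and b: "\<forall>f\<in>E_min R \<alpha>. \<forall>\<omega>\<in>neg_space R \<tau>'.
      cmod (diff_op f \<omega>) \<le> 2 * exp 1 * growth_norm R \<sigma> l a' f * growth_weight \<tau>' 0 a \<omega>"
    using diff_op_bounded[OF \<alpha> a \<tau>'(1), of 0] by metis
  show ?thesis unfolding bounded_functional_def
  proof (intro conjI allI ballI bexI[OF _ 1(1)] bexI[OF _ 1(2)] exI[of _ l] exI[of _ "2 * exp 1 * growth_weight \<tau>' 0 a \<omega>"])
    show "diff_op (fcomb c f d g) \<omega> = c * diff_op f \<omega> + d * diff_op g \<omega>" if "f \<in> E_min R \<alpha>" "g \<in> E_min R \<alpha>" for c d f g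
      unfolding diff_op_fcomb[OF \<alpha> that] by (simp add: fcomb_def)
    show "cmod (diff_op f \<omega>) \<le> 2 * exp 1 * growth_weight \<tau>' 0 a \<omega> * growth_norm R \<sigma> l a' f" if "f \<in> E_min R \<alpha>" for f
      using bspec[OF bspec[OF b that] \<tau>'(2)] by (simp only: mult_ac)
  qed simp
qed

text \<open>The generating function determines \<open>S\<close> on powers; there it agrees with the operator, and
  both sides are bounded linear functionals of the tensor.\<close>

lemma diff_op_appell:
  assumes S: "monic_polynomial_sequence R S"
    and gen: "\<And>\<omega> \<xi>. \<omega> \<in> Phi_dual R \<Longrightarrow> \<xi> \<in> Phi R \<Longrightarrow>
      Abs_fps (\<lambda>n. 1 / fact n * S n \<omega> (tensor_pow R n \<xi>)) = gen_series R \<kappa> \<xi> * fps_exp (\<omega> \<xi>)"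
    and \<phi>: "\<phi> \<in> Phi_sym R n"
  shows "diff_op (monomial R n \<phi>) = (\<lambda>\<omega>. if \<omega> \<in> Phi_dual R then S n \<omega> \<phi> else 0)"
proof
  fix \<omega>
  show "diff_op (monomial R n \<phi>) \<omega> = (if \<omega> \<in> Phi_dual R then S n \<omega> \<phi> else 0)"
  proof (cases "\<omega> \<in> Phi_dual R")
    case True
    \<comment> \<open>Monomials lie in all the spaces of entire functions; the one with exponent \<open>\<beta>\<close> is used.\<close>
    have \<beta>0: "0 \<le> \<beta>" "\<beta> \<le> \<beta>" using \<beta> by auto
    have "diff_op (monomial R n \<phi>) \<omega> = S n \<omega> \<phi>"
    proof (rule functionals_agree[OF bounded_functional_monomials[OF \<beta>0(1) diff_op_at_bounded[OF \<beta>0 True]]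
          monic_sequence_functional[OF S True] _ \<phi>])
      fix \<xi> assume \<xi>: "\<xi> \<in> Phi R"
      have "diff_op (power_function n \<xi>) \<omega> / fact n = 1 / fact n * S n \<omega> (tensor_pow R n \<xi>)"
        unfolding diff_op_power_series[OF \<xi> True] gen[OF True \<xi>, symmetric] by simp
      then show "diff_op (monomial R n (tensor_pow R n \<xi>)) \<omega> = S n \<omega> (tensor_pow R n \<xi>)"
        by (simp add: power_function_def)
    qed
    then show ?thesis using True by simp
  qed (simp add: diff_op_zero_outside)
qed

lemma diff_op_continuous:
  assumes \<alpha>: "0 \<le> \<alpha>" "\<alpha> \<le> \<beta>"
  shows "continuous_map (E_min_topology R \<alpha>) (E_min_topology R \<alpha>) diff_op"
  by (rule E_min_continuous_map[OF \<alpha>(1) diff_op_in[OF \<alpha>] diff_op_fcomb[OF \<alpha>] diff_op_growth_norm[OF \<alpha>]]) simp_all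

end

theorem theorem3p10:
  fixes R :: "('t, 'v::real_vector) hilbert_family"
    and S :: "'v poly_sequence"
    and \<rho> \<theta> :: "nat \<Rightarrow> 'v dual_tensor"
    and \<beta> C \<alpha> :: real
    and \<tau> :: 't
  assumes "nuclear_hilbert_family R"
    and "appell_sequence R \<rho> S"
    and "\<forall>n. \<theta> n \<in> Phi_dual_sym R n"
    and "\<forall>\<xi>\<in>Phi R. 1 / gen_series R \<rho> \<xi> = gen_series R \<theta> \<xi>"
    and "1 < \<beta>"
    and "\<tau> \<in> indices R"
    and "1 \<le> C"
    and "\<forall>n\<ge>1. \<theta> n \<in> neg_sym R \<tau> n \<and> neg_sym_norm R \<tau> n (\<theta> n) \<le> C ^ n * fact n powr (1 / \<beta> - 1)"
    and "\<forall>n\<ge>1. \<rho> n \<in> neg_sym R \<tau> n \<and> neg_sym_norm R \<tau> n (\<rho> n) \<le> C ^ n * fact n powr (1 / \<beta> - 1)"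
    and "0 \<le> \<alpha>" and "\<alpha> \<le> \<beta>"
  shows "polynomials R \<subseteq> E_min R \<alpha> \<and>
         E_min_topology R \<alpha> closure_of polynomials R = E_min R \<alpha> \<and>
         (\<exists>A. flinear_on (E_min R \<alpha>) A \<and>
              homeomorphic_map (E_min_topology R \<alpha>) (E_min_topology R \<alpha>) A \<and>
              (\<forall>p\<in>polynomials R. A p = sheffer_operator R S p))"
proof -
  interpret nuclear_family R by (rule nuclear_family.intro[OF assms(1)])
  have monic: "monic_polynomial_sequence R S" and \<rho>0: "\<rho> 0 = dual_one R"
    and genS: "\<And>\<omega> \<xi>. \<omega> \<in> Phi_dual R \<Longrightarrow> \<xi> \<in> Phi R \<Longrightarrow>
        Abs_fps (\<lambda>n. 1 / fact n * S n \<omega> (tensor_pow R n \<xi>)) = fps_exp (\<omega> \<xi>) / gen_series R \<rho> \<xi>"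
    using assms(2) unfolding appell_sequence_def by blast+
  have \<rho>_one: "gen_series R \<rho> \<xi> $ 0 = 1" if "\<xi> \<in> Phi R" for \<xi>
    using tensor_pow_in[OF that, of 0] by (simp add: gen_series_def \<rho>0 dual_one_def tensor_pow_def)
  have div: "x / gen_series R \<rho> \<xi> = x * inverse (gen_series R \<rho> \<xi>)" if "\<xi> \<in> Phi R" for x \<xi>
    using \<rho>_one[OF that] by (intro fps_divide_unit) simp
  have \<theta>_inv: "gen_series R \<theta> \<xi> = inverse (gen_series R \<rho> \<xi>)" if "\<xi> \<in> Phi R" for \<xi>
    using assms(4) that div[OF that, of 1] by simp
  have \<theta>\<rho>: "gen_series R \<theta> \<xi> * gen_series R \<rho> \<xi> = 1" if "\<xi> \<in> Phi R" for \<xi>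
    unfolding \<theta>_inv[OF that] using \<rho>_one[OF that] by (intro inverse_mult_eq_1) simp
  have \<rho>\<theta>: "gen_series R \<rho> \<xi> * gen_series R \<theta> \<xi> = 1" if "\<xi> \<in> Phi R" for \<xi>
    using \<theta>\<rho>[OF that] by (simp only: mult.commute)
  \<comment> \<open>The space \<open>\<Phi>\<^sup>\<odot>\<^sup>0\<close> is spanned by \<open>0\<^sup>\<otimes>\<^sup>0\<close>, whose value at the empty list is \<open>1\<close>.\<close>
  have zero_tensor: "\<phi> = fcomb (\<phi> []) (tensor_pow R 0 0) 0 (tensor_pow R 0 0)" if \<phi>: "\<phi> \<in> Phi_sym R 0" for \<phi>
  proof
    fix ws
    show "\<phi> ws = fcomb (\<phi> []) (tensor_pow R 0 0) 0 (tensor_pow R 0 0) ws"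
      using Phi_symD(1)[OF \<phi>, of ws] by (cases ws) (simp_all add: fcomb_def tensor_pow_def)
  qed
  have \<theta>0: "\<theta> 0 \<phi> = \<phi> []" if \<phi>: "\<phi> \<in> Phi_sym R 0" for \<phi>
  proof -
    have "gen_series R \<theta> 0 $ 0 = 1" using \<theta>_inv[OF Phi_zero] \<rho>_one[OF Phi_zero] by simp
    then have one: "\<theta> 0 (tensor_pow R 0 0) = 1" by (simp add: gen_series_def)
    have "sym_linear_functional 0 (\<theta> 0)" by (rule Phi_dual_sym_functional(1)[OF spec[OF assms(3)]])
    then have "\<theta> 0 (fcomb (\<phi> []) (tensor_pow R 0 0) 0 (tensor_pow R 0 0)) = \<phi> [] * 1 + 0 * 1"
      using tensor_pow_in[OF Phi_zero, of 0] one unfolding sym_linear_functional_def by metis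
    then show ?thesis using zero_tensor[OF \<phi>] by simp
  qed
  have A: "appell_coefficients R \<theta> \<tau> \<beta> C"
    by unfold_locales (use assms(5-8) \<theta>0 in auto)
  have B: "appell_coefficients R \<rho> \<tau> \<beta> C"
    by unfold_locales (use assms(5-7,9) in \<open>auto simp: \<rho>0 dual_one_def\<close>)
  interpret A: appell_coefficients R \<theta> \<tau> \<beta> C by (rule A)
  interpret B: appell_coefficients R \<rho> \<tau> \<beta> C by (rule B)
  note \<alpha> = assms(10,11)
  have top: "topspace (E_min_topology R \<alpha>) = E_min R \<alpha>" by (rule topspace_E_min_topology) (use assms(6) in blast)
  have "homeomorphic_maps (E_min_topology R \<alpha>) (E_min_topology R \<alpha>) A.diff_op B.diff_op"
    unfolding homeomorphic_maps_def top
  proof (intro conjI ballI A.diff_op_continuous[OF \<alpha>] B.diff_op_continuous[OF \<alpha>])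
    fix f assume f: "f \<in> E_min R \<alpha>"
    show "B.diff_op (A.diff_op f) = f" by (rule diff_op_inverse[OF A B \<theta>\<rho> \<alpha> f])
    show "A.diff_op (B.diff_op f) = f" by (rule diff_op_inverse[OF B A \<rho>\<theta> \<alpha> f])
  qed
  then have homeo: "homeomorphic_map (E_min_topology R \<alpha>) (E_min_topology R \<alpha>) A.diff_op"
    by (rule homeomorphic_maps_imp_map)
  have lin: "flinear_on (E_min R \<alpha>) A.diff_op" unfolding flinear_on_def using A.diff_op_fcomb[OF \<alpha>] by blast
  have poly: "polynomials R \<subseteq> E_min R \<alpha>" by (rule polynomials_in[OF \<alpha>(1)])
  have linp: "flinear_on (polynomials R) A.diff_op" using lin poly unfolding flinear_on_def by blast
  have mono: "A.diff_op (monomial R n \<phi>) = (\<lambda>\<omega>. if \<omega> \<in> Phi_dual R then S n \<omega> \<phi> else 0)" if "\<phi> \<in> Phi_sym R n" for n \<phi>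
  proof (rule A.diff_op_appell[OF monic _ that])
    fix \<omega> \<xi> assume "\<omega> \<in> Phi_dual R" and \<xi>: "\<xi> \<in> Phi R"
    then show "Abs_fps (\<lambda>n. 1 / fact n * S n \<omega> (tensor_pow R n \<xi>)) = gen_series R \<theta> \<xi> * fps_exp (\<omega> \<xi>)"
      using genS div[OF \<xi>] \<theta>_inv[OF \<xi>] by (simp add: mult.commute)
  qed
  have sheffer: "flinear_on (polynomials R) (sheffer_operator R S) \<and>
      (\<forall>n. \<forall>\<phi>\<in>Phi_sym R n. sheffer_operator R S (monomial R n \<phi>) = (\<lambda>\<omega>. if \<omega> \<in> Phi_dual R then S n \<omega> \<phi> else 0))"
    unfolding sheffer_operator_def by (rule someI[of _ A.diff_op]) (use linp mono in blast)
  have "A.diff_op p = sheffer_operator R S p" if "p \<in> polynomials R" for p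
    by (rule linear_on_polynomials_determined[OF linp conjunct1[OF sheffer] _ that]) (use sheffer mono in auto)
  then show ?thesis using poly polynomials_dense[OF \<alpha>(1)] lin homeo by blast
qed

end
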